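(* Let $\mathcal S$ be a root generating system, $\mathfrak g$ its Kac–Moody algebra, $\mathcal U$ the integral enveloping algebra. For $x\in\mathfrak g_{\alpha\mathbb Z}$, $\alpha\in\Delta\cup\{0\}$, there exist elements $x^{[n]}\in\mathcal U_{n\alpha}$ ($n\in\mathbb N$) such that $x^{[0]}=1$, $x^{[1]}=x$, $x^{[n]}-x^n/n!$ has filtration $<n$ in $\mathcal U_{\mathbb C}(\mathfrak g)$ for all $n$, and moreover $$\nabla(x^{[n]})=\sum_{p+q=n}x^{[p]}\otimes x^{[q]}\ \text{ for all } n,\qquad \epsilon(x^{[n]})=0\ \text{ for } n>0 .$$
   Context: A Kac–Moody matrix is an integer matrix $A=(a_{i,j})_{i,j\in I}$, $I$ finite, with $a_{i,i}=2$, $a_{i,j}\le 0$ for $i\neq j$, $a_{i,j}=0\iff a_{j,i}=0$. A root generating system is $\mathcal S=(A,Y,(\overline{\alpha_i})_{i\in I},(\alpha_i^\vee)_{i\in I})$ with $Y$ a free $\mathbb Z$-module of finite rank, $\overline{\alpha_i}\in X=Y^*$, $\alpha_i^\vee\in Y$, $\overline{\alpha_j}(\alpha_i^\vee)=a_{i,j}$. $Q=\bigoplus_i\mathbb Z\alpha_i$ is free on symbols $\alpha_i$, mapped to $X$ by $\alpha_i\mapsto\overline{\alpha_i}$. $\mathfrak g$ is the complex Lie algebra generated by $\mathfrak h=Y\otimes\mathbb C$, $e_i,f_i$ with relations $[h,h']=0$, $[h,e_i]=\alpha_i(h)e_i$, $[h,f_i]=-\alpha_i(h)f_i$, $[e_i,f_i]=-\alpha_i^\vee$,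 and for $i\ne j$: $[e_i,f_j]=0$, $(\mathrm{ad}\,e_i)^{1-a_{i,j}}e_j=(\mathrm{ad}\,f_i)^{1-a_{i,j}}f_j=0$. It is $Q$-graded: $\mathfrak g=\mathfrak h\oplus\bigoplus_{\alpha\in\Delta}\mathfrak g_\alpha$, $\mathfrak g_0=\mathfrak h$. $\mathcal U$ is the $\mathbb Z$-subalgebra of the enveloping algebra $\mathcal U_{\mathbb C}(\mathfrak g)$ generated by $e_i^n/n!$, $f_i^n/n!$ ($i\in I$) and $\binom hn$ ($h\in Y$), $n\in\mathbb N$; it is $Q$-graded, $\mathcal U=\bigoplus_\alpha\mathcal U_\alpha$, and is a sub-Hopf-algebra over $\mathbb Z$ for the usual comultiplication $\nabla$ (elements of $\mathfrak g$ primitive) and counit $\epsilon$. "Filtration" means the standard filtration of $\mathcal U_{\mathbb C}(\mathfrak g)$. $\mathfrak g_{\alpha\mathbb Z}=\mathfrak g_\alpha\cap\mathcal U$ (with $\mathfrak g_{0\mathbb Z}=Y$). *)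

theory Defs
  imports Complex_Main "HOL-Library.Poly_Mapping"
begin

section \<open>Complex vector spaces and algebras\<close>

class scaleC =
  fixes scaleC :: "complex \<Rightarrow> 'a \<Rightarrow> 'a"  (infixr \<open>*\<^sub>C\<close> 75)

class complex_vector = scaleC + ab_group_add +
  assumes scaleC_add_right: "a *\<^sub>C (x + y) = a *\<^sub>C x + a *\<^sub>C y"
    and scaleC_add_left: "(a + b) *\<^sub>C x = a *\<^sub>C x + b *\<^sub>C x"
    and scaleC_scaleC: "a *\<^sub>C b *\<^sub>C x = (a * b) *\<^sub>C x"
    and scaleC_one: "1 *\<^sub>C x = x"

global_interpretation complex_vector: vector_space "scaleC :: complex \<Rightarrow> 'a \<Rightarrow> 'a :: complex_vector"
  by unfold_locales (simp_all add: scaleC_add_right scaleC_add_left scaleC_scaleC scaleC_one)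

class complex_algebra_1 = complex_vector + ring_1 +
  assumes mult_scaleC_left: "a *\<^sub>C x * y = a *\<^sub>C (x * y)"
    and mult_scaleC_right: "x * a *\<^sub>C y = a *\<^sub>C (x * y)"

class complex_lie_algebra = complex_vector +
  fixes lie_bracket :: "'a \<Rightarrow> 'a \<Rightarrow> 'a"
  assumes lie_bracket_add_left: "lie_bracket (x + y) z = lie_bracket x z + lie_bracket y z"
    and lie_bracket_add_right: "lie_bracket x (y + z) = lie_bracket x y + lie_bracket x z"
    and lie_bracket_scaleC_left: "lie_bracket (a *\<^sub>C x) y = a *\<^sub>C lie_bracket x y"
    and lie_bracket_scaleC_right: "lie_bracket x (a *\<^sub>C y) = a *\<^sub>C lie_bracket x y"
    and lie_bracket_self: "lie_bracket x x = 0"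
    and jacobi: "lie_bracket x (lie_bracket y z) + lie_bracket y (lie_bracket z x)
                   + lie_bracket z (lie_bracket x y) = 0"

instantiation complex :: complex_algebra_1
begin
definition scaleC_complex :: "complex \<Rightarrow> complex \<Rightarrow> complex" where
  "scaleC_complex a x = a * x"
instance by standard (simp_all add: scaleC_complex_def algebra_simps)
end

instantiation poly_mapping :: (type, complex_vector) complex_vector
begin
lift_definition scaleC_poly_mapping :: "complex \<Rightarrow> ('a \<Rightarrow>\<^sub>0 'b) \<Rightarrow> 'a \<Rightarrow>\<^sub>0 'b"
  is "\<lambda>c f k. c *\<^sub>C f k"
  by (erule finite_subset[rotated]) auto
instance
  by (standard; transfer)
    (simp_all add: fun_eq_iff scaleC_add_right scaleC_add_left scaleC_scaleC scaleC_one)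
end

lemma lookup_scaleC [simp]:
  "Poly_Mapping.lookup (c *\<^sub>C p) k = c *\<^sub>C Poly_Mapping.lookup p k"
  by transfer simp

lemma poly_mapping_add_induct [case_names zero add]:
  assumes "P 0" and "\<And>p k c. P p \<Longrightarrow> P (p + Poly_Mapping.single k c)"
  shows "P (p :: 'm \<Rightarrow>\<^sub>0 'b::comm_monoid_add)"
proof (induction p rule: update_induct)
  case const
  show ?case using assms(1) by simp
next
  case (update f a b)
  have "Poly_Mapping.update a b f = f + Poly_Mapping.single a b"
    using update by (intro poly_mapping_eqI)
      (auto simp: lookup_update lookup_add lookup_single in_keys_iff)
  with update assms(2) show ?case by simp
qed

text \<open>For a monoid \<open>M\<close> (written additively), \<open>M \<Rightarrow>\<^sub>0 \<complex>\<close> is the monoid algebra \<open>\<complex>[M]\<close>, and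
  \<open>monoid_algebra_lift m\<close> is the linear extension of a map \<open>m\<close> on \<open>M\<close>.\<close>

lemma scaleC_eq_single_times:
  fixes p :: "'m::monoid_add \<Rightarrow>\<^sub>0 complex"
  shows "c *\<^sub>C p = Poly_Mapping.single 0 c * p"
proof -
  have "c *\<^sub>C p = Poly_Mapping.map ((*) c) p"
    by (rule poly_mapping_eqI) (simp add: map.rep_eq scaleC_complex_def when_def)
  then show ?thesis by (simp add: mult_map_scale_conv_mult)
qed

lemma single_zero_commute:
  fixes p :: "'m::monoid_add \<Rightarrow>\<^sub>0 complex"
  shows "Poly_Mapping.single 0 c * p = p * Poly_Mapping.single 0 c"
  by (induction p rule: poly_mapping_add_induct)
    (simp_all add: mult_single mult.commute distrib_left distrib_right)

definition monoid_algebra_lift ::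
    "('m \<Rightarrow> 'a::complex_algebra_1) \<Rightarrow> ('m \<Rightarrow>\<^sub>0 complex) \<Rightarrow> 'a" where
  "monoid_algebra_lift m p =
     (\<Sum>k\<in>Poly_Mapping.keys p. Poly_Mapping.lookup p k *\<^sub>C m k)"

lemma monoid_algebra_lift_superset:
  assumes "finite K" "Poly_Mapping.keys p \<subseteq> K"
  shows "monoid_algebra_lift m p = (\<Sum>k\<in>K. Poly_Mapping.lookup p k *\<^sub>C m k)"
  unfolding monoid_algebra_lift_def using assms
  by (intro sum.mono_neutral_left) (auto simp: in_keys_iff)

lemma monoid_algebra_lift_add:
  "monoid_algebra_lift m (p + q) = monoid_algebra_lift m p + monoid_algebra_lift m q"
proof -
  let ?K = "Poly_Mapping.keys p \<union> Poly_Mapping.keys q"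
  have "monoid_algebra_lift m r = (\<Sum>k\<in>?K. Poly_Mapping.lookup r k *\<^sub>C m k)"
    if "r \<in> {p, q, p + q}" for r
    using that keys_add[of p q] by (intro monoid_algebra_lift_superset) auto
  then show ?thesis
    by (simp add: lookup_add scaleC_add_left sum.distrib)
qed

lemma monoid_algebra_lift_zero [simp]: "monoid_algebra_lift m 0 = 0"
  by (simp add: monoid_algebra_lift_def)

lemma monoid_algebra_lift_diff:
  "monoid_algebra_lift m (p - q) = monoid_algebra_lift m p - monoid_algebra_lift m q"
  by (metis add_diff_cancel_right' diff_add_cancel monoid_algebra_lift_add)

lemma monoid_algebra_lift_single [simp]:
  "monoid_algebra_lift m (Poly_Mapping.single k c) = c *\<^sub>C m k"
  by (simp add: monoid_algebra_lift_def)

lemma monoid_algebra_lift_one: "monoid_algebra_lift m 1 = m 0"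
  by (metis monoid_algebra_lift_single scaleC_one single_one)

lemma monoid_algebra_lift_scaleC:
  "monoid_algebra_lift m (c *\<^sub>C p) = c *\<^sub>C monoid_algebra_lift m p"
proof -
  have "Poly_Mapping.keys (c *\<^sub>C p) \<subseteq> Poly_Mapping.keys p"
    by (auto simp: in_keys_iff)
  then have "monoid_algebra_lift m (c *\<^sub>C p)
      = (\<Sum>k\<in>Poly_Mapping.keys p. Poly_Mapping.lookup (c *\<^sub>C p) k *\<^sub>C m k)"
    by (intro monoid_algebra_lift_superset) auto
  then show ?thesis
    by (simp add: monoid_algebra_lift_def scaleC_complex_def
        complex_vector.scale_sum_right scaleC_scaleC)
qed

lemma monoid_algebra_lift_mult:
  fixes m :: "'m::monoid_add \<Rightarrow> 'a::complex_algebra_1"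
  assumes m: "\<And>a b. m (a + b) = m a * m b"
  shows "monoid_algebra_lift m (p * q) = monoid_algebra_lift m p * monoid_algebra_lift m q"
proof (induction p rule: poly_mapping_add_induct)
  case zero
  show ?case by simp
next
  case (add p k c)
  have "monoid_algebra_lift m (Poly_Mapping.single k c * q)
      = monoid_algebra_lift m (Poly_Mapping.single k c) * monoid_algebra_lift m q"
    by (induction q rule: poly_mapping_add_induct)
      (simp_all add: distrib_left monoid_algebra_lift_add mult_single m
        mult_scaleC_left mult_scaleC_right scaleC_scaleC)
  with add show ?case
    by (simp add: distrib_right monoid_algebra_lift_add)
qed

inductive_set ideal_gen :: "'r::ring_1 set \<Rightarrow> 'r set" for R :: "'r set" where
  zero: "0 \<in> ideal_gen R"
| gen: "r \<in> R \<Longrightarrow> r \<in> ideal_gen R"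
| add: "a \<in> ideal_gen R \<Longrightarrow> b \<in> ideal_gen R \<Longrightarrow> a + b \<in> ideal_gen R"
| mult_left: "a \<in> ideal_gen R \<Longrightarrow> r * a \<in> ideal_gen R"
| mult_right: "a \<in> ideal_gen R \<Longrightarrow> a * r \<in> ideal_gen R"

lemma ideal_gen_uminus: "a \<in> ideal_gen R \<Longrightarrow> - a \<in> ideal_gen R"
  using ideal_gen.mult_left[of a R "- 1"] by simp

lemma ideal_gen_diff: "a \<in> ideal_gen R \<Longrightarrow> b \<in> ideal_gen R \<Longrightarrow> a - b \<in> ideal_gen R"
  using ideal_gen.add[OF _ ideal_gen_uminus, of a R b] by simp

lemma ideal_gen_scaleC:
  fixes a :: "'m::monoid_add \<Rightarrow>\<^sub>0 complex"
  shows "a \<in> ideal_gen R \<Longrightarrow> c *\<^sub>C a \<in> ideal_gen R"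
  by (simp add: scaleC_eq_single_times ideal_gen.mult_left)

lemma equivp_ideal_gen: "equivp (\<lambda>a b. a - b \<in> ideal_gen R)"
proof (intro equivpI reflpI sympI transpI)
  show "a - a \<in> ideal_gen R" for a by (simp add: ideal_gen.zero)
  show "b - a \<in> ideal_gen R" if "a - b \<in> ideal_gen R" for a b
    using ideal_gen_uminus[OF that] by simp
  show "a - c \<in> ideal_gen R" if "a - b \<in> ideal_gen R" "b - c \<in> ideal_gen R" for a b c
    using ideal_gen.add[OF that] by simp
qed

lemma ideal_gen_cong_add:
  assumes "a - a' \<in> ideal_gen R" "b - b' \<in> ideal_gen R"
  shows "(a + b) - (a' + b') \<in> ideal_gen R"
  using ideal_gen.add[OF assms] by (simp add: algebra_simps)

lemma ideal_gen_cong_diff: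
  assumes "a - a' \<in> ideal_gen R" "b - b' \<in> ideal_gen R"
  shows "(a - b) - (a' - b') \<in> ideal_gen R"
  using ideal_gen_diff[OF assms] by (simp add: algebra_simps)

lemma ideal_gen_cong_uminus:
  assumes "a - a' \<in> ideal_gen R"
  shows "(- a) - (- a') \<in> ideal_gen R"
  using ideal_gen_uminus[OF assms] by simp

lemma ideal_gen_cong_mult:
  assumes "a - a' \<in> ideal_gen R" "b - b' \<in> ideal_gen R"
  shows "a * b - a' * b' \<in> ideal_gen R"
proof -
  have "a * b - a' * b' = a * (b - b') + (a - a') * b'"
    by (simp add: algebra_simps)
  with assms show ?thesis
    by (simp add: ideal_gen.add ideal_gen.mult_left ideal_gen.mult_right)
qed

lemma ideal_gen_cong_scaleC:
  fixes a :: "'m::monoid_add \<Rightarrow>\<^sub>0 complex"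
  assumes "a - a' \<in> ideal_gen R"
  shows "c *\<^sub>C a - c *\<^sub>C a' \<in> ideal_gen R"
  using ideal_gen_scaleC[OF assms, of c] by (simp add: complex_vector.scale_right_diff_distrib)

lemma monoid_algebra_lift_ideal_gen:
  fixes m :: "'m::monoid_add \<Rightarrow> 'a::complex_algebra_1"
  assumes m: "\<And>a b. m (a + b) = m a * m b"
    and R: "\<And>r. r \<in> R \<Longrightarrow> monoid_algebra_lift m r = 0"
    and p: "p \<in> ideal_gen R"
  shows "monoid_algebra_lift m p = 0"
  using p by induction (simp_all add: R monoid_algebra_lift_add monoid_algebra_lift_mult[of m, OF m])

lemma scaleC_mult_monoid_algebra:
  fixes p q :: "'m::monoid_add \<Rightarrow>\<^sub>0 complex"
  shows "c *\<^sub>C p * q = c *\<^sub>C (p * q)" "p * c *\<^sub>C q = c *\<^sub>C (p * q)"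
   apply (simp add: scaleC_eq_single_times mult.assoc)
  by (metis (no_types, lifting) mult.assoc scaleC_eq_single_times single_zero_commute)


section \<open>The enveloping algebra of a complex Lie algebra\<close>

text \<open>Words under concatenation, written additively: \<open>'x fword \<Rightarrow>\<^sub>0 \<complex>\<close> is the free associative
  unital algebra on \<open>'x\<close>.\<close>

datatype 'x fword = FWord (letters: "'x list")

instantiation fword :: (type) monoid_add
begin
definition zero_fword :: "'x fword" where "zero_fword = FWord []"
definition plus_fword :: "'x fword \<Rightarrow> 'x fword \<Rightarrow> 'x fword" where
  "plus_fword v w = FWord (letters v @ letters w)"
instance by standard (simp_all add: zero_fword_def plus_fword_def)
end

definition letter :: "'x \<Rightarrow> 'x fword \<Rightarrow>\<^sub>0 complex" where
  "letter x = Poly_Mapping.single (FWord [x]) 1"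

text \<open>The first two families of relations cut the free algebra on the set \<open>'g\<close> down to the tensor
  algebra of the vector space \<open>'g\<close>.\<close>

inductive_set uea_relations :: "('g::complex_lie_algebra fword \<Rightarrow>\<^sub>0 complex) set" where
  "letter (x + y) - (letter x + letter y) \<in> uea_relations"
| "letter (c *\<^sub>C x) - c *\<^sub>C letter x \<in> uea_relations"
| "letter x * letter y - letter y * letter x - letter (lie_bracket x y) \<in> uea_relations"

quotient_type (overloaded) 'g uea = "'g::complex_lie_algebra fword \<Rightarrow>\<^sub>0 complex"
  / "\<lambda>p q. p - q \<in> ideal_gen uea_relations"
  by (rule equivp_ideal_gen)

instantiation uea :: (complex_lie_algebra) complex_algebra_1
begin
lift_definition zero_uea :: "'a uea" is 0 .
lift_definition one_uea :: "'a uea" is 1 .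
lift_definition plus_uea :: "'a uea \<Rightarrow> 'a uea \<Rightarrow> 'a uea" is "(+)" by (rule ideal_gen_cong_add)
lift_definition minus_uea :: "'a uea \<Rightarrow> 'a uea \<Rightarrow> 'a uea" is "(-)" by (rule ideal_gen_cong_diff)
lift_definition uminus_uea :: "'a uea \<Rightarrow> 'a uea" is uminus by (rule ideal_gen_cong_uminus)
lift_definition times_uea :: "'a uea \<Rightarrow> 'a uea \<Rightarrow> 'a uea" is "(*)" by (rule ideal_gen_cong_mult)
lift_definition scaleC_uea :: "complex \<Rightarrow> 'a uea \<Rightarrow> 'a uea" is "scaleC"
  by (rule ideal_gen_cong_scaleC)
instance
proof
  show "(0::'a uea) \<noteq> 1"
  proof transfer
    let ?m = "\<lambda>w::'a fword. if w = 0 then 1 else (0::complex)"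
    have m: "?m (v + w) = ?m v * ?m w" for v w
      by (cases v; cases w) (auto simp: plus_fword_def zero_fword_def)
    have "monoid_algebra_lift ?m r = 0" if "r \<in> uea_relations" for r
      using that by cases
        (simp_all add: letter_def monoid_algebra_lift_diff monoid_algebra_lift_add
          monoid_algebra_lift_scaleC mult_single zero_fword_def plus_fword_def
          scaleC_complex_def)
    then have "monoid_algebra_lift ?m p = 0" if "p \<in> ideal_gen uea_relations" for p
      using monoid_algebra_lift_ideal_gen[of ?m, OF m _ that] by blast
    moreover have "monoid_algebra_lift ?m (0 - 1) = - 1"
      by (simp only: monoid_algebra_lift_diff monoid_algebra_lift_one) simp
    ultimately show "0 - 1 \<notin> ideal_gen (uea_relations :: ('a fword \<Rightarrow>\<^sub>0 complex) set)"
      by fastforce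
  qed
qed (transfer; simp add: algebra_simps scaleC_add_right scaleC_add_left scaleC_scaleC scaleC_one
    scaleC_mult_monoid_algebra ideal_gen.zero)+
end

lift_definition uea_of :: "'g::complex_lie_algebra \<Rightarrow> 'g uea" is letter .

text \<open>The extension of a Lie algebra homomorphism \<open>\<phi>\<close> from \<open>'g\<close> into an associative algebra; for
  other \<open>\<phi>\<close> the value is unspecified.\<close>

definition uea_lift :: "('g::complex_lie_algebra \<Rightarrow> 'a::complex_algebra_1) \<Rightarrow> 'g uea \<Rightarrow> 'a" where
  "uea_lift \<phi> u = monoid_algebra_lift (\<lambda>w. prod_list (map \<phi> (letters w))) (rep_uea u)"

definition lie_representation :: "('g::complex_lie_algebra \<Rightarrow> 'a::complex_algebra_1) \<Rightarrow> bool" where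
  "lie_representation \<phi> \<longleftrightarrow>
     (\<forall>x y. \<phi> (x + y) = \<phi> x + \<phi> y) \<and> (\<forall>c x. \<phi> (c *\<^sub>C x) = c *\<^sub>C \<phi> x) \<and>
     (\<forall>x y. \<phi> (lie_bracket x y) = \<phi> x * \<phi> y - \<phi> y * \<phi> x)"

lemma uea_of_add: "uea_of (x + y) = uea_of x + uea_of y"
  by transfer (rule ideal_gen.gen, rule uea_relations.intros)

lemma uea_of_scaleC: "uea_of (c *\<^sub>C x) = c *\<^sub>C uea_of x"
  by transfer (rule ideal_gen.gen, rule uea_relations.intros)

lemma uea_of_lie_bracket: "uea_of (lie_bracket x y) = uea_of x * uea_of y - uea_of y * uea_of x"
  by transfer
    (metis (no_types) ideal_gen.gen ideal_gen_uminus minus_diff_eq uea_relations.intros(3))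

lemma lie_representation_uea_of: "lie_representation uea_of"
  by (simp add: lie_representation_def uea_of_add uea_of_scaleC uea_of_lie_bracket)

lemma uea_lift_abs:
  fixes \<phi> :: "'g::complex_lie_algebra \<Rightarrow> 'a::complex_algebra_1"
  assumes "lie_representation \<phi>"
  shows "uea_lift \<phi> (abs_uea p) = monoid_algebra_lift (\<lambda>w. prod_list (map \<phi> (letters w))) p"
proof -
  let ?m = "\<lambda>w. prod_list (map \<phi> (letters w))"
  have m: "?m (v + w) = ?m v * ?m w" for v w by (simp add: plus_fword_def)
  have "monoid_algebra_lift ?m r = 0" if "r \<in> uea_relations" for r
    using that assms by cases
      (simp_all add: letter_def monoid_algebra_lift_diff monoid_algebra_lift_add
        monoid_algebra_lift_scaleC monoid_algebra_lift_mult[of ?m, OF m] lie_representation_def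
        scaleC_one)
  then have *: "monoid_algebra_lift ?m r = 0" if "r \<in> ideal_gen uea_relations" for r
    using monoid_algebra_lift_ideal_gen[of ?m, OF m _ that] by blast
  have "rep_uea (abs_uea p) - p \<in> ideal_gen uea_relations"
    using Quotient3_rep_abs[OF Quotient3_uea, of p] ideal_gen.zero by fastforce
  from *[OF this] show ?thesis
    by (simp add: uea_lift_def monoid_algebra_lift_diff)
qed

lemma uea_lift_hom:
  assumes "lie_representation \<phi>"
  shows "uea_lift \<phi> (uea_of x) = \<phi> x" "uea_lift \<phi> 1 = 1"
    "uea_lift \<phi> (u + v) = uea_lift \<phi> u + uea_lift \<phi> v"
    "uea_lift \<phi> (c *\<^sub>C u) = c *\<^sub>C uea_lift \<phi> u"
    "uea_lift \<phi> (u * v) = uea_lift \<phi> u * uea_lift \<phi> v"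
proof -
  note lift = uea_lift_abs[OF assms]
  obtain p q where pq: "u = abs_uea p" "v = abs_uea q"
    using Quotient3_abs_rep[OF Quotient3_uea] by metis
  show "uea_lift \<phi> (uea_of x) = \<phi> x"
    by (simp add: uea_of.abs_eq lift letter_def scaleC_one)
  show "uea_lift \<phi> 1 = 1"
    by (simp only: one_uea.abs_eq lift monoid_algebra_lift_one) (simp add: zero_fword_def)
  show "uea_lift \<phi> (u + v) = uea_lift \<phi> u + uea_lift \<phi> v"
    by (simp add: pq plus_uea.abs_eq lift monoid_algebra_lift_add)
  show "uea_lift \<phi> (c *\<^sub>C u) = c *\<^sub>C uea_lift \<phi> u"
    by (simp add: pq scaleC_uea.abs_eq lift monoid_algebra_lift_scaleC)
  show "uea_lift \<phi> (u * v) = uea_lift \<phi> u * uea_lift \<phi> v"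
    by (simp add: pq times_uea.abs_eq lift monoid_algebra_lift_mult plus_fword_def)
qed


section \<open>Tensor products over the complex numbers\<close>

text \<open>A copy of the product type, to carry the componentwise monoid structure written additively:
  \<open>('a, 'b) fpair \<Rightarrow>\<^sub>0 \<complex>\<close> is the vector space with basis \<open>'a \<times> 'b\<close>, and its multiplication is the
  bilinear extension of \<open>(a, b) (c, d) = (a c, b d)\<close>.\<close>

datatype ('a, 'b) fpair = FPair 'a 'b

instantiation fpair :: (monoid_mult, monoid_mult) monoid_add
begin
definition zero_fpair :: "('a, 'b) fpair" where "zero_fpair = FPair 1 1"
fun plus_fpair :: "('a, 'b) fpair \<Rightarrow> ('a, 'b) fpair \<Rightarrow> ('a, 'b) fpair" where
  "plus_fpair (FPair a b) (FPair c d) = FPair (a * c) (b * d)"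
instance
proof
  fix x y z :: "('a, 'b) fpair"
  show "x + y + z = x + (y + z)" "0 + x = x" "x + 0 = x"
    by (cases x; cases y; cases z; simp add: zero_fpair_def mult.assoc)+
qed
end

definition pair_single :: "'a \<Rightarrow> 'b \<Rightarrow> ('a, 'b) fpair \<Rightarrow>\<^sub>0 complex" where
  "pair_single a b = Poly_Mapping.single (FPair a b) 1"

inductive_set tensor_relations :: "(('a::complex_vector, 'b::complex_vector) fpair \<Rightarrow>\<^sub>0 complex) set" where
  "pair_single (a + a') b - (pair_single a b + pair_single a' b) \<in> tensor_relations"
| "pair_single a (b + b') - (pair_single a b + pair_single a b') \<in> tensor_relations"
| "pair_single (c *\<^sub>C a) b - c *\<^sub>C pair_single a b \<in> tensor_relations"
| "pair_single a (c *\<^sub>C b) - c *\<^sub>C pair_single a b \<in> tensor_relations"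

lemma equivp_span: "equivp (\<lambda>a b. a - b \<in> complex_vector.span R)"
proof (intro equivpI reflpI sympI transpI)
  show "a - a \<in> complex_vector.span R" for a by (simp add: complex_vector.span_zero)
  show "b - a \<in> complex_vector.span R" if "a - b \<in> complex_vector.span R" for a b
    using complex_vector.span_neg[OF that] by simp
  show "a - c \<in> complex_vector.span R"
    if "a - b \<in> complex_vector.span R" "b - c \<in> complex_vector.span R" for a b c
    using complex_vector.span_add[OF that] by simp
qed

quotient_type (overloaded) ('a, 'b) tensor =
    "('a::complex_vector, 'b::complex_vector) fpair \<Rightarrow>\<^sub>0 complex"
  / "\<lambda>p q. p - q \<in> complex_vector.span tensor_relations"
  by (rule equivp_span)

lift_definition tensor_of :: "'a::complex_vector \<Rightarrow> 'b::complex_vector \<Rightarrow> ('a, 'b) tensor"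
    (infixl \<open>\<otimes>\<close> 72) is pair_single .

instantiation tensor :: (complex_vector, complex_vector) complex_vector
begin
lift_definition zero_tensor :: "('a, 'b) tensor" is 0 .
lift_definition plus_tensor :: "('a, 'b) tensor \<Rightarrow> ('a, 'b) tensor \<Rightarrow> ('a, 'b) tensor" is "(+)"
  using complex_vector.span_add by (metis add_diff_add)
lift_definition minus_tensor :: "('a, 'b) tensor \<Rightarrow> ('a, 'b) tensor \<Rightarrow> ('a, 'b) tensor" is "(-)"
proof -
  fix p p' q q' :: "('a, 'b) fpair \<Rightarrow>\<^sub>0 complex"
  assume "p - p' \<in> complex_vector.span tensor_relations" "q - q' \<in> complex_vector.span tensor_relations"
  from complex_vector.span_diff[OF this]
  show "p - q - (p' - q') \<in> complex_vector.span tensor_relations" by (simp add: algebra_simps)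
qed
lift_definition uminus_tensor :: "('a, 'b) tensor \<Rightarrow> ('a, 'b) tensor" is uminus
  by (metis complex_vector.span_neg minus_diff_eq minus_diff_minus)
lift_definition scaleC_tensor :: "complex \<Rightarrow> ('a, 'b) tensor \<Rightarrow> ('a, 'b) tensor" is scaleC
  by (metis complex_vector.scale_right_diff_distrib complex_vector.span_scale)
instance
  by (standard; transfer; simp add: algebra_simps scaleC_add_right scaleC_add_left scaleC_scaleC
      scaleC_one complex_vector.span_zero)
end

lemma tensor_of_add_left: "(a + a') \<otimes> b = a \<otimes> b + a' \<otimes> b"
  by transfer (intro complex_vector.span_base tensor_relations.intros)

lemma tensor_of_add_right: "a \<otimes> (b + b') = a \<otimes> b + a \<otimes> b'"
  by transfer (intro complex_vector.span_base tensor_relations.intros)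

lemma tensor_of_scaleC_left: "(c *\<^sub>C a) \<otimes> b = c *\<^sub>C (a \<otimes> b)"
  by transfer (intro complex_vector.span_base tensor_relations.intros)

lemma tensor_of_scaleC_right: "a \<otimes> (c *\<^sub>C b) = c *\<^sub>C (a \<otimes> b)"
  by transfer (intro complex_vector.span_base tensor_relations.intros)

lemma pair_single_mult: "pair_single a b * pair_single c d = pair_single (a * c) (b * d)"
  by (simp add: pair_single_def mult_single)

lemma span_tensor_relations_mult:
  fixes p :: "('a::complex_algebra_1, 'b::complex_algebra_1) fpair \<Rightarrow>\<^sub>0 complex"
  assumes p: "p \<in> complex_vector.span tensor_relations"
  shows "q * p \<in> complex_vector.span tensor_relations" "p * q \<in> complex_vector.span tensor_relations"
proof -
  have single: "Poly_Mapping.single k c = c *\<^sub>C (case k of FPair a b \<Rightarrow> pair_single a b)"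
    for k :: "('a, 'b) fpair" and c
    by (rule poly_mapping_eqI, cases k)
      (simp add: pair_single_def lookup_single scaleC_complex_def when_def)
  have gen: "pair_single a b * r \<in> tensor_relations" "r * pair_single a b \<in> tensor_relations"
    if "r \<in> tensor_relations" for a b and r :: "('a, 'b) fpair \<Rightarrow>\<^sub>0 complex"
    using that
    by (cases; simp add: pair_single_mult right_diff_distrib left_diff_distrib distrib_left
        distrib_right scaleC_mult_monoid_algebra mult_scaleC_left mult_scaleC_right
        tensor_relations.intros)+
  have span: "pair_single a b * r \<in> complex_vector.span tensor_relations
      \<and> r * pair_single a b \<in> complex_vector.span tensor_relations"
    if "r \<in> complex_vector.span tensor_relations" for a b and r :: "('a, 'b) fpair \<Rightarrow>\<^sub>0 complex"
    using that
    by (induction r rule: complex_vector.span_induct_alt)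
      (simp_all add: complex_vector.span_zero distrib_left distrib_right scaleC_mult_monoid_algebra
        complex_vector.span_add complex_vector.span_scale complex_vector.span_base gen)
  show "q * p \<in> complex_vector.span tensor_relations" "p * q \<in> complex_vector.span tensor_relations"
    by (induction q rule: poly_mapping_add_induct)
      (auto simp: complex_vector.span_zero distrib_left distrib_right single
        scaleC_mult_monoid_algebra span[OF p] split: fpair.splits
        intro!: complex_vector.span_add complex_vector.span_scale)
qed

lemma exists_linear_functional:
  fixes v :: "'a::complex_vector"
  assumes "v \<noteq> 0"
  obtains f :: "'a \<Rightarrow> complex" where "\<And>x y. f (x + y) = f x + f y" "\<And>c x. f (c *\<^sub>C x) = c * f x" "f v = 1"
proof -
  have ind: "complex_vector.independent {v}" using assms by simp
  define B where "B = complex_vector.extend_basis {v}"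
  have B: "complex_vector.independent B" "complex_vector.span B = UNIV" "v \<in> B"
    using complex_vector.independent_extend_basis[OF ind] complex_vector.span_extend_basis[OF ind]
      complex_vector.extend_basis_superset[OF ind] by (auto simp: B_def)
  show ?thesis
    by (rule that[of "\<lambda>x. complex_vector.representation B x v"])
      (simp_all add: B complex_vector.representation_add complex_vector.representation_scale
        complex_vector.representation_basis)
qed

instantiation tensor :: (complex_algebra_1, complex_algebra_1) complex_algebra_1
begin
lift_definition one_tensor :: "('a, 'b) tensor" is 1 .
lift_definition times_tensor :: "('a, 'b) tensor \<Rightarrow> ('a, 'b) tensor \<Rightarrow> ('a, 'b) tensor" is "(*)"
proof -
  fix p p' q q' :: "('a, 'b) fpair \<Rightarrow>\<^sub>0 complex"
  assume *: "p - p' \<in> complex_vector.span tensor_relations" "q - q' \<in> complex_vector.span tensor_relations"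
  have "p * q - p' * q' = p * (q - q') + (p - p') * q'" by (simp add: algebra_simps)
  with * show "p * q - p' * q' \<in> complex_vector.span tensor_relations"
    by (simp add: complex_vector.span_add span_tensor_relations_mult)
qed
instance
proof
  show "(0::('a, 'b) tensor) \<noteq> 1"
  proof transfer
    obtain f :: "'a \<Rightarrow> complex" where f: "\<And>x y. f (x + y) = f x + f y" "\<And>c x. f (c *\<^sub>C x) = c * f x" "f 1 = 1"
      by (rule exists_linear_functional[of 1]) auto
    obtain g :: "'b \<Rightarrow> complex" where g: "\<And>x y. g (x + y) = g x + g y" "\<And>c x. g (c *\<^sub>C x) = c * g x" "g 1 = 1"
      by (rule exists_linear_functional[of 1]) auto
    let ?m = "\<lambda>w. case w of FPair a b \<Rightarrow> f a * g b"
    have rel: "monoid_algebra_lift ?m r = 0" if "r \<in> tensor_relations" for r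
      using that by cases
        (simp_all add: pair_single_def monoid_algebra_lift_diff monoid_algebra_lift_add
          monoid_algebra_lift_scaleC scaleC_complex_def f g distrib_left distrib_right)
    have *: "monoid_algebra_lift ?m r = 0" if "r \<in> complex_vector.span tensor_relations" for r
      using that by (induction r rule: complex_vector.span_induct_alt)
        (simp_all add: rel monoid_algebra_lift_add monoid_algebra_lift_scaleC scaleC_complex_def)
    have "monoid_algebra_lift ?m (0 - 1) = - 1"
      by (simp only: monoid_algebra_lift_diff monoid_algebra_lift_one) (simp add: zero_fpair_def f g)
    with *[of "0 - 1"]
    show "0 - 1 \<notin> complex_vector.span (tensor_relations :: (('a, 'b) fpair \<Rightarrow>\<^sub>0 complex) set)"
      by fastforce
  qed
qed (transfer; simp add: algebra_simps scaleC_mult_monoid_algebra complex_vector.span_zero)+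
end

lemma tensor_of_one: "1 \<otimes> 1 = 1"
  by transfer (simp add: pair_single_def complex_vector.span_zero flip: zero_fpair_def)

lemma tensor_of_mult: "(a \<otimes> b) * (c \<otimes> d) = (a * c) \<otimes> (b * d)"
  by transfer (simp add: pair_single_mult complex_vector.span_zero)


section \<open>The Hopf structure and the filtration of the enveloping algebra\<close>

definition comult :: "'g::complex_lie_algebra uea \<Rightarrow> ('g uea, 'g uea) tensor" where
  "comult = uea_lift (\<lambda>x. uea_of x \<otimes> 1 + 1 \<otimes> uea_of x)"

definition counit :: "'g::complex_lie_algebra uea \<Rightarrow> complex" where
  "counit = uea_lift (\<lambda>x. 0)"

lemma lie_representation_comult: "lie_representation (\<lambda>x. uea_of x \<otimes> 1 + 1 \<otimes> uea_of x)"
proof -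
  have diff: "(a - a') \<otimes> b = a \<otimes> b - a' \<otimes> b" "b \<otimes> (a - a') = b \<otimes> a - b \<otimes> a'"
    for a a' b :: "'a uea"
    by (metis add_diff_cancel_right' diff_add_cancel tensor_of_add_left tensor_of_add_right)+
  show ?thesis
    unfolding lie_representation_def
    by (simp add: uea_of_add uea_of_scaleC uea_of_lie_bracket tensor_of_add_left tensor_of_add_right
        tensor_of_scaleC_left tensor_of_scaleC_right tensor_of_mult diff scaleC_add_right
        distrib_left distrib_right)
qed

lemma comult_hom:
  "comult (uea_of x) = uea_of x \<otimes> 1 + 1 \<otimes> uea_of x" "comult 1 = 1"
  "comult (u + v) = comult u + comult v" "comult (c *\<^sub>C u) = c *\<^sub>C comult u"
  "comult (u * v) = comult u * comult v"
  unfolding comult_def by (simp_all add: uea_lift_hom[OF lie_representation_comult])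

lemma counit_hom:
  "counit (uea_of x) = 0" "counit 1 = 1"
  "counit (u + v) = counit u + counit v" "counit (c *\<^sub>C u) = c * counit u"
  "counit (u * v) = counit u * counit v"
proof -
  have "lie_representation (\<lambda>x. 0 :: complex)"
    by (simp add: lie_representation_def scaleC_complex_def)
  from uea_lift_hom[OF this] show
    "counit (uea_of x) = 0" "counit 1 = 1"
    "counit (u + v) = counit u + counit v" "counit (c *\<^sub>C u) = c * counit u"
    "counit (u * v) = counit u * counit v"
    unfolding counit_def by (simp_all add: scaleC_complex_def)
qed

definition uea_filtration :: "nat \<Rightarrow> 'g::complex_lie_algebra uea set" where
  "uea_filtration n = complex_vector.span {prod_list (map uea_of xs) | xs. length xs \<le> n}"

text \<open>The filtration vanishes in negative degrees.\<close>

definition filtration_less :: "'g::complex_lie_algebra uea \<Rightarrow> nat \<Rightarrow> bool" where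
  "filtration_less u n \<longleftrightarrow> u = 0 \<or> (\<exists>m<n. u \<in> uea_filtration m)"


section \<open>Lie algebras given by generators and relations\<close>

datatype 'x lie_term =
    LGen 'x
  | LZero
  | LAdd "'x lie_term" "'x lie_term"
  | LScale complex "'x lie_term"
  | LBracket "'x lie_term" "'x lie_term"

primrec lie_eval :: "('x \<Rightarrow> 'g::complex_lie_algebra) \<Rightarrow> 'x lie_term \<Rightarrow> 'g" where
  "lie_eval \<gamma> (LGen x) = \<gamma> x"
| "lie_eval \<gamma> LZero = 0"
| "lie_eval \<gamma> (LAdd s t) = lie_eval \<gamma> s + lie_eval \<gamma> t"
| "lie_eval \<gamma> (LScale c t) = c *\<^sub>C lie_eval \<gamma> t"
| "lie_eval \<gamma> (LBracket s t) = lie_bracket (lie_eval \<gamma> s) (lie_eval \<gamma> t)"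

text \<open>The least congruence on terms containing \<open>R\<close> whose quotient is a complex Lie algebra.\<close>

inductive lie_derivable :: "('x lie_term \<Rightarrow> 'x lie_term \<Rightarrow> bool) \<Rightarrow> 'x lie_term \<Rightarrow> 'x lie_term \<Rightarrow> bool"
  for R where
  rel: "R s t \<Longrightarrow> lie_derivable R s t"
| refl: "lie_derivable R t t"
| sym: "lie_derivable R s t \<Longrightarrow> lie_derivable R t s"
| trans: "lie_derivable R s t \<Longrightarrow> lie_derivable R t u \<Longrightarrow> lie_derivable R s u"
| add_cong: "lie_derivable R s s' \<Longrightarrow> lie_derivable R t t' \<Longrightarrow> lie_derivable R (LAdd s t) (LAdd s' t')"
| scale_cong: "lie_derivable R t t' \<Longrightarrow> lie_derivable R (LScale c t) (LScale c t')"
| bracket_cong: "lie_derivable R s s' \<Longrightarrow> lie_derivable R t t' \<Longrightarrow>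
    lie_derivable R (LBracket s t) (LBracket s' t')"
| add_assoc: "lie_derivable R (LAdd (LAdd s t) u) (LAdd s (LAdd t u))"
| add_commute: "lie_derivable R (LAdd s t) (LAdd t s)"
| add_zero: "lie_derivable R (LAdd LZero t) t"
| add_inverse: "lie_derivable R (LAdd (LScale (- 1) t) t) LZero"
| scale_add_right: "lie_derivable R (LScale c (LAdd s t)) (LAdd (LScale c s) (LScale c t))"
| scale_add_left: "lie_derivable R (LScale (c + d) t) (LAdd (LScale c t) (LScale d t))"
| scale_scale: "lie_derivable R (LScale c (LScale d t)) (LScale (c * d) t)"
| scale_one: "lie_derivable R (LScale 1 t) t"
| bracket_add_left: "lie_derivable R (LBracket (LAdd s t) u) (LAdd (LBracket s u) (LBracket t u))"
| bracket_add_right: "lie_derivable R (LBracket s (LAdd t u)) (LAdd (LBracket s t) (LBracket s u))"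
| bracket_scale_left: "lie_derivable R (LBracket (LScale c s) t) (LScale c (LBracket s t))"
| bracket_scale_right: "lie_derivable R (LBracket s (LScale c t)) (LScale c (LBracket s t))"
| bracket_self: "lie_derivable R (LBracket t t) LZero"
| jacobi: "lie_derivable R (LAdd (LAdd (LBracket s (LBracket t u)) (LBracket t (LBracket u s)))
    (LBracket u (LBracket s t))) LZero"

text \<open>\<open>lie_presented X R \<gamma>\<close>: the complex Lie algebra \<open>'g\<close> is, via \<open>\<gamma>\<close>, the one with generators \<open>X\<close>
  and relations \<open>R\<close>, i.e. evaluation of terms over \<open>X\<close> is onto \<open>'g\<close> and identifies exactly the terms
  that \<open>R\<close> and the Lie algebra axioms force to be equal. The symbols outside \<open>X\<close> play no role: if
  \<open>R\<close> does not involve them, they can be replaced by \<^const>\<open>LZero\<close> in any derivation.\<close>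

definition lie_presented ::
    "'x set \<Rightarrow> ('x lie_term \<Rightarrow> 'x lie_term \<Rightarrow> bool) \<Rightarrow> ('x \<Rightarrow> 'g::complex_lie_algebra) \<Rightarrow> bool" where
  "lie_presented X R \<gamma> \<longleftrightarrow>
     (\<forall>z. \<exists>t. set_lie_term t \<subseteq> X \<and> lie_eval \<gamma> t = z) \<and>
     (\<forall>s t. set_lie_term s \<subseteq> X \<longrightarrow> set_lie_term t \<subseteq> X \<longrightarrow>
        (lie_eval \<gamma> s = lie_eval \<gamma> t \<longleftrightarrow> lie_derivable R s t))"

lemma lie_derivable_sound:
  assumes "lie_derivable R s t" "\<And>s t. R s t \<Longrightarrow> lie_eval \<gamma> s = lie_eval \<gamma> t"
  shows "lie_eval \<gamma> s = lie_eval \<gamma> t"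
  using assms(1)
proof induction
  case (jacobi s t u)
  then show ?case
    using complex_lie_algebra_class.jacobi[of "lie_eval \<gamma> s" "lie_eval \<gamma> t" "lie_eval \<gamma> u"] by simp
qed (simp_all add: assms(2) scaleC_add_right scaleC_add_left scaleC_scaleC scaleC_one
    lie_bracket_add_left lie_bracket_add_right lie_bracket_scaleC_left lie_bracket_scaleC_right
    lie_bracket_self add.assoc add.commute complex_vector.scale_minus_left)

text \<open>The universal property.\<close>

lemma lie_presented_universal:
  fixes \<gamma> :: "'x \<Rightarrow> 'g::complex_lie_algebra" and \<delta> :: "'x \<Rightarrow> 'k::complex_lie_algebra"
  assumes \<gamma>: "lie_presented X R \<gamma>"
    and \<delta>: "\<And>s t. R s t \<Longrightarrow> lie_eval \<delta> s = lie_eval \<delta> t"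
  shows "\<exists>!\<phi>. (\<forall>x y. \<phi> (x + y) = \<phi> x + \<phi> y) \<and> (\<forall>c x. \<phi> (c *\<^sub>C x) = c *\<^sub>C \<phi> x) \<and>
    (\<forall>x y. \<phi> (lie_bracket x y) = lie_bracket (\<phi> x) (\<phi> y)) \<and> (\<forall>x\<in>X. \<phi> (\<gamma> x) = \<delta> x)"
    (is "\<exists>!\<phi>. ?P \<phi>")
proof -
  define rep where "rep z = (SOME t. set_lie_term t \<subseteq> X \<and> lie_eval \<gamma> t = z)" for z
  have rep: "set_lie_term (rep z) \<subseteq> X" "lie_eval \<gamma> (rep z) = z" for z
    using \<gamma> someI_ex[of "\<lambda>t. set_lie_term t \<subseteq> X \<and> lie_eval \<gamma> t = z"]
    unfolding lie_presented_def rep_def by blast+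
  define \<phi> where "\<phi> z = lie_eval \<delta> (rep z)" for z
  have \<phi>: "\<phi> (lie_eval \<gamma> t) = lie_eval \<delta> t" if "set_lie_term t \<subseteq> X" for t
    using \<gamma> rep that lie_derivable_sound[of R, OF _ \<delta>] unfolding lie_presented_def \<phi>_def by metis
  have "?P \<phi>"
  proof (intro conjI allI ballI)
    show "\<phi> (x + y) = \<phi> x + \<phi> y" for x y
      using \<phi>[of "LAdd (rep x) (rep y)"] rep by (simp add: \<phi>_def)
    show "\<phi> (c *\<^sub>C x) = c *\<^sub>C \<phi> x" for c x
      using \<phi>[of "LScale c (rep x)"] rep by (simp add: \<phi>_def)
    show "\<phi> (lie_bracket x y) = lie_bracket (\<phi> x) (\<phi> y)" for x y
      using \<phi>[of "LBracket (rep x) (rep y)"] rep by (simp add: \<phi>_def)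
    show "\<phi> (\<gamma> x) = \<delta> x" if "x \<in> X" for x
      using \<phi>[of "LGen x"] that by simp
  qed
  moreover have "\<psi> = \<phi>" if \<psi>: "?P \<psi>" for \<psi>
  proof
    fix z
    have "\<psi> 0 = 0" using \<psi> by (metis add_cancel_right_right)
    then have "\<psi> (lie_eval \<gamma> t) = lie_eval \<delta> t" if "set_lie_term t \<subseteq> X" for t
      using that \<psi> by (induction t) auto
    from this[OF rep(1)] show "\<psi> z = \<phi> z" by (simp add: \<phi>_def rep(2))
  qed
  ultimately show ?thesis by (rule ex1I)
qed


section \<open>Root generating systems and Kac--Moody algebras\<close>

text \<open>\<open>Y\<close> is the type \<open>'y\<close>, and the dual \<open>X\<close> consists of the additive maps from \<open>'y\<close> to \<open>int\<close>.\<close>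

record ('i, 'y) root_system_data =
  index_set :: "'i set"
  km_matrix :: "'i \<Rightarrow> 'i \<Rightarrow> int"
  simple_root :: "'i \<Rightarrow> 'y \<Rightarrow> int"
  simple_coroot :: "'i \<Rightarrow> 'y"

definition kac_moody_matrix :: "'i set \<Rightarrow> ('i \<Rightarrow> 'i \<Rightarrow> int) \<Rightarrow> bool" where
  "kac_moody_matrix I A \<longleftrightarrow> finite I \<and>
     (\<forall>i\<in>I. A i i = 2) \<and>
     (\<forall>i\<in>I. \<forall>j\<in>I. i \<noteq> j \<longrightarrow> A i j \<le> 0) \<and>
     (\<forall>i\<in>I. \<forall>j\<in>I. A i j = 0 \<longleftrightarrow> A j i = 0)"

text \<open>For some finite \<open>B\<close>, the homomorphism from the free abelian group on \<open>B\<close> that extends the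
  inclusion of \<open>B\<close> is bijective.\<close>

definition free_of_finite_rank :: "'y::ab_group_add itself \<Rightarrow> bool" where
  "free_of_finite_rank _ \<longleftrightarrow>
     (\<exists>(B::'y set) \<phi>. finite B \<and> additive \<phi> \<and> (\<forall>b\<in>B. \<phi> (frag_of b) = b) \<and>
        bij_betw \<phi> {c. Poly_Mapping.keys c \<subseteq> B} UNIV)"

definition root_generating_system :: "('i, 'y::ab_group_add) root_system_data \<Rightarrow> bool" where
  "root_generating_system S \<longleftrightarrow>
     kac_moody_matrix (index_set S) (km_matrix S) \<and>
     free_of_finite_rank TYPE('y) \<and>
     (\<forall>i\<in>index_set S. additive (simple_root S i)) \<and>
     (\<forall>i\<in>index_set S. \<forall>j\<in>index_set S.
        simple_root S j (simple_coroot S i) = km_matrix S i j)"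

datatype ('i, 'y) km_generator = H 'y | E 'i | F 'i

definition km_generators :: "('i, 'y) root_system_data \<Rightarrow> ('i, 'y) km_generator set" where
  "km_generators S = range H \<union> E ` index_set S \<union> F ` index_set S"

text \<open>The generating space \<open>\<hh> = Y \<otimes> \<complex>\<close> enters through generators \<open>H y\<close>, to be read as \<open>y \<otimes> 1\<close>, subject
  to \<open>H_add\<close>: \<open>Y \<otimes> \<complex>\<close> is the universal complex vector space with an additive map from \<open>Y\<close>. The relations
  involving \<open>\<hh>\<close> are linear in \<open>h \<in> \<hh>\<close>, so it suffices to impose them for \<open>h \<in> Y\<close>.\<close>

inductive km_relation :: "('i, 'y::ab_group_add) root_system_data \<Rightarrow>
    ('i, 'y) km_generator lie_term \<Rightarrow> ('i, 'y) km_generator lie_term \<Rightarrow> bool"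
  for S where
  H_add: "km_relation S (LGen (H (y + y'))) (LAdd (LGen (H y)) (LGen (H y')))"
| H_H: "km_relation S (LBracket (LGen (H y)) (LGen (H y'))) LZero"
| H_E: "i \<in> index_set S \<Longrightarrow>
    km_relation S (LBracket (LGen (H y)) (LGen (E i)))
      (LScale (of_int (simple_root S i y)) (LGen (E i)))"
| H_F: "i \<in> index_set S \<Longrightarrow>
    km_relation S (LBracket (LGen (H y)) (LGen (F i)))
      (LScale (- of_int (simple_root S i y)) (LGen (F i)))"
| E_F_same: "i \<in> index_set S \<Longrightarrow>
    km_relation S (LBracket (LGen (E i)) (LGen (F i)))
      (LScale (- 1) (LGen (H (simple_coroot S i))))"
| E_F: "i \<in> index_set S \<Longrightarrow> j \<in> index_set S \<Longrightarrow> i \<noteq> j \<Longrightarrow>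
    km_relation S (LBracket (LGen (E i)) (LGen (F j))) LZero"
| serre_E: "i \<in> index_set S \<Longrightarrow> j \<in> index_set S \<Longrightarrow> i \<noteq> j \<Longrightarrow>
    km_relation S ((LBracket (LGen (E i)) ^^ nat (1 - km_matrix S i j)) (LGen (E j))) LZero"
| serre_F: "i \<in> index_set S \<Longrightarrow> j \<in> index_set S \<Longrightarrow> i \<noteq> j \<Longrightarrow>
    km_relation S ((LBracket (LGen (F i)) ^^ nat (1 - km_matrix S i j)) (LGen (F j))) LZero"

text \<open>The Kac--Moody algebra is determined up to a unique isomorphism compatible with the generators
  \<open>\<gamma>\<close>; \<open>'g\<close> with \<open>\<gamma>\<close> is any realization of it.\<close>

definition kac_moody_algebra :: "('i, 'y::ab_group_add) root_system_data \<Rightarrow>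
    (('i, 'y) km_generator \<Rightarrow> 'g::complex_lie_algebra) \<Rightarrow> bool" where
  "kac_moody_algebra S \<gamma> \<longleftrightarrow>
     lie_presented (km_generators S) (km_relation S) \<gamma>"

text \<open>Degrees lie in \<open>Q\<close>, realized as the elements of \<open>'i \<Rightarrow>\<^sub>0 int\<close> supported in the index set, with
  \<open>\<alpha>\<^sub>i\<close> = \<^term>\<open>frag_of i\<close>. \<open>root_space S \<gamma> \<alpha>\<close> is the component of degree \<open>\<alpha>\<close> of the grading in which
  \<open>H y\<close>, \<open>E i\<close>, \<open>F i\<close> have degree \<open>0\<close>, \<open>\<alpha>\<^sub>i\<close>, \<open>- \<alpha>\<^sub>i\<close>. It is in general smaller than a weight space of \<open>\<hh>\<close>,
  because the images of the \<open>\<alpha>\<^sub>i\<close> in \<open>X\<close> may be linearly dependent.\<close>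

inductive km_homogeneous :: "('i, 'y) root_system_data \<Rightarrow> (('i, 'y) km_generator \<Rightarrow> 'g::complex_lie_algebra) \<Rightarrow>
    ('i \<Rightarrow>\<^sub>0 int) \<Rightarrow> 'g \<Rightarrow> bool" for S \<gamma> where
  "km_homogeneous S \<gamma> \<alpha> 0"
| "km_homogeneous S \<gamma> \<alpha> x \<Longrightarrow> km_homogeneous S \<gamma> \<alpha> y \<Longrightarrow> km_homogeneous S \<gamma> \<alpha> (x + y)"
| "km_homogeneous S \<gamma> \<alpha> x \<Longrightarrow> km_homogeneous S \<gamma> \<alpha> (c *\<^sub>C x)"
| "km_homogeneous S \<gamma> 0 (\<gamma> (H y))"
| "i \<in> index_set S \<Longrightarrow> km_homogeneous S \<gamma> (frag_of i) (\<gamma> (E i))"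
| "i \<in> index_set S \<Longrightarrow> km_homogeneous S \<gamma> (- frag_of i) (\<gamma> (F i))"
| "km_homogeneous S \<gamma> \<alpha> x \<Longrightarrow> km_homogeneous S \<gamma> \<beta> y \<Longrightarrow>
    km_homogeneous S \<gamma> (\<alpha> + \<beta>) (lie_bracket x y)"

definition root_space :: "('i, 'y) root_system_data \<Rightarrow> (('i, 'y) km_generator \<Rightarrow> 'g::complex_lie_algebra) \<Rightarrow>
    ('i \<Rightarrow>\<^sub>0 int) \<Rightarrow> 'g set" where
  "root_space S \<gamma> \<alpha> = {x. km_homogeneous S \<gamma> \<alpha> x}"

definition roots :: "('i, 'y) root_system_data \<Rightarrow> (('i, 'y) km_generator \<Rightarrow> 'g::complex_lie_algebra) \<Rightarrow>
    ('i \<Rightarrow>\<^sub>0 int) set" where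
  "roots S \<gamma> = {\<alpha>. \<alpha> \<noteq> 0 \<and> root_space S \<gamma> \<alpha> \<noteq> {0}}"

definition uea_root_space :: "('i, 'y) root_system_data \<Rightarrow> (('i, 'y) km_generator \<Rightarrow> 'g::complex_lie_algebra) \<Rightarrow>
    ('i \<Rightarrow>\<^sub>0 int) \<Rightarrow> 'g uea set" where
  "uea_root_space S \<gamma> \<alpha> = complex_vector.span
     {prod_list (map uea_of xs) | xs \<beta>s.
        list_all2 (\<lambda>x \<beta>. x \<in> root_space S \<gamma> \<beta>) xs \<beta>s \<and> sum_list \<beta>s = \<alpha>}"


section \<open>The integral form\<close>

definition divided_power :: "'a::complex_algebra_1 \<Rightarrow> nat \<Rightarrow> 'a" where
  "divided_power x n = (1 / fact n) *\<^sub>C x ^ n"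

definition binomial_element :: "'a::complex_algebra_1 \<Rightarrow> nat \<Rightarrow> 'a" where
  "binomial_element h n = (1 / fact n) *\<^sub>C prod_list (map (\<lambda>k. h - of_nat k) [0..<n])"

inductive_set integral_form :: "('i, 'y) root_system_data \<Rightarrow> (('i, 'y) km_generator \<Rightarrow> 'g::complex_lie_algebra) \<Rightarrow>
    'g uea set" for S \<gamma> where
  "1 \<in> integral_form S \<gamma>"
| "u \<in> integral_form S \<gamma> \<Longrightarrow> v \<in> integral_form S \<gamma> \<Longrightarrow> u - v \<in> integral_form S \<gamma>"
| "u \<in> integral_form S \<gamma> \<Longrightarrow> v \<in> integral_form S \<gamma> \<Longrightarrow> u * v \<in> integral_form S \<gamma>"
| "i \<in> index_set S \<Longrightarrow> divided_power (uea_of (\<gamma> (E i))) n \<in> integral_form S \<gamma>"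
| "i \<in> index_set S \<Longrightarrow> divided_power (uea_of (\<gamma> (F i))) n \<in> integral_form S \<gamma>"
| "binomial_element (uea_of (\<gamma> (H y))) n \<in> integral_form S \<gamma>"

text \<open>The intersection of \<open>root_space S \<gamma> \<alpha>\<close> with the integral form, through the canonical map
  \<^const>\<open>uea_of\<close>. For \<open>\<alpha> = 0\<close> it is the image of \<open>Y\<close> under \<open>\<gamma> \<circ> H\<close>; this is a theorem, not part of
  the definition.\<close>

definition integral_root_space :: "('i, 'y) root_system_data \<Rightarrow> (('i, 'y) km_generator \<Rightarrow> 'g::complex_lie_algebra) \<Rightarrow>
    ('i \<Rightarrow>\<^sub>0 int) \<Rightarrow> 'g set" where
  "integral_root_space S \<gamma> \<alpha> = {x \<in> root_space S \<gamma> \<alpha>. uea_of x \<in> integral_form S \<gamma>}"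

definition integral_uea_root_space :: "('i, 'y) root_system_data \<Rightarrow> (('i, 'y) km_generator \<Rightarrow> 'g::complex_lie_algebra) \<Rightarrow>
    ('i \<Rightarrow>\<^sub>0 int) \<Rightarrow> 'g uea set" where
  "integral_uea_root_space S \<gamma> \<alpha> = uea_root_space S \<gamma> \<alpha> \<inter> integral_form S \<gamma>"

end

theory Submission
  imports Defs "HOL-Algebra.Exponent" "HOL-Library.Product_Plus" "HOL-Library.Multiset"
begin

text \<open>
  A sequence \<open>x\<^bsup>[n]\<^esup>\<close> with the required comultiplication is a group-like power series, a curve through the
  origin with tangent vector \<open>x\<close>; the filtration condition and the counit are then automatic. Over \<open>\<complex>\<close> the
  curve \<open>exp (t x)\<close> is one, and the task is to make its coefficients integral one degree at a time. The
  obstruction in degree \<open>r\<close> is the class of the coefficient \<open>D\<^sub>r\<close> modulo the integral form and the primitive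
  elements.

  For a curve \<open>D\<close> that is integral below degree \<open>r\<close>, compare \<open>D(s) D(t)\<close> with \<open>D(s + t)\<close>. Their quotient is a
  group-like series in \<open>s\<close>, \<open>t\<close> which is trivial on both axes, so it factors into series in monomials
  \<open>s\<^sup>a t\<^sup>b\<close> with \<open>a\<close>, \<open>b > 0\<close>. Hence, for \<open>0 < i < r\<close>, the class of \<open>r choose i\<close> times \<open>D\<^sub>r\<close> comes from
  obstructions in proper divisors of \<open>r\<close>. The binomial coefficients deal with all primes except \<open>p\<close> when \<open>r\<close> is a
  power of \<open>p\<close>; in this case the obstruction is moved to a curve of higher order.

  Applied to the curves \<open>exp (t e\<^sub>i)\<close>, \<open>exp (t f\<^sub>i)\<close> and \<open>(1 + t)\<^sup>h\<close>, whose coefficients generate the integral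
  form, the same quotients straighten every element of it, modulo shorter words, into an integral
  combination of ordered monomials in the coefficients of integral curves. As the symbols of these monomials are
  linearly independent, an integral primitive element is itself the tangent vector of curves that are integral
  to arbitrarily high degree, and by comparison with those all obstructions vanish.
\<close>

text \<open>The obstacle is that the integral primitive elements are not known in advance: nothing
  says that such an x is an integral combination of iterated brackets of generators, and no integral
  basis of a root space is at hand. Integrality therefore enters only through a subring and through
  curves with coefficients in it up to some degree. That degree is a precision, and it gets lost:
  when a series is integral up to N, its factor in the monomial s^a t^b is known to be integral only
  up to N / (a + b). This is the origin of the conditions m * N' \<le> N, and the reason why a word
  of order m is taken at precision m! N in order to end at precision N. Any such start is possible
  because the generators of the integral form are coefficients of curves that are integral in all
  degrees. Tangent vectors can be made independent over the integers only, while symbols have to be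
  compared over the complex numbers; and curves multiply to homogeneous curves only when they have
  the same degree. Hence the tags on tangent vectors, and the graded extension of scalars that
  provides complex linear functionals.\<close>

definition clinear :: "('a::complex_vector \<Rightarrow> 'b::complex_vector) \<Rightarrow> bool" where
  "clinear f \<longleftrightarrow> (\<forall>x y. f (x + y) = f x + f y) \<and> (\<forall>c x. f (c *\<^sub>C x) = c *\<^sub>C f x)"

lemma clinearI:
  "(\<And>x y. f (x + y) = f x + f y) \<Longrightarrow> (\<And>c x. f (c *\<^sub>C x) = c *\<^sub>C f x) \<Longrightarrow> clinear f"
  by (simp add: clinear_def)

lemma clinear_0: "clinear f \<Longrightarrow> f 0 = 0"
  unfolding clinear_def by (metis add_cancel_left_left)

lemma clinear_minus: "clinear f \<Longrightarrow> f (x - y) = f x - f y"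
  unfolding clinear_def by (metis add_diff_cancel_right' diff_add_cancel)

lemma clinear_sum: "clinear f \<Longrightarrow> f (\<Sum>i\<in>I. g i) = (\<Sum>i\<in>I. f (g i))"
  by (induction I rule: infinite_finite_induct) (simp_all add: clinear_0, simp add: clinear_def)

lemma clinear_span_mem:
  assumes "clinear f" "x \<in> complex_vector.span S" "complex_vector.subspace V"
    "\<And>s. s \<in> S \<Longrightarrow> f s \<in> V"
  shows "f x \<in> V"
  using assms(2)
  by (induction rule: complex_vector.span_induct_alt)
    (use assms in \<open>auto simp: clinear_0 clinear_def intro: complex_vector.subspace_0
       complex_vector.subspace_add complex_vector.subspace_scale\<close>)

lemma clinear_span_eq:
  assumes "clinear f" "clinear g" "x \<in> complex_vector.span S" "\<And>s. s \<in> S \<Longrightarrow> f s = g s"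
  shows "f x = g x"
  using assms(3)
  by (induction rule: complex_vector.span_induct_alt)
    (use assms in \<open>auto simp: clinear_0 clinear_def\<close>)

lemma clinear_compose: "clinear f \<Longrightarrow> clinear g \<Longrightarrow> clinear (\<lambda>x. f (g x))"
  by (simp add: clinear_def)

lemma clinear_mult_left: "clinear f \<Longrightarrow> clinear (\<lambda>x. y * f x)" for y :: "'a::complex_algebra_1"
  by (simp add: clinear_def distrib_left mult_scaleC_right)

lemma clinear_scale: "clinear f \<Longrightarrow> clinear (\<lambda>x. c *\<^sub>C f x)"
  by (simp add: clinear_def scaleC_add_right scaleC_scaleC mult.commute)

lemma clinear_diff: "clinear f \<Longrightarrow> clinear g \<Longrightarrow> clinear (\<lambda>x. f x - g x)"
  by (simp add: clinear_def complex_vector.scale_right_diff_distrib)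

subsection \<open>Bilinear maps and tensors\<close>

definition bilin :: "('a::complex_vector \<Rightarrow> 'b::complex_vector \<Rightarrow> 'c::complex_vector) \<Rightarrow> bool" where
  "bilin B \<longleftrightarrow> (\<forall>b. clinear (\<lambda>a. B a b)) \<and> (\<forall>a. clinear (B a))"

text \<open>The linear map induced by a bilinear one, computed on a representative. The codomain is
  an algebra because \<open>monoid_algebra_lift\<close> is typed that way.\<close>

definition tensor_lift ::
    "('a::complex_vector \<Rightarrow> 'b::complex_vector \<Rightarrow> 'c::complex_algebra_1) \<Rightarrow> ('a, 'b) tensor \<Rightarrow> 'c" where
  "tensor_lift B t =
     monoid_algebra_lift (\<lambda>w. case w of FPair a b \<Rightarrow> B a b) (rep_tensor t)"

lemma tensor_lift_abs:
  assumes "bilin B"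
  shows "tensor_lift B (abs_tensor p) = monoid_algebra_lift (\<lambda>w. case w of FPair a b \<Rightarrow> B a b) p"
proof -
  let ?m = "\<lambda>w. case w of FPair a b \<Rightarrow> B a b"
  have rel: "monoid_algebra_lift ?m r = 0" if "r \<in> tensor_relations" for r
    using that assms by cases
      (simp_all add: pair_single_def monoid_algebra_lift_diff monoid_algebra_lift_add
        monoid_algebra_lift_scaleC bilin_def clinear_def scaleC_one)
  have *: "monoid_algebra_lift ?m r = 0" if "r \<in> complex_vector.span tensor_relations" for r
    using that by (induction r rule: complex_vector.span_induct_alt)
      (simp_all add: rel monoid_algebra_lift_add monoid_algebra_lift_scaleC)
  have "rep_tensor (abs_tensor p) - p \<in> complex_vector.span tensor_relations"
    using Quotient3_rep_abs[OF Quotient3_tensor, of p] complex_vector.span_zero by fastforce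
  from *[OF this] show ?thesis
    by (simp add: tensor_lift_def monoid_algebra_lift_diff)
qed

lemma tensor_lift_tensor_of: "bilin B \<Longrightarrow> tensor_lift B (a \<otimes> b) = B a b"
  by (simp add: tensor_of.abs_eq tensor_lift_abs pair_single_def scaleC_one)

lemma clinear_tensor_lift: "bilin B \<Longrightarrow> clinear (tensor_lift B)"
proof (rule clinearI)
  assume B: "bilin B"
  fix s t :: "('a, 'b) tensor" and c
  obtain p q where pq: "s = abs_tensor p" "t = abs_tensor q"
    using Quotient3_abs_rep[OF Quotient3_tensor] by metis
  show "tensor_lift B (s + t) = tensor_lift B s + tensor_lift B t"
    by (simp add: pq plus_tensor.abs_eq tensor_lift_abs[OF B] monoid_algebra_lift_add)
  show "tensor_lift B (c *\<^sub>C s) = c *\<^sub>C tensor_lift B s"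
    by (simp add: pq scaleC_tensor.abs_eq tensor_lift_abs[OF B] monoid_algebra_lift_scaleC)
qed

text \<open>Scalars are absorbed into the left factor, so the step is stated for pure
  tensors.\<close>

lemma tensor_induct [case_names zero add]:
  assumes "P 0" "\<And>t a b. P t \<Longrightarrow> P (t + a \<otimes> b)"
  shows "P t"
proof -
  obtain p where p: "t = abs_tensor p"
    using Quotient3_abs_rep[OF Quotient3_tensor] by metis
  have "P (abs_tensor p)"
  proof (induction p rule: poly_mapping_add_induct)
    case zero
    show ?case using assms(1) by (simp add: zero_tensor.abs_eq)
  next
    case (add p k c)
    obtain a b where k: "k = FPair a b" by (cases k)
    have "Poly_Mapping.single k c = c *\<^sub>C pair_single a b"
      by (rule poly_mapping_eqI) (simp add: k pair_single_def lookup_single scaleC_complex_def when_def)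
    then have "abs_tensor (Poly_Mapping.single k c) = (c *\<^sub>C a) \<otimes> b"
      by (simp only: tensor_of_scaleC_left) (simp add: tensor_of.abs_eq scaleC_tensor.abs_eq)
    with assms(2)[OF add] show ?case by (simp flip: plus_tensor.abs_eq)
  qed
  with p show ?thesis by simp
qed

lemma tensor_zero_left [simp]: "0 \<otimes> b = 0"
  by (metis add_cancel_right_right tensor_of_add_left)
lemma tensor_zero_right [simp]: "a \<otimes> 0 = 0"
  by (metis add_cancel_right_right tensor_of_add_right)
lemma tensor_diff_left: "(a - a') \<otimes> b = a \<otimes> b - a' \<otimes> b"
  by (metis add_diff_cancel_right' diff_add_cancel tensor_of_add_left)
lemma tensor_diff_right: "a \<otimes> (b - b') = a \<otimes> b - a \<otimes> b'"
  by (metis add_diff_cancel_right' diff_add_cancel tensor_of_add_right)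

subsection \<open>Words in the enveloping algebra\<close>

text \<open>The standard filtration shifted by one. With the strict bound, \<open>lower 0\<close> is
  zero, and having filtration below n is membership for every n, including n = 0.\<close>

definition lower :: "nat \<Rightarrow> 'g::complex_lie_algebra uea set" where
  "lower n = complex_vector.span {prod_list (map uea_of xs) | xs. length xs < n}"

lemma uea_filtration_eq_lower: "uea_filtration n = lower (Suc n)"
  by (simp add: uea_filtration_def lower_def less_Suc_eq_le)

lemma lower_subspace: "complex_vector.subspace (lower n)"
  by (simp add: lower_def)

lemma lower_0 [simp]: "lower 0 = {0}"
  by (simp add: lower_def)

lemma lower_add: "u \<in> lower n \<Longrightarrow> v \<in> lower n \<Longrightarrow> u + v \<in> lower n"
  by (simp add: lower_def complex_vector.span_add)
lemma lower_diff: "u \<in> lower n \<Longrightarrow> v \<in> lower n \<Longrightarrow> u - v \<in> lower n"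
  by (simp add: lower_def complex_vector.span_diff)
lemma lower_scale: "u \<in> lower n \<Longrightarrow> c *\<^sub>C u \<in> lower n"
  by (simp add: lower_def complex_vector.span_scale)
lemma lower_zero: "0 \<in> lower n"
  by (simp add: lower_def complex_vector.span_zero)
lemma lower_sum: "(\<And>i. i \<in> I \<Longrightarrow> f i \<in> lower n) \<Longrightarrow> (\<Sum>i\<in>I. f i) \<in> lower n"
  by (simp add: lower_def complex_vector.span_sum)

lemma lower_mono: "m \<le> n \<Longrightarrow> lower m \<subseteq> lower n"
  unfolding lower_def by (rule complex_vector.span_mono) auto

lemma lower_word: "length xs < n \<Longrightarrow> prod_list (map uea_of xs) \<in> lower n"
  unfolding lower_def by (rule complex_vector.span_base) auto

lemma filtration_less_iff_lower: "filtration_less u n \<longleftrightarrow> u \<in> lower n"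
proof
  show "filtration_less u n \<Longrightarrow> u \<in> lower n"
    unfolding filtration_less_def uea_filtration_eq_lower
    using lower_mono lower_zero by (metis Suc_leI subsetD)
  show "u \<in> lower n \<Longrightarrow> filtration_less u n"
    by (cases n) (auto simp: filtration_less_def uea_filtration_eq_lower)
qed

lemma clinear_id: "clinear (\<lambda>x. x)" by (simp add: clinear_def)

lemma lower_mult_left_aux:
  assumes "u \<in> lower a" "length ys \<le> b"
  shows "u * prod_list (map uea_of ys) \<in> lower (a + b)"
proof (rule clinear_span_mem[OF _ assms(1)[unfolded lower_def] lower_subspace])
  show "clinear (\<lambda>u. u * prod_list (map uea_of ys))"
    by (simp add: clinear_def distrib_right mult_scaleC_left)
  fix s :: "'a uea" assume "s \<in> {prod_list (map uea_of xs) |xs. length xs < a}"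
  then obtain xs where "s = prod_list (map uea_of xs)" "length xs < a" by auto
  then show "s * prod_list (map uea_of ys) \<in> lower (a + b)"
    using lower_word[of "xs @ ys" "a + b"] assms(2) by simp
qed

lemma lower_mult_left:
  assumes "u \<in> lower a" "v \<in> lower (Suc b)"
  shows "u * v \<in> lower (a + b)"
  by (rule clinear_span_mem[OF clinear_mult_left[OF clinear_id] assms(2)[unfolded lower_def] lower_subspace])
    (use lower_mult_left_aux[OF assms(1)] in auto)

lemma lower_mult_right:
  assumes "u \<in> lower (Suc a)" "v \<in> lower b"
  shows "u * v \<in> lower (a + b)"
proof (cases b)
  case 0
  then show ?thesis using assms by (simp add: lower_zero)
next
  case (Suc b')
  then show ?thesis using lower_mult_left[OF assms(1), of v b'] assms(2) by simp
qed

lemma abs_uea_word: "abs_uea (Poly_Mapping.single (FWord xs) 1) = prod_list (map uea_of xs)"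
proof (induction xs)
  case Nil
  have "Poly_Mapping.single (FWord [] :: 'a fword) (1::complex) = 1"
    by (metis single_one zero_fword_def)
  then show ?case by (simp only: one_uea.abs_eq list.map prod_list.Nil)
next
  case (Cons x xs)
  have "Poly_Mapping.single (FWord (x # xs)) (1::complex) = letter x * Poly_Mapping.single (FWord xs) 1"
    by (simp add: letter_def mult_single plus_fword_def)
  with Cons show ?case by (simp add: uea_of.abs_eq flip: times_uea.abs_eq)
qed

lemma uea_spanned: "u \<in> complex_vector.span (range (\<lambda>xs. prod_list (map uea_of xs)))"
proof -
  obtain p where p: "u = abs_uea p"
    using Quotient3_abs_rep[OF Quotient3_uea] by metis
  have "abs_uea p \<in> complex_vector.span (range (\<lambda>xs. prod_list (map uea_of xs)))"
  proof (induction p rule: poly_mapping_add_induct)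
    case zero
    show ?case by (simp add: complex_vector.span_zero flip: zero_uea.abs_eq)
  next
    case (add p k c)
    obtain xs where k: "k = FWord xs" by (cases k)
    have "Poly_Mapping.single k c = c *\<^sub>C Poly_Mapping.single (FWord xs) 1"
      by (rule poly_mapping_eqI) (simp add: k lookup_single scaleC_complex_def when_def)
    then have "abs_uea (Poly_Mapping.single k c) = c *\<^sub>C prod_list (map uea_of xs)"
      by (simp add: abs_uea_word flip: scaleC_uea.abs_eq)
    then have "abs_uea (p + Poly_Mapping.single k c) = abs_uea p + c *\<^sub>C prod_list (map uea_of xs)"
      by (simp flip: plus_uea.abs_eq)
    then show ?case
      using complex_vector.span_add[OF add complex_vector.span_scale[OF complex_vector.span_base]] by simp
  qed
  with p show ?thesis by simp
qed

lemma uea_lower_exhaust: obtains n where "u \<in> lower n"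
proof -
  have "\<exists>n. u \<in> lower n"
    using uea_spanned[of u]
  proof (induction rule: complex_vector.span_induct_alt)
    case base
    then show ?case by (auto intro: lower_zero)
  next
    case (step c x y)
    then obtain xs n where "x = prod_list (map uea_of xs)" "y \<in> lower n" by auto
    then have "x \<in> lower (Suc (length xs) + n)" "y \<in> lower (Suc (length xs) + n)"
      using lower_word[of xs "Suc (length xs) + n"] lower_mono[of n "Suc (length xs) + n"] by auto
    then show ?case by (meson lower_add lower_scale)
  qed
  with that show ?thesis by blast
qed

lemma uea_clinear_eqI:
  assumes "clinear f" "clinear g" "\<And>xs. f (prod_list (map uea_of xs)) = g (prod_list (map uea_of xs))"
  shows "f u = g u"
  using clinear_span_eq[OF assms(1,2) uea_spanned] assms(3) by blast

lemma clinear_comult: "clinear comult"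
  by (simp add: clinear_def comult_hom)
lemma clinear_counit: "clinear counit"
  by (simp add: clinear_def counit_hom scaleC_complex_def)

subsection \<open>Contraction\<close>

text \<open>The operator (f \<otimes> id) \<circ> \<nabla>. When f vanishes at 1 it lowers the
  filtration by one and acts on symbols as the derivation that sends a generator y to f y. It serves
  as a partial derivative by which coefficients of ordered monomials are read off.\<close>

definition contract :: "('g::complex_lie_algebra uea \<Rightarrow> complex) \<Rightarrow> 'g uea \<Rightarrow> 'g uea" where
  "contract f u = tensor_lift (\<lambda>a b. f a *\<^sub>C b) (comult u)"

lemma bilin_contract: "clinear f \<Longrightarrow> bilin (\<lambda>a b. f a *\<^sub>C b)"
  by (simp add: bilin_def clinear_def scaleC_add_left scaleC_add_right scaleC_scaleC scaleC_complex_def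
      mult.commute)

lemma clinear_contract: "clinear f \<Longrightarrow> clinear (contract f)"
  unfolding contract_def by (intro clinear_compose[OF clinear_tensor_lift clinear_comult] bilin_contract)

lemma contract_one: "clinear f \<Longrightarrow> contract f 1 = f 1 *\<^sub>C 1"
  by (simp add: contract_def comult_hom bilin_contract tensor_lift_tensor_of flip: tensor_of_one)

lemma contract_mult:
  assumes f: "clinear f"
  shows "contract f (uea_of y * v) = contract (\<lambda>a. f (uea_of y * a)) v + uea_of y * contract f v"
proof -
  have f': "clinear (\<lambda>a. f (uea_of y * a))"
    using clinear_compose[OF f clinear_mult_left[OF clinear_id]] .
  have "tensor_lift (\<lambda>a b. f a *\<^sub>C b) ((uea_of y \<otimes> 1 + 1 \<otimes> uea_of y) * t)
     = tensor_lift (\<lambda>a b. f (uea_of y * a) *\<^sub>C b) t + uea_of y * tensor_lift (\<lambda>a b. f a *\<^sub>C b) t" for t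
  proof (induction t rule: tensor_induct)
    case zero
    show ?case by (simp add: clinear_0 clinear_tensor_lift bilin_contract f f')
  next
    case (add t a b)
    note lin = clinear_tensor_lift[OF bilin_contract[OF f], unfolded clinear_def]
      clinear_tensor_lift[OF bilin_contract[OF f'], unfolded clinear_def]
    from add show ?case
      by (simp add: distrib_left distrib_right lin tensor_of_mult tensor_lift_tensor_of bilin_contract f f'
          mult_scaleC_right)
  qed
  then show ?thesis by (simp add: contract_def comult_hom)
qed

lemma contract_counit: "contract counit u = u"
proof (rule uea_clinear_eqI[OF clinear_contract[OF clinear_counit] clinear_id])
  fix xs :: "'a list"
  show "contract counit (prod_list (map uea_of xs)) = prod_list (map uea_of xs)"
  proof (induction xs)
    case Nil
    show ?case by (simp add: contract_one clinear_counit counit_hom scaleC_one)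
  next
    case (Cons x xs)
    have "contract (\<lambda>a. counit (uea_of x * a)) u = 0" for u
    proof -
      have "bilin (\<lambda>(a :: 'a uea) (b :: 'a uea). 0 :: 'a uea)" by (simp add: bilin_def clinear_def)
      then have "tensor_lift (\<lambda>a b. 0 :: 'a uea) t = 0" for t :: "('a uea, 'a uea) tensor"
        by (induction t rule: tensor_induct)
          (simp_all add: clinear_0 clinear_tensor_lift clinear_tensor_lift[unfolded clinear_def] tensor_lift_tensor_of)
      then show ?thesis by (simp add: contract_def counit_hom)
    qed
    with Cons show ?case by (simp add: contract_mult clinear_counit)
  qed
qed

text \<open>The first two terms are the Leibniz rule. Subtracting the multiple of the counit makes
  the remaining functional vanish at 1, so the third term has smaller order; the subtracted part
  contracts to a multiple of v by the counit law.\<close>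

lemma contract_Cons:
  assumes f: "clinear f"
  shows "contract f (uea_of y * v) = uea_of y * contract f v + f (uea_of y) *\<^sub>C v
     + contract (\<lambda>a. f (uea_of y * a) - f (uea_of y) *\<^sub>C counit a) v"
proof -
  define g where "g = (\<lambda>a. f (uea_of y * a) - f (uea_of y) *\<^sub>C counit a)"
  have f': "clinear (\<lambda>a. f (uea_of y * a))"
    using clinear_compose[OF f clinear_mult_left[OF clinear_id]] .
  have g: "clinear g"
    unfolding g_def by (intro clinear_diff f' clinear_scale clinear_counit)
  have add: "tensor_lift (\<lambda>a b. f (uea_of y * a) *\<^sub>C b) t =
      f (uea_of y) *\<^sub>C tensor_lift (\<lambda>a b. counit a *\<^sub>C b) t + tensor_lift (\<lambda>a b. g a *\<^sub>C b) t"
    for t :: "('a uea, 'a uea) tensor"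
  proof (induction t rule: tensor_induct)
    case zero
    show ?case by (simp add: clinear_0 clinear_tensor_lift bilin_contract f' g clinear_counit)
  next
    case (add t a b)
    note lin = clinear_tensor_lift[OF bilin_contract[OF f'], unfolded clinear_def]
      clinear_tensor_lift[OF bilin_contract[OF g], unfolded clinear_def]
      clinear_tensor_lift[OF bilin_contract[OF clinear_counit], unfolded clinear_def]
    from add show ?case
      by (simp add: lin tensor_lift_tensor_of bilin_contract f' g clinear_counit scaleC_add_right)
        (simp add: g_def complex_vector.scale_left_diff_distrib scaleC_scaleC scaleC_complex_def)
  qed
  show ?thesis
    using add[of "comult v"] contract_counit[of v]
    unfolding contract_mult[OF f] by (simp add: contract_def g_def algebra_simps)
qed

text \<open>The induction runs over all functionals at once, because the error term of the Leibniz
  rule contracts the shorter word with a different functional.\<close>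

lemma contract_word_lower:
  assumes "clinear f" "f 1 = 0"
  shows "contract f (prod_list (map uea_of xs)) \<in> lower (length xs)"
  using assms
proof (induction xs arbitrary: f)
  case Nil
  then show ?case by (simp add: contract_one)
next
  case (Cons x xs)
  define g where "g = (\<lambda>a. f (uea_of x * a) - f (uea_of x) *\<^sub>C counit a)"
  have g: "clinear g" "g 1 = 0"
    unfolding g_def
    by (intro clinear_diff clinear_scale clinear_counit clinear_compose[OF Cons.prems(1) clinear_mult_left[OF clinear_id]])
      (simp add: counit_hom scaleC_complex_def)
  have "uea_of x * contract f (prod_list (map uea_of xs)) \<in> lower (1 + length xs)"
    by (rule lower_mult_right[OF _ Cons.IH[OF Cons.prems]]) (use lower_word[of "[x]" "Suc 1"] in simp)
  moreover have "f (uea_of x) *\<^sub>C prod_list (map uea_of xs) \<in> lower (1 + length xs)"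
    by (intro lower_scale lower_word) simp
  moreover have "contract g (prod_list (map uea_of xs)) \<in> lower (1 + length xs)"
    using Cons.IH[OF g] lower_mono[of "length xs" "1 + length xs"] by auto
  ultimately show ?case
    by (simp add: contract_Cons[OF Cons.prems(1)] flip: g_def) (meson lower_add)
qed

lemma contract_lower:
  assumes "clinear f" "f 1 = 0" "u \<in> lower (Suc n)"
  shows "contract f u \<in> lower n"
proof (rule clinear_span_mem[OF clinear_contract[OF assms(1)] assms(3)[unfolded lower_def] lower_subspace])
  fix s :: "'a uea" assume "s \<in> {prod_list (map uea_of xs) |xs. length xs < Suc n}"
  then obtain xs where "s = prod_list (map uea_of xs)" "length xs \<le> n" by auto
  then show "contract f s \<in> lower n"
    using contract_word_lower[OF assms(1,2), of xs] lower_mono[of "length xs" n] by auto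
qed

lemma contract_Cons_lower:
  assumes "clinear f" "f 1 = 0" "v \<in> lower (Suc n)"
  shows "contract f (uea_of y * v) - (uea_of y * contract f v + f (uea_of y) *\<^sub>C v) \<in> lower n"
proof -
  define g where "g = (\<lambda>a. f (uea_of y * a) - f (uea_of y) *\<^sub>C counit a)"
  have g: "clinear g" "g 1 = 0"
    unfolding g_def
    by (intro clinear_diff clinear_scale clinear_counit clinear_compose[OF assms(1) clinear_mult_left[OF clinear_id]])
      (simp add: counit_hom scaleC_complex_def)
  show ?thesis
    using contract_lower[OF g assms(3)] by (simp add: contract_Cons[OF assms(1)] flip: g_def)
qed

subsection \<open>Primitive elements\<close>

definition primitive :: "'g::complex_lie_algebra uea \<Rightarrow> bool" where
  "primitive u \<longleftrightarrow> comult u = u \<otimes> 1 + 1 \<otimes> u"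

lemma primitive_uea_of: "primitive (uea_of x)"
  by (simp add: primitive_def comult_hom)

lemma primitive_diff: "primitive u \<Longrightarrow> primitive v \<Longrightarrow> primitive (u - v)"
  by (simp add: primitive_def clinear_minus[OF clinear_comult] tensor_diff_left tensor_diff_right)
lemma primitive_0: "primitive 0"
  by (simp add: primitive_def clinear_0[OF clinear_comult])

text \<open>Applying the counit to the left leg of \<nabla> u gives u = \<epsilon>(u) 1 + u.\<close>

lemma primitive_counit: "primitive u \<Longrightarrow> counit u = 0"
proof -
  assume u: "primitive u"
  have "u = tensor_lift (\<lambda>a b. counit a *\<^sub>C b) (u \<otimes> 1 + 1 \<otimes> u)"
    using contract_counit[of u] u by (simp add: contract_def primitive_def)
  also have "\<dots> = counit u *\<^sub>C 1 + u"
    by (simp add: clinear_tensor_lift[OF bilin_contract[OF clinear_counit], unfolded clinear_def]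
        tensor_lift_tensor_of bilin_contract clinear_counit counit_hom scaleC_one)
  finally have "counit u *\<^sub>C (1 :: 'a uea) = 0" by simp
  then have "counit (counit u *\<^sub>C (1 :: 'a uea)) = 0" by (simp add: clinear_0[OF clinear_counit])
  then show ?thesis by (simp add: counit_hom)
qed

text \<open>The commutator of a word with y replaces one letter at a time by its bracket with y,
  which keeps the length.\<close>

lemma commutator_lower:
  assumes "a \<in> lower (Suc n)"
  shows "a * uea_of y - uea_of y * a \<in> lower (Suc n)"
proof (rule clinear_span_mem[OF _ assms[unfolded lower_def] lower_subspace])
  show "clinear (\<lambda>a. a * uea_of y - uea_of y * a)"
    by (rule clinearI)
      (simp_all add: algebra_simps mult_scaleC_left mult_scaleC_right complex_vector.scale_right_diff_distrib)
  have word: "prod_list (map uea_of xs) * uea_of y - uea_of y * prod_list (map uea_of xs) \<in> lower (Suc (length xs))"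
    for xs
  proof (induction xs)
    case Nil
    show ?case by (simp add: lower_zero)
  next
    case (Cons x xs)
    let ?w = "prod_list (map uea_of xs)"
    have "prod_list (map uea_of (x # xs)) * uea_of y - uea_of y * prod_list (map uea_of (x # xs))
      = uea_of x * (?w * uea_of y - uea_of y * ?w) + prod_list (map uea_of (lie_bracket x y # xs))"
      by (simp add: uea_of_lie_bracket algebra_simps)
    moreover have "uea_of x * (?w * uea_of y - uea_of y * ?w) \<in> lower (1 + Suc (length xs))"
      by (rule lower_mult_right[OF _ Cons.IH]) (use lower_word[of "[x]" "Suc 1"] in simp)
    moreover have "prod_list (map uea_of (lie_bracket x y # xs)) \<in> lower (1 + Suc (length xs))"
      by (rule lower_word) simp
    ultimately show ?case by (metis lower_add length_Cons plus_1_eq_Suc)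
  qed
  fix s :: "'a uea" assume "s \<in> {prod_list (map uea_of xs) |xs. length xs < Suc n}"
  then obtain xs where "s = prod_list (map uea_of xs)" "length xs \<le> n" by auto
  then show "s * uea_of y - uea_of y * s \<in> lower (Suc n)"
    using word[of xs] lower_mono[of "Suc (length xs)" "Suc n"] by auto
qed

lemma comult_word_mem:
  "comult (prod_list (map uea_of xs)) \<in> complex_vector.span
     {a \<otimes> b | a b i j. a \<in> lower (Suc i) \<and> b \<in> lower (Suc j) \<and> i + j \<le> length xs}"
  (is "_ \<in> ?T (length xs)")
proof (induction xs)
  case Nil
  have "(1 :: 'a uea) \<in> lower (Suc 0)" using lower_word[of "[]" "Suc 0"] by simp
  then show ?case
    unfolding list.map prod_list.Nil comult_hom(2) tensor_of_one[symmetric]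
    by (intro complex_vector.span_base) fastforce
next
  case (Cons x xs)
  have x: "uea_of x \<in> lower (Suc 1)" using lower_word[of "[x]" "Suc 1"] by simp
  have "(uea_of x \<otimes> 1 + 1 \<otimes> uea_of x) * t \<in> ?T (Suc (length xs))" if "t \<in> ?T (length xs)" for t
  proof (rule clinear_span_mem[OF clinear_mult_left[OF clinear_id] that])
    fix s :: "('a uea, 'a uea) tensor" assume "s \<in> {a \<otimes> b | a b i j. a \<in> lower (Suc i) \<and> b \<in> lower (Suc j) \<and> i + j \<le> length xs}"
    then obtain a b i j where s: "s = a \<otimes> b" "a \<in> lower (Suc i)" "b \<in> lower (Suc j)" "i + j \<le> length xs"
      by blast
    have "(uea_of x * a) \<otimes> b \<in> ?T (Suc (length xs))"
      using s lower_mult_right[OF x s(2)]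
      by (intro complex_vector.span_base CollectI exI[of _ "uea_of x * a"] exI[of _ b] exI[of _ "Suc i"] exI[of _ j]) simp
    moreover have "a \<otimes> (uea_of x * b) \<in> ?T (Suc (length xs))"
      using s lower_mult_right[OF x s(3)]
      by (intro complex_vector.span_base CollectI exI[of _ a] exI[of _ "uea_of x * b"] exI[of _ i] exI[of _ "Suc j"]) simp
    ultimately show "(uea_of x \<otimes> 1 + 1 \<otimes> uea_of x) * s \<in> ?T (Suc (length xs))"
      by (simp add: s distrib_right tensor_of_mult complex_vector.span_add)
  qed simp
  with Cons show ?case by (simp add: comult_hom)
qed

lemma bilin_mult: "bilin ((*) :: 'a::complex_algebra_1 \<Rightarrow> _)"
  by (simp add: bilin_def clinear_def algebra_simps mult_scaleC_left mult_scaleC_right)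

definition square_conv :: "'g::complex_lie_algebra uea \<Rightarrow> 'g uea" where
  "square_conv u = tensor_lift (*) (comult u)"

lemma clinear_square_conv: "clinear square_conv"
  unfolding square_conv_def by (rule clinear_compose[OF clinear_tensor_lift[OF bilin_mult] clinear_comult])

text \<open>Since \<open>\<mu> \<circ> \<nabla>\<close> acts on the symbols of degree \<open>n\<close> as multiplication by \<open>2\<^sup>n\<close> and doubles primitive
  elements, the latter have degree at most 1.\<close>

lemma square_conv_word:
  "square_conv (prod_list (map uea_of xs)) - 2 ^ length xs *\<^sub>C prod_list (map uea_of xs) \<in> lower (length xs)"
proof (induction xs)
  case Nil
  show ?case by (simp add: square_conv_def comult_hom scaleC_one tensor_lift_tensor_of[OF bilin_mult] flip: tensor_of_one)
next
  case (Cons y xs)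
  let ?w = "prod_list (map uea_of xs)" and ?n = "length xs"
  \<comment> \<open>Multiplying the legs after y has entered the right one requires moving y to the
    left past a. \<open>B\<close> is the commutator that this costs, and it does not raise the
    order.\<close>
  define B :: "'a uea \<Rightarrow> 'a uea \<Rightarrow> 'a uea" where "B = (\<lambda>a b. (a * uea_of y - uea_of y * a) * b)"
  have B: "bilin B"
    by (simp add: B_def bilin_def clinear_def algebra_simps mult_scaleC_left mult_scaleC_right
        complex_vector.scale_right_diff_distrib)
  note lin = clinear_tensor_lift[OF B, unfolded clinear_def] clinear_tensor_lift[OF bilin_mult, unfolded clinear_def]
  have "tensor_lift (*) ((uea_of y \<otimes> 1 + 1 \<otimes> uea_of y) * t)
      = 2 *\<^sub>C (uea_of y * tensor_lift (*) t) + tensor_lift B t" for t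
  proof (induction t rule: tensor_induct)
    case zero
    show ?case by (simp add: clinear_0 clinear_tensor_lift B bilin_mult)
  next
    case (add t a b)
    have two: "2 *\<^sub>C u = u + u" for u :: "'a uea"
      using scaleC_add_left[of 1 1 u] by (simp add: scaleC_one)
    from add show ?case
      unfolding two
      by (simp add: distrib_left distrib_right lin tensor_of_mult tensor_lift_tensor_of bilin_mult B)
         (simp add: B_def algebra_simps)
  qed
  then have *: "square_conv (uea_of y * ?w) = 2 *\<^sub>C (uea_of y * square_conv ?w) + tensor_lift B (comult ?w)"
    by (simp add: square_conv_def comult_hom)
  have "tensor_lift B (comult ?w) \<in> lower (Suc ?n)"
  proof (rule clinear_span_mem[OF clinear_tensor_lift[OF B] comult_word_mem lower_subspace])
    fix s :: "('a uea, 'a uea) tensor" assume "s \<in> {a \<otimes> b | a b i j. a \<in> lower (Suc i) \<and> b \<in> lower (Suc j) \<and> i + j \<le> ?n}"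
    then obtain a b i j where s: "s = a \<otimes> b" "a \<in> lower (Suc i)" "b \<in> lower (Suc j)" "i + j \<le> ?n"
      by blast
    have "B a b \<in> lower (Suc i + j)"
      unfolding B_def by (rule lower_mult_left[OF commutator_lower[OF s(2)] s(3)])
    then show "tensor_lift B s \<in> lower (Suc ?n)"
      using s lower_mono[of "Suc i + j" "Suc ?n"] by (auto simp: tensor_lift_tensor_of B)
  qed
  moreover have "2 *\<^sub>C (uea_of y * (square_conv ?w - 2 ^ ?n *\<^sub>C ?w)) \<in> lower (1 + ?n)"
    by (intro lower_scale lower_mult_right[OF _ Cons.IH]) (use lower_word[of "[y]" "Suc 1"] in simp)
  ultimately have "2 *\<^sub>C (uea_of y * (square_conv ?w - 2 ^ ?n *\<^sub>C ?w)) + tensor_lift B (comult ?w) \<in> lower (Suc ?n)"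
    by (simp add: lower_add)
  moreover have "2 *\<^sub>C (uea_of y * (square_conv ?w - 2 ^ ?n *\<^sub>C ?w)) + tensor_lift B (comult ?w)
     = square_conv (uea_of y * ?w) - 2 ^ Suc ?n *\<^sub>C (uea_of y * ?w)"
    unfolding * by (simp add: right_diff_distrib complex_vector.scale_right_diff_distrib mult_scaleC_right
        scaleC_scaleC algebra_simps)
  ultimately show ?case by simp
qed

lemma square_conv_lower:
  assumes "u \<in> lower (Suc n)"
  shows "square_conv u - 2 ^ n *\<^sub>C u \<in> lower n"
proof (rule clinear_span_mem[OF _ assms[unfolded lower_def] lower_subspace])
  show "clinear (\<lambda>u. square_conv u - 2 ^ n *\<^sub>C u)"
    by (intro clinear_diff clinear_square_conv clinear_scale clinear_id)
  fix s :: "'a uea" assume "s \<in> {prod_list (map uea_of xs) |xs. length xs < Suc n}"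
  then obtain xs where s: "s = prod_list (map uea_of xs)" "length xs \<le> n" by auto
  show "square_conv s - 2 ^ n *\<^sub>C s \<in> lower n"
  proof (cases "length xs = n")
    case True
    with square_conv_word[of xs] s show ?thesis by simp
  next
    case False
    with s have l: "length xs < n" by simp
    then have "s \<in> lower n" using s by (simp add: lower_word)
    moreover have "square_conv s - 2 ^ length xs *\<^sub>C s \<in> lower n"
      using square_conv_word[of xs] s l lower_mono[of "length xs" n] by auto
    ultimately have "square_conv s - 2 ^ length xs *\<^sub>C s + (2 ^ length xs *\<^sub>C s - 2 ^ n *\<^sub>C s) \<in> lower n"
      by (meson lower_diff lower_add lower_scale)
    then show ?thesis by simp
  qed
qed

text \<open>For u of order n \<ge> 2, doubling and multiplication by 2^n agree up to smaller order,
  and 2 - 2^n is invertible; so the order drops until it is at most 1. The scalar that then remains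
  is the counit of u, which is 0.\<close>

theorem primitive_iff: "primitive u \<longleftrightarrow> u \<in> range uea_of"
proof
  assume u: "primitive u"
  have sq: "square_conv u = u + u"
    using u by (simp add: square_conv_def primitive_def tensor_lift_tensor_of[OF bilin_mult]
        clinear_tensor_lift[OF bilin_mult, unfolded clinear_def])
  have "u \<in> lower (Suc 1)" if "u \<in> lower n" for n
    using that
  proof (induction n)
    case 0
    then show ?case by (simp add: lower_zero)
  next
    case (Suc n)
    show ?case
    proof (cases "n \<ge> 2")
      case True
      have "(2 - 2 ^ n) *\<^sub>C u \<in> lower n"
        using square_conv_lower[OF Suc.prems] scaleC_add_left[of 1 1 u]
        by (simp add: sq complex_vector.scale_left_diff_distrib scaleC_one)
      then have "(1 / (2 - 2 ^ n)) *\<^sub>C (2 - 2 ^ n) *\<^sub>C u \<in> lower n" by (rule lower_scale)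
      moreover have "(2::complex) - 2 ^ n \<noteq> 0"
      proof -
        have "(2::nat) ^ 1 < 2 ^ n" using True by (intro power_strict_increasing) auto
        then have "of_nat (2 ^ n) \<noteq> (of_nat 2 :: complex)" by (metis nat_neq_iff of_nat_eq_iff power_one_right)
        then show ?thesis by simp
      qed
      ultimately show ?thesis using Suc.IH by (simp add: scaleC_scaleC scaleC_one)
    next
      case False
      then show ?thesis using Suc.prems lower_mono[of "Suc n" "Suc 1"] by auto
    qed
  qed
  then have "u \<in> lower (Suc 1)" using uea_lower_exhaust by metis
  then have "\<exists>c x. u = c *\<^sub>C 1 + uea_of x"
    unfolding lower_def
  proof (induction rule: complex_vector.span_induct_alt)
    case base
    have "uea_of 0 = 0" using uea_of_scaleC[of 0 0] by simp
    then show ?case by (intro exI[of _ 0]) simp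
  next
    case (step c w v)
    then obtain xs d x where w: "w = prod_list (map uea_of xs)" "length xs < Suc 1" and v: "v = d *\<^sub>C 1 + uea_of x"
      by auto
    show ?case
    proof (cases xs)
      case Nil
      then have "c *\<^sub>C w + v = (c + d) *\<^sub>C 1 + uea_of x" by (simp add: w v scaleC_add_left)
      then show ?thesis by blast
    next
      case (Cons y ys)
      then have "c *\<^sub>C w + v = d *\<^sub>C 1 + uea_of (c *\<^sub>C y + x)"
        using w by (simp add: v uea_of_add uea_of_scaleC)
      then show ?thesis by blast
    qed
  qed
  then obtain c x where cx: "u = c *\<^sub>C 1 + uea_of x" by blast
  have "counit u = c" by (simp add: cx counit_hom)
  with primitive_counit[OF u] cx show "u \<in> range uea_of" by simp
qed (auto simp: primitive_uea_of)

lemma primitive_lower: "primitive u \<Longrightarrow> u \<in> lower (Suc 1)"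
  unfolding primitive_iff using lower_word[of "[_]" "Suc 1"] by fastforce

text \<open>Exponent monoids, so that series in one and in two variables share one development:
  \<open>wt\<close> is the total degree, and finiteness of decompositions makes convolution a finite
  sum.\<close>

class fin_decomp = cancel_comm_monoid_add +
  fixes wt :: "'a \<Rightarrow> nat"
  assumes wt_add: "wt (u + v) = wt u + wt v"
    and wt_eq_0_iff: "wt u = 0 \<longleftrightarrow> u = 0"
    and finite_decompositions: "finite {(u, v). u + v = w}"

instantiation nat :: fin_decomp
begin
definition wt_nat :: "nat \<Rightarrow> nat" where "wt_nat n = n"
instance
proof
  fix w :: nat
  show "finite {(u, v). u + v = w}"
    by (rule finite_subset[of _ "{..w} \<times> {..w}"]) auto
qed (simp_all add: wt_nat_def)
end

instantiation prod :: (fin_decomp, fin_decomp) fin_decomp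
begin
definition wt_prod :: "'a \<times> 'b \<Rightarrow> nat" where "wt_prod w = wt (fst w) + wt (snd w)"
instance
proof
  fix w :: "'a \<times> 'b"
  let ?A = "{(u, v). u + v = fst w}" and ?B = "{(u, v). u + v = snd w}"
  have "{(u, v). u + v = w} \<subseteq> (\<lambda>(p, q). ((fst p, fst q), (snd p, snd q))) ` (?A \<times> ?B)"
  proof
    fix p assume "p \<in> {(u, v). u + v = w}"
    then have "((fst (fst p), fst (snd p)), (snd (fst p), snd (snd p))) \<in> ?A \<times> ?B" by auto
    then show "p \<in> (\<lambda>(p, q). ((fst p, fst q), (snd p, snd q))) ` (?A \<times> ?B)"
      by (rule rev_image_eqI) simp
  qed
  moreover have "finite (?A \<times> ?B)" by (intro finite_cartesian_product finite_decompositions)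
  ultimately show "finite {(u, v). u + v = w}" by (meson finite_imageI finite_subset)
next
  fix u v :: "'a \<times> 'b"
  show "wt (u + v) = wt u + wt v" by (simp add: wt_prod_def wt_add)
  show "wt u = 0 \<longleftrightarrow> u = 0" by (cases u) (simp add: wt_prod_def wt_eq_0_iff zero_prod_def)
qed
end

definition decomp :: "'w::fin_decomp \<Rightarrow> ('w \<times> 'w) set" where
  "decomp w = {(u, v). u + v = w}"

lemma finite_decomp [simp]: "finite (decomp w)"
  by (simp add: decomp_def finite_decompositions)

lemma decomp_mem: "(u, v) \<in> decomp w \<longleftrightarrow> u + v = w"
  by (simp add: decomp_def)

lemma wt_zero [simp]: "wt 0 = 0" by (simp add: wt_eq_0_iff)

lemma decomp_zero [simp]: "decomp 0 = {(0, 0)}"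
proof -
  have "u + v = 0 \<longleftrightarrow> u = 0 \<and> v = 0" for u v :: 'a
    using wt_add[of u v] wt_eq_0_iff[of "u + v"] wt_eq_0_iff[of u] wt_eq_0_iff[of v] by auto
  then show ?thesis by (auto simp: decomp_def)
qed

lemma decomp_wt: "(u, v) \<in> decomp w \<Longrightarrow> wt w = wt u + wt v"
  by (auto simp: decomp_def wt_add)

lemma sum_decomp_nat: "(\<Sum>(u, v)\<in>decomp n. h u v) = (\<Sum>i\<le>n. h i (n - i))" for n :: nat
  by (rule sum.reindex_bij_witness[of _ "\<lambda>i. (i, n - i)" fst]) (auto simp: decomp_def)

subsection \<open>Power series with noncommuting coefficients\<close>

text \<open>A separate type lets convolution be the multiplication of a type class. Only the
  multiplicative structure is instantiated: curves are multiplied and divided, never added.\<close>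

typedef ('w, 'a) series = "UNIV :: ('w \<Rightarrow> 'a) set" morphisms coef Series by simp

lemma coef_Series [simp]: "coef (Series f) = f"
  by (rule Series_inverse) simp

lemma series_eqI: "(\<And>w. coef f w = coef g w) \<Longrightarrow> f = g"
  by (metis coef_inject ext)

instantiation series :: (fin_decomp, ring_1) monoid_mult
begin
definition one_series :: "('a, 'b) series" where
  "one_series = Series (\<lambda>w. if w = 0 then 1 else 0)"
definition times_series :: "('a, 'b) series \<Rightarrow> ('a, 'b) series \<Rightarrow> ('a, 'b) series" where
  "times_series f g = Series (\<lambda>w. \<Sum>(u, v)\<in>decomp w. coef f u * coef g v)"
instance
proof
  fix f g h :: "('a, 'b) series"
  show "f * g * h = f * (g * h)"
  proof (rule series_eqI)
    fix w :: 'a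
    have "coef (f * g * h) w
        = (\<Sum>p\<in>decomp w. \<Sum>q\<in>decomp (fst p). coef f (fst q) * coef g (snd q) * coef h (snd p))"
      by (simp add: times_series_def case_prod_beta sum_distrib_right)
    also have "\<dots> = (\<Sum>(p, q)\<in>(SIGMA p:decomp w. decomp (fst p)). coef f (fst q) * coef g (snd q) * coef h (snd p))"
      by (subst sum.Sigma) auto
    also have "\<dots> = (\<Sum>(p, q)\<in>(SIGMA p:decomp w. decomp (snd p)). coef f (fst p) * (coef g (fst q) * coef h (snd q)))"
      by (rule sum.reindex_bij_witness[of _ "\<lambda>(p, q). ((fst p + fst q, snd q), (fst p, fst q))"
            "\<lambda>(p, q). ((fst q, snd q + snd p), (snd q, snd p))"])
        (auto simp: decomp_def add.assoc mult.assoc)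
    also have "\<dots> = (\<Sum>p\<in>decomp w. \<Sum>q\<in>decomp (snd p). coef f (fst p) * (coef g (fst q) * coef h (snd q)))"
      by (subst sum.Sigma) auto
    also have "\<dots> = coef (f * (g * h)) w"
      by (simp add: times_series_def case_prod_beta sum_distrib_left)
    finally show "coef (f * g * h) w = coef (f * (g * h)) w" .
  qed
  show "1 * f = f"
  proof (rule series_eqI)
    fix w :: 'a
    have "coef (1 * f) w = (\<Sum>p\<in>decomp w. if p = (0, w) then coef f w else 0)"
      unfolding one_series_def times_series_def coef_Series
      by (rule sum.cong) (auto simp: decomp_def split: if_splits)
    then show "coef (1 * f) w = coef f w" by (simp add: decomp_mem)
  qed
  show "f * 1 = f"
  proof (rule series_eqI)
    fix w :: 'a
    have "coef (f * 1) w = (\<Sum>p\<in>decomp w. if p = (w, 0) then coef f w else 0)"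
      unfolding one_series_def times_series_def coef_Series
      by (rule sum.cong) (auto simp: decomp_def split: if_splits)
    then show "coef (f * 1) w = coef f w" by (simp add: decomp_mem)
  qed
qed
end

lemma coef_one: "coef 1 w = (if w = 0 then 1 else 0)"
  by (simp add: one_series_def)

lemma coef_mult: "coef (f * g) w = (\<Sum>(u, v)\<in>decomp w. coef f u * coef g v)"
  by (simp add: times_series_def)

lemma coef_mult_0: "coef (f * g) 0 = coef f 0 * coef g 0"
  by (simp add: coef_mult)

lemma coef_mult_split_left:
  "coef (f * g) w = coef f 0 * coef g w + (\<Sum>(u, v)\<in>{p \<in> decomp w. fst p \<noteq> 0}. coef f u * coef g v)"
proof -
  have "decomp w = insert (0, w) {p \<in> decomp w. fst p \<noteq> 0}" by (auto simp: decomp_def)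
  then have "coef (f * g) w = (\<Sum>(u, v)\<in>insert (0, w) {p \<in> decomp w. fst p \<noteq> 0}. coef f u * coef g v)"
    by (simp only: coef_mult)
  then show ?thesis by simp
qed

lemma coef_mult_split:
  assumes "w \<noteq> 0"
  shows "coef (f * g) w = coef f 0 * coef g w + coef f w * coef g 0
     + (\<Sum>(u, v)\<in>{p \<in> decomp w. fst p \<noteq> 0 \<and> snd p \<noteq> 0}. coef f u * coef g v)"
proof -
  let ?D = "{p \<in> decomp w. fst p \<noteq> 0 \<and> snd p \<noteq> 0}"
  have "{p \<in> decomp w. fst p \<noteq> 0} = insert (w, 0) ?D" using assms by (auto simp: decomp_def)
  then have "(\<Sum>(u, v)\<in>{p \<in> decomp w. fst p \<noteq> 0}. coef f u * coef g v)
      = coef f w * coef g 0 + (\<Sum>(u, v)\<in>?D. coef f u * coef g v)" by simp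
  then show ?thesis by (simp add: coef_mult_split_left)
qed

lemma decomp_proper_wt: "p \<in> decomp w \<Longrightarrow> fst p \<noteq> 0 \<Longrightarrow> wt (snd p) < wt w"
  by (cases p) (use wt_eq_0_iff[of "fst p"] in \<open>simp add: decomp_wt\<close>)
lemma decomp_proper_wt': "p \<in> decomp w \<Longrightarrow> snd p \<noteq> 0 \<Longrightarrow> wt (fst p) < wt w"
  by (cases p) (use wt_eq_0_iff[of "snd p"] in \<open>simp add: decomp_wt\<close>)

lemma series_left_cancel:
  fixes g x y :: "('w::fin_decomp, 'a::ring_1) series"
  assumes "coef g 0 = 1" "g * x = g * y"
  shows "x = y"
proof (rule series_eqI)
  fix w
  show "coef x w = coef y w"
  proof (induction "wt w" arbitrary: w rule: less_induct)
    case less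
    have "(\<Sum>(u, v)\<in>{p \<in> decomp w. fst p \<noteq> 0}. coef g u * coef x v)
        = (\<Sum>(u, v)\<in>{p \<in> decomp w. fst p \<noteq> 0}. coef g u * coef y v)"
    proof (rule sum.cong[OF HOL.refl], clarify)
      fix u v assume "(u, v) \<in> decomp w" "fst (u, v) \<noteq> 0"
      from less[OF decomp_proper_wt[OF this, simplified]] show "coef g u * coef x v = coef g u * coef y v" by simp
    qed
    with assms(2) coef_mult_split_left[of g x w] coef_mult_split_left[of g y w] assms(1)
    show ?case by simp
  qed
qed

text \<open>The coefficients of g^-1 f for g with constant term 1, by recursion on the
  weight.\<close>

function series_quot :: "('w::fin_decomp, 'a::ring_1) series \<Rightarrow> ('w, 'a) series \<Rightarrow> 'w \<Rightarrow> 'a" where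
  "series_quot f g w = coef f w - (\<Sum>p\<in>{p \<in> decomp w. fst p \<noteq> 0}. coef g (fst p) * series_quot f g (snd p))"
  by auto
termination
  by (relation "measure (\<lambda>(f, g, w). wt w)") (auto dest: decomp_proper_wt)

declare series_quot.simps [simp del]

lemma series_div_exists:
  fixes f g :: "('w::fin_decomp, 'a::ring_1) series"
  assumes "coef g 0 = 1"
  obtains x where "f = g * x"
proof
  show "f = g * Series (series_quot f g)"
  proof (rule series_eqI)
    fix w
    show "coef f w = coef (g * Series (series_quot f g)) w"
      by (subst coef_mult_split_left) (simp add: assms series_quot.simps[of f g w] case_prod_beta)
  qed
qed

lemma coef_mult_low:
  assumes "coef f 0 = 1" "coef g 0 = 1" "\<And>u. u \<noteq> 0 \<Longrightarrow> wt u < m \<Longrightarrow> coef g u = 0" "wt w \<le> m" "w \<noteq> 0"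
  shows "coef (f * g) w = coef f w + coef g w"
proof -
  have "(\<Sum>(u, v)\<in>{p \<in> decomp w. fst p \<noteq> 0 \<and> snd p \<noteq> 0}. coef f u * coef g v) = 0"
  proof (rule sum.neutral, clarify)
    fix u v assume "(u, v) \<in> decomp w" "fst (u, v) \<noteq> 0" "snd (u, v) \<noteq> 0"
    then have "coef g v = 0"
      using decomp_proper_wt[of "(u, v)" w] assms(4) by (intro assms(3)) auto
    then show "coef f u * coef g v = 0" by simp
  qed
  with coef_mult_split[OF assms(5), of f g] assms(1,2) show ?thesis by simp
qed

definition map_series :: "('a \<Rightarrow> 'b) \<Rightarrow> ('w, 'a) series \<Rightarrow> ('w, 'b) series" where
  "map_series h f = Series (\<lambda>w. h (coef f w))"

lemma coef_map_series [simp]: "coef (map_series h f) w = h (coef f w)"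
  by (simp add: map_series_def)

lemma map_series_mult:
  fixes f g :: "('w::fin_decomp, 'a::ring_1) series" and h :: "'a \<Rightarrow> 'b::ring_1"
  assumes "\<And>x y. h (x + y) = h x + h y" "\<And>x y. h (x * y) = h x * h y"
  shows "map_series h (f * g) = map_series h f * map_series h g"
proof (rule series_eqI)
  fix w
  have "h 0 = 0" using assms(1)[of 0 0] by simp
  then have "h (\<Sum>i\<in>I. t i) = (\<Sum>i\<in>I. h (t i))" for t :: "'w \<times> 'w \<Rightarrow> 'a" and I :: "('w \<times> 'w) set"
    by (induction I rule: infinite_finite_induct) (simp_all add: assms(1))
  then show "coef (map_series h (f * g)) w = coef (map_series h f * map_series h g) w"
    by (simp add: coef_mult case_prod_beta assms(2))
qed

subsection \<open>Group-like series\<close>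

definition grouplike :: "('w::fin_decomp, 'g::complex_lie_algebra uea) series \<Rightarrow> bool" where
  "grouplike f \<longleftrightarrow> coef f 0 = 1 \<and>
     (\<forall>w. comult (coef f w) = (\<Sum>(u, v)\<in>decomp w. coef f u \<otimes> coef f v))"

text \<open>An equation between products of series over the tensor square. The two legs commute, so
  products and quotients of group-like series are handled by rearranging factors.\<close>

lemma grouplike_iff:
  "grouplike f \<longleftrightarrow> coef f 0 = 1 \<and>
     map_series comult f = map_series (\<lambda>a. a \<otimes> 1) f * map_series (\<lambda>a. 1 \<otimes> a) f"
proof -
  have "coef (map_series (\<lambda>a. a \<otimes> 1) f * map_series (\<lambda>a. 1 \<otimes> a) f) w
      = (\<Sum>(u, v)\<in>decomp w. coef f u \<otimes> coef f v)" for w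
    by (simp add: coef_mult tensor_of_mult)
  then have "map_series comult f = map_series (\<lambda>a. a \<otimes> 1) f * map_series (\<lambda>a. 1 \<otimes> a) f \<longleftrightarrow>
      (\<forall>w. comult (coef f w) = (\<Sum>(u, v)\<in>decomp w. coef f u \<otimes> coef f v))"
    by (metis coef_map_series series_eqI)
  then show ?thesis by (simp add: grouplike_def)
qed

lemma map_series_tensor_commute:
  "map_series (\<lambda>a. a \<otimes> 1) f * map_series (\<lambda>a. 1 \<otimes> a) g = map_series (\<lambda>a. 1 \<otimes> a) g * map_series (\<lambda>a. a \<otimes> 1) f"
  for f g :: "('w::fin_decomp, 'a::complex_algebra_1) series"
proof (rule series_eqI)
  fix w
  have "(\<Sum>(u, v)\<in>decomp w. coef f u \<otimes> coef g v) = (\<Sum>(u, v)\<in>decomp w. coef f v \<otimes> coef g u)"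
    by (rule sum.reindex_bij_witness[of _ prod.swap prod.swap]) (auto simp: decomp_def add.commute)
  then show "coef (map_series (\<lambda>a. a \<otimes> 1) f * map_series (\<lambda>a. 1 \<otimes> a) g) w
     = coef (map_series (\<lambda>a. 1 \<otimes> a) g * map_series (\<lambda>a. a \<otimes> 1) f) w"
    by (simp add: coef_mult tensor_of_mult)
qed

lemma map_series_comult_mult: "map_series comult (f * g) = map_series comult f * map_series comult g"
  by (rule map_series_mult) (simp_all add: comult_hom)
lemma map_series_left_mult:
  "map_series (\<lambda>a. a \<otimes> 1) (f * g) = map_series (\<lambda>a. a \<otimes> (1::'b::complex_algebra_1)) f * map_series (\<lambda>a. a \<otimes> 1) g"
  for f g :: "('w::fin_decomp, 'a::complex_algebra_1) series"
  by (rule map_series_mult) (simp_all add: tensor_of_add_left tensor_of_mult)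
lemma map_series_right_mult:
  "map_series (\<lambda>a. 1 \<otimes> a) (f * g) = map_series (\<lambda>a. (1::'b::complex_algebra_1) \<otimes> a) f * map_series (\<lambda>a. 1 \<otimes> a) g"
  for f g :: "('w::fin_decomp, 'a::complex_algebra_1) series"
  by (rule map_series_mult) (simp_all add: tensor_of_add_right tensor_of_mult)

lemma grouplike_one: "grouplike (1 :: ('w::fin_decomp, 'g::complex_lie_algebra uea) series)"
proof -
  have "comult (coef 1 w) = (\<Sum>(u, v)\<in>decomp w. coef 1 u \<otimes> coef (1 :: ('w, 'g uea) series) v)" for w :: 'w
  proof (cases "w = 0")
    case True
    then show ?thesis by (simp add: coef_one comult_hom tensor_of_one)
  next
    case False
    then show ?thesis
      by (subst sum.neutral) (auto simp: coef_one decomp_def clinear_0[OF clinear_comult])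
  qed
  then show ?thesis by (simp add: grouplike_def coef_one)
qed

lemma grouplike_mult:
  assumes "grouplike f" "grouplike g"
  shows "grouplike (f * g)"
proof -
  let ?l = "map_series (\<lambda>a. a \<otimes> 1)" and ?r = "map_series (\<lambda>a. 1 \<otimes> a)"
  have "map_series comult (f * g) = ?l f * (?r f * ?l g) * ?r g"
    using assms by (simp add: grouplike_iff map_series_comult_mult mult.assoc)
  also have "?r f * ?l g = ?l g * ?r f" by (rule map_series_tensor_commute[symmetric])
  finally have "map_series comult (f * g) = ?l (f * g) * ?r (f * g)"
    by (simp add: map_series_left_mult map_series_right_mult mult.assoc)
  then show ?thesis using assms by (simp add: grouplike_iff coef_mult_0)
qed

text \<open>After the commuting legs are exchanged, \<nabla> g stands on the left of both sides;
  having constant term 1, it can be cancelled.\<close>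

lemma grouplike_cancel:
  assumes g: "grouplike g" and gx: "grouplike (g * x)"
  shows "grouplike x"
proof -
  let ?l = "map_series (\<lambda>a. a \<otimes> 1)" and ?r = "map_series (\<lambda>a. 1 \<otimes> a)"
  have g0: "coef g 0 = 1" and x0: "coef x 0 = 1"
    using assms by (auto simp: grouplike_def coef_mult_0)
  have "map_series comult g * map_series comult x = ?l g * ?l x * (?r g * ?r x)"
    using gx by (simp add: grouplike_iff map_series_comult_mult map_series_left_mult map_series_right_mult)
  also have "\<dots> = ?l g * (?l x * ?r g) * ?r x" by (simp add: mult.assoc)
  also have "?l x * ?r g = ?r g * ?l x" by (rule map_series_tensor_commute)
  also have "?l g * (?r g * ?l x) * ?r x = ?l g * ?r g * (?l x * ?r x)" by (simp add: mult.assoc)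
  also have "\<dots> = map_series comult g * (?l x * ?r x)"
    using g by (simp add: grouplike_iff)
  finally have "map_series comult x = ?l x * ?r x"
    by (rule series_left_cancel[rotated]) (simp add: g0 comult_hom)
  with x0 show ?thesis by (simp add: grouplike_iff)
qed

lemma grouplike_primitive:
  assumes f: "grouplike f" and w: "w \<noteq> 0"
    and van: "\<And>u v. u + v = w \<Longrightarrow> u \<noteq> 0 \<Longrightarrow> v \<noteq> 0 \<Longrightarrow> coef f u = 0 \<or> coef f v = 0"
  shows "primitive (coef f w)"
proof -
  let ?D = "{p \<in> decomp w. fst p \<noteq> 0 \<and> snd p \<noteq> 0}"
  have "decomp w = insert (0, w) (insert (w, 0) ?D)" by (auto simp: decomp_def)
  moreover have "(\<Sum>(u, v)\<in>?D. coef f u \<otimes> coef f v) = 0"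
  proof (rule sum.neutral, clarify)
    fix u v assume "(u, v) \<in> decomp w" "fst (u, v) \<noteq> 0" "snd (u, v) \<noteq> 0"
    with van[of u v] show "coef f u \<otimes> coef f v = 0" by (auto simp: decomp_def)
  qed
  moreover have "(\<Sum>(u, v)\<in>insert (0, w) (insert (w, 0) ?D). coef f u \<otimes> coef f v)
      = 1 \<otimes> coef f w + (coef f w \<otimes> 1 + (\<Sum>(u, v)\<in>?D. coef f u \<otimes> coef f v))"
    using f w by (simp add: grouplike_def)
  ultimately have "(\<Sum>(u, v)\<in>decomp w. coef f u \<otimes> coef f v) = 1 \<otimes> coef f w + coef f w \<otimes> 1"
    by (simp only: add_0_right)
  then show ?thesis using f by (simp add: primitive_def grouplike_def add.commute)
qed

subsection \<open>Substitution of a monomial\<close>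

definition nmul :: "nat \<Rightarrow> 'w::comm_monoid_add \<Rightarrow> 'w" where
  "nmul k w = (\<Sum>i<k. w)"

lemma nmul_0 [simp]: "nmul 0 w = 0" by (simp add: nmul_def)
lemma nmul_Suc: "nmul (Suc k) w = w + nmul k w" by (simp add: nmul_def add.commute)
lemma nmul_1 [simp]: "nmul (Suc 0) w = w" by (simp add: nmul_def)
lemma nmul_add: "nmul (j + k) w = nmul j w + nmul k w"
  by (induction j) (simp_all add: nmul_Suc add.assoc)
lemma nmul_nat [simp]: "nmul k n = k * n" for n :: nat
  by (simp add: nmul_def)
lemma nmul_pair: "nmul k (a, b) = (k * a, k * b)" for a b :: nat
proof (induction k)
  case 0
  show ?case by (simp add: zero_prod_def)
next
  case (Suc k)
  then show ?case by (simp only: nmul_Suc) simp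
qed
lemma wt_nmul: "wt (nmul k w) = k * wt w"
  by (induction k) (simp_all add: nmul_Suc wt_add)
lemma nmul_inj: "w \<noteq> 0 \<Longrightarrow> nmul j w = nmul k w \<longleftrightarrow> j = k" for w :: "'w::fin_decomp"
  by (metis mult_cancel2 wt_eq_0_iff wt_nmul)

text \<open>Substitution of the monomial with exponent \<open>w0\<close> for the variable. For
  nonzero \<open>w0\<close> the index set of the sum has at most one element; for
  \<open>w0 = 0\<close> it is infinite at w = 0, hence the condition on \<open>w0\<close> in what
  follows.\<close>

definition sub :: "'w::fin_decomp \<Rightarrow> (nat, 'a::ring_1) series \<Rightarrow> ('w, 'a) series" where
  "sub w0 f = Series (\<lambda>w. \<Sum>k | nmul k w0 = w. coef f k)"

lemma coef_sub_nmul: "w0 \<noteq> 0 \<Longrightarrow> coef (sub w0 f) (nmul k w0) = coef f k"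
  by (simp add: sub_def nmul_inj)
lemma coef_sub_other: "(\<And>k. w \<noteq> nmul k w0) \<Longrightarrow> coef (sub w0 f) w = 0"
  unfolding sub_def coef_Series
  by (rule sum.neutral) auto
lemma coef_sub_0: "w0 \<noteq> 0 \<Longrightarrow> coef (sub w0 f) 0 = coef f 0"
  using coef_sub_nmul[of w0 f 0] by simp

lemma grouplike_sub:
  assumes w0: "w0 \<noteq> 0" and f: "grouplike f"
  shows "grouplike (sub w0 f)"
  unfolding grouplike_def
proof (intro conjI allI)
  show "coef (sub w0 f) 0 = 1" using assms by (simp add: coef_sub_0 grouplike_def)
  fix w
  show "comult (coef (sub w0 f) w) = (\<Sum>(u, v)\<in>decomp w. coef (sub w0 f) u \<otimes> coef (sub w0 f) v)"
  proof (cases "\<exists>k. w = nmul k w0")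
    case True
    then obtain k where k: "w = nmul k w0" by blast
    let ?h = "\<lambda>(i, j). (nmul i w0, nmul j w0)"
    have "(\<Sum>(u, v)\<in>decomp w. coef (sub w0 f) u \<otimes> coef (sub w0 f) v)
        = (\<Sum>(u, v)\<in>?h ` decomp k. coef (sub w0 f) u \<otimes> coef (sub w0 f) v)"
    proof (rule sum.mono_neutral_right)
      show "?h ` decomp k \<subseteq> decomp w" by (auto simp: decomp_def k simp flip: nmul_add)
      show "\<forall>p\<in>decomp w - ?h ` decomp k. (case p of (u, v) \<Rightarrow> coef (sub w0 f) u \<otimes> coef (sub w0 f) v) = 0"
      proof
        fix p assume p: "p \<in> decomp w - ?h ` decomp k"
        have "\<not> (\<exists>i j. p = (nmul i w0, nmul j w0))"
        proof
          assume "\<exists>i j. p = (nmul i w0, nmul j w0)"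
          then obtain i j where ij: "p = (nmul i w0, nmul j w0)" by blast
          with p have "nmul (i + j) w0 = nmul k w0" by (simp add: decomp_def k nmul_add)
          then have "(i, j) \<in> decomp k" using w0 by (simp add: nmul_inj decomp_def)
          with p ij show False by force
        qed
        then show "(case p of (u, v) \<Rightarrow> coef (sub w0 f) u \<otimes> coef (sub w0 f) v) = 0"
          by (cases p) (metis (mono_tags, lifting) case_prod_conv coef_sub_other tensor_zero_left tensor_zero_right)
      qed
    qed simp
    also have "\<dots> = (\<Sum>(i, j)\<in>decomp k. coef f i \<otimes> coef f j)"
      using w0 by (subst sum.reindex) (auto simp: inj_on_def nmul_inj coef_sub_nmul intro!: sum.cong)
    finally show ?thesis using f w0 by (simp add: k coef_sub_nmul grouplike_def)
  next
    case False
    have "(\<Sum>(u, v)\<in>decomp w. coef (sub w0 f) u \<otimes> coef (sub w0 f) v) = 0"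
    proof (rule sum.neutral, clarify)
      fix u v assume "(u, v) \<in> decomp w"
      then have "\<not> ((\<exists>i. u = nmul i w0) \<and> (\<exists>j. v = nmul j w0))"
        using False by (metis decomp_mem nmul_add)
      then show "coef (sub w0 f) u \<otimes> coef (sub w0 f) v = 0"
        by (metis coef_sub_other tensor_zero_left tensor_zero_right)
    qed
    with False show ?thesis by (simp add: coef_sub_other clinear_0[OF clinear_comult])
  qed
qed

lemma wt_nat [simp]: "wt (n :: nat) = n" by (simp add: wt_nat_def)

text \<open>Curves that agree below weight m have a quotient that starts in weight m or later.
  Leading terms are removed in this way throughout.\<close>

lemma quot_vanish:
  fixes g x :: "('w::fin_decomp, 'a::ring_1) series"
  assumes "coef g 0 = 1" "coef x 0 = 1" "\<And>w. wt w < m \<Longrightarrow> coef (g * x) w = coef g w"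
  shows "w \<noteq> 0 \<Longrightarrow> wt w < m \<Longrightarrow> coef x w = 0"
proof (induction "wt w" arbitrary: w rule: less_induct)
  case less
  have "coef (g * x) w = coef g w + coef x w"
  proof (rule coef_mult_low[OF assms(1,2) _ order_refl less.prems(1)])
    fix u :: 'w assume "u \<noteq> 0" "wt u < wt w"
    then show "coef x u = 0" using less by simp
  qed
  with assms(3)[OF less.prems(2)] show ?case by simp
qed

subsection \<open>Exponential series\<close>

text \<open>The recursion is the differential equation (1 + c t) D' = D \<eta>, solved by exp (t
  \<eta>) for c = 0 and by (1 + t)^\<eta> for c = 1. In the comultiplication of (n + 1) D_(n+1) the
  two legs contribute the factors i and n + 1 - i to the i-th summand, which add up to n +
  1.\<close>

lemma grouplike_recursion:
  fixes d :: "(nat, 'g::complex_lie_algebra uea) series"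
  assumes d0: "coef d 0 = 1" and \<eta>: "primitive \<eta>"
    and rec: "\<And>k. of_nat (Suc k) *\<^sub>C coef d (Suc k) = coef d k * (\<eta> - (c * of_nat k) *\<^sub>C 1)"
  shows "grouplike d"
proof -
  have scale_sum: "z *\<^sub>C (\<Sum>i\<in>I. t i) = (\<Sum>i\<in>I. z *\<^sub>C t i)"
    for z and t :: "nat \<Rightarrow> ('g uea, 'g uea) tensor" and I by (rule complex_vector.scale_sum_right)
  have "comult (coef d n) = (\<Sum>i\<le>n. coef d i \<otimes> coef d (n - i))" for n
  proof (induction n)
    case 0
    show ?case by (simp add: d0 comult_hom tensor_of_one)
  next
    case (Suc n)
    define t where "t i = coef d i \<otimes> coef d (Suc n - i)" for i
    have "of_nat (Suc n) *\<^sub>C comult (coef d (Suc n)) = comult (coef d n * (\<eta> - (c * of_nat n) *\<^sub>C 1))"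
      by (simp only: rec flip: comult_hom(4))
    also have "\<dots> = (\<Sum>i\<le>n. coef d i \<otimes> coef d (n - i)) * (\<eta> \<otimes> 1 + 1 \<otimes> \<eta> - (c * of_nat n) *\<^sub>C 1)"
      using \<eta> by (simp add: comult_hom clinear_minus[OF clinear_comult] Suc primitive_def)
    also have "\<dots> = (\<Sum>i\<le>n. of_nat (Suc i) *\<^sub>C t (Suc i) + of_nat (Suc n - i) *\<^sub>C t i)"
      unfolding sum_distrib_right
    proof (rule sum.cong[OF HOL.refl])
      fix i assume "i \<in> {..n}"
      then have i: "i \<le> n" by simp
      then have [simp]: "Suc n - i = Suc (n - i)" by simp
      have "(coef d i \<otimes> coef d (n - i)) * (\<eta> \<otimes> 1 + 1 \<otimes> \<eta> - (c * of_nat n) *\<^sub>C 1)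
        = (coef d i * (\<eta> - (c * of_nat i) *\<^sub>C 1)) \<otimes> coef d (n - i)
          + coef d i \<otimes> (coef d (n - i) * (\<eta> - (c * of_nat (n - i)) *\<^sub>C 1))"
      proof -
        have "(c * of_nat n) *\<^sub>C (1 :: ('g uea, 'g uea) tensor)
            = (c * of_nat i) *\<^sub>C 1 + (c * of_nat (n - i)) *\<^sub>C 1"
          using i by (simp add: of_nat_diff ring_distribs flip: scaleC_add_left)
        then show ?thesis
          by (simp add: right_diff_distrib distrib_left tensor_of_mult tensor_diff_left tensor_diff_right
              mult_scaleC_right tensor_of_scaleC_left tensor_of_scaleC_right)
      qed
      also have "\<dots> = of_nat (Suc i) *\<^sub>C t (Suc i) + of_nat (Suc n - i) *\<^sub>C t i"
        by (simp only: rec[symmetric] tensor_of_scaleC_left tensor_of_scaleC_right t_def) simp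
      finally show "(coef d i \<otimes> coef d (n - i)) * (\<eta> \<otimes> 1 + 1 \<otimes> \<eta> - (c * of_nat n) *\<^sub>C 1)
        = of_nat (Suc i) *\<^sub>C t (Suc i) + of_nat (Suc n - i) *\<^sub>C t i" .
    qed
    also have "\<dots> = (\<Sum>i\<le>Suc n. of_nat i *\<^sub>C t i) + (\<Sum>i\<le>Suc n. of_nat (Suc n - i) *\<^sub>C t i)"
      by (subst sum.atMost_Suc_shift) (simp add: sum.distrib)
    also have "\<dots> = (\<Sum>i\<le>Suc n. of_nat (Suc n) *\<^sub>C t i)"
      unfolding sum.distrib[symmetric]
      by (rule sum.cong) (auto simp flip: scaleC_add_left of_nat_add)
    also have "\<dots> = of_nat (Suc n) *\<^sub>C (\<Sum>i\<le>Suc n. t i)"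
      by (simp only: scale_sum)
    finally have "of_nat (Suc n) *\<^sub>C comult (coef d (Suc n)) = of_nat (Suc n) *\<^sub>C (\<Sum>i\<le>Suc n. t i)" .
    then have "comult (coef d (Suc n)) = (\<Sum>i\<le>Suc n. t i)"
      by (subst (asm) complex_vector.scale_cancel_left) (metis of_nat_eq_0_iff Zero_not_Suc)
    then show ?case by (simp only: t_def)
  qed
  then show ?thesis by (simp add: grouplike_def d0 sum_decomp_nat)
qed

definition exp_series :: "'a::complex_algebra_1 \<Rightarrow> (nat, 'a) series" where
  "exp_series x = Series (divided_power x)"

lemma coef_exp_series: "coef (exp_series x) n = (1 / fact n) *\<^sub>C x ^ n"
  by (simp add: exp_series_def divided_power_def)

lemma coef_exp_series_0 [simp]: "coef (exp_series x) 0 = 1"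
  by (simp add: coef_exp_series scaleC_one)
lemma coef_exp_series_1 [simp]: "coef (exp_series x) (Suc 0) = x"
  by (simp add: coef_exp_series scaleC_one)

lemma grouplike_exp_series: "primitive \<eta> \<Longrightarrow> grouplike (exp_series \<eta>)"
proof (rule grouplike_recursion[where c = 0 and \<eta> = \<eta>])
  fix k
  have "of_nat (Suc k) * (1 / fact (Suc k)) = (1 / fact k :: complex)"
    by (simp add: field_simps del: of_nat_Suc)
  then show "of_nat (Suc k) *\<^sub>C coef (exp_series \<eta>) (Suc k) = coef (exp_series \<eta>) k * (\<eta> - (0 * of_nat k) *\<^sub>C 1)"
    by (simp only: coef_exp_series scaleC_scaleC) (simp add: mult_scaleC_left power_commutes)
qed simp_all

definition binomial_series :: "'a::complex_algebra_1 \<Rightarrow> (nat, 'a) series" where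
  "binomial_series x = Series (binomial_element x)"

lemma scaleC_of_nat: "of_nat k *\<^sub>C (1 :: 'a::complex_algebra_1) = of_nat k"
  by (induction k) (simp_all add: scaleC_add_left scaleC_one)

lemma grouplike_binomial_series: "primitive \<eta> \<Longrightarrow> grouplike (binomial_series \<eta>)"
proof (rule grouplike_recursion[where c = 1 and \<eta> = \<eta>])
  show "coef (binomial_series \<eta>) 0 = 1"
    by (simp add: binomial_series_def binomial_element_def scaleC_one)
  fix k
  have "of_nat (Suc k) * (1 / fact (Suc k)) = (1 / fact k :: complex)"
    by (simp add: field_simps del: of_nat_Suc)
  then show "of_nat (Suc k) *\<^sub>C coef (binomial_series \<eta>) (Suc k)
      = coef (binomial_series \<eta>) k * (\<eta> - (1 * of_nat k) *\<^sub>C 1)"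
    by (simp only: binomial_series_def coef_Series binomial_element_def scaleC_scaleC)
      (simp add: mult_scaleC_left scaleC_of_nat)
qed

subsection \<open>Sums of variables and scalars\<close>

text \<open>The series f (z t): a curve with z times the tangent vector, and for an integer z
  integral as far as f is. Integer multiples of tangent vectors arise in this way.\<close>

definition scal :: "complex \<Rightarrow> ('w::fin_decomp, 'a::complex_algebra_1) series \<Rightarrow> ('w, 'a) series" where
  "scal z f = Series (\<lambda>w. z ^ wt w *\<^sub>C coef f w)"

lemma coef_scal: "coef (scal z f) w = z ^ wt w *\<^sub>C coef f w"
  by (simp add: scal_def)

lemma grouplike_scal: "grouplike f \<Longrightarrow> grouplike (scal z f)"
  unfolding grouplike_def coef_scal
proof (intro conjI allI, goal_cases)
  case 1
  then show ?case by (simp add: scaleC_one)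
next
  case (2 w)
  then have "comult (z ^ wt w *\<^sub>C coef f w) = (\<Sum>(u, v)\<in>decomp w. z ^ wt w *\<^sub>C (coef f u \<otimes> coef f v))"
    by (simp add: comult_hom complex_vector.scale_sum_right case_prod_beta)
  also have "\<dots> = (\<Sum>(u, v)\<in>decomp w. (z ^ wt u *\<^sub>C coef f u) \<otimes> (z ^ wt v *\<^sub>C coef f v))"
    by (rule sum.cong)
      (auto simp: tensor_of_scaleC_left tensor_of_scaleC_right scaleC_scaleC decomp_wt power_add)
  finally show ?case .
qed

text \<open>The series \<open>f (s + t)\<close> in two variables.\<close>

definition addc :: "(nat, 'a::complex_algebra_1) series \<Rightarrow> (nat \<times> nat, 'a) series" where
  "addc f = Series (\<lambda>w. of_nat (wt w choose fst w) *\<^sub>C coef f (wt w))"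

lemma coef_addc: "coef (addc f) w = of_nat (wt w choose fst w) *\<^sub>C coef f (wt w)"
  by (simp add: addc_def)

lemma wt_pair: "wt w = fst w + snd w" for w :: "nat \<times> nat"
  by (simp add: wt_prod_def)

text \<open>Group-likeness of D (s + t), coefficientwise: with n = \<open>wt w\<close>, the
  coefficient of D_p \<otimes> D_(n-p) collects the ways to split w with a first part of weight
  p.\<close>

lemma vandermonde_decomp:
  fixes w :: "nat \<times> nat"
  assumes "p \<le> wt w"
  shows "(\<Sum>x | x \<in> decomp w \<and> wt (fst x) = p. (p choose fst (fst x)) * ((wt w - p) choose fst (snd x)))
     = (wt w choose fst w)"
proof -
  obtain i j where w: "w = (i, j)" by (cases w)
  let ?D = "{x \<in> decomp w. wt (fst x) = p}"
  have D: "?D = (\<lambda>k. ((k, p - k), (i - k, j - (p - k)))) ` {k. k \<le> i \<and> k \<le> p \<and> p - k \<le> j}" (is "_ = ?h ` ?K")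
  proof (intro equalityI subsetI)
    fix x assume x: "x \<in> ?D"
    then have "x = ?h (fst (fst x))" "fst (fst x) \<in> ?K"
      by (auto simp: decomp_def wt_pair w prod_eq_iff)
    then show "x \<in> ?h ` ?K" by blast
  qed (auto simp: decomp_def wt_pair w)
  have inj: "inj_on ?h ?K" by (rule inj_onI) auto
  have "(\<Sum>x\<in>?D. (p choose fst (fst x)) * ((wt w - p) choose fst (snd x)))
     = (\<Sum>k\<in>?K. (p choose k) * ((wt w - p) choose (i - k)))"
    unfolding D sum.reindex[OF inj] by simp
  also have "\<dots> = (\<Sum>k\<le>i. (p choose k) * ((wt w - p) choose (i - k)))"
  proof (rule sum.mono_neutral_left)
    show "\<forall>k\<in>{..i} - ?K. (p choose k) * ((wt w - p) choose (i - k)) = 0"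
      using assms by (auto simp: w wt_pair)
  qed auto
  also have "\<dots> = (p + (wt w - p) choose i)" by (rule vandermonde)
  also have "\<dots> = (wt w choose fst w)" using assms by (simp add: w)
  finally show ?thesis .
qed

lemma grouplike_addc:
  fixes f :: "(nat, 'g::complex_lie_algebra uea) series"
  assumes "grouplike f"
  shows "grouplike (addc f)"
  unfolding grouplike_def
proof (intro conjI allI)
  show "coef (addc f) 0 = 1" using assms by (simp add: coef_addc grouplike_def scaleC_one)
  fix w :: "nat \<times> nat"
  define t where "t p = coef f p \<otimes> coef f (wt w - p)" for p
  have "(\<Sum>(u, v)\<in>decomp w. coef (addc f) u \<otimes> coef (addc f) v)
      = (\<Sum>x\<in>decomp w. of_nat ((wt (fst x) choose fst (fst x)) * ((wt w - wt (fst x)) choose fst (snd x))) *\<^sub>C t (wt (fst x)))"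
    by (rule sum.cong)
      (auto simp: coef_addc tensor_of_scaleC_left tensor_of_scaleC_right scaleC_scaleC t_def decomp_wt)
  also have "\<dots> = (\<Sum>p\<le>wt w. \<Sum>x | x \<in> decomp w \<and> wt (fst x) = p.
      of_nat ((wt (fst x) choose fst (fst x)) * ((wt w - wt (fst x)) choose fst (snd x))) *\<^sub>C t (wt (fst x)))"
    by (rule sum.group[symmetric]) (auto simp: decomp_wt)
  also have "\<dots> = (\<Sum>p\<le>wt w. of_nat (wt w choose fst w) *\<^sub>C t p)"
  proof (rule sum.cong[OF HOL.refl])
    fix p assume "p \<in> {..wt w}"
    then have p: "p \<le> wt w" by simp
    have "(\<Sum>x | x \<in> decomp w \<and> wt (fst x) = p.
        of_nat ((wt (fst x) choose fst (fst x)) * ((wt w - wt (fst x)) choose fst (snd x))) *\<^sub>C t (wt (fst x)))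
      = (\<Sum>x | x \<in> decomp w \<and> wt (fst x) = p.
          of_nat ((p choose fst (fst x)) * ((wt w - p) choose fst (snd x)))) *\<^sub>C t p"
      unfolding complex_vector.scale_sum_left by (rule sum.cong) auto
    then show "(\<Sum>x | x \<in> decomp w \<and> wt (fst x) = p.
        of_nat ((wt (fst x) choose fst (fst x)) * ((wt w - wt (fst x)) choose fst (snd x))) *\<^sub>C t (wt (fst x)))
      = of_nat (wt w choose fst w) *\<^sub>C t p"
      by (simp only: of_nat_sum[symmetric] vandermonde_decomp[OF p])
  qed
  also have "\<dots> = comult (coef (addc f) w)"
    using assms by (simp add: coef_addc comult_hom grouplike_def sum_decomp_nat t_def complex_vector.scale_sum_right)
  finally show "comult (coef (addc f) w) = (\<Sum>(u, v)\<in>decomp w. coef (addc f) u \<otimes> coef (addc f) v)" ..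
qed

subsection \<open>Filtration of the coefficients of group-like series\<close>

lemma div_add_div_le: "a div k + b div k \<le> (a + b) div k" for a b k :: nat
proof (cases "k = 0")
  case False
  have "(a div k + b div k) * k \<le> a + b"
    unfolding distrib_right by (intro add_mono) auto
  with False show ?thesis by (simp add: less_eq_div_iff_mult_less_eq)
qed simp

lemma lower_one: "1 \<in> lower (Suc n)"
  using lower_word[of "[]" "Suc n"] by simp

lemma coef_exp_series_lower:
  assumes "primitive \<eta>"
  shows "coef (exp_series \<eta>) n \<in> lower (Suc n)"
proof -
  have "\<eta> ^ n \<in> lower (Suc n)"
  proof (induction n)
    case (Suc n)
    show ?case using lower_mult_right[OF primitive_lower[OF assms] Suc] by simp
  qed (simp add: lower_one)
  then show ?thesis by (simp add: coef_exp_series lower_scale)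
qed

lemma grouplike_leading:
  fixes f :: "(nat, 'g::complex_lie_algebra uea) series"
  assumes "grouplike f" "k \<noteq> 0" "\<And>i. 0 < i \<Longrightarrow> i < k \<Longrightarrow> coef f i = 0"
  shows "primitive (coef f k)"
  using assms by (intro grouplike_primitive) auto

lemma nmul_dvd: "(\<exists>j. n = nmul j k) \<longleftrightarrow> k dvd n" for n k :: nat
  by (auto simp: dvd_def mult.commute)

lemma coef_sub_nat: "k \<noteq> 0 \<Longrightarrow> coef (sub k f) n = (if k dvd n then coef f (n div k) else 0)" for n k :: nat
proof (cases "k dvd n")
  case True
  assume "k \<noteq> 0"
  then show ?thesis using coef_sub_nmul[of k f "n div k"] True by simp
next
  case False
  then show ?thesis using coef_sub_other[of n k f] nmul_dvd[of n k] by auto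
qed

text \<open>Division by exp (t^k \<eta>), with \<eta> the leading coefficient, raises k. The
  exponential has order j in degree k j, and n div k is superadditive in n. The process ends at
  \<open>N\<close>, since a series that is trivial up to degree N leaves nothing to divide
  by.\<close>

lemma grouplike_lower_aux:
  fixes f :: "(nat, 'g::complex_lie_algebra uea) series"
  assumes "grouplike f" "0 < k" "\<And>i. 0 < i \<Longrightarrow> i < k \<Longrightarrow> coef f i = 0" "n \<le> N"
  shows "coef f n \<in> lower (Suc (n div k))"
  using assms
proof (induction "Suc N - k" arbitrary: f k n rule: less_induct)
  case less
  note f = \<open>grouplike f\<close> and k = \<open>0 < k\<close> and van = less.prems(3)
  show ?case
  proof (cases "k \<le> N")
    case False
    show ?thesis
    proof (cases "n = 0")
      case True
      then show ?thesis using f by (simp add: grouplike_def lower_one)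
    next
      case n: False
      then have "coef f n = 0" using False less.prems(4) by (intro van) auto
      then show ?thesis by (simp add: lower_zero)
    qed
  next
    case True
    define \<eta> where "\<eta> = coef f k"
    have \<eta>: "primitive \<eta>" unfolding \<eta>_def using f k van by (intro grouplike_leading) auto
    define g where "g = sub k (exp_series \<eta>)"
    have g: "grouplike g" unfolding g_def using k by (intro grouplike_sub grouplike_exp_series \<eta>) simp
    have g0: "coef g 0 = 1" using g by (simp add: grouplike_def)
    obtain x where fx: "f = g * x" using series_div_exists[OF g0] .
    then have x: "grouplike x" using grouplike_cancel[OF g] f by simp
    have "coef f w = coef g w" if "w < Suc k" for w
    proof (cases "w = 0 \<or> w = k")
      case True
      then show ?thesis using f k by (auto simp: g0 grouplike_def g_def coef_sub_nat \<eta>_def)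
    next
      case False
      then have "coef f w = 0" using that by (intro van) auto
      moreover have "coef g w = 0" using False that k by (auto simp: g_def coef_sub_nat dest: dvd_imp_le)
      ultimately show ?thesis by simp
    qed
    then have van': "coef x i = 0" if "0 < i" "i < Suc k" for i
      using that quot_vanish[of g x "Suc k" i] g0 x by (simp add: grouplike_def fx)
    have "coef x m \<in> lower (Suc (m div Suc k))" if "m \<le> N" for m
      using less.hyps[of "Suc k" x m] True x van' that by simp
    moreover have "coef g i \<in> lower (Suc (i div k))" for i
      using k coef_exp_series_lower[OF \<eta>] by (simp add: g_def coef_sub_nat lower_zero)
    ultimately have "coef g i * coef x (n - i) \<in> lower (Suc (n div k))" if "i \<le> n" for i
    proof -
      have "coef g i * coef x (n - i) \<in> lower (Suc (i div k) + ((n - i) div Suc k))"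
        using \<open>coef g i \<in> _\<close> \<open>\<And>m. m \<le> N \<Longrightarrow> _\<close>[of "n - i"] less.prems(4) by (intro lower_mult_left) auto
      moreover have "(n - i) div Suc k \<le> (n - i) div k" using k by (intro div_le_mono2) auto
      then have "Suc (i div k) + ((n - i) div Suc k) \<le> Suc (n div k)"
        using div_add_div_le[of i k "n - i"] that by simp
      ultimately show ?thesis using lower_mono by blast
    qed
    then show ?thesis
      unfolding fx coef_mult sum_decomp_nat by (intro lower_sum) auto
  qed
qed

lemma grouplike_lower:
  fixes f :: "(nat, 'g::complex_lie_algebra uea) series"
  assumes "grouplike f"
  shows "coef f n \<in> lower (Suc n)"
  using grouplike_lower_aux[OF assms, of 1 n n] by simp

text \<open>After division by exp (t \<eta>), with \<eta> the tangent vector, the quotient starts in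
  degree 2, so its coefficient in degree m has order at most m div 2. Every mixed product then has
  order below n, and the exponential alone determines the symbol.\<close>

lemma grouplike_symbol:
  fixes f :: "(nat, 'g::complex_lie_algebra uea) series"
  assumes f: "grouplike f"
  shows "coef f n - (1 / fact n) *\<^sub>C coef f 1 ^ n \<in> lower n"
proof -
  define \<eta> where "\<eta> = coef f 1"
  have \<eta>: "primitive \<eta>" unfolding \<eta>_def using f by (intro grouplike_leading) auto
  define g where "g = exp_series \<eta>"
  have g: "grouplike g" unfolding g_def by (intro grouplike_exp_series \<eta>)
  have g0: "coef g 0 = 1" using g by (simp add: grouplike_def)
  obtain x where fx: "f = g * x" using series_div_exists[OF g0] .
  then have x: "grouplike x" using grouplike_cancel[OF g] f by simp
  have "coef f w = coef g w" if "w < 2" for w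
    using that f g0 by (cases "w = 0") (auto simp: grouplike_def g_def \<eta>_def less_2_cases_iff)
  then have van': "coef x i = 0" if "0 < i" "i < 2" for i
    using that quot_vanish[of g x 2 i] g0 x by (simp add: grouplike_def fx)
  have x_lower: "coef x m \<in> lower (Suc (m div 2))" for m
    using grouplike_lower_aux[OF x, of 2 m m] van' by simp
  have "coef f n = (\<Sum>i<n. coef g i * coef x (n - i)) + coef g n"
    unfolding fx coef_mult sum_decomp_nat using x by (simp add: grouplike_def flip: lessThan_Suc_atMost)
  moreover have "coef g i * coef x (n - i) \<in> lower n" if "i < n" for i
  proof -
    have "coef g i * coef x (n - i) \<in> lower (Suc i + (n - i) div 2)"
      using coef_exp_series_lower[OF \<eta>] by (intro lower_mult_left x_lower) (simp add: g_def)
    moreover have "Suc i + (n - i) div 2 \<le> n" using that by linarith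
    ultimately show ?thesis using lower_mono by blast
  qed
  ultimately show ?thesis
    by (auto simp: g_def coef_exp_series \<eta>_def intro: lower_sum)
qed

section \<open>Homogeneous curves in a graded algebra with a subring\<close>

definition monoid_hom :: "('w::comm_monoid_add \<Rightarrow> 'q::comm_monoid_add) \<Rightarrow> bool" where
  "monoid_hom \<delta> \<longleftrightarrow> \<delta> 0 = 0 \<and> (\<forall>u v. \<delta> (u + v) = \<delta> u + \<delta> v)"

lemma monoid_hom_nmul: "monoid_hom \<delta> \<Longrightarrow> monoid_hom (\<lambda>k. \<delta> (nmul k w))"
  by (simp add: monoid_hom_def nmul_add)

lemma monoid_hom_wt: "monoid_hom \<delta> \<Longrightarrow> monoid_hom (\<lambda>w. \<delta> (wt w))"
  by (simp add: monoid_hom_def wt_add)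

text \<open>What the arithmetic of curves uses: subspaces indexed by degrees and compatible with
  multiplication, and a subring. Generation of \<open>U\<close> by curves and separation of degrees
  are added in \<open>separated_graded_form\<close>, where tangent vectors have to be
  identified.\<close>

locale graded_form =
  fixes Ag :: "'q::comm_monoid_add \<Rightarrow> 'g::complex_lie_algebra uea set" and U :: "'g uea set"
  assumes Ag_subspace: "complex_vector.subspace (Ag q)"
    and Ag_one: "1 \<in> Ag 0"
    and Ag_mult: "u \<in> Ag p \<Longrightarrow> v \<in> Ag q \<Longrightarrow> u * v \<in> Ag (p + q)"
    and U_one: "1 \<in> U"
    and U_diff: "u \<in> U \<Longrightarrow> v \<in> U \<Longrightarrow> u - v \<in> U"
    and U_mult: "u \<in> U \<Longrightarrow> v \<in> U \<Longrightarrow> u * v \<in> U"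
begin

lemma Ag_zero: "0 \<in> Ag q" and Ag_add: "u \<in> Ag q \<Longrightarrow> v \<in> Ag q \<Longrightarrow> u + v \<in> Ag q"
  and Ag_scale: "u \<in> Ag q \<Longrightarrow> c *\<^sub>C u \<in> Ag q"
  and Ag_diff: "u \<in> Ag q \<Longrightarrow> v \<in> Ag q \<Longrightarrow> u - v \<in> Ag q"
  using Ag_subspace complex_vector.subspace_0 complex_vector.subspace_add complex_vector.subspace_scale
    complex_vector.subspace_diff by blast+

lemma Ag_sum: "(\<And>i. i \<in> I \<Longrightarrow> f i \<in> Ag q) \<Longrightarrow> (\<Sum>i\<in>I. f i) \<in> Ag q"
  using complex_vector.subspace_sum[OF Ag_subspace] .

lemma U_zero: "0 \<in> U" using U_diff[OF U_one U_one] by simp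
lemma U_uminus: "u \<in> U \<Longrightarrow> - u \<in> U" using U_diff[OF U_zero] by simp
lemma U_add: "u \<in> U \<Longrightarrow> v \<in> U \<Longrightarrow> u + v \<in> U" using U_diff[OF _ U_uminus] by simp
lemma U_sum: "(\<And>i. i \<in> I \<Longrightarrow> f i \<in> U) \<Longrightarrow> (\<Sum>i\<in>I. f i) \<in> U"
  by (induction I rule: infinite_finite_induct) (simp_all add: U_zero U_add)

lemma U_of_nat: "u \<in> U \<Longrightarrow> of_nat n *\<^sub>C u \<in> U"
  by (induction n) (simp_all add: U_zero U_add scaleC_add_left scaleC_one)

lemma U_of_int: "u \<in> U \<Longrightarrow> of_int m *\<^sub>C u \<in> U"
  by (cases m rule: int_cases2) (simp_all add: U_of_nat U_uminus complex_vector.scale_minus_left)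

subsection \<open>Curves\<close>

text \<open>The degree map \<delta> on exponents follows substitutions: inserting a monomial
  composes it with \<open>nmul\<close>, and two variables carry sums of degrees. In one variable it
  is determined by \<delta> 1.\<close>

definition curve :: "('w::fin_decomp \<Rightarrow> 'q) \<Rightarrow> ('w, 'g uea) series \<Rightarrow> bool" where
  "curve \<delta> f \<longleftrightarrow> monoid_hom \<delta> \<and> grouplike f \<and> (\<forall>w. coef f w \<in> Ag (\<delta> w))"

text \<open>The bound is strict: integrality up to and including N is \<open>ibelow (Suc N)\<close>,
  while \<open>ibelow n\<close> leaves open degree n, where the obstruction lives.\<close>

definition ibelow :: "nat \<Rightarrow> ('w::fin_decomp, 'g uea) series \<Rightarrow> bool" where
  "ibelow n f \<longleftrightarrow> (\<forall>w. wt w < n \<longrightarrow> coef f w \<in> U)"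

lemma curve_0: "curve \<delta> f \<Longrightarrow> coef f 0 = 1"
  by (simp add: curve_def grouplike_def)
lemma curve_hom: "curve \<delta> f \<Longrightarrow> monoid_hom \<delta>"
  by (simp add: curve_def)
lemma curve_grouplike: "curve \<delta> f \<Longrightarrow> grouplike f"
  by (simp add: curve_def)
lemma curve_Ag: "curve \<delta> f \<Longrightarrow> coef f w \<in> Ag (\<delta> w)"
  by (simp add: curve_def)

lemma curve_one: "monoid_hom \<delta> \<Longrightarrow> curve \<delta> 1"
  by (auto simp: curve_def grouplike_one coef_one monoid_hom_def Ag_one Ag_zero)

lemma Ag_coef_mult:
  assumes "monoid_hom \<delta>" "\<And>u. coef f u \<in> Ag (\<delta> u)" "\<And>u. coef g u \<in> Ag (\<delta> u)" "p \<in> decomp w"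
  shows "coef f (fst p) * coef g (snd p) \<in> Ag (\<delta> w)"
  using assms(1,4) Ag_mult[OF assms(2)[of "fst p"] assms(3)[of "snd p"]]
  by (auto simp: decomp_def monoid_hom_def)

lemma curve_mult: "curve \<delta> f \<Longrightarrow> curve \<delta> g \<Longrightarrow> curve \<delta> (f * g)"
  unfolding curve_def
  by (auto simp: coef_mult case_prod_beta intro!: grouplike_mult Ag_sum Ag_coef_mult)

lemma curve_div:
  assumes f: "curve \<delta> f" and g: "curve \<delta> g"
  obtains x where "f = g * x" "curve \<delta> x"
proof -
  obtain x where x: "f = g * x" using series_div_exists[OF curve_0[OF g]] .
  have gx: "grouplike x" using grouplike_cancel[of g x] f g x by (simp add: curve_def)
  have "coef x w \<in> Ag (\<delta> w)" for w
  proof (induction "wt w" arbitrary: w rule: less_induct)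
    case less
    have "(\<Sum>(u, v)\<in>{p \<in> decomp w. fst p \<noteq> 0}. coef g u * coef x v) \<in> Ag (\<delta> w)"
    proof (rule Ag_sum, clarify)
      fix u v assume uv: "(u, v) \<in> decomp w" "fst (u, v) \<noteq> 0"
      have "coef x v \<in> Ag (\<delta> v)" using less decomp_proper_wt[OF uv] by simp
      moreover have "\<delta> w = \<delta> u + \<delta> v"
        using uv(1) curve_hom[OF f] by (auto simp: decomp_def monoid_hom_def)
      ultimately show "coef g u * coef x v \<in> Ag (\<delta> w)"
        using Ag_mult[OF curve_Ag[OF g, of u]] by simp
    qed
    then show ?case
      using coef_mult_split_left[of g x w] curve_0[OF g] curve_Ag[OF f, of w] Ag_diff by (simp add: x) fastforce
  qed
  then have "curve \<delta> x" using gx f by (simp add: curve_def)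
  with x that show ?thesis by blast
qed

lemma curve_sub:
  assumes "monoid_hom \<delta>" "w0 \<noteq> 0" "curve (\<lambda>k. \<delta> (nmul k w0)) f"
  shows "curve \<delta> (sub w0 f)"
  unfolding curve_def
proof (intro conjI allI)
  show "grouplike (sub w0 f)" using assms by (intro grouplike_sub) (auto simp: curve_def)
  fix w show "coef (sub w0 f) w \<in> Ag (\<delta> w)"
  proof (cases "\<exists>k. w = nmul k w0")
    case True
    then show ?thesis using assms curve_Ag[OF assms(3)] by (auto simp: coef_sub_nmul)
  next
    case False
    then show ?thesis by (simp add: coef_sub_other Ag_zero)
  qed
qed (fact assms)

lemma curve_exp_series:
  assumes "monoid_hom \<delta>" "primitive \<eta>" "\<eta> \<in> Ag (\<delta> 1)"
  shows "curve \<delta> (exp_series \<eta>)"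
proof -
  have "\<eta> ^ k \<in> Ag (\<delta> k)" for k
  proof (induction k)
    case 0
    show ?case using assms(1) by (simp add: monoid_hom_def Ag_one)
  next
    case (Suc k)
    have "\<delta> (Suc k) = \<delta> 1 + \<delta> k" using assms(1) unfolding monoid_hom_def by (metis plus_1_eq_Suc)
    with Suc assms(3) show ?case by (simp add: Ag_mult)
  qed
  then show ?thesis
    using assms by (auto simp: curve_def grouplike_exp_series coef_exp_series intro: Ag_scale)
qed

lemma curve_scal: "curve \<delta> f \<Longrightarrow> curve \<delta> (scal z f)"
  by (auto simp: curve_def grouplike_scal coef_scal intro: Ag_scale)

lemma curve_addc: "curve \<delta> f \<Longrightarrow> curve (\<lambda>w. \<delta> (wt w)) (addc f)"
  by (auto simp: curve_def grouplike_addc coef_addc monoid_hom_wt intro: Ag_scale)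

lemma curve_leading:
  fixes f :: "(nat, 'g uea) series"
  assumes "curve \<delta> f" "k \<noteq> 0" "\<And>i. 0 < i \<Longrightarrow> i < k \<Longrightarrow> coef f i = 0"
  shows "primitive (coef f k)"
  using assms by (intro grouplike_leading) (auto simp: curve_def)

text \<open>If a curve matches f below n, the difference in degree n is primitive because all mixed
  terms cancel, and multiplication by its exponential in t^n repairs that degree. So truncated
  group-like sequences extend over the complex numbers; nothing is said about integrality from n
  on.\<close>

lemma curve_extend:
  fixes f :: "nat \<Rightarrow> 'g uea"
  assumes \<delta>: "monoid_hom \<delta>" and f0: "f 0 = 1"
    and f: "\<And>k. k < n \<Longrightarrow> f k \<in> Ag (\<delta> k) \<and> comult (f k) = (\<Sum>i\<le>k. f i \<otimes> f (k - i))"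
  shows "\<exists>F. curve \<delta> F \<and> (\<forall>k<n. coef F k = f k)"
  using f
proof (induction n)
  case 0
  show ?case using curve_one[OF \<delta>] by blast
next
  case (Suc n)
  then obtain F where F: "curve \<delta> F" and Ff: "\<And>k. k < n \<Longrightarrow> coef F k = f k" by fastforce
  show ?case
  proof (cases "n = 0")
    case True
    then show ?thesis using F f0 by (auto simp: curve_0)
  next
    case n: False
    define \<eta> where "\<eta> = f n - coef F n"
    have split: "(\<Sum>i\<le>n. t i) = t 0 + t n + (\<Sum>i\<in>{0<..<n}. t i)" for t :: "nat \<Rightarrow> ('g uea, 'g uea) tensor"
    proof -
      have "{..n} = insert 0 (insert n {0<..<n})" using n by auto
      then show ?thesis using n by (simp add: add.assoc)
    qed
    have "comult \<eta> = comult (f n) - comult (coef F n)"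
      by (simp add: \<eta>_def clinear_minus[OF clinear_comult])
    also have "comult (f n) = (\<Sum>i\<le>n. f i \<otimes> f (n - i))" using Suc.prems[of n] by simp
    also have "comult (coef F n) = (\<Sum>i\<le>n. coef F i \<otimes> coef F (n - i))"
      using F by (simp add: curve_def grouplike_def sum_decomp_nat)
    also have "(\<Sum>i\<le>n. f i \<otimes> f (n - i)) - (\<Sum>i\<le>n. coef F i \<otimes> coef F (n - i)) = \<eta> \<otimes> 1 + 1 \<otimes> \<eta>"
      unfolding split using Ff by (simp add: \<eta>_def f0 curve_0[OF F] tensor_diff_left tensor_diff_right)
    finally have prim: "primitive \<eta>" by (simp add: primitive_def)
    have "\<eta> \<in> Ag (\<delta> n)" using Suc.prems[of n] curve_Ag[OF F, of n] by (simp add: \<eta>_def Ag_diff)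
    then have e: "curve (\<lambda>k. \<delta> (nmul k n)) (exp_series \<eta>)"
      using prim by (intro curve_exp_series monoid_hom_nmul[OF \<delta>]) auto
    define G where "G = sub n (exp_series \<eta>)"
    have G: "curve \<delta> G" unfolding G_def by (rule curve_sub[OF \<delta> n e])
    have "coef (F * G) k = f k" if "k < Suc n" for k
    proof (cases "k = 0")
      case True
      then show ?thesis by (simp add: coef_mult_0 curve_0[OF F] curve_0[OF G] f0)
    next
      case False
      have van: "coef G u = 0" if "u \<noteq> 0" "u < n" for u
        using that n by (auto simp: G_def coef_sub_nat dest: dvd_imp_le)
      have "coef (F * G) k = coef F k + coef G k"
        by (rule coef_mult_low[of _ _ n]) (use van that False curve_0[OF F] curve_0[OF G] in auto)
      also have "\<dots> = f k"
      proof (cases "k = n")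
        case True
        then show ?thesis using n by (simp add: G_def coef_sub_nat \<eta>_def)
      next
        case False
        then show ?thesis using that van[of k] \<open>k \<noteq> 0\<close> Ff[of k] by simp
      qed
      finally show ?thesis .
    qed
    then show ?thesis using curve_mult[OF F G] by blast
  qed
qed

lemma ibelow_mono: "ibelow n f \<Longrightarrow> m \<le> n \<Longrightarrow> ibelow m f"
  by (simp add: ibelow_def)

lemma ibelow_mult: "ibelow n f \<Longrightarrow> ibelow n g \<Longrightarrow> ibelow n (f * g)"
  unfolding ibelow_def coef_mult
  by (intro allI impI U_sum) (auto simp: decomp_wt intro!: U_mult)

lemma ibelow_quot:
  fixes g x :: "('w::fin_decomp, 'g uea) series"
  assumes "coef g 0 = 1" "ibelow n g" "ibelow n (g * x)"
  shows "ibelow n x"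
  unfolding ibelow_def
proof (intro allI impI)
  fix w :: 'w assume "wt w < n"
  then show "coef x w \<in> U"
  proof (induction "wt w" arbitrary: w rule: less_induct)
    case less
    have "(\<Sum>(u, v)\<in>{p \<in> decomp w. fst p \<noteq> 0}. coef g u * coef x v) \<in> U"
    proof (rule U_sum, clarify)
      fix u v assume uv: "(u, v) \<in> decomp w" "fst (u, v) \<noteq> 0"
      have "coef x v \<in> U" using less decomp_proper_wt[OF uv] by simp
      moreover have "coef g u \<in> U" using assms(2) less.prems decomp_wt[OF uv(1)] by (simp add: ibelow_def)
      ultimately show "coef g u * coef x v \<in> U" by (simp add: U_mult)
    qed
    moreover have "coef (g * x) w \<in> U" using assms(3) less.prems by (simp add: ibelow_def)
    ultimately show ?case
      using coef_mult_split_left[of g x w] assms(1) U_diff by fastforce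
  qed
qed

text \<open>The mixed terms have both factors of weight below n, hence integral ones. Taking the top
  coefficient modulo \<open>U\<close> thus turns products of curves into sums, which makes
  obstructions additive.\<close>

lemma coef_mult_top:
  assumes "coef f 0 = 1" "coef g 0 = 1" "ibelow n f" "ibelow n g" "wt w \<le> n" "w \<noteq> 0"
  shows "coef (f * g) w - (coef f w + coef g w) \<in> U"
proof -
  have "(\<Sum>(u, v)\<in>{p \<in> decomp w. fst p \<noteq> 0 \<and> snd p \<noteq> 0}. coef f u * coef g v) \<in> U"
  proof (rule U_sum, clarify)
    fix u v assume uv: "(u, v) \<in> decomp w" "fst (u, v) \<noteq> 0" "snd (u, v) \<noteq> 0"
    then have "wt u < n" "wt v < n"
      using decomp_proper_wt[OF uv(1,2)] decomp_proper_wt'[OF uv(1,3)] assms(5) by auto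
    then show "coef f u * coef g v \<in> U" using assms(3,4) by (simp add: ibelow_def U_mult)
  qed
  then show ?thesis using coef_mult_split[OF assms(6), of f g] assms(1,2) by (simp add: add.commute)
qed

lemma ibelow_sub:
  fixes w0 :: "'w::fin_decomp"
  assumes "w0 \<noteq> 0" "\<And>k. k * wt w0 < n \<Longrightarrow> coef f k \<in> U"
  shows "ibelow n (sub w0 f)"
  unfolding ibelow_def
proof (intro allI impI)
  fix w :: 'w assume "wt w < n"
  then show "coef (sub w0 f) w \<in> U"
    using assms by (cases "\<exists>k. w = nmul k w0") (auto simp: coef_sub_nmul wt_nmul coef_sub_other U_zero)
qed

subsection \<open>Factorization along slopes\<close>

lemma on_ray:
  fixes u :: "nat \<times> nat"
  assumes "coprime a b" "0 < a" "fst u * b = snd u * a"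
  shows "\<exists>i. u = nmul i (a, b)"
proof -
  have "a dvd fst u * b" using assms(3) by simp
  then have "a dvd fst u" using assms(1) by (simp add: coprime_dvd_mult_left_iff)
  then obtain i where i: "fst u = a * i" by (elim dvdE)
  with assms(2,3) have "snd u = b * i" by (simp add: mult.assoc mult.commute)
  with i have "u = nmul i (a, b)" by (simp add: nmul_pair prod_eq_iff mult.commute)
  then show ?thesis ..
qed

text \<open>Let G vanish, in weights below n, strictly on one side of the ray through (a, b). Then
  its coefficients on the ray are group-like by themselves: a point of the ray splits into two
  points of the ray, or one of its parts lies on the vanishing side. They extend to a curve in one
  variable, and division by it clears the ray and leaves the axis \<open>snd u = 0\<close>
  untouched.\<close>

lemma peel_ray:
  fixes \<delta> :: "nat \<times> nat \<Rightarrow> 'q"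
  assumes G: "curve \<delta> G" and ab: "coprime a b" "0 < a" "0 < b"
    and van: "\<And>u. u \<noteq> 0 \<Longrightarrow> wt u < n \<Longrightarrow> fst u * b < snd u * a \<Longrightarrow> coef G u = 0"
  obtains g E where "curve (\<lambda>k. \<delta> (nmul k (a, b))) g" "curve \<delta> E" "G = sub (a, b) g * E"
    "\<And>k. k * wt (a, b) < n \<Longrightarrow> coef g k = coef G (nmul k (a, b))"
    "\<And>u. u \<noteq> 0 \<Longrightarrow> wt u < n \<Longrightarrow> fst u * b \<le> snd u * a \<Longrightarrow> coef E u = 0"
    "\<And>u. u \<noteq> 0 \<Longrightarrow> snd u = 0 \<Longrightarrow> coef E u = coef G u"
proof -
  let ?w = "(a, b)"
  have w0: "?w \<noteq> 0" and wpos: "0 < wt ?w" using ab by (auto simp: zero_prod_def wt_pair)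
  have \<delta>: "monoid_hom \<delta>" using G by (simp add: curve_def)
  have G0: "coef G 0 = 1" using curve_0[OF G] .
  have slope_nmul: "fst (nmul k ?w) * b = snd (nmul k ?w) * a" for k by (simp add: nmul_pair)
  have grp: "coef G (nmul k ?w) \<in> Ag (\<delta> (nmul k ?w)) \<and>
      comult (coef G (nmul k ?w)) = (\<Sum>i\<le>k. coef G (nmul i ?w) \<otimes> coef G (nmul (k - i) ?w))"
    if k: "k * wt ?w < n" for k
  proof
    show "coef G (nmul k ?w) \<in> Ag (\<delta> (nmul k ?w))" by (rule curve_Ag[OF G])
    have "comult (coef G (nmul k ?w)) = (\<Sum>(u, v)\<in>decomp (nmul k ?w). coef G u \<otimes> coef G v)"
      using curve_grouplike[OF G] unfolding grouplike_def by blast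
    also have "\<dots> = (\<Sum>(u, v)\<in>(\<lambda>i. (nmul i ?w, nmul (k - i) ?w)) ` {..k}. coef G u \<otimes> coef G v)"
    proof (rule sum.mono_neutral_right)
      show "(\<lambda>i. (nmul i ?w, nmul (k - i) ?w)) ` {..k} \<subseteq> decomp (nmul k ?w)"
        by (auto simp: decomp_def simp flip: nmul_add)
      show "\<forall>p\<in>decomp (nmul k ?w) - (\<lambda>i. (nmul i ?w, nmul (k - i) ?w)) ` {..k}.
          (case p of (u, v) \<Rightarrow> coef G u \<otimes> coef G v) = 0"
      proof (intro ballI, clarify)
        fix u1 u2 v1 v2 :: nat
        let ?u = "(u1, u2)" and ?v = "(v1, v2)"
        assume uv: "(?u, ?v) \<in> decomp (nmul k ?w)"
          and not: "(?u, ?v) \<notin> (\<lambda>i. (nmul i ?w, nmul (k - i) ?w)) ` {..k}"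
        have s: "u1 + v1 = k * a" "u2 + v2 = k * b" using uv by (auto simp: decomp_def nmul_pair)
        then have "(u1 + v1) * b = (u2 + v2) * a" by simp
        then have eq: "u1 * b + v1 * b = u2 * a + v2 * a" by (simp only: distrib_right)
        have wts: "wt ?u < n" "wt ?v < n"
          using decomp_wt[OF uv] k by (auto simp: wt_nmul)
        have "u1 * b \<noteq> u2 * a"
        proof
          assume "u1 * b = u2 * a"
          then obtain i where i: "?u = nmul i ?w" using on_ray[OF ab(1,2), of ?u] by auto
          with s(1) ab have ik: "i \<le> k" by (simp add: nmul_pair) (metis le_add1 mult_le_cancel2)
          moreover have "?v = nmul (k - i) ?w"
            using s i ik by (auto simp: nmul_pair diff_mult_distrib)
          ultimately show False using not i by auto
        qed
        \<comment> \<open>The two parts add up to a point of the ray, so their deviations from it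
          are opposite and one of them is on the vanishing side.\<close>
        then consider "u1 * b < u2 * a" | "v1 * b < v2 * a" using eq by linarith
        then show "coef G ?u \<otimes> coef G ?v = 0"
        proof cases
          case 1
          then have "coef G ?u = 0" using wts by (intro van) (auto simp: zero_prod_def)
          then show ?thesis by simp
        next
          case 2
          then have "coef G ?v = 0" using wts by (intro van) (auto simp: zero_prod_def)
          then show ?thesis by simp
        qed
      qed
    qed simp
    also have "\<dots> = (\<Sum>i\<le>k. coef G (nmul i ?w) \<otimes> coef G (nmul (k - i) ?w))"
      using w0 by (subst sum.reindex) (auto simp: inj_on_def nmul_inj)
    finally show "comult (coef G (nmul k ?w)) = (\<Sum>i\<le>k. coef G (nmul i ?w) \<otimes> coef G (nmul (k - i) ?w))" .
  qed
  \<comment> \<open>The number of k with k * wt (a, b) < n, that is, of the points of the ray with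
    known coefficients. For n = 0 the subtraction n - 1 would be truncated.\<close>
  define m where "m = (if n = 0 then 0 else Suc ((n - 1) div wt ?w))"
  have m: "k < m \<longleftrightarrow> k * wt ?w < n" for k
    using wpos by (auto simp: m_def less_Suc_eq_le less_eq_div_iff_mult_less_eq)
  obtain g where g: "curve (\<lambda>k. \<delta> (nmul k ?w)) g" and gG: "\<And>k. k < m \<Longrightarrow> coef g k = coef G (nmul k ?w)"
    using curve_extend[OF monoid_hom_nmul[OF \<delta>, of ?w], of "\<lambda>k. coef G (nmul k ?w)" m] grp m G0
    by auto
  have sg: "curve \<delta> (sub ?w g)" by (rule curve_sub[OF \<delta> w0 g])
  have sg0: "coef (sub ?w g) 0 = 1" by (rule curve_0[OF sg])
  obtain E where E: "G = sub ?w g * E" "curve \<delta> E" using curve_div[OF G sg] .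
  have E0: "coef E 0 = 1" by (rule curve_0[OF E(2)])
  have off: "coef (sub ?w g) u = 0" if "fst u * b \<noteq> snd u * a" for u
    using that slope_nmul by (intro coef_sub_other) auto
  have Evan: "coef E u = 0" if "u \<noteq> 0" "wt u < n" "fst u * b \<le> snd u * a" for u
    using that
  proof (induction "wt u" arbitrary: u rule: less_induct)
    case less
    have "(\<Sum>(v, u')\<in>{p \<in> decomp u. fst p \<noteq> 0 \<and> snd p \<noteq> 0}. coef (sub ?w g) v * coef E u') = 0"
    proof (rule sum.neutral, clarify)
      fix v1 v2 u1 u2 :: nat assume p: "((v1, v2), (u1, u2)) \<in> decomp u" "fst ((v1, v2), (u1, u2)) \<noteq> 0"
        "snd ((v1, v2), (u1, u2)) \<noteq> 0"
      show "coef (sub ?w g) (v1, v2) * coef E (u1, u2) = 0"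
      proof (cases "v1 * b = v2 * a")
        case True
        have "fst u = v1 + u1" "snd u = v2 + u2" using p(1) by (auto simp: decomp_def)
        with True less.prems(3) have "u1 * b \<le> u2 * a" by (simp add: distrib_right)
        then have "coef E (u1, u2) = 0"
          using less decomp_proper_wt[OF p(1,2)] p(3) by simp
        then show ?thesis by simp
      next
        case False
        then show ?thesis using off[of "(v1, v2)"] by simp
      qed
    qed
    then have sum: "coef G u = coef E u + coef (sub ?w g) u"
      using coef_mult_split[OF less.prems(1), of "sub ?w g" E] by (simp add: E(1)[symmetric] sg0 E0)
    show ?case
    proof (cases "fst u * b = snd u * a")
      case True
      then obtain i where i: "u = nmul i ?w" using on_ray[OF ab(1,2)] by blast
      then have "coef (sub ?w g) u = coef G u"
        using w0 gG[of i] m[of i] less.prems(2) by (simp add: coef_sub_nmul wt_nmul)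
      with sum show ?thesis by simp
    next
      case False
      then have "coef G u = 0" using less.prems by (intro van) auto
      with sum off[OF False] show ?thesis by simp
    qed
  qed
  have Eax: "coef E u = coef G u" if u: "u \<noteq> 0" "snd u = 0" for u
  proof -
    have off0: "coef (sub ?w g) v = 0" if "v \<noteq> 0" "snd v = 0" for v
      using that ab by (intro off) (auto simp: zero_prod_def prod_eq_iff)
    have "(\<Sum>(v, u')\<in>{p \<in> decomp u. fst p \<noteq> 0 \<and> snd p \<noteq> 0}. coef (sub ?w g) v * coef E u') = 0"
      using u by (intro sum.neutral) (auto simp: decomp_def off0)
    then show ?thesis
      using coef_mult_split[OF u(1), of "sub ?w g" E] off0[OF u] by (simp add: E(1)[symmetric] sg0 E0)
  qed
  show ?thesis
    by (rule that[OF g E(2,1) _ Evan Eax]) (use gG m in auto)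
qed

lemma coef_mult_agree:
  fixes f x y :: "('w::fin_decomp, 'a::ring_1) series"
  assumes "\<And>u. wt u < n \<Longrightarrow> coef x u = coef y u" "wt w < n"
  shows "coef (f * x) w = coef (f * y) w"
  unfolding coef_mult
  by (rule sum.cong) (use assms in \<open>auto simp: decomp_wt\<close>)

text \<open>Rays are peeled off by increasing slope \<open>fst u / snd u\<close>. The k-th
  coefficient of the factor at w is a coefficient of the current quotient in weight k * wt w, so
  integrality of G below m is inherited as long as k * wt w < m. Having all m \<le> n in the claim
  permits a factorization beyond the weights in which G is known to be integral.\<close>

lemma slope_factorization:
  fixes \<delta> :: "nat \<times> nat \<Rightarrow> 'q"
  assumes "curve \<delta> G" "\<And>u. u \<noteq> 0 \<Longrightarrow> wt u < n \<Longrightarrow> fst u = 0 \<or> snd u = 0 \<Longrightarrow> coef G u = 0"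
  shows "\<exists>L. (\<forall>(w, g)\<in>set L. 0 < fst w \<and> 0 < snd w \<and> curve (\<lambda>k. \<delta> (nmul k w)) g \<and>
        (\<forall>m\<le>n. ibelow m G \<longrightarrow> (\<forall>k. k * wt w < m \<longrightarrow> coef g k \<in> U))) \<and>
      (\<forall>u. wt u < n \<longrightarrow> coef G u = coef (prod_list (map (\<lambda>(w, g). sub w g) L)) u)"
proof -
  define pos where "pos = {u :: nat \<times> nat. wt u < n \<and> 0 < fst u \<and> 0 < snd u}"
  define r where "r u = real (fst u) / real (snd u)" for u :: "nat \<times> nat"
  have fin: "finite pos"
    by (rule finite_subset[of _ "{..n} \<times> {..n}"]) (auto simp: pos_def wt_pair)
  have "\<exists>L. (\<forall>(w, g)\<in>set L. 0 < fst w \<and> 0 < snd w \<and> curve (\<lambda>k. \<delta> (nmul k w)) g \<and>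
        (\<forall>m\<le>n. ibelow m G \<longrightarrow> (\<forall>k. k * wt w < m \<longrightarrow> coef g k \<in> U))) \<and>
      (\<forall>u. wt u < n \<longrightarrow> coef G u = coef (prod_list (map (\<lambda>(w, g). sub w g) L)) u)"
    if "curve \<delta> G" "\<And>u. u \<noteq> 0 \<Longrightarrow> wt u < n \<Longrightarrow> fst u = 0 \<or> snd u = 0 \<Longrightarrow> coef G u = 0"
      "\<And>u. u \<in> pos \<Longrightarrow> r u \<le> \<mu> \<Longrightarrow> coef G u = 0" for \<mu> G
    using that
  proof (induction "card {u \<in> pos. \<mu> < r u}" arbitrary: G \<mu> rule: less_induct)
    case less
    note G = less.prems(1) and ax = less.prems(2) and van = less.prems(3)
    let ?T = "{u \<in> pos. \<mu> < r u}"
    show ?case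
    proof (cases "?T = {}")
      case True
      have "coef G u = coef 1 u" if "wt u < n" for u
      proof (cases "u = 0")
        case True
        then show ?thesis by (simp add: curve_0[OF G] coef_one)
      next
        case False
        have "coef G u = 0"
        proof (cases "u \<in> pos")
          case True
          moreover from this have "\<not> \<mu> < r u" using \<open>?T = {}\<close> by blast
          ultimately show ?thesis by (intro van) auto
        next
          case F: False
          then show ?thesis using that False by (intro ax) (auto simp: pos_def)
        qed
        with False show ?thesis by (simp add: coef_one)
      qed
      then show ?thesis by (intro exI[of _ "[]"]) simp
    next
      case False
      have finT: "finite ?T" using fin by simp
      have "Min (r ` ?T) \<in> r ` ?T" using finT False by (intro Min_in) auto
      then obtain u0 where u0: "u0 \<in> ?T" and rmin: "Min (r ` ?T) = r u0" by blast
      have min: "r u0 \<le> r u" if "u \<in> ?T" for u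
        unfolding rmin[symmetric] using finT that by (intro Min_le) auto
      \<comment> \<open>The smallest remaining slope, in lowest terms a / b, is the next
        ray.\<close>
      define d where "d = gcd (fst u0) (snd u0)"
      define a b where "a = fst u0 div d" and "b = snd u0 div d"
      have u0pos: "0 < fst u0" "0 < snd u0" using u0 by (auto simp: pos_def)
      have dpos: "0 < d" using u0pos by (simp add: d_def)
      have u0ab: "fst u0 = d * a" "snd u0 = d * b" by (auto simp: a_def b_def d_def)
      have "coprime a b" unfolding a_def b_def d_def by (rule div_gcd_coprime) (use u0pos in auto)
      moreover have "a \<noteq> 0" "b \<noteq> 0" using u0pos by (simp_all only: u0ab) auto
      ultimately have ab: "coprime a b" "0 < a" "0 < b" by auto
      have r0: "r u0 = real a / real b" using dpos by (simp add: r_def u0ab)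
      have cmp: "r u < r u0 \<longleftrightarrow> fst u * b < snd u * a" "r u \<le> r u0 \<longleftrightarrow> fst u * b \<le> snd u * a"
        if "0 < snd u" for u
      proof -
        have eq: "r u = real (fst u) / real (snd u)" by (simp add: r_def)
        have "r u < r u0 \<longleftrightarrow> real (fst u) * real b < real (snd u) * real a"
          "r u \<le> r u0 \<longleftrightarrow> real (fst u) * real b \<le> real (snd u) * real a"
          using that ab unfolding r0 eq by (simp_all add: field_simps)
        then show "r u < r u0 \<longleftrightarrow> fst u * b < snd u * a" "r u \<le> r u0 \<longleftrightarrow> fst u * b \<le> snd u * a"
          by (simp_all only: of_nat_mult[symmetric] of_nat_less_iff of_nat_le_iff)
      qed
      have van': "coef G u = 0" if "u \<noteq> 0" "wt u < n" "fst u * b < snd u * a" for u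
      proof (cases "u \<in> pos")
        case True
        then have "r u < r u0" using that cmp(1)[of u] by (simp add: pos_def)
        then have "\<not> \<mu> < r u" using min[of u] True by auto
        then show ?thesis using True by (intro van) auto
      next
        case False
        then show ?thesis using that by (intro ax) (auto simp: pos_def)
      qed
      obtain g E where g: "curve (\<lambda>k. \<delta> (nmul k (a, b))) g" and E: "curve \<delta> E"
        and GE: "G = sub (a, b) g * E"
        and gG: "\<And>k. k * wt (a, b) < n \<Longrightarrow> coef g k = coef G (nmul k (a, b))"
        and Evan: "\<And>u. u \<noteq> 0 \<Longrightarrow> wt u < n \<Longrightarrow> fst u * b \<le> snd u * a \<Longrightarrow> coef E u = 0"
        and Eax: "\<And>u. u \<noteq> 0 \<Longrightarrow> snd u = 0 \<Longrightarrow> coef E u = coef G u"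
        by (rule peel_ray[OF G ab van']) blast+
      have w0: "(a, b) \<noteq> 0" using ab by (simp add: zero_prod_def)
      have sg: "curve \<delta> (sub (a, b) g)" by (rule curve_sub[OF curve_hom[OF G] w0 g])
      have gU: "\<forall>k. k * wt (a, b) < m \<longrightarrow> coef g k \<in> U" if "m \<le> n" "ibelow m G" for m
      proof (intro allI impI)
        fix k assume k: "k * wt (a, b) < m"
        then have "coef g k = coef G (nmul k (a, b))" using that(1) by (intro gG) simp
        moreover have "wt (nmul k (a, b)) < m" using k by (simp add: wt_nmul)
        ultimately show "coef g k \<in> U" using that(2) unfolding ibelow_def by metis
      qed
      have EU: "ibelow m E" if "m \<le> n" "ibelow m G" for m
      proof (rule ibelow_quot[OF curve_0[OF sg]])
        show "ibelow m (sub (a, b) g)" using gU[OF that] by (intro ibelow_sub[OF w0]) auto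
        show "ibelow m (sub (a, b) g * E)" using that GE by simp
      qed
      have "{u \<in> pos. r u0 < r u} \<subset> ?T" using u0 by auto
      then have card: "card {u \<in> pos. r u0 < r u} < card ?T" using finT by (rule psubset_card_mono[rotated])
      have "\<exists>L. (\<forall>(w, g)\<in>set L. 0 < fst w \<and> 0 < snd w \<and> curve (\<lambda>k. \<delta> (nmul k w)) g \<and>
          (\<forall>m\<le>n. ibelow m E \<longrightarrow> (\<forall>k. k * wt w < m \<longrightarrow> coef g k \<in> U))) \<and>
        (\<forall>u. wt u < n \<longrightarrow> coef E u = coef (prod_list (map (\<lambda>(w, g). sub w g) L)) u)"
      proof (rule less.hyps[OF card E])
        fix u :: "nat \<times> nat" assume u: "u \<noteq> 0" "wt u < n" "fst u = 0 \<or> snd u = 0"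
        show "coef E u = 0"
        proof (cases "snd u = 0")
          case True
          then show ?thesis using Eax[OF u(1)] ax[OF u] by simp
        next
          case False
          then show ?thesis using u by (intro Evan) auto
        qed
      next
        fix u assume "u \<in> pos" "r u \<le> r u0"
        then show "coef E u = 0" using cmp(2)[of u] by (intro Evan) (auto simp: pos_def)
      qed
      then obtain L where L: "\<And>w g. (w, g) \<in> set L \<Longrightarrow> 0 < fst w \<and> 0 < snd w \<and> curve (\<lambda>k. \<delta> (nmul k w)) g \<and>
          (\<forall>m\<le>n. ibelow m E \<longrightarrow> (\<forall>k. k * wt w < m \<longrightarrow> coef g k \<in> U))"
        and LE: "\<And>u. wt u < n \<Longrightarrow> coef E u = coef (prod_list (map (\<lambda>(w, g). sub w g) L)) u"
        by blast
      have "\<forall>u. wt u < n \<longrightarrow> coef G u = coef (prod_list (map (\<lambda>(w, g). sub w g) (((a, b), g) # L))) u"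
        using coef_mult_agree[of n E _ _ "sub (a, b) g", OF LE] GE by auto
      moreover have "\<forall>(w, h)\<in>set (((a, b), g) # L). 0 < fst w \<and> 0 < snd w \<and> curve (\<lambda>k. \<delta> (nmul k w)) h \<and>
          (\<forall>m\<le>n. ibelow m G \<longrightarrow> (\<forall>k. k * wt w < m \<longrightarrow> coef h k \<in> U))"
        using L EU gU ab g by auto
      ultimately show ?thesis by blast
    qed
  qed
  note main = this
  show ?thesis
  proof (rule main[OF assms(1)])
    \<comment> \<open>The threshold starts at 0, below the slope of every interior point.\<close>
    fix u assume u: "u \<in> pos" "r u \<le> 0"
    then have "0 < r u" by (cases u) (auto simp: pos_def r_def)
    with u show "coef G u = 0" by simp
  qed (fact assms(2))
qed

end

section \<open>Series on the two axes, subgroups of the integers, binomial coefficients\<close>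

lemma unit_nonzero: "(1, 0) \<noteq> (0 :: nat \<times> nat)" "(0, 1) \<noteq> (0 :: nat \<times> nat)"
  by (auto simp: zero_prod_def)

lemma coef_sub_axis:
  fixes f :: "(nat, 'a::ring_1) series" and a b :: nat
  shows "coef (sub (1, 0) f) (a, b) = (if b = 0 then coef f a else 0)"
    "coef (sub (0, 1) f) (a, b) = (if a = 0 then coef f b else 0)"
  using coef_sub_nmul[OF unit_nonzero(1), of f a] coef_sub_other[of "(a, b)" "(1, 0)" f]
    coef_sub_nmul[OF unit_nonzero(2), of f b] coef_sub_other[of "(a, b)" "(0, 1)" f]
  by (auto simp: nmul_pair)

lemma coef_sub_axes:
  fixes f g :: "(nat, 'a::ring_1) series"
  shows "coef (sub (1, 0) f * sub (0, 1) g) w = coef f (fst w) * coef g (snd w)"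
    "coef (sub (0, 1) g * sub (1, 0) f) w = coef g (snd w) * coef f (fst w)"
proof -
  obtain i j where w: "w = (i, j)" by (cases w)
  have "coef (sub (1, 0) f * sub (0, 1) g) w
      = (\<Sum>p\<in>decomp w. if p = ((i, 0), (0, j)) then coef f i * coef g j else 0)"
    unfolding coef_mult
  proof (rule sum.cong[OF HOL.refl], clarify)
    fix a b c d assume "((a, b), (c, d)) \<in> decomp w"
    then show "coef (sub (1, 0) f) (a, b) * coef (sub (0, 1) g) (c, d)
        = (if ((a, b), c, d) = ((i, 0), 0, j) then coef f i * coef g j else 0)"
      unfolding coef_sub_axis by (auto simp: w decomp_def)
  qed
  then show "coef (sub (1, 0) f * sub (0, 1) g) w = coef f (fst w) * coef g (snd w)"
    by (simp add: w decomp_mem)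
  have "coef (sub (0, 1) g * sub (1, 0) f) w
      = (\<Sum>p\<in>decomp w. if p = ((0, j), (i, 0)) then coef g j * coef f i else 0)"
    unfolding coef_mult
  proof (rule sum.cong[OF HOL.refl], clarify)
    fix a b c d assume "((a, b), (c, d)) \<in> decomp w"
    then show "coef (sub (0, 1) g) (a, b) * coef (sub (1, 0) f) (c, d)
        = (if ((a, b), c, d) = ((0, j), i, 0) then coef g j * coef f i else 0)"
      unfolding coef_sub_axis by (auto simp: w decomp_def)
  qed
  then show "coef (sub (0, 1) g * sub (1, 0) f) w = coef g (snd w) * coef f (fst w)"
    by (simp add: w decomp_mem)
qed

lemma quot_axis:
  fixes A K :: "(nat \<times> nat, 'a::ring_1) series"
  assumes "coef A 0 = 1" "coef K 0 = 1"
    and agree: "\<And>u. fst u = 0 \<or> snd u = 0 \<Longrightarrow> coef (A * K) u = coef A u"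
  shows "u \<noteq> 0 \<Longrightarrow> fst u = 0 \<or> snd u = 0 \<Longrightarrow> coef K u = 0"
proof (induction "wt u" arbitrary: u rule: less_induct)
  case less
  have "(\<Sum>(v, u')\<in>{p \<in> decomp u. fst p \<noteq> 0 \<and> snd p \<noteq> 0}. coef A v * coef K u') = 0"
  proof (rule sum.neutral, clarify)
    fix a b c d :: nat assume p: "((a, b), (c, d)) \<in> decomp u" "fst ((a, b), (c, d)) \<noteq> 0" "snd ((a, b), (c, d)) \<noteq> 0"
    have "coef K (c, d) = 0"
      using decomp_proper_wt[OF p(1,2)] p less.prems(2) by (intro less.hyps) (auto simp: decomp_def)
    then show "coef A (a, b) * coef K (c, d) = 0" by simp
  qed
  then show ?case
    using coef_mult_split[OF less.prems(1), of A K] assms(1,2) agree[OF less.prems(2)] by simp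
qed

text \<open>A proper subgroup of the integers is contained in the multiples of some prime.
  Obstructions can thus be treated one prime at a time.\<close>

lemma int_subgroup_one:
  fixes I :: "int set"
  assumes zero: "0 \<in> I" and diff: "\<And>a b. a \<in> I \<Longrightarrow> b \<in> I \<Longrightarrow> a - b \<in> I"
    and p: "\<And>p :: nat. prime p \<Longrightarrow> \<exists>M\<in>I. \<not> int p dvd M"
  shows "1 \<in> I"
proof -
  have neg: "- a \<in> I" if "a \<in> I" for a using diff[OF zero that] by simp
  have add: "a + b \<in> I" if "a \<in> I" "b \<in> I" for a b using diff[OF that(1) neg[OF that(2)]] by simp
  have nat_mul: "int n * a \<in> I" if "a \<in> I" for n a
    by (induction n) (simp_all add: zero that add distrib_right)
  have mul: "k * a \<in> I" if "a \<in> I" for k a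
    using nat_mul[OF that, of "nat k"] nat_mul[OF neg[OF that], of "nat (- k)"] by (cases "k \<ge> 0") auto
  have "Gcd I \<in> I"
  proof -
    define P where "P n \<longleftrightarrow> 0 < n \<and> int n \<in> I" for n
    obtain M where M: "M \<in> I" "\<not> int 2 dvd M" using p[of 2] by auto
    then have "M \<noteq> 0" by auto
    then have "P (nat \<bar>M\<bar>)" using neg[OF M(1)] M(1) by (auto simp: P_def abs_if)
    then have L: "P (LEAST n. P n)" by (rule LeastI)
    define g where "g = (LEAST n. P n)"
    have g: "0 < g" "int g \<in> I" using L by (auto simp: g_def P_def)
    have "int g dvd a" if a: "a \<in> I" for a
    proof (rule ccontr)
      assume "\<not> int g dvd a"
      then have "a mod int g \<noteq> 0" by (simp add: mod_eq_0_iff_dvd)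
      moreover have "0 \<le> a mod int g" "a mod int g < int g" using g(1) by simp_all
      ultimately have r: "0 < a mod int g" "a mod int g < int g" by linarith+
      have "a mod int g = a - (a div int g) * int g" by (simp add: minus_div_mult_eq_mod)
      then have "a mod int g \<in> I" using diff[OF a mul[OF g(2)]] by simp
      then have "P (nat (a mod int g))" using r by (simp add: P_def)
      then have "g \<le> nat (a mod int g)" unfolding g_def by (rule Least_le)
      with r show False by linarith
    qed
    then have "int g dvd Gcd I" by (rule Gcd_greatest)
    then show ?thesis using mul[OF g(2)] by (auto simp: dvd_def mult.commute)
  qed
  moreover have "Gcd I = 1"
  proof (rule ccontr)
    assume "Gcd I \<noteq> 1"
    then have "nat (Gcd I) \<noteq> 1" using Gcd_int_greater_eq_0[of I] by linarith
    then obtain q where q: "prime q" "q dvd nat (Gcd I)" using prime_factor_nat by blast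
    then have "int q dvd int (nat (Gcd I))" by (simp only: int_dvd_int_iff)
    then have "int q dvd Gcd I" using Gcd_int_greater_eq_0[of I] by simp
    with p[OF q(1)] show False using Gcd_dvd dvd_trans by blast
  qed
  ultimately show ?thesis by simp
qed

text \<open>The count from the proof of Sylow's first theorem: the binomial coefficient and m
  contain p to the same power.\<close>

lemma prime_not_dvd_choose:
  assumes p: "prime p" and m: "\<not> p dvd m"
  shows "\<not> p dvd (p ^ v * m choose p ^ v)"
proof -
  have "m > 0" using m by (cases m) auto
  then have "multiplicity p (p ^ v * m choose p ^ v) = multiplicity p m"
    using const_p_fac[of m p v] p by simp
  also have "\<dots> = 0" using m by (simp add: not_dvd_imp_multiplicity_0)
  finally have 0: "multiplicity p (p ^ v * m choose p ^ v) = 0" .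
  have "p ^ v \<le> p ^ v * m" using \<open>m > 0\<close> p by (intro dvd_imp_le) (auto simp: prime_gt_0_nat)
  then have "0 < (p ^ v * m choose p ^ v)" by (rule zero_less_binomial)
  then have "(p ^ v * m choose p ^ v) \<noteq> 0" by (rule less_not_refl2)
  then show ?thesis
    using 0 prime_multiplicity_gt_zero_iff[of p "p ^ v * m choose p ^ v"] p by simp
qed

context graded_form
begin

subsection \<open>Obstructions\<close>

lemma Ag_uminus: "u \<in> Ag q \<Longrightarrow> - u \<in> Ag q"
  using Ag_diff[OF Ag_zero] by simp
lemma primitive_uminus: "primitive u \<Longrightarrow> primitive (- u)"
  using primitive_diff[OF primitive_0] by simp

lemma monoid_hom_axes: "monoid_hom \<delta> \<Longrightarrow> (\<lambda>w. \<delta> (fst w) + \<delta> (snd w)) = (\<lambda>w. \<delta> (wt w))"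
  for \<delta> :: "nat \<Rightarrow> 'q"
  by (auto simp: monoid_hom_def wt_pair)

lemma curve_axes:
  fixes D D' :: "(nat, 'g uea) series"
  assumes D: "curve \<delta> D" and D': "curve \<delta>' D'"
  shows "curve (\<lambda>w. \<delta> (fst w) + \<delta>' (snd w)) (sub (1, 0) D)"
    "curve (\<lambda>w. \<delta> (fst w) + \<delta>' (snd w)) (sub (0, 1) D')"
proof -
  have "monoid_hom (\<lambda>w. \<delta> (fst w) + \<delta>' (snd w))" and "\<delta> 0 = 0" "\<delta>' 0 = 0"
    using D D' by (auto simp: curve_def monoid_hom_def add_ac)
  then show "curve (\<lambda>w. \<delta> (fst w) + \<delta>' (snd w)) (sub (1, 0) D)"
    "curve (\<lambda>w. \<delta> (fst w) + \<delta>' (snd w)) (sub (0, 1) D')"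
    using D D' by (auto simp only: nmul_pair mult_1_right mult_0_right fst_conv snd_conv add_0_left add_0_right
        intro!: curve_sub unit_nonzero)
qed

definition subgrp :: "'g uea set \<Rightarrow> bool" where
  "subgrp Q \<longleftrightarrow> 0 \<in> Q \<and> (\<forall>a\<in>Q. \<forall>b\<in>Q. a - b \<in> Q)"

lemma subgrp_neg: "subgrp Q \<Longrightarrow> a \<in> Q \<Longrightarrow> - a \<in> Q"
  unfolding subgrp_def by (metis diff_0)
lemma subgrp_diff: "subgrp Q \<Longrightarrow> a \<in> Q \<Longrightarrow> b \<in> Q \<Longrightarrow> a - b \<in> Q"
  unfolding subgrp_def by blast
lemma subgrp_add: "subgrp Q \<Longrightarrow> a \<in> Q \<Longrightarrow> b \<in> Q \<Longrightarrow> a + b \<in> Q"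
  using subgrp_diff[OF _ _ subgrp_neg] by fastforce
lemma subgrp_of_int: "subgrp Q \<Longrightarrow> a \<in> Q \<Longrightarrow> of_int m *\<^sub>C a \<in> Q"
proof -
  assume Q: "subgrp Q" and a: "a \<in> Q"
  have "of_nat n *\<^sub>C b \<in> Q" if "b \<in> Q" for n b
    using Q by (induction n) (simp_all add: subgrp_def[of Q] scaleC_add_left scaleC_one subgrp_add[OF Q that])
  then show ?thesis
    using a subgrp_neg[OF Q] by (cases m rule: int_cases2) (simp_all add: complex_vector.scale_minus_left)
qed

lemma subgrp_sum: "subgrp Q \<Longrightarrow> (\<And>i. i \<in> I \<Longrightarrow> f i \<in> Q) \<Longrightarrow> (\<Sum>i\<in>I. f i) \<in> Q"
  by (induction I rule: infinite_finite_induct) (auto simp: subgrp_def[of Q] intro: subgrp_add)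

lemma subgrp_of_nat: "subgrp Q \<Longrightarrow> a \<in> Q \<Longrightarrow> of_nat n *\<^sub>C a \<in> Q"
  using subgrp_of_int[of Q a "int n"] by simp

text \<open>Multiplying a curve by the exponential of a primitive element in t^n changes the
  coefficient in degree n by that element and nothing below. The class modulo this set is what such
  changes cannot affect.\<close>

definition Bs :: "'q \<Rightarrow> 'g uea set" where
  "Bs q = {u + \<eta> | u \<eta>. u \<in> U \<and> primitive \<eta> \<and> \<eta> \<in> Ag q}"

lemma Bs_U: "u \<in> U \<Longrightarrow> u \<in> Bs q"
  using primitive_0 Ag_zero by (force simp: Bs_def)

lemma subgrp_Bs: "subgrp (Bs q)"
  unfolding subgrp_def
proof (intro conjI ballI)
  show "0 \<in> Bs q" by (rule Bs_U[OF U_zero])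
  fix a b assume "a \<in> Bs q" "b \<in> Bs q"
  then obtain u \<eta> v \<zeta> where *: "a = u + \<eta>" "b = v + \<zeta>" "u \<in> U" "v \<in> U"
    "primitive \<eta>" "primitive \<zeta>" "\<eta> \<in> Ag q" "\<zeta> \<in> Ag q"
    by (auto simp: Bs_def)
  then have "a - b = (u - v) + (\<eta> - \<zeta>)" by simp
  then show "a - b \<in> Bs q" unfolding Bs_def using * by (blast intro: U_diff primitive_diff Ag_diff)
qed

text \<open>Modulo \<^const>\<open>Bs\<close>, the top coefficient of a curve that is integral below \<open>n\<close> is the obstruction to
  making it integral in degree \<open>n\<close> without changing the lower coefficients.\<close>

definition Ob :: "nat \<Rightarrow> (nat \<Rightarrow> 'q) \<Rightarrow> 'g uea set" where
  "Ob n \<delta> = {a. \<exists>D. curve \<delta> D \<and> ibelow n D \<and> a - coef D n \<in> Bs (\<delta> n)}"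

text \<open>The curves here have zero tangent vector. Division by such a curve alters the class in
  degree n and keeps the tangent vector, so a class in this set can be removed, see
  \<open>kill_obstruction\<close>.\<close>

definition Ob0 :: "nat \<Rightarrow> (nat \<Rightarrow> 'q) \<Rightarrow> 'g uea set" where
  "Ob0 n \<delta> = {a. \<exists>D. curve \<delta> D \<and> ibelow n D \<and> coef D 1 = 0 \<and> a - coef D n \<in> Bs (\<delta> n)}"

lemma Bs_Ob0:
  assumes "monoid_hom \<delta>" "0 < n" "a \<in> Bs (\<delta> n)"
  shows "a \<in> Ob0 n \<delta>"
  using assms U_one U_zero unfolding Ob0_def
  by (auto simp: coef_one ibelow_def intro!: exI[of _ 1] curve_one)

lemma coef_mult_1:
  "coef f 0 = 1 \<Longrightarrow> coef g 0 = 1 \<Longrightarrow> coef (f * g) (1 :: nat) = coef f 1 + coef g 1"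
  by (rule coef_mult_low[of _ _ 1]) auto

text \<open>The quotient of two curves realizes the difference of their classes, and has zero
  tangent vector again.\<close>

lemma subgrp_Ob0:
  assumes \<delta>: "monoid_hom \<delta>" and n: "0 < n"
  shows "subgrp (Ob0 n \<delta>)"
  unfolding subgrp_def
proof (intro conjI ballI)
  show "0 \<in> Ob0 n \<delta>" using Bs_Ob0[OF \<delta> n Bs_U[OF U_zero]] .
  fix a b assume "a \<in> Ob0 n \<delta>" "b \<in> Ob0 n \<delta>"
  then obtain D E where D: "curve \<delta> D" "ibelow n D" "coef D 1 = 0" "a - coef D n \<in> Bs (\<delta> n)"
    and E: "curve \<delta> E" "ibelow n E" "coef E 1 = 0" "b - coef E n \<in> Bs (\<delta> n)"
    by (auto simp: Ob0_def)
  obtain x where x: "D = E * x" "curve \<delta> x" using curve_div[OF D(1) E(1)] .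
  have ix: "ibelow n x" using ibelow_quot[OF curve_0[OF E(1)] E(2)] D(2) x(1) by simp
  have "coef x 1 = 0" using coef_mult_1[OF curve_0[OF E(1)] curve_0[OF x(2)]] D(3) E(3) x(1) by simp
  moreover have "coef D n - (coef E n + coef x n) \<in> U"
    unfolding x(1) using n by (intro coef_mult_top[OF curve_0[OF E(1)] curve_0[OF x(2)] E(2) ix]) auto
  then have "(a - coef D n) - (b - coef E n) + (coef D n - (coef E n + coef x n)) \<in> Bs (\<delta> n)"
    by (intro subgrp_add[OF subgrp_Bs] subgrp_diff[OF subgrp_Bs] D(4) E(4) Bs_U)
  then have "(a - b) - coef x n \<in> Bs (\<delta> n)" by (simp add: algebra_simps)
  ultimately show "a - b \<in> Ob0 n \<delta>" using x(2) ix by (auto simp: Ob0_def)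
qed

text \<open>Substitute t^l for t; since l > 1, the tangent vector becomes 0.\<close>

lemma Ob_sub_Ob0:
  assumes \<delta>: "monoid_hom \<delta>" and l: "2 \<le> l" and a: "a \<in> Ob c (\<lambda>k. \<delta> (k * l))"
  shows "a \<in> Ob0 (c * l) \<delta>"
proof -
  obtain D where D: "curve (\<lambda>k. \<delta> (k * l)) D" "ibelow c D" "a - coef D c \<in> Bs (\<delta> (c * l))"
    using a by (auto simp: Ob_def)
  have l0: "l \<noteq> 0" using l by simp
  have "curve \<delta> (sub l D)" using D(1) by (intro curve_sub \<delta> l0) simp
  moreover have "ibelow (c * l) (sub l D)"
    using D(2) l0 by (intro ibelow_sub) (auto simp: ibelow_def)
  moreover have "coef (sub l D) 1 = 0" "coef (sub l D) (c * l) = coef D c"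
    using l by (auto simp: coef_sub_nat)
  ultimately show ?thesis using D(3) by (auto simp: Ob0_def)
qed

text \<open>At w = (i, r - i) the coefficient of D(s) D(t) is integral, that of D(s + t) is the
  binomial multiple of D_r, and that of their quotient is, modulo \<open>U\<close>, a sum over the
  factors whose ray passes through w. A factor at w' contributes only if w = c w', so c divides i
  and c * wt w' = r, and its contribution is an obstruction in degree c. The target \<open>Q\<close>
  is a parameter, because a class in degree c is also measured in the obstruction group of another
  degree.\<close>

lemma choose_obstruction:
  fixes \<delta> :: "nat \<Rightarrow> 'q"
  assumes D: "curve \<delta> D" "ibelow r D" and i: "0 < i" "i < r"
    and Q: "subgrp Q" "U \<subseteq> Q"
    and Ob: "\<And>c l. c * l = r \<Longrightarrow> c dvd i \<Longrightarrow> Ob c (\<lambda>k. \<delta> (k * l)) \<subseteq> Q"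
  shows "of_nat (r choose i) *\<^sub>C coef D r \<in> Q"
proof -
  define \<delta>2 where "\<delta>2 = (\<lambda>w :: nat \<times> nat. \<delta> (wt w))"
  have \<delta>: "monoid_hom \<delta>" using D by (simp add: curve_def)
  have \<delta>2: "monoid_hom \<delta>2" unfolding \<delta>2_def by (rule monoid_hom_wt[OF \<delta>])
  define P :: "(nat \<times> nat, 'g uea) series" where "P = sub (1, 0) D * sub (0, 1) D"
  define A :: "(nat \<times> nat, 'g uea) series" where "A = addc D"
  have P: "curve \<delta>2 P"
    using curve_mult[OF curve_axes[OF D(1) D(1)]] by (simp add: P_def \<delta>2_def monoid_hom_axes[OF \<delta>])
  have A: "curve \<delta>2 A" unfolding A_def \<delta>2_def by (rule curve_addc[OF D(1)])
  obtain K where K: "P = A * K" "curve \<delta>2 K" using curve_div[OF P A] .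
  have Pc: "coef P w = coef D (fst w) * coef D (snd w)" for w
    unfolding P_def by (rule coef_sub_axes)
  have iP: "ibelow r P" using D(2) by (auto simp: ibelow_def Pc wt_pair intro!: U_mult)
  have iA: "ibelow r A" using D(2) by (auto simp: ibelow_def A_def coef_addc intro!: U_of_nat)
  have iK: "ibelow r K" using ibelow_quot[OF curve_0[OF A] iA] iP K(1) by simp
  have "coef (A * K) u = coef A u" if "fst u = 0 \<or> snd u = 0" for u
    unfolding K(1)[symmetric]
    using that curve_0[OF D(1)] by (auto simp: Pc A_def coef_addc wt_pair scaleC_one)
  note ax = quot_axis[OF curve_0[OF A] curve_0[OF K(2)] this]
  define w where "w = (i, r - i)"
  have w: "wt w = r" "w \<noteq> 0" using i by (auto simp: w_def wt_pair zero_prod_def)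
  obtain L where L: "\<forall>(w, g)\<in>set L. 0 < fst w \<and> 0 < snd w \<and> curve (\<lambda>k. \<delta>2 (nmul k w)) g \<and>
        (\<forall>m\<le>Suc r. ibelow m K \<longrightarrow> (\<forall>k. k * wt w < m \<longrightarrow> coef g k \<in> U))"
     and KL: "\<And>u. wt u < Suc r \<Longrightarrow> coef K u = coef (prod_list (map (\<lambda>(w, g). sub w g) L)) u"
    using slope_factorization[OF K(2), of "Suc r"] ax by blast
  let ?Pi = "\<lambda>L. prod_list (map (\<lambda>(w, g). sub w g) L)"
  have "curve \<delta>2 (?Pi L') \<and> ibelow r (?Pi L') \<and> coef (?Pi L') w \<in> Q" if "set L' \<subseteq> set L" for L'
    using that
  proof (induction L')
    case Nil
    show ?case using w Q curve_one[OF \<delta>2] U_one U_zero by (auto simp: ibelow_def coef_one)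
  next
    case (Cons x L')
    obtain w' g where x: "x = (w', g)" by (cases x)
    have "(w', g) \<in> set L" using Cons.prems by (simp add: x)
    from bspec[OF L this] have Lg: "0 < fst w'" "curve (\<lambda>k. \<delta>2 (nmul k w')) g"
      "\<forall>m\<le>Suc r. ibelow m K \<longrightarrow> (\<forall>k. k * wt w' < m \<longrightarrow> coef g k \<in> U)" by auto
    have g: "0 < fst w'" "curve (\<lambda>k. \<delta>2 (nmul k w')) g" "\<And>k. k * wt w' < r \<Longrightarrow> coef g k \<in> U"
      using Lg(1,2) Lg(3)[rule_format, of r] iK by simp_all
    have w'0: "w' \<noteq> 0" using g(1) by (auto simp: zero_prod_def)
    have s: "curve \<delta>2 (sub w' g)" by (rule curve_sub[OF \<delta>2 w'0 g(2)])
    have isub: "ibelow r (sub w' g)" using g(3) by (intro ibelow_sub[OF w'0]) auto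
    have IH: "curve \<delta>2 (?Pi L')" "ibelow r (?Pi L')" "coef (?Pi L') w \<in> Q" using Cons by auto
    have "coef (sub w' g) w \<in> Q"
    proof (cases "\<exists>c. w = nmul c w'")
      case True
      then obtain c where c: "w = nmul c w'" by blast
      have cr: "c * wt w' = r" using w(1) by (simp add: c wt_nmul)
      moreover have "c dvd i" using c by (cases w') (simp add: w_def nmul_pair)
      moreover have "coef g c \<in> Ob c (\<lambda>k. \<delta> (k * wt w'))"
        unfolding Ob_def
      proof (intro CollectI exI conjI)
        show "curve (\<lambda>k. \<delta> (k * wt w')) g" using g(2) by (simp add: \<delta>2_def wt_nmul)
        show "ibelow c g"
          unfolding ibelow_def
        proof (intro allI impI)
          fix k :: nat assume "wt k < c"
          then have "k * wt w' < r" using w'0 wt_eq_0_iff[of w'] unfolding cr[symmetric] by auto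
          then show "coef g k \<in> U" by (rule g(3))
        qed
        show "coef g c - coef g c \<in> Bs (\<delta> (c * wt w'))" by (simp add: Bs_U U_zero)
      qed
      ultimately have "coef g c \<in> Q" using Ob by blast
      then show ?thesis using w'0 by (simp add: c coef_sub_nmul)
    next
      case False
      then show ?thesis using Q by (simp add: coef_sub_other subgrp_def)
    qed
    moreover have "coef (sub w' g * ?Pi L') w - (coef (sub w' g) w + coef (?Pi L') w) \<in> U"
      using w by (intro coef_mult_top[OF curve_0[OF s] curve_0[OF IH(1)] isub IH(2)]) auto
    ultimately have "(coef (sub w' g * ?Pi L') w - (coef (sub w' g) w + coef (?Pi L') w))
        + (coef (sub w' g) w + coef (?Pi L') w) \<in> Q"
      using Q(2) by (intro subgrp_add[OF Q(1)] IH(3)) auto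
    then have "coef (?Pi (x # L')) w \<in> Q" by (simp add: x)
    moreover have "curve \<delta>2 (?Pi (x # L'))" using curve_mult[OF s IH(1)] by (simp add: x)
    moreover have "ibelow r (?Pi (x # L'))" using ibelow_mult[OF isub IH(2)] by (simp add: x)
    ultimately show ?case by blast
  qed
  then have KQ: "coef K w \<in> Q" using KL[of w] w by simp
  have "coef P w - (coef A w + coef K w) \<in> U"
    unfolding K(1) using w by (intro coef_mult_top[OF curve_0[OF A] curve_0[OF K(2)] iA iK]) auto
  moreover have "coef P w \<in> U" using D(2) i by (simp add: Pc w_def ibelow_def U_mult)
  ultimately have "coef P w \<in> Q" "coef P w - (coef A w + coef K w) \<in> Q" using Q(2) by blast+
  then have "coef P w - (coef P w - (coef A w + coef K w)) - coef K w \<in> Q"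
    by (intro subgrp_diff[OF Q(1) subgrp_diff[OF Q(1)] KQ])
  then have "coef A w \<in> Q" by simp
  then show ?thesis using w by (simp add: A_def coef_addc) (simp add: w_def)
qed

text \<open>A curve E that starts in degree k resembles some D (t^k), and integrality of E up to k r
  resembles that of D up to r. The statement asks for an actual curve D with this precision and with
  the leading coefficient of E as tangent vector.\<close>

definition lead_lifts :: "nat \<Rightarrow> bool" where
  "lead_lifts r \<longleftrightarrow> (\<forall>k \<delta> E. 0 < k \<longrightarrow> curve \<delta> E \<longrightarrow> ibelow (Suc (k * r)) E \<longrightarrow>
     (\<forall>i. 0 < i \<longrightarrow> i < k \<longrightarrow> coef E i = 0) \<longrightarrow>
     (\<exists>D. curve (\<lambda>j. \<delta> (j * k)) D \<and> ibelow (Suc r) D \<and> coef D 1 = coef E k))"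

lemma divide_leading:
  fixes \<delta> :: "nat \<Rightarrow> 'q" and E :: "(nat, 'g uea) series"
  assumes E: "curve \<delta> E" and k: "0 < k" and lead: "\<And>i. 0 < i \<Longrightarrow> i < k \<Longrightarrow> coef E i = 0"
    and D: "curve (\<lambda>j. \<delta> (j * k)) D" "coef D 1 = coef E k"
  obtains E' where "E = sub k D * E'" "curve \<delta> (sub k D)" "curve \<delta> E'"
    "\<And>i. 0 < i \<Longrightarrow> i < Suc k \<Longrightarrow> coef E' i = 0"
proof -
  have k0: "k \<noteq> 0" using k by simp
  have s: "curve \<delta> (sub k D)" using D(1) by (intro curve_sub[OF curve_hom[OF E] k0]) simp
  obtain E' where E': "E = sub k D * E'" "curve \<delta> E'" using curve_div[OF E s] .
  have "coef E w = coef (sub k D) w" if "w < Suc k" for w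
  proof (cases "w = 0 \<or> w = k")
    case True
    then show ?thesis using k curve_0[OF E] curve_0[OF s] D(2) by (auto simp: coef_sub_nat)
  next
    case False
    then have "coef E w = 0" using that by (intro lead) auto
    moreover have "coef (sub k D) w = 0" using False that k by (auto simp: coef_sub_nat dest: dvd_imp_le)
    ultimately show ?thesis by simp
  qed
  then have "coef E' i = 0" if "0 < i" "i < Suc k" for i
    using quot_vanish[OF curve_0[OF s] curve_0[OF E'(2)], of "Suc k" i] that E'(1) by simp
  then show ?thesis using that E' s by blast
qed

text \<open>E is divided successively by D (t^k), with D from \<open>lead_lifts\<close>. Modulo
  \<open>U\<close>, its coefficient in degree n is then a sum of coefficients of such D in degrees c
  with c l = n, and each of them is an obstruction. The condition (n - 1) div k < R keeps the
  instances of \<open>lead_lifts\<close> below R, so that this can be used inside the induction that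
  proves them.\<close>

lemma leading_obstruction:
  fixes \<delta> :: "nat \<Rightarrow> 'q" and E :: "(nat, 'g uea) series"
  assumes J: "\<And>r. r < R \<Longrightarrow> lead_lifts r" and n: "0 < n" and Q: "subgrp Q" "U \<subseteq> Q"
  shows "0 < k \<Longrightarrow> (n - 1) div k < R \<Longrightarrow> curve \<delta> E \<Longrightarrow> ibelow n E \<Longrightarrow>
     (\<And>i. 0 < i \<Longrightarrow> i < k \<Longrightarrow> coef E i = 0) \<Longrightarrow>
     (\<And>c l. c * l = n \<Longrightarrow> k \<le> l \<Longrightarrow> Ob c (\<lambda>j. \<delta> (j * l)) \<subseteq> Q) \<Longrightarrow> coef E n \<in> Q"
proof (induction "Suc n - k" arbitrary: k E rule: less_induct)
  case less
  note k = \<open>0 < k\<close> and E = \<open>curve \<delta> E\<close> and iE = \<open>ibelow n E\<close> and lead = less.prems(5) and Ob = less.prems(6)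
  show ?case
  proof (cases "k \<le> n")
    case False
    then have "coef E n = 0" using n by (intro lead) auto
    then show ?thesis using Q by (simp add: subgrp_def)
  next
    case True
    \<comment> \<open>The largest r with k * r < n, as E is integral only below n.\<close>
    define r where "r = (n - 1) div k"
    have "k * r \<le> n - 1" by (simp add: r_def)
    then have "ibelow (Suc (k * r)) E" using n by (intro ibelow_mono[OF iE]) auto
    then obtain D where D: "curve (\<lambda>j. \<delta> (j * k)) D" "ibelow (Suc r) D" "coef D 1 = coef E k"
      using J[of r] less.prems(2) k E lead unfolding lead_lifts_def r_def by blast
    obtain E' where E': "E = sub k D * E'" "curve \<delta> (sub k D)" "curve \<delta> E'"
      and lead': "\<And>i. 0 < i \<Longrightarrow> i < Suc k \<Longrightarrow> coef E' i = 0"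
      using divide_leading[OF E k lead D(1,3)] by blast
    have jr: "j < Suc r" if "j * k < n" for j
      using that k by (auto simp: r_def less_Suc_eq_le less_eq_div_iff_mult_less_eq)
    have isub: "ibelow n (sub k D)"
      using jr D(2) k by (intro ibelow_sub) (auto simp: ibelow_def)
    have iE': "ibelow n E'" using ibelow_quot[OF curve_0[OF E'(2)] isub] iE E'(1) by simp
    have "coef E' n \<in> Q"
    proof (rule less.hyps[OF _ _ _ E'(3) iE' lead'])
      show "Suc n - Suc k < Suc n - k" using True by simp
      show "(n - 1) div Suc k < R"
        using div_le_mono2[of k "Suc k" "n - 1"] k less.prems(2) by simp
      fix c l assume "c * l = n" "Suc k \<le> l"
      then show "Ob c (\<lambda>j. \<delta> (j * l)) \<subseteq> Q" by (intro Ob) auto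
    qed auto
    moreover have "coef (sub k D) n \<in> Q"
    proof (cases "k dvd n")
      case True
      then obtain c where c: "n = c * k" by (metis dvd_def mult.commute)
      have "coef D c \<in> Ob c (\<lambda>j. \<delta> (j * k))"
        unfolding Ob_def
      proof (intro CollectI exI conjI)
        show "ibelow c D" using jr D(2) k by (auto simp: ibelow_def c)
        show "coef D c - coef D c \<in> Bs (\<delta> (c * k))" by (simp add: Bs_U U_zero)
      qed (fact D(1))
      then have "coef D c \<in> Q" using Ob[of c k] c by auto
      then show ?thesis using k by (simp add: coef_sub_nat c)
    next
      case False
      then show ?thesis using k Q by (simp add: coef_sub_nat subgrp_def)
    qed
    moreover have "coef E n - (coef (sub k D) n + coef E' n) \<in> U"
      unfolding E'(1) using n by (intro coef_mult_top[OF curve_0[OF E'(2)] curve_0[OF E'(3)] isub iE']) auto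
    ultimately have "(coef E n - (coef (sub k D) n + coef E' n)) + (coef (sub k D) n + coef E' n) \<in> Q"
      using Q(2) by (intro subgrp_add[OF Q(1)]) auto
    then show ?thesis by simp
  qed
qed

lemma remove_obstruction:
  fixes \<delta> :: "nat \<Rightarrow> 'q"
  assumes D: "curve \<delta> D" "ibelow n D" and n: "0 < n" and ob: "coef D n \<in> Bs (\<delta> n)"
  obtains X where "curve \<delta> X" "ibelow (Suc n) X" "\<And>k. k < n \<Longrightarrow> coef X k = coef D k"
proof -
  have \<delta>: "monoid_hom \<delta>" using D by (simp add: curve_def)
  obtain u \<eta> where u: "coef D n = u + \<eta>" "u \<in> U" "primitive \<eta>" "\<eta> \<in> Ag (\<delta> n)"
    using ob by (auto simp: Bs_def)
  define e where "e = sub n (exp_series (- \<eta>))"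
  have n0: "n \<noteq> 0" using n by simp
  have e: "curve \<delta> e"
    unfolding e_def using u
    by (intro curve_sub \<delta> n0 curve_exp_series monoid_hom_nmul) (auto intro: Ag_uminus primitive_uminus)
  have evan: "coef e w = 0" if "w \<noteq> 0" "w < n" for w
    using that n by (auto simp: e_def coef_sub_nat dest: dvd_imp_le)
  have De: "coef (D * e) w = coef D w + coef e w" if "w \<noteq> 0" "w \<le> n" for w
    by (rule coef_mult_low[OF curve_0[OF D(1)] curve_0[OF e], of n]) (use that evan in auto)
  have top: "coef (D * e) n = u" using De[of n] n u(1) by (simp add: e_def coef_sub_nat)
  have low: "coef (D * e) w = coef D w" if "w < n" for w
    using De[of w] evan[of w] that curve_0[OF D(1)] curve_0[OF e] by (cases "w = 0") (auto simp: coef_mult_0)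
  have "ibelow (Suc n) (D * e)"
    using D(2) u(2) top low by (auto simp: ibelow_def less_Suc_eq)
  then show ?thesis using that[OF curve_mult[OF D(1) e]] low by blast
qed

lemma kill_obstruction:
  assumes D: "curve \<delta> D" "ibelow r D" and r: "2 \<le> r" and ob: "coef D r \<in> Ob0 r \<delta>"
  obtains X where "curve \<delta> X" "ibelow (Suc r) X" "coef X 1 = coef D 1"
proof -
  have \<delta>: "monoid_hom \<delta>" using D by (simp add: curve_def)
  obtain F where F: "curve \<delta> F" "ibelow r F" "coef F 1 = 0" "coef D r - coef F r \<in> Bs (\<delta> r)"
    using ob by (auto simp: Ob0_def)
  obtain x where x: "D = F * x" "curve \<delta> x" using curve_div[OF D(1) F(1)] .
  have ix: "ibelow r x" using ibelow_quot[OF curve_0[OF F(1)] F(2)] D(2) x(1) by simp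
  have x1: "coef x 1 = coef D 1"
    using coef_mult_1[OF curve_0[OF F(1)] curve_0[OF x(2)]] F(3) x(1) by simp
  have "coef D r - (coef F r + coef x r) \<in> U"
    unfolding x(1) using r by (intro coef_mult_top[OF curve_0[OF F(1)] curve_0[OF x(2)] F(2) ix]) auto
  then have "(coef D r - coef F r) - (coef D r - (coef F r + coef x r)) \<in> Bs (\<delta> r)"
    by (intro subgrp_diff[OF subgrp_Bs] F(4) Bs_U)
  then have ob': "coef x r \<in> Bs (\<delta> r)" by simp
  have "0 < r" using r by simp
  then obtain X where X: "curve \<delta> X" "ibelow (Suc r) X" "\<And>k. k < r \<Longrightarrow> coef X k = coef x k"
    using remove_obstruction[OF x(2) ix _ ob'] by blast
  then show ?thesis using that[of X] X(3)[of 1] r x1 by simp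
qed

text \<open>By induction there is a curve D integral below r with the right tangent vector; its
  class in degree r must be shown to lie in \<open>Ob0\<close>. Unless r is a power of p, some
  binomial coefficient r choose i with 0 < i < r is prime to p. For r = p^j all of them are
  divisible by p, and integrality of E in degree k r enters: in E = D (t^k) E' the class of D in
  degree r is minus that of E' in degree k r, and E' starts beyond degree k.\<close>

theorem lead_lifts: "lead_lifts r"
proof (induction r rule: less_induct)
  case (less r)
  show ?case
    unfolding lead_lifts_def
  proof (intro allI impI)
    fix k :: nat and \<delta> E
    assume k: "0 < k" and E: "curve \<delta> E" and iE: "ibelow (Suc (k * r)) E"
      and lead0: "\<forall>i. 0 < i \<longrightarrow> i < k \<longrightarrow> coef E i = 0"
    then have lead: "coef E i = 0" if "0 < i" "i < k" for i using that by blast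
    have \<delta>: "monoid_hom \<delta>" using E by (simp add: curve_def)
    define \<delta>k where "\<delta>k = (\<lambda>j. \<delta> (j * k))"
    have \<delta>k: "monoid_hom \<delta>k" unfolding \<delta>k_def using monoid_hom_nmul[OF \<delta>, of k] by simp
    show "\<exists>D. curve (\<lambda>j. \<delta> (j * k)) D \<and> ibelow (Suc r) D \<and> coef D 1 = coef E k"
    proof (cases "r < 2")
      case True
      \<comment> \<open>Up to degree 1 the exponential is integral as soon as its tangent vector
        is.\<close>
      let ?e = "exp_series (coef E k)"
      have "curve \<delta>k ?e"
        using curve_leading[OF E _ lead] k curve_Ag[OF E, of k]
        by (intro curve_exp_series \<delta>k) (auto simp: \<delta>k_def)
      moreover have "ibelow (Suc r) ?e"
        unfolding ibelow_def
      proof (intro allI impI)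
        fix w :: nat assume w: "wt w < Suc r"
        then have "w = 0 \<or> w = 1 \<and> r = 1" using True by auto
        then show "coef ?e w \<in> U" using iE by (auto simp: U_one ibelow_def)
      qed
      ultimately show ?thesis by (intro exI[of _ ?e]) (simp add: \<delta>k_def)
    next
      case False
      then have r: "2 \<le> r" by simp
      have "ibelow (Suc (k * (r - 1))) E" by (rule ibelow_mono[OF iE]) simp
      then obtain D where D: "curve \<delta>k D" "ibelow r D" "coef D 1 = coef E k"
        using less[of "r - 1"] r k E lead0 unfolding lead_lifts_def \<delta>k_def
        by (metis Suc_diff_1 diff_less gr0I less_one not_numeral_le_zero)
      define n where "n = k * r"
      have n: "0 < n" using k r by (simp add: n_def)
      obtain E' where E': "E = sub k D * E'" "curve \<delta> (sub k D)" "curve \<delta> E'"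
        and lead': "\<And>i. 0 < i \<Longrightarrow> i < Suc k \<Longrightarrow> coef E' i = 0"
        using divide_leading[OF E k lead D(1,3)[unfolded \<delta>k_def]] by blast
      have iEn: "ibelow n E" using iE by (rule ibelow_mono) (simp add: n_def)
      have isub: "ibelow n (sub k D)"
        using D(2) k by (intro ibelow_sub) (auto simp: ibelow_def n_def mult.commute)
      have iE': "ibelow n E'" using ibelow_quot[OF curve_0[OF E'(2)] isub] iEn E'(1) by simp
      have "coef E n - (coef (sub k D) n + coef E' n) \<in> U"
        unfolding E'(1) using n by (intro coef_mult_top[OF curve_0[OF E'(2)] curve_0[OF E'(3)] isub iE']) auto
      moreover have "coef E n \<in> U" using iE by (simp add: ibelow_def n_def)
      moreover have "coef (sub k D) n = coef D r" using k by (simp add: coef_sub_nat n_def)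
      ultimately have "coef E n - (coef E n - (coef D r + coef E' n)) \<in> U" by (metis U_diff)
      \<comment> \<open>The coefficient of E in degree n = k * r is integral, so the classes of D
        and E' cancel.\<close>
      then have DE': "coef D r + coef E' n \<in> U" by (simp add: add.commute)
      have O: "subgrp (Ob0 r \<delta>k)" using \<delta>k r by (intro subgrp_Ob0) auto
      have UO: "U \<subseteq> Ob0 r \<delta>k" using Bs_Ob0[OF \<delta>k] Bs_U r by auto
      have ObO: "Ob c (\<lambda>j. \<delta>k (j * l)) \<subseteq> Ob0 r \<delta>k" if "c * l = r" "2 \<le> l" for c l
        using Ob_sub_Ob0[OF \<delta>k that(2), of _ c] that(1) by auto
      have "1 \<in> {M. of_int M *\<^sub>C coef D r \<in> Ob0 r \<delta>k}"
      proof (rule int_subgroup_one)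
        show "0 \<in> {M. of_int M *\<^sub>C coef D r \<in> Ob0 r \<delta>k}" using O by (simp add: subgrp_def)
        show "a - b \<in> {M. of_int M *\<^sub>C coef D r \<in> Ob0 r \<delta>k}"
          if "a \<in> {M. of_int M *\<^sub>C coef D r \<in> Ob0 r \<delta>k}" "b \<in> {M. of_int M *\<^sub>C coef D r \<in> Ob0 r \<delta>k}" for a b
          using that subgrp_diff[OF O] by (simp add: complex_vector.scale_left_diff_distrib)
        fix p :: nat assume p: "prime p"
        have p1: "1 < p" using p by (rule prime_gt_1_nat)
        have "\<exists>M. of_int M *\<^sub>C coef D r \<in> Ob0 r \<delta>k \<and> \<not> int p dvd M"
        proof (cases "\<exists>j. r = p ^ j")
          case False
          \<comment> \<open>For i = p^v, the exact power of p in r, the binomial coefficient is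
            prime to p; and a divisor c of i is smaller than r, so that l = r / c is at least 2 and
            the obstruction lies in \<open>Ob0\<close>.\<close>
          define v where "v = multiplicity p r"
          obtain m where m: "r = p ^ v * m" "\<not> p dvd m"
            using multiplicity_decompose'[of r p] r p1 by (auto simp: v_def)
          have "m \<noteq> 0" using m(2) by (cases m) auto
          moreover have "m \<noteq> 1" using False m(1) by auto
          ultimately have i: "0 < p ^ v" "p ^ v < r" using p1 m(1) by auto
          have "of_nat (r choose p ^ v) *\<^sub>C coef D r \<in> Ob0 r \<delta>k"
          proof (rule choose_obstruction[OF D(1,2) i O UO ObO])
            fix c l assume cl: "c * l = r" "c dvd p ^ v"
            then have "c \<le> p ^ v" using i by (intro dvd_imp_le) auto
            then show "2 \<le> l" using cl i by (cases "l = 0 \<or> l = 1") auto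
          qed
          moreover have "\<not> p dvd (r choose p ^ v)" using prime_not_dvd_choose[OF p m(2)] m(1) by simp
          ultimately show ?thesis by (intro exI[of _ "int (r choose p ^ v)"]) simp
        next
          case True
          then obtain j where j: "r = p ^ j" by blast
          \<comment> \<open>The elements with a multiple prime to p in \<open>Ob0\<close>: that
            group localized at p.\<close>
          define Q where "Q = {a. \<exists>M. of_int M *\<^sub>C a \<in> Ob0 r \<delta>k \<and> \<not> int p dvd M}"
          have ip: "prime (int p)" using p by simp
          have Q: "subgrp Q"
            unfolding subgrp_def
          proof (intro conjI ballI)
            have "of_int 1 *\<^sub>C 0 \<in> Ob0 r \<delta>k" using O by (simp add: subgrp_def)
            then show "0 \<in> Q" unfolding Q_def using p1 by (intro CollectI exI[of _ 1]) auto
            fix a b assume "a \<in> Q" "b \<in> Q"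
            then obtain M N where M: "of_int M *\<^sub>C a \<in> Ob0 r \<delta>k" "\<not> int p dvd M"
              and N: "of_int N *\<^sub>C b \<in> Ob0 r \<delta>k" "\<not> int p dvd N" by (auto simp: Q_def)
            have "of_int (M * N) *\<^sub>C (a - b) = of_int N *\<^sub>C of_int M *\<^sub>C a - of_int M *\<^sub>C of_int N *\<^sub>C b"
              by (simp add: complex_vector.scale_right_diff_distrib scaleC_scaleC mult.commute)
            also have "\<dots> \<in> Ob0 r \<delta>k" by (intro subgrp_diff[OF O] subgrp_of_int[OF O] M N)
            finally show "a - b \<in> Q"
              using M(2) N(2) ip by (auto simp: Q_def prime_dvd_mult_iff intro!: exI[of _ "M * N"])
          qed
          have OQ: "a \<in> Q" if "a \<in> Ob0 r \<delta>k" for a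
            using that p1 by (auto simp: Q_def scaleC_one intro!: exI[of _ 1])
          have "coef E' n \<in> Q"
          proof (rule leading_obstruction[OF less n Q _ _ _ E'(3) iE' lead'])
            show "U \<subseteq> Q" using UO OQ by blast
            have "n - 1 < n" "n \<le> r * Suc k" using n by (auto simp: n_def mult.commute)
            then have "n - 1 < r * Suc k" by linarith
            then show "(n - 1) div Suc k < r" by (simp add: div_less_iff_less_mult)
            fix c l assume cl: "c * l = n" "Suc k \<le> l"
            have c0: "0 < c" using cl n by (cases c) auto
            \<comment> \<open>The factors of E' are in t^l with l > k, and c l = k r then forces c <
              r. Although c may fail to divide r = p^j, its exact power p^v of p does divide
              it.\<close>
            have cr: "c < r"
            proof (rule ccontr)
              assume "\<not> c < r"
              then have "r * Suc k \<le> c * l" using cl(2) by (intro mult_le_mono) auto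
              then show False using cl(1) r by (simp add: n_def mult.commute)
            qed
            define v where "v = multiplicity p c"
            obtain m where m: "c = p ^ v * m" "\<not> p dvd m"
              using multiplicity_decompose'[of c p] c0 p1 by (auto simp: v_def)
            have m0: "0 < m" using m by (cases m) auto
            have "p ^ v \<le> c" using m0 by (simp add: m(1))
            then have "p ^ v < p ^ j" using cr j by simp
            then have vj: "v < j" using p1 by (simp add: power_strict_increasing_iff)
            \<comment> \<open>For a divisor c' of p^v, the substitutions of exponents l' and l
              combine to s * k with s = r / c'. Since s \<ge> 2, the obstruction lands in
              \<open>Ob0 r\<close> for the degree map with step k.\<close>
            have ObOl: "Ob c' (\<lambda>j. \<delta> (j * l' * l)) \<subseteq> Ob0 r \<delta>k" if c': "c' * l' = c" "c' dvd p ^ v" for c' l'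
            proof -
              have "c' dvd r" unfolding j by (rule dvd_trans[OF c'(2) le_imp_power_dvd]) (use vj in simp)
              then obtain s where s: "r = c' * s" by (elim dvdE)
              have c'0: "0 < c'" using c' c0 by (cases c') auto
              have "c' \<le> c" using c' c0 by (intro dvd_imp_le) auto
              have "s \<noteq> 0" using s r by (cases s) auto
              moreover have "s \<noteq> 1" using s cr \<open>c' \<le> c\<close> by auto
              ultimately have s2: "2 \<le> s" by simp
              have "c' * (l' * l) = c * l" using c'(1) by (simp add: mult.assoc[symmetric])
              also have "\<dots> = c' * (s * k)" using cl(1) s by (simp add: n_def mult.left_commute mult.commute)
              finally have "c' * (l' * l) = c' * (s * k)" .
              then have "l' * l = s * k" using c'0 by simp
              then have "(\<lambda>j. \<delta> (j * l' * l)) = (\<lambda>j. \<delta>k (j * s))"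
                by (simp add: \<delta>k_def mult.assoc)
              then show ?thesis using ObO[of c' s] s s2 by simp
            qed
            show "Ob c (\<lambda>j. \<delta> (j * l)) \<subseteq> Q"
            proof
              fix a assume a: "a \<in> Ob c (\<lambda>j. \<delta> (j * l))"
              show "a \<in> Q"
              \<comment> \<open>If c is a power of p, it divides r and the substitution applies
                directly. Otherwise the binomial coefficient at p^v is prime to p and reduces the
                class to divisors of p^v.\<close>
              proof (cases "m = 1")
                case True
                then show ?thesis using ObOl[of c 1] a m(1) by (intro OQ) auto
              next
                case False
                then have i: "0 < p ^ v" "p ^ v < c" using p1 m m0 by auto
                obtain D' where D': "curve (\<lambda>j. \<delta> (j * l)) D'" "ibelow c D'" "a - coef D' c \<in> Bs (\<delta> (c * l))"
                  using a by (auto simp: Ob_def)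
                have "of_nat (c choose p ^ v) *\<^sub>C coef D' c \<in> Ob0 r \<delta>k"
                proof (rule choose_obstruction[OF D'(1,2) i O UO])
                  fix c' l' assume "c' * l' = c" "c' dvd p ^ v"
                  then show "Ob c' (\<lambda>k. \<delta> (k * l' * l)) \<subseteq> Ob0 r \<delta>k" by (rule ObOl)
                qed
                moreover have "\<not> p dvd (c choose p ^ v)" using prime_not_dvd_choose[OF p m(2)] m(1) by simp
                ultimately have "coef D' c \<in> Q"
                  unfolding Q_def by (intro CollectI exI[of _ "int (c choose p ^ v)"]) simp
                moreover have "a - coef D' c \<in> Ob0 r \<delta>k"
                  using D'(3) r by (intro Bs_Ob0 \<delta>k) (auto simp: cl(1) n_def \<delta>k_def mult.commute)
                ultimately have "(a - coef D' c) + coef D' c \<in> Q"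
                  using subgrp_add[OF Q OQ] by blast
                then show ?thesis by simp
              qed
            qed
          qed auto
          moreover have "coef D r + coef E' n \<in> Q" using DE' UO OQ by blast
          ultimately have "(coef D r + coef E' n) - coef E' n \<in> Q" by (intro subgrp_diff[OF Q])
          then show ?thesis by (simp add: Q_def)
        qed
        then show "\<exists>M\<in>{M. of_int M *\<^sub>C coef D r \<in> Ob0 r \<delta>k}. \<not> int p dvd M" by blast
      qed
      then have "coef D r \<in> Ob0 r \<delta>k" by (simp add: scaleC_one)
      then obtain X where "curve \<delta>k X" "ibelow (Suc r) X" "coef X 1 = coef D 1"
        using kill_obstruction[OF D(1,2) r] by blast
      then show ?thesis using D(3) by (auto simp: \<delta>k_def)
    qed
  qed
qed

end

lemma coef_mult_split_right:
  "coef (f * g) w = coef f w * coef g 0 + (\<Sum>(u, v)\<in>{p \<in> decomp w. snd p \<noteq> 0}. coef f u * coef g v)"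
proof -
  have "decomp w = insert (w, 0) {p \<in> decomp w. snd p \<noteq> 0}" by (auto simp: decomp_def)
  then have "coef (f * g) w = (\<Sum>(u, v)\<in>insert (w, 0) {p \<in> decomp w. snd p \<noteq> 0}. coef f u * coef g v)"
    by (simp only: coef_mult)
  then show ?thesis by simp
qed

lemma monoid_hom_nat_eqI:
  fixes \<delta> \<epsilon> :: "nat \<Rightarrow> 'q::comm_monoid_add"
  assumes "monoid_hom \<delta>" "monoid_hom \<epsilon>" "\<delta> 1 = \<epsilon> 1"
  shows "\<delta> = \<epsilon>"
proof
  fix n show "\<delta> n = \<epsilon> n"
  proof (induction n)
    case 0
    show ?case using assms by (simp add: monoid_hom_def)
  next
    case (Suc n)
    have "\<delta> (Suc n) = \<delta> 1 + \<delta> n" "\<epsilon> (Suc n) = \<epsilon> 1 + \<epsilon> n"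
      using assms(1,2) unfolding monoid_hom_def by (metis plus_1_eq_Suc)+
    with Suc assms(3) show ?case by simp
  qed
qed

context graded_form
begin

subsection \<open>Words in the coefficients of curves\<close>

text \<open>\<open>N\<close> is the precision of the letters; m bounds the total degree of a word
  and hence its filtration. The letters may come from curves with different degree maps, so words of
  several degrees are mixed. Closure under differences gives integer combinations.\<close>

inductive word_span :: "nat \<Rightarrow> nat \<Rightarrow> 'g uea \<Rightarrow> bool" for N where
  one: "word_span N m 1"
| diff: "word_span N m u \<Longrightarrow> word_span N m v \<Longrightarrow> word_span N m (u - v)"
| mono: "word_span N m u \<Longrightarrow> m \<le> m' \<Longrightarrow> word_span N m' u"
| step: "curve \<delta> D \<Longrightarrow> ibelow (Suc N) D \<Longrightarrow> word_span N m u \<Longrightarrow> word_span N (n + m) (coef D n * u)"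

lemma word_span_zero: "word_span N m 0"
  using word_span.diff[OF word_span.one word_span.one] by simp
lemma word_span_uminus: "word_span N m u \<Longrightarrow> word_span N m (- u)"
  using word_span.diff[OF word_span_zero] by simp
lemma word_span_add: "word_span N m u \<Longrightarrow> word_span N m v \<Longrightarrow> word_span N m (u + v)"
  using word_span.diff[OF _ word_span_uminus] by simp
lemma word_span_sum: "(\<And>i. i \<in> I \<Longrightarrow> word_span N m (f i)) \<Longrightarrow> word_span N m (\<Sum>i\<in>I. f i)"
  by (induction I rule: infinite_finite_induct) (simp_all add: word_span_zero word_span_add)
lemma word_span_of_nat: "word_span N m u \<Longrightarrow> word_span N m (of_nat k *\<^sub>C u)"
  by (induction k) (simp_all add: word_span_zero word_span_add scaleC_add_left scaleC_one)

lemma word_span_letter: "curve \<delta> D \<Longrightarrow> ibelow (Suc N) D \<Longrightarrow> word_span N n (coef D n)"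
  using word_span.step[OF _ _ word_span.one[of N 0]] by force

lemma word_span_mult:
  assumes "word_span N a u" "word_span N b v"
  shows "word_span N (a + b) (u * v)"
  using assms(1)
proof induction
  case (one m)
  show ?case using word_span.mono[OF assms(2)] by simp
next
  case (diff m u u')
  then show ?case by (simp add: left_diff_distrib word_span.diff)
next
  case (mono m u m')
  then show ?case by (meson add_le_mono1 word_span.mono)
next
  case (step \<delta> D m u n)
  then show ?case using word_span.step by (simp add: mult.assoc add.assoc)
qed

lemma word_span_antimono: "word_span N m u \<Longrightarrow> N' \<le> N \<Longrightarrow> word_span N' m u"
proof (induction rule: word_span.induct)
  case (step \<delta> D m u n)
  then show ?case by (intro word_span.step ibelow_mono[OF step(2)]) auto
qed (auto intro: word_span.intros)

lemma word_span_lower: "word_span N m u \<Longrightarrow> u \<in> lower (Suc m)"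
proof (induction rule: word_span.induct)
  case (one m)
  show ?case by (rule lower_one)
next
  case (diff m u v)
  then show ?case by (simp add: lower_diff)
next
  case (mono m u m')
  then show ?case using lower_mono[of "Suc m" "Suc m'"] by auto
next
  case (step \<delta> D m u n)
  then show ?case using lower_mult_right[OF grouplike_lower[OF curve_grouplike[OF step(1)]] step(4)] by simp
qed

text \<open>Every factor of K sits at an exponent w of weight at least 2, so its k-th coefficient
  counts with order k but uses up weight 2 k or more; this is the gain of \<open>div 2\<close>. A
  nontrivial term of it in weight at most M requires wt w \<le> M, and the factor is then integral
  up to N' because M * N' \<le> N.\<close>

lemma slope_words:
  fixes \<delta> :: "nat \<times> nat \<Rightarrow> 'q" and K :: "(nat \<times> nat, 'g uea) series"
  assumes K: "curve \<delta> K" "ibelow (Suc N) K" "\<And>u. u \<noteq> 0 \<Longrightarrow> fst u = 0 \<or> snd u = 0 \<Longrightarrow> coef K u = 0"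
    and N: "M * N' \<le> N" "0 < N'" and v: "wt v \<le> M"
  shows "word_span N' (wt v div 2) (coef K v)"
proof -
  have MN: "M \<le> N" using N by (metis le_trans mult_le_mono2 nat_mult_1_right Suc_leI One_nat_def)
  obtain L where L: "\<forall>(w, g)\<in>set L. 0 < fst w \<and> 0 < snd w \<and> curve (\<lambda>k. \<delta> (nmul k w)) g \<and>
        (\<forall>m\<le>Suc N. ibelow m K \<longrightarrow> (\<forall>k. k * wt w < m \<longrightarrow> coef g k \<in> U))"
     and KL: "\<And>u. wt u < Suc N \<Longrightarrow> coef K u = coef (prod_list (map (\<lambda>(w, g). sub w g) L)) u"
    using slope_factorization[OF K(1), of "Suc N"] K(3) by blast
  let ?Pi = "\<lambda>L. prod_list (map (\<lambda>(w, g). sub w g) L)"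
  have "word_span N' (wt v div 2) (coef (?Pi L') v)" if "set L' \<subseteq> set L" "wt v \<le> M" for L' v
    using that
  proof (induction L' arbitrary: v)
    case Nil
    then show ?case by (auto simp: coef_one word_span_zero intro: word_span.one)
  next
    case (Cons x L')
    obtain w g where x: "x = (w, g)" by (cases x)
    have "(w, g) \<in> set L" using Cons.prems by (simp add: x)
    from bspec[OF L this] have w: "0 < fst w" "0 < snd w" and g: "curve (\<lambda>k. \<delta> (nmul k w)) g"
      and gU: "\<forall>m\<le>Suc N. ibelow m K \<longrightarrow> (\<forall>k. k * wt w < m \<longrightarrow> coef g k \<in> U)" by auto
    have w0: "w \<noteq> 0" using w by (auto simp: zero_prod_def)
    have w2: "2 \<le> wt w" using w by (simp add: wt_pair)
    have "word_span N' (wt v div 2) (coef (sub w g) a * coef (?Pi L') b)" if ab: "(a, b) \<in> decomp v" for a b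
    proof (cases "\<exists>k. a = nmul k w")
      case True
      then obtain k where k: "a = nmul k w" by blast
      have wts: "wt v = k * wt w + wt b" using decomp_wt[OF ab] by (simp add: k wt_nmul)
      have IH: "word_span N' (wt b div 2) (coef (?Pi L') b)"
        using Cons wts by auto
      show ?thesis
      proof (cases "k = 0")
        case True
        then show ?thesis using IH wts w0 curve_0[OF g] by (simp add: k coef_sub_0)
      next
        case False
        then have "wt w \<le> k * wt w" by simp
        then have wM: "wt w \<le> M" using Cons.prems(2) wts by linarith
        have "ibelow (Suc N') g"
          unfolding ibelow_def
        proof (intro allI impI)
          fix i :: nat assume "wt i < Suc N'"
          then have "i * wt w \<le> N' * M" using wM by (intro mult_le_mono) auto
          then have "i * wt w < Suc N" using N(1) by (simp add: mult.commute)
          then show "coef g i \<in> U" using gU[rule_format, of "Suc N" i] K(2) by simp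
        qed
        from word_span.step[OF g this IH, of k]
        have "word_span N' (k + wt b div 2) (coef (sub w g) a * coef (?Pi L') b)"
          by (simp add: k coef_sub_nmul w0)
        moreover have "k * 2 \<le> k * wt w" using w2 by (rule mult_le_mono2)
        then have "k + wt b div 2 \<le> wt v div 2" using wts by linarith
        ultimately show ?thesis by (rule word_span.mono)
      qed
    next
      case False
      then show ?thesis by (simp add: coef_sub_other word_span_zero)
    qed
    then show ?case by (auto simp: x coef_mult intro!: word_span_sum)
  qed
  from this[of L v] KL[of v] v MN show ?thesis by simp
qed

text \<open>With P = A K, the difference P - A consists of products A_u K_v with v \<noteq> 0, where
  K_v has at most half the order of its weight. It is applied to D(s) D'(t) against D'(t) D(s) for
  commutators, and to D(s) D(t) against D(s + t) for products within one curve.\<close>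

lemma word_span_quot:
  fixes \<delta> :: "nat \<times> nat \<Rightarrow> 'q" and A K :: "(nat \<times> nat, 'g uea) series"
  assumes A: "curve \<delta> A" "ibelow (Suc N) A" and P: "curve \<delta> P" "ibelow (Suc N) P"
    and agree: "\<And>u. fst u = 0 \<or> snd u = 0 \<Longrightarrow> coef P u = coef A u"
    and AW: "\<And>u. word_span N' (wt u) (coef A u)"
    and N: "wt w * N' \<le> N" "0 < N'" and w: "w \<noteq> 0"
  shows "word_span N' (wt w - 1) (coef P w - coef A w)"
proof -
  obtain K where K: "P = A * K" "curve \<delta> K" using curve_div[OF P(1) A(1)] .
  have iK: "ibelow (Suc N) K" using ibelow_quot[OF curve_0[OF A(1)] A(2)] P(2) K(1) by simp
  have ax: "coef K u = 0" if "u \<noteq> 0" "fst u = 0 \<or> snd u = 0" for u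
    using quot_axis[OF curve_0[OF A(1)] curve_0[OF K(2)]] agree that K(1) by blast
  have "coef P w - coef A w = (\<Sum>(u, v)\<in>{p \<in> decomp w. snd p \<noteq> 0}. coef A u * coef K v)"
    using coef_mult_split_right[of A K w] curve_0[OF K(2)] by (simp add: K(1))
  also have "word_span N' (wt w - 1) \<dots>"
  proof (rule word_span_sum, clarify)
    fix a b c d :: nat assume p: "((a, b), (c, d)) \<in> decomp w" "snd ((a, b), (c, d)) \<noteq> 0"
    have wts: "wt w = wt (a, b) + wt (c, d)" using decomp_wt[OF p(1)] .
    have "wt (c, d) \<noteq> 0" using p(2) wt_eq_0_iff[of "(c, d)"] by simp
    have "word_span N' (wt (c, d) div 2) (coef K (c, d))"
      by (rule slope_words[OF K(2) iK ax N]) (use wts in simp_all)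
    from word_span_mult[OF AW[of "(a, b)"] this]
    have "word_span N' (wt (a, b) + wt (c, d) div 2) (coef A (a, b) * coef K (c, d))" .
    moreover have "wt (a, b) + wt (c, d) div 2 \<le> wt w - 1"
      using wts \<open>wt (c, d) \<noteq> 0\<close> by linarith
    ultimately show "word_span N' (wt w - 1) (coef A (a, b) * coef K (c, d))"
      by (rule word_span.mono)
  qed
  finally show ?thesis .
qed

lemma word_span_commute:
  assumes D: "curve \<delta> D" "ibelow (Suc N) D" and D': "curve \<delta>' D'" "ibelow (Suc N) D'"
    and N: "(a + b) * N' \<le> N" "0 < N'" and ab: "0 < a + b"
  shows "word_span N' (a + b - 1) (coef D a * coef D' b - coef D' b * coef D a)"
proof -
  define \<delta>2 where "\<delta>2 = (\<lambda>w :: nat \<times> nat. \<delta> (fst w) + \<delta>' (snd w))"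
  have s: "curve \<delta>2 (sub (1, 0) D)" "curve \<delta>2 (sub (0, 1) D')"
    unfolding \<delta>2_def by (rule curve_axes[OF D(1) D'(1)])+
  define P :: "(nat \<times> nat, 'g uea) series" where "P = sub (1, 0) D * sub (0, 1) D'"
  define A :: "(nat \<times> nat, 'g uea) series" where "A = sub (0, 1) D' * sub (1, 0) D"
  have Pc: "coef P u = coef D (fst u) * coef D' (snd u)" for u unfolding P_def by (rule coef_sub_axes)
  have Ac: "coef A u = coef D' (snd u) * coef D (fst u)" for u unfolding A_def by (rule coef_sub_axes)
  have "word_span N' (wt (a, b) - 1) (coef P (a, b) - coef A (a, b))"
  proof (rule word_span_quot)
    show "curve \<delta>2 A" "curve \<delta>2 P" unfolding A_def P_def using s by (auto intro: curve_mult)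
    show "ibelow (Suc N) A" "ibelow (Suc N) P"
      using D(2) D'(2) by (auto simp: ibelow_def Ac Pc wt_pair intro!: U_mult)
    show "coef P u = coef A u" if "fst u = 0 \<or> snd u = 0" for u
      using that curve_0[OF D(1)] curve_0[OF D'(1)] by (auto simp: Pc Ac)
    have NN: "N' \<le> N" using N ab by (metis le_trans mult_le_mono1 Suc_leI nat_mult_1 One_nat_def)
    show "word_span N' (wt u) (coef A u)" for u
      using word_span_mult[OF word_span_letter[OF D'(1)] word_span_letter[OF D(1)], of N' "snd u" "fst u"]
        ibelow_mono[OF D(2), of "Suc N'"] ibelow_mono[OF D'(2), of "Suc N'"] NN
      by (simp add: Ac wt_pair add.commute)
    show "wt (a, b) * N' \<le> N" using N by (simp add: wt_pair)
    show "(a, b) \<noteq> 0" using ab by (auto simp: zero_prod_def)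
  qed (fact N)
  then show ?thesis by (simp add: Pc Ac wt_pair)
qed

lemma word_span_merge:
  assumes D: "curve \<delta> D" "ibelow (Suc N) D" and N: "(a + b) * N' \<le> N" "0 < N'" and ab: "0 < a + b"
  shows "word_span N' (a + b - 1) (coef D a * coef D b - of_nat (a + b choose a) *\<^sub>C coef D (a + b))"
proof -
  define \<delta>2 where "\<delta>2 = (\<lambda>w :: nat \<times> nat. \<delta> (wt w))"
  have s: "curve \<delta>2 (sub (1, 0) D)" "curve \<delta>2 (sub (0, 1) D)"
    using curve_axes[OF D(1) D(1)] by (simp_all add: \<delta>2_def monoid_hom_axes[OF curve_hom[OF D(1)]])
  define P :: "(nat \<times> nat, 'g uea) series" where "P = sub (1, 0) D * sub (0, 1) D"
  define A :: "(nat \<times> nat, 'g uea) series" where "A = addc D"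
  have Pc: "coef P u = coef D (fst u) * coef D (snd u)" for u unfolding P_def by (rule coef_sub_axes)
  have Ac: "coef A u = of_nat (wt u choose fst u) *\<^sub>C coef D (wt u)" for u unfolding A_def by (rule coef_addc)
  have "word_span N' (wt (a, b) - 1) (coef P (a, b) - coef A (a, b))"
  proof (rule word_span_quot)
    show "curve \<delta>2 A" unfolding A_def \<delta>2_def by (rule curve_addc[OF D(1)])
    show "curve \<delta>2 P" unfolding P_def using s by (auto intro: curve_mult)
    show "ibelow (Suc N) A" "ibelow (Suc N) P"
      using D(2) by (auto simp: ibelow_def Ac Pc wt_pair intro!: U_mult U_of_nat)
    show "coef P u = coef A u" if "fst u = 0 \<or> snd u = 0" for u
      using that curve_0[OF D(1)] by (auto simp: Pc Ac wt_pair scaleC_one)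
    have NN: "N' \<le> N" using N ab by (metis le_trans mult_le_mono1 Suc_leI nat_mult_1 One_nat_def)
    show "word_span N' (wt u) (coef A u)" for u
      unfolding Ac using ibelow_mono[OF D(2), of "Suc N'"] NN
      by (intro word_span_of_nat word_span_letter[OF D(1)]) auto
    show "wt (a, b) * N' \<le> N" using N by (simp add: wt_pair)
    show "(a, b) \<noteq> 0" using ab by (auto simp: zero_prod_def)
  qed (fact N)
  then show ?thesis by (simp add: Pc Ac wt_pair)
qed

text \<open>The analogue of \<open>slope_words\<close> in one variable: \<open>lead_lifts\<close>
  supplies factors D (t^k) with D integral up to N div k, and since k \<ge> 2 their coefficients
  have at most half the order of their degree.\<close>

lemma word_span_leading:
  fixes \<delta> :: "nat \<Rightarrow> 'q" and E :: "(nat, 'g uea) series"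
  assumes N: "M * N' \<le> N" "0 < N'"
  shows "2 \<le> k \<Longrightarrow> curve \<delta> E \<Longrightarrow> ibelow (Suc N) E \<Longrightarrow> (\<And>i. 0 < i \<Longrightarrow> i < k \<Longrightarrow> coef E i = 0) \<Longrightarrow>
    v \<le> M \<Longrightarrow> word_span N' (v div 2) (coef E v)"
proof (induction "Suc M - k" arbitrary: k E v rule: less_induct)
  case less
  note k2 = \<open>2 \<le> k\<close> and E = \<open>curve \<delta> E\<close> and iE = \<open>ibelow (Suc N) E\<close> and lead = less.prems(4)
  show ?case
  proof (cases "k \<le> M")
    case False
    show ?thesis
    proof (cases "v = 0")
      case True
      then show ?thesis using curve_0[OF E] by (simp add: word_span.one)
    next
      case v: False
      have "coef E v = 0" using False v less.prems(5) by (intro lead) auto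
      then show ?thesis by (simp add: word_span_zero)
    qed
  next
    case True
    have k: "0 < k" using k2 by simp
    define r where "r = N div k"
    have "ibelow (Suc (k * r)) E" by (rule ibelow_mono[OF iE]) (simp add: r_def)
    then obtain D where D: "curve (\<lambda>j. \<delta> (j * k)) D" "ibelow (Suc r) D" "coef D 1 = coef E k"
      using lead_lifts[of r] k E lead unfolding lead_lifts_def by blast
    have "N' * k \<le> N" using N(1) True by (metis le_trans mult.commute mult_le_mono1)
    then have "N' \<le> r" using k by (simp add: r_def less_eq_div_iff_mult_less_eq)
    then have D': "ibelow (Suc N') D" by (intro ibelow_mono[OF D(2)]) simp
    obtain E' where E': "E = sub k D * E'" "curve \<delta> (sub k D)" "curve \<delta> E'"
      and lead': "\<And>i. 0 < i \<Longrightarrow> i < Suc k \<Longrightarrow> coef E' i = 0"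
      using divide_leading[OF E k lead D(1,3)] by blast
    have "j < Suc r" if "j * k < Suc N" for j
      using that k by (simp add: r_def less_Suc_eq_le less_eq_div_iff_mult_less_eq)
    then have isub: "ibelow (Suc N) (sub k D)"
      using D(2) k by (intro ibelow_sub) (auto simp: ibelow_def)
    have iE': "ibelow (Suc N) E'" using ibelow_quot[OF curve_0[OF E'(2)] isub] iE E'(1) by simp
    have IH: "word_span N' (i div 2) (coef E' i)" if "i \<le> M" for i
      by (rule less.hyps[OF _ _ E'(3) iE' lead']) (use True k2 that in auto)
    have "word_span N' (v div 2) (coef (sub k D) i * coef E' (v - i))" if i: "i \<le> v" for i
    proof (cases "k dvd i")
      case True
      then obtain j where j: "i = k * j" by (elim dvdE)
      have "word_span N' (j + (v - i) div 2) (coef D j * coef E' (v - i))"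
        using less.prems(5) i by (intro word_span.step[OF D(1) D' IH]) auto
      moreover have "2 * j \<le> i" using k2 by (simp add: j)
      then have "j + (v - i) div 2 \<le> v div 2" using i by linarith
      ultimately have "word_span N' (v div 2) (coef D j * coef E' (v - i))" by (rule word_span.mono)
      then show ?thesis using k by (simp add: coef_sub_nat j)
    next
      case False
      then show ?thesis using k by (simp add: coef_sub_nat word_span_zero)
    qed
    then show ?thesis unfolding E'(1) coef_mult sum_decomp_nat by (intro word_span_sum) auto
  qed
qed

end

subsection \<open>Independence of ordered monomials\<close>

lemma contract_prim_mult:
  assumes "clinear f" "f 1 = 0" "primitive y" "v \<in> lower (Suc n)"
  shows "contract f (y * v) - (y * contract f v + f y *\<^sub>C v) \<in> lower n"
  using contract_Cons_lower[OF assms(1,2,4)] assms(3) by (auto simp: primitive_iff)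

lemma prim_mult_lower_pred:
  assumes "primitive y" "u \<in> lower (n - 1)"
  shows "y * u \<in> lower n"
proof (cases n)
  case 0
  then show ?thesis using assms by (simp add: lower_zero)
next
  case (Suc m)
  then show ?thesis using lower_mult_right[OF primitive_lower[OF assms(1)], of u m] assms(2) by simp
qed

lemma prim_mult_lower: "primitive y \<Longrightarrow> v \<in> lower n \<Longrightarrow> y * v \<in> lower (Suc n)"
  using lower_mult_right[OF primitive_lower] by fastforce

lemma prim_list_lower: "(\<forall>y\<in>set ps. primitive y) \<Longrightarrow> v \<in> lower (Suc n) \<Longrightarrow> prod_list ps * v \<in> lower (Suc (length ps + n))"
proof (induction ps)
  case (Cons y ps)
  then show ?case using prim_mult_lower[of y "prod_list ps * v" "Suc (length ps + n)"] by (simp add: mult.assoc)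
qed simp

text \<open>On symbols the contraction is a derivation, for which the factors in \<open>ps\<close>
  are constants.\<close>

lemma contract_prefix:
  assumes f: "clinear f" "f 1 = 0" and v: "v \<in> lower (Suc n)"
    and ps: "\<forall>y\<in>set ps. primitive y \<and> f y = 0"
  shows "contract f (prod_list ps * v) - prod_list ps * contract f v \<in> lower (length ps + n - 1)"
  using ps
proof (induction ps)
  case Nil
  show ?case by (simp add: lower_zero)
next
  case (Cons y ps)
  let ?V = "prod_list ps * v"
  have "?V \<in> lower (Suc (length ps + n))" using Cons.prems by (intro prim_list_lower v) auto
  from contract_prim_mult[OF f _ this, of y] Cons.prems
  have "contract f (y * ?V) - y * contract f ?V \<in> lower (length ps + n)" by simp
  moreover have "y * (contract f ?V - prod_list ps * contract f v) \<in> lower (length ps + n)"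
    using Cons by (intro prim_mult_lower_pred) auto
  ultimately have "(contract f (y * ?V) - y * contract f ?V) + y * (contract f ?V - prod_list ps * contract f v)
      \<in> lower (length ps + n)" by (rule lower_add)
  then show ?case by (simp add: algebra_simps)
qed

text \<open>The derivative of y^k. Subtraction is truncated: for k + n = 0 the error is exactly
  zero, since \<open>lower 0\<close> is.\<close>

lemma contract_power:
  assumes f: "clinear f" "f 1 = 0" and y: "primitive y" "f y = 1"
    and v: "v \<in> lower (Suc n)" "contract f v \<in> lower (n - 1)"
  shows "contract f (y ^ k * v) - of_nat k *\<^sub>C (y ^ (k - 1) * v) \<in> lower (k + n - 1)"
proof (induction k)
  case 0
  show ?case using v by simp
next
  case (Suc k)
  let ?V = "y ^ k * v"
  have V: "?V \<in> lower (Suc (k + n))"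
    using prim_list_lower[of "replicate k y" v n] y v by (simp add: prod_list_replicate)
  from contract_prim_mult[OF f y(1) V] y(2)
  have "contract f (y * ?V) - (y * contract f ?V + ?V) \<in> lower (k + n)" by (simp add: scaleC_one)
  moreover have "y * (contract f ?V - of_nat k *\<^sub>C (y ^ (k - 1) * v)) \<in> lower (k + n)"
    by (rule prim_mult_lower_pred[OF y(1) Suc])
  ultimately have "(contract f (y * ?V) - (y * contract f ?V + ?V))
      + y * (contract f ?V - of_nat k *\<^sub>C (y ^ (k - 1) * v)) \<in> lower (k + n)" by (rule lower_add)
  moreover have "y * (of_nat k *\<^sub>C (y ^ (k - 1) * v)) = of_nat k *\<^sub>C ?V"
    by (cases k) (simp_all add: mult_scaleC_right mult.assoc)
  ultimately show ?case by (simp add: algebra_simps scaleC_add_left scaleC_one)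
qed

text \<open>The list fixes the order of the factors and the multiset their exponents, so that
  removing an element from the multiset is differentiation up to an integer factor.\<close>

definition pbw_monomial :: "(nat \<Rightarrow> 'a::monoid_mult) \<Rightarrow> nat list \<Rightarrow> nat multiset \<Rightarrow> 'a" where
  "pbw_monomial z js M = prod_list (map (\<lambda>j. z j ^ count M j) js)"

lemma prod_list_concat: "prod_list (concat xss) = prod_list (map prod_list xss)" for xss :: "'a::monoid_mult list list"
  by (induction xss) simp_all

lemma pbw_monomial_word:
  "pbw_monomial z js M = prod_list (concat (map (\<lambda>j. replicate (count M j) (z j)) js))"
  by (simp add: pbw_monomial_def prod_list_concat comp_def prod_list_replicate)

lemma size_eq_sum_list:
  assumes "distinct js" "set_mset M \<subseteq> set js"
  shows "sum_list (map (count M) js) = size M"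
proof -
  have "sum_list (map (count M) js) = (\<Sum>j\<in>set js. count M j)"
    using assms(1) by (rule sum_list_distinct_conv_sum_set)
  also have "\<dots> = (\<Sum>j\<in>set_mset M. count M j)"
    using assms(2) by (intro sum.mono_neutral_right) (auto simp: not_in_iff)
  finally show ?thesis by (simp add: size_multiset_overloaded_eq)
qed

lemma length_concat_replicate:
  "length (concat (map (\<lambda>j. replicate (count M j) (z j)) js)) = sum_list (map (count M) js)"
  by (simp add: length_concat comp_def)

text \<open>Contraction with the functional dual to z_j is, on symbols, the partial derivative with
  respect to z_j.\<close>

lemma contract_pbw_monomial:
  assumes f: "clinear f" "f 1 = 0" and js: "distinct js" "set_mset M \<subseteq> set js"
    and z: "\<And>i. i \<in> set js \<Longrightarrow> primitive (z i)" and j: "j \<in> set js" "f (z j) = 1"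
    and fz: "\<And>i. i \<in> set js \<Longrightarrow> i \<noteq> j \<Longrightarrow> f (z i) = 0"
  shows "contract f (pbw_monomial z js M) - of_nat (count M j) *\<^sub>C pbw_monomial z js (M - {#j#})
     \<in> lower (size M - 1)"
proof -
  obtain pre post where split: "js = pre @ j # post" using j(1) by (meson split_list)
  have nj: "j \<notin> set pre" "j \<notin> set post" using js(1) by (auto simp: split)
  define W where "W = (\<lambda>js. concat (map (\<lambda>j. replicate (count M j) (z j)) js))"
  define k where "k = count M j"
  have Wp: "\<forall>y\<in>set (W js'). primitive y \<and> f y = 0" if "js' = pre \<or> js' = post" for js'
    using that z fz nj by (auto simp: W_def split)
  have Wpre: "\<forall>y\<in>set (W pre). primitive y \<and> f y = 0" and Wpost: "\<forall>y\<in>set (W post). primitive y \<and> f y = 0"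
    using Wp by blast+
  have lens: "length (W pre) + k + length (W post) = size M"
    using size_eq_sum_list[OF js] unfolding W_def length_concat_replicate by (simp add: split k_def)
  have P: "pbw_monomial z js M = prod_list (W pre) * (z j ^ k * prod_list (W post))"
    unfolding pbw_monomial_word W_def by (simp add: split prod_list_replicate k_def mult.assoc)
  have same: "map (\<lambda>i. replicate (count (M - {#j#}) i) (z i)) js' = map (\<lambda>i. replicate (count M i) (z i)) js'"
    if "j \<notin> set js'" for js' using that by (induction js') auto
  have P': "pbw_monomial z js (M - {#j#}) = prod_list (W pre) * (z j ^ (k - 1) * prod_list (W post))"
    unfolding pbw_monomial_word W_def split map_append list.map same[OF nj(1)] same[OF nj(2)]
    by (simp add: prod_list_replicate k_def mult.assoc)
  have post: "prod_list (W post) \<in> lower (Suc (length (W post)))"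
    using prim_list_lower[of "W post" 1 0] Wpost lower_one[of 0] by simp
  have "contract f (prod_list (W post)) \<in> lower (length (W post) - 1)"
    using contract_prefix[OF f lower_one[of 0], of "W post"] Wpost f by (simp add: contract_one)
  note pow = contract_power[OF f z[OF j(1)] j(2) post this, of k]
  have zk: "z j ^ k * prod_list (W post) \<in> lower (Suc (k + length (W post)))"
    using prim_list_lower[of "replicate k (z j)", OF _ post] z[OF j(1)] by (simp add: prod_list_replicate)
  note pre = contract_prefix[OF f zk, of "W pre"]
  let ?r = "contract f (z j ^ k * prod_list (W post)) - of_nat k *\<^sub>C (z j ^ (k - 1) * prod_list (W post))"
  have "prod_list (W pre) * ?r \<in> lower (size M - 1)"
  proof (cases "k + length (W post)")
    case 0
    then have "?r = 0" using pow by simp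
    then show ?thesis by (simp add: lower_zero)
  next
    case (Suc n)
    then have "?r \<in> lower n" using pow by simp
    moreover have "prod_list (W pre) \<in> lower (Suc (length (W pre)))"
      using prim_list_lower[of "W pre" 1 0] Wpre lower_one[of 0] by simp
    ultimately have "prod_list (W pre) * ?r \<in> lower (length (W pre) + n)" by (intro lower_mult_right)
    then show ?thesis using lens Suc by (simp add: add.assoc flip: lens)
  qed
  moreover have "contract f (prod_list (W pre) * (z j ^ k * prod_list (W post)))
      - prod_list (W pre) * contract f (z j ^ k * prod_list (W post)) \<in> lower (size M - 1)"
    using pre Wpre lens by (simp add: add.assoc)
  ultimately have "(contract f (prod_list (W pre) * (z j ^ k * prod_list (W post)))
      - prod_list (W pre) * contract f (z j ^ k * prod_list (W post))) + prod_list (W pre) * ?r \<in> lower (size M - 1)"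
    by (intro lower_add)
  then show ?thesis
    by (simp add: P P' k_def[symmetric] right_diff_distrib mult_scaleC_right)
qed

text \<open>Contracting a relation between symbols of degree m + 1 with the functional dual to z_j
  gives a relation of degree m, in which c M is multiplied by the exponent of j in M. This exponent
  is nonzero for a suitable j, so c M vanishes by induction. The dual functionals take the place of
  the Poincare-Birkhoff-Witt theorem.\<close>

lemma pbw_independent:
  fixes z :: "nat \<Rightarrow> 'g::complex_lie_algebra uea"
  assumes js: "distinct js" and z: "\<And>j. j \<in> set js \<Longrightarrow> primitive (z j)"
    and dual: "\<And>j. j \<in> set js \<Longrightarrow> \<exists>f :: 'g uea \<Rightarrow> complex. clinear f \<and> f 1 = 0 \<and> f (z j) = 1 \<and> (\<forall>i\<in>set js. i \<noteq> j \<longrightarrow> f (z i) = 0)"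
  shows "finite S \<Longrightarrow> (\<And>M. M \<in> S \<Longrightarrow> size M = m \<and> set_mset M \<subseteq> set js) \<Longrightarrow>
    (\<Sum>M\<in>S. c M *\<^sub>C pbw_monomial z js M) \<in> lower m \<Longrightarrow> M \<in> S \<Longrightarrow> c M = (0 :: complex)"
proof (induction m arbitrary: S c M)
  case 0
  then have S: "S = {{#}}" by auto
  have "c {#} *\<^sub>C (1 :: 'g uea) = 0"
    using 0 by (simp add: S pbw_monomial_def map_replicate_const prod_list_replicate)
  then have "counit (c {#} *\<^sub>C (1 :: 'g uea)) = 0" by (simp add: clinear_0[OF clinear_counit])
  then show ?case using 0 S by (simp add: counit_hom)
next
  case (Suc m)
  have "size M = Suc m" using Suc.prems(2,4) by blast
  then have "M \<noteq> {#}" by auto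
  then obtain j where jM: "j \<in># M" by blast
  then have j: "j \<in> set js" using Suc.prems by auto
  obtain f :: "'g uea \<Rightarrow> complex" where f: "clinear f" "f 1 = 0" "f (z j) = 1" "\<And>i. i \<in> set js \<Longrightarrow> i \<noteq> j \<Longrightarrow> f (z i) = 0"
    using dual[OF j] by blast
  let ?P = "pbw_monomial z js"
  \<comment> \<open>The derivative annihilates the monomials without j, and on the others removing
    one j is injective.\<close>
  define S' where "S' = {M \<in> S. j \<in># M}"
  define c' where "c' N = c (add_mset j N) * of_nat (count (add_mset j N) j)" for N
  have lin: "contract f (\<Sum>M\<in>S. c M *\<^sub>C ?P M) = (\<Sum>M\<in>S. c M *\<^sub>C contract f (?P M))"
    using clinear_contract[OF f(1)] by (simp add: clinear_sum) (simp add: clinear_def)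
  have "contract f (\<Sum>M\<in>S. c M *\<^sub>C ?P M) \<in> lower m"
    by (rule contract_lower[OF f(1,2) Suc.prems(3)])
  moreover have "(\<Sum>M\<in>S. c M *\<^sub>C (contract f (?P M) - of_nat (count M j) *\<^sub>C ?P (M - {#j#}))) \<in> lower m"
  proof (intro lower_sum lower_scale)
    fix M assume "M \<in> S"
    then have M: "size M = Suc m" "set_mset M \<subseteq> set js" using Suc.prems(2) by blast+
    have "contract f (?P M) - of_nat (count M j) *\<^sub>C ?P (M - {#j#}) \<in> lower (size M - 1)"
      by (rule contract_pbw_monomial[where f = f and z = z and j = j and js = js and M = M, OF f(1,2) js M(2) z j f(3,4)])
    then show "contract f (?P M) - of_nat (count M j) *\<^sub>C ?P (M - {#j#}) \<in> lower m" by (simp add: M)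
  qed
  ultimately have "contract f (\<Sum>M\<in>S. c M *\<^sub>C ?P M)
      - (\<Sum>M\<in>S. c M *\<^sub>C (contract f (?P M) - of_nat (count M j) *\<^sub>C ?P (M - {#j#}))) \<in> lower m"
    by (rule lower_diff)
  then have "(\<Sum>M\<in>S. (c M * of_nat (count M j)) *\<^sub>C ?P (M - {#j#})) \<in> lower m"
    unfolding lin by (simp add: complex_vector.scale_right_diff_distrib sum_subtractf scaleC_scaleC)
  also have "(\<Sum>M\<in>S. (c M * of_nat (count M j)) *\<^sub>C ?P (M - {#j#}))
      = (\<Sum>M\<in>S'. (c M * of_nat (count M j)) *\<^sub>C ?P (M - {#j#}))"
    using Suc.prems(1) by (intro sum.mono_neutral_right) (auto simp: S'_def not_in_iff)
  also have "\<dots> = (\<Sum>N\<in>(\<lambda>M. M - {#j#}) ` S'. c' N *\<^sub>C ?P N)"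
  proof (subst sum.reindex)
    show "inj_on (\<lambda>M. M - {#j#}) S'"
      by (rule inj_onI) (metis (no_types, lifting) S'_def insert_DiffM mem_Collect_eq)
  next
    show "(\<Sum>M\<in>S'. (c M * of_nat (count M j)) *\<^sub>C ?P (M - {#j#}))
      = sum ((\<lambda>N. c' N *\<^sub>C ?P N) \<circ> (\<lambda>M. M - {#j#})) S'"
      by (rule sum.cong) (auto simp: S'_def c'_def)
  qed
  finally have "(\<Sum>N\<in>(\<lambda>M. M - {#j#}) ` S'. c' N *\<^sub>C ?P N) \<in> lower m" .
  then have "c' (M - {#j#}) = 0"
  proof (rule Suc.IH[rotated 2])
    show "finite ((\<lambda>M. M - {#j#}) ` S')" using Suc.prems(1) by (simp add: S'_def)
    show "M - {#j#} \<in> (\<lambda>M. M - {#j#}) ` S'" using Suc.prems(4) jM by (simp add: S'_def)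
    fix N assume "N \<in> (\<lambda>M. M - {#j#}) ` S'"
    then obtain M' where "M' \<in> S" "j \<in># M'" "N = M' - {#j#}" by (auto simp: S'_def)
    then show "size N = m \<and> set_mset N \<subseteq> set js"
      using Suc.prems(2)[of M'] by (auto simp: size_Diff_singleton dest: in_diffD)
  qed
  moreover have "count M j \<noteq> 0" using jM by simp
  ultimately show ?case using jM by (simp add: c'_def)
qed

subsection \<open>Independent generators of finitely generated tagged subgroups\<close>

text \<open>The tag of a tangent vector is the degree map of a curve through it. Combinations stay
  within one tag, because curves multiply to a curve when they share the degree map.\<close>

definition tagged_cover :: "nat set \<Rightarrow> (nat \<Rightarrow> 'd) \<Rightarrow> (nat \<Rightarrow> 'a::complex_vector) \<Rightarrow> ('d \<times> 'a) set \<Rightarrow> bool" where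
  "tagged_cover J ds zs Y \<longleftrightarrow> (\<forall>(\<delta>, y)\<in>Y. \<exists>b :: nat \<Rightarrow> int. (\<forall>j\<in>J. b j \<noteq> 0 \<longrightarrow> ds j = \<delta>) \<and>
     y = (\<Sum>j\<in>J. of_int (b j) *\<^sub>C zs j))"

text \<open>Relations are tested within one tag; independence across tags comes later from the
  grading.\<close>

definition tagged_independent :: "nat set \<Rightarrow> (nat \<Rightarrow> 'd) \<Rightarrow> (nat \<Rightarrow> 'a::complex_vector) \<Rightarrow> bool" where
  "tagged_independent J ds zs \<longleftrightarrow> (\<forall>b :: nat \<Rightarrow> int. (\<forall>i\<in>J. \<forall>j\<in>J. b i \<noteq> 0 \<longrightarrow> b j \<noteq> 0 \<longrightarrow> ds i = ds j) \<longrightarrow>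
     (\<Sum>j\<in>J. of_int (b j) *\<^sub>C zs j) = 0 \<longrightarrow> (\<forall>j\<in>J. b j = 0))"

text \<open>A relation between the members of a family of minimal size is shortened by the Euclidean
  algorithm until it forces one member to vanish.\<close>

lemma tagged_family_exists:
  fixes Y :: "('d \<times> 'a::complex_vector) set" and T :: "'d \<Rightarrow> 'a set"
  assumes Y: "finite Y" "\<And>\<delta> y. (\<delta>, y) \<in> Y \<Longrightarrow> y \<in> T \<delta>"
    and T: "\<And>\<delta> x y. x \<in> T \<delta> \<Longrightarrow> y \<in> T \<delta> \<Longrightarrow> x + y \<in> T \<delta>" "\<And>\<delta> x y. x \<in> T \<delta> \<Longrightarrow> y \<in> T \<delta> \<Longrightarrow> x - y \<in> T \<delta>"
  obtains J ds zs where "finite J" "\<And>j. j \<in> J \<Longrightarrow> zs j \<in> T (ds j)" "tagged_cover J ds zs Y"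
    "tagged_independent J ds zs"
proof -
  define good where "good J ds zs \<longleftrightarrow> finite J \<and> (\<forall>j\<in>J. zs j \<in> T (ds j)) \<and> tagged_cover J ds zs Y" for J ds zs
  obtain f where f: "bij_betw f {..<card Y} Y" using ex_bij_betw_nat_finite[OF Y(1)] by (auto simp: atLeast0LessThan)
  have g0: "good {..<card Y} (fst \<circ> f) (snd \<circ> f)"
    unfolding good_def tagged_cover_def
  proof (intro conjI ballI, simp, goal_cases)
    case (1 j)
    then have "f j \<in> Y" using f by (auto simp: bij_betw_def)
    then show ?case using Y(2)[of "fst (f j)" "snd (f j)"] by simp
  next
    case (2 p)
    then have "p \<in> f ` {..<card Y}" using f by (simp add: bij_betw_def)
    then obtain j where j: "j < card Y" "f j = p" by blast
    have "(\<Sum>i<card Y. of_int (if i = j then 1 else 0) *\<^sub>C (snd \<circ> f) i) = (\<Sum>i<card Y. if i = j then snd (f i) else 0)"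
      by (rule sum.cong) (auto simp: scaleC_one)
    then have eq: "(\<Sum>i<card Y. of_int (if i = j then 1 else 0) *\<^sub>C (snd \<circ> f) i) = snd p" using j by simp
    show ?case
    proof (cases p)
      case (Pair \<delta> y)
      show ?thesis unfolding Pair prod.case
        by (rule exI[of _ "\<lambda>i. if i = j then 1 else 0"]) (use eq j Pair in auto)
    qed
  qed
  define n where "n = (LEAST n. \<exists>J ds zs. good J ds zs \<and> card J = n)"
  have "\<exists>J ds zs. good J ds zs \<and> card J = n"
    unfolding n_def by (rule LeastI_ex) (use g0 in blast)
  then obtain J ds zs where J: "good J ds zs" "card J = n" by blast
  have min: "n \<le> card J'" if "good J' ds' zs'" for J' ds' zs'
    unfolding n_def by (rule Least_le) (use that in blast)
  have fin: "finite J" using J by (simp add: good_def)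
  have no_rel: "\<forall>j\<in>J. b j = 0"
    if "good J ds zs" "\<forall>i\<in>J. \<forall>j\<in>J. b i \<noteq> 0 \<longrightarrow> b j \<noteq> 0 \<longrightarrow> ds i = ds j"
      "(\<Sum>j\<in>J. of_int (b j) *\<^sub>C zs j) = 0" for zs and b :: "nat \<Rightarrow> int"
    using that
  proof (induction "\<Sum>j\<in>J. nat \<bar>b j\<bar>" arbitrary: zs b rule: less_induct)
    case less
    show ?case
    proof (rule ccontr)
      assume "\<not> (\<forall>j\<in>J. b j = 0)"
      then obtain i where i: "i \<in> J" "b i \<noteq> 0" by blast
      show False
      proof (cases "\<exists>j\<in>J. j \<noteq> i \<and> b j \<noteq> 0")
        case False
        then have "(\<Sum>j\<in>J. of_int (b j) *\<^sub>C zs j) = (\<Sum>j\<in>J. if j = i then of_int (b i) *\<^sub>C zs i else 0)"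
          by (intro sum.cong) auto
        then have "of_int (b i) *\<^sub>C zs i = 0" using less.prems(3) i fin by simp
        then have z0: "zs i = 0" using i(2) by simp
        have "good (J - {i}) ds zs"
          unfolding good_def tagged_cover_def
        proof (intro conjI ballI)
          show "finite (J - {i})" using fin by simp
          show "zs j \<in> T (ds j)" if "j \<in> J - {i}" for j using that less.prems(1) by (simp add: good_def)
          fix p assume "p \<in> Y"
          moreover obtain \<delta> y where p: "p = (\<delta>, y)" by (cases p)
          ultimately obtain b where b: "\<forall>j\<in>J. b j \<noteq> 0 \<longrightarrow> ds j = \<delta>" "y = (\<Sum>j\<in>J. of_int (b j) *\<^sub>C zs j)"
            using less.prems(1) by (auto simp: good_def tagged_cover_def)
          have "y = (\<Sum>j\<in>J - {i}. of_int (b j) *\<^sub>C zs j)"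
            unfolding b(2) using fin i z0 by (simp add: sum.remove[of J i])
          with b(1) show "case p of (\<delta>, y) \<Rightarrow> \<exists>b :: nat \<Rightarrow> int. (\<forall>j\<in>J - {i}. b j \<noteq> 0 \<longrightarrow> ds j = \<delta>) \<and>
              y = (\<Sum>j\<in>J - {i}. of_int (b j) *\<^sub>C zs j)"
            unfolding p by auto
        qed
        from min[OF this] show False using J(2) i(1) fin by (metis card_Diff1_less not_le)
      next
        case True
        then obtain i' where i': "i' \<in> J" "i' \<noteq> i" "b i' \<noteq> 0" by blast
        define p q where "p = (if \<bar>b i'\<bar> \<le> \<bar>b i\<bar> then i else i')" and "q = (if \<bar>b i'\<bar> \<le> \<bar>b i\<bar> then i' else i)"
        have pq: "p \<in> J" "q \<in> J" "p \<noteq> q" "b p \<noteq> 0" "b q \<noteq> 0" "\<bar>b q\<bar> \<le> \<bar>b p\<bar>"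
          using i i' by (auto simp: p_def q_def)
        have ds: "ds p = ds q" using less.prems(2) pq by blast
        define s where "s = sgn (b p) * sgn (b q)"
        have s: "s = 1 \<or> s = - 1" using pq by (auto simp: s_def sgn_if)
        \<comment> \<open>One Euclidean step: replacing z_q by z_q + s z_p, with s the product of
          the signs, turns the coefficient b p into b p - s * b q, which is smaller in absolute
          value, and keeps the generated group. The tags of p and q agree, as both occur in the
          relation.\<close>
        define zs' where "zs' = zs(q := zs q + of_int s *\<^sub>C zs p)"
        have shift: "(\<Sum>j\<in>J. of_int ((c(p := c p - s * c q)) j) *\<^sub>C zs' j) = (\<Sum>j\<in>J. of_int (c j) *\<^sub>C zs j)" for c
        proof -
          have J_split: "J = insert p (insert q (J - {p, q}))" using pq by auto
          have "(\<Sum>j\<in>J - {p, q}. of_int ((c(p := c p - s * c q)) j) *\<^sub>C zs' j) = (\<Sum>j\<in>J - {p, q}. of_int (c j) *\<^sub>C zs j)"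
            by (rule sum.cong) (auto simp: zs'_def)
          moreover have "(\<Sum>j\<in>J. g j) = g p + (g q + (\<Sum>j\<in>J - {p, q}. g j))" for g :: "nat \<Rightarrow> 'a"
            using fin pq(3) by (subst J_split) simp
          ultimately show ?thesis
            using pq(3) by (simp add: zs'_def scaleC_add_right complex_vector.scale_left_diff_distrib scaleC_scaleC mult.commute)
        qed
        define b' where "b' = b(p := b p - s * b q)"
        have "\<bar>b p - s * b q\<bar> < \<bar>b p\<bar>" using pq by (auto simp: s_def sgn_if abs_if split: if_splits)
        then have "(\<Sum>j\<in>J. nat \<bar>b' j\<bar>) < (\<Sum>j\<in>J. nat \<bar>b j\<bar>)"
          using fin pq(1) by (intro sum_strict_mono_ex1) (auto simp: b'_def intro!: bexI[of _ p])
        moreover have "good J ds zs'"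
          unfolding good_def tagged_cover_def
        proof (intro conjI ballI)
          show "finite J" by (rule fin)
          have Tz: "zs p \<in> T (ds q)" "zs q \<in> T (ds q)" using less.prems(1) pq ds by (auto simp: good_def)
          have "zs q + of_int s *\<^sub>C zs p \<in> T (ds q)"
            using s T(1)[OF Tz(2,1)] T(2)[OF Tz(2,1)] by (auto simp: scaleC_one complex_vector.scale_minus_left)
          then show "zs' j \<in> T (ds j)" if "j \<in> J" for j
            using that less.prems(1) by (auto simp: zs'_def good_def)
          fix r assume "r \<in> Y"
          moreover obtain \<delta> y where r: "r = (\<delta>, y)" by (cases r)
          ultimately obtain c where c: "\<forall>j\<in>J. c j \<noteq> 0 \<longrightarrow> ds j = \<delta>" "y = (\<Sum>j\<in>J. of_int (c j) *\<^sub>C zs j)"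
            using less.prems(1) by (auto simp: good_def tagged_cover_def)
          have "y = (\<Sum>j\<in>J. of_int ((c(p := c p - s * c q)) j) *\<^sub>C zs' j)" using shift c(2) by simp
          moreover have "\<forall>j\<in>J. (c(p := c p - s * c q)) j \<noteq> 0 \<longrightarrow> ds j = \<delta>"
          proof (intro ballI impI)
            fix j assume j: "j \<in> J" "(c(p := c p - s * c q)) j \<noteq> 0"
            show "ds j = \<delta>"
            proof (cases "j = p")
              case True
              then have "c p \<noteq> 0 \<or> c q \<noteq> 0" using j(2) by auto
              then show ?thesis using c(1) pq ds True by auto
            next
              case False
              then show ?thesis using j c(1) by simp
            qed
          qed
          ultimately show "case r of (\<delta>, y) \<Rightarrow> \<exists>b :: nat \<Rightarrow> int. (\<forall>j\<in>J. b j \<noteq> 0 \<longrightarrow> ds j = \<delta>) \<and>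
              y = (\<Sum>j\<in>J. of_int (b j) *\<^sub>C zs' j)"
            unfolding r prod.case by blast
        qed
        moreover have "\<forall>i\<in>J. \<forall>j\<in>J. b' i \<noteq> 0 \<longrightarrow> b' j \<noteq> 0 \<longrightarrow> ds i = ds j"
        proof -
          have "b j \<noteq> 0" if "b' j \<noteq> 0" for j using that pq by (cases "j = p") (auto simp: b'_def)
          then show ?thesis using less.prems(2) by blast
        qed
        moreover have "(\<Sum>j\<in>J. of_int (b' j) *\<^sub>C zs' j) = 0"
          unfolding b'_def shift by (rule less.prems(3))
        ultimately have "\<forall>j\<in>J. b' j = 0" by (rule less.hyps)
        then have "b' q = 0" using pq(2) by blast
        then show False using pq by (simp add: b'_def)
      qed
    qed
  qed
  have "tagged_independent J ds zs"
    unfolding tagged_independent_def using no_rel[OF J(1)] by blast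
  then show ?thesis using that J(1) by (auto simp: good_def)
qed

context graded_form
begin

definition tangents :: "nat \<Rightarrow> (nat \<Rightarrow> 'q) \<Rightarrow> 'g uea set" where
  "tangents N \<delta> = {coef D 1 | D. curve \<delta> D \<and> ibelow (Suc N) D}"

subsection \<open>Straightening\<close>

text \<open>Words of order strictly below m. For m = 0 this has to be zero, whereas m - 1 would be
  truncated to 0.\<close>

definition rem_span :: "nat \<Rightarrow> nat \<Rightarrow> 'g uea set" where
  "rem_span N m = (if m = 0 then {0} else Collect (word_span N (m - 1)))"

lemma subgrp_rem_span: "subgrp (rem_span N m)"
  by (auto simp: subgrp_def rem_span_def word_span_zero intro: word_span.diff)

lemma rem_span_word: "word_span N k u \<Longrightarrow> k < m \<Longrightarrow> u \<in> rem_span N m"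
  by (auto simp: rem_span_def elim: word_span.mono)

lemma rem_span_mult_left:
  assumes "word_span N a w" "u \<in> rem_span N m"
  shows "w * u \<in> rem_span N (a + m)"
proof (cases "m = 0")
  case True
  then show ?thesis using assms subgrp_rem_span by (auto simp: rem_span_def word_span_zero)
next
  case False
  then have "word_span N (a + (m - 1)) (w * u)" using assms by (intro word_span_mult) (auto simp: rem_span_def)
  then show ?thesis using False by (auto intro: rem_span_word)
qed

lemma rem_span_mult_right:
  assumes "u \<in> rem_span N m" "word_span N a w"
  shows "u * w \<in> rem_span N (m + a)"
proof (cases "m = 0")
  case True
  then show ?thesis using assms subgrp_rem_span by (auto simp: rem_span_def word_span_zero)
next
  case False
  then have "word_span N ((m - 1) + a) (u * w)" using assms by (intro word_span_mult) (auto simp: rem_span_def)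
  then show ?thesis using False by (auto intro: rem_span_word)
qed

lemma rem_span_commute:
  assumes D: "curve \<delta> D" "ibelow (Suc N) D" and D': "curve \<delta>' D'" "ibelow (Suc N) D'"
    and N: "(a + b) * N' \<le> N" "0 < N'"
  shows "coef D a * coef D' b - coef D' b * coef D a \<in> rem_span N' (a + b)"
proof (cases "a + b = 0")
  case True
  then show ?thesis using curve_0[OF D(1)] curve_0[OF D'(1)] by (simp add: rem_span_def)
next
  case False
  then show ?thesis using word_span_commute[OF D D' N] by (auto intro: rem_span_word)
qed

lemma rem_span_merge:
  assumes D: "curve \<delta> D" "ibelow (Suc N) D" and N: "(a + b) * N' \<le> N" "0 < N'"
  shows "coef D a * coef D b - of_nat (a + b choose a) *\<^sub>C coef D (a + b) \<in> rem_span N' (a + b)"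
proof (cases "a + b = 0")
  case True
  then show ?thesis using curve_0[OF D(1)] by (simp add: rem_span_def scaleC_one)
next
  case False
  then show ?thesis using word_span_merge[OF D N] by (auto intro: rem_span_word)
qed

lemma letters_word_span:
  assumes "\<And>j. j \<in> set js \<Longrightarrow> curve (ds j) (Z j) \<and> ibelow (Suc N) (Z j)"
  shows "word_span N (sum_list (map k js)) (prod_list (map (\<lambda>j. coef (Z j) (k j)) js))"
  using assms
proof (induction js)
  case Nil
  show ?case by (simp add: word_span.one)
next
  case (Cons j js)
  then have "curve (ds j) (Z j)" "ibelow (Suc N) (Z j)" by auto
  from word_span.step[OF this Cons.IH, of "k j"] Cons.prems show ?case by simp
qed

lemma rem_span_commute_list:
  assumes D: "curve \<delta> D" "ibelow (Suc N) D"
    and Z: "\<And>j. j \<in> set js \<Longrightarrow> curve (ds j) (Z j) \<and> ibelow (Suc N) (Z j)"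
    and N': "0 < N'" "N' \<le> N" and N: "(a + sum_list (map k js)) * N' \<le> N"
  shows "coef D a * prod_list (map (\<lambda>j. coef (Z j) (k j)) js)
    - prod_list (map (\<lambda>j. coef (Z j) (k j)) js) * coef D a \<in> rem_span N' (a + sum_list (map k js))"
  using Z N
proof (induction js)
  case Nil
  show ?case using subgrp_rem_span by (simp add: subgrp_def)
next
  case (Cons j js)
  let ?x = "coef (Z j) (k j)" and ?l = "coef D a" and ?P = "prod_list (map (\<lambda>j. coef (Z j) (k j)) js)"
  let ?s = "sum_list (map k js)"
  have Zj: "curve (ds j) (Z j)" "ibelow (Suc N) (Z j)" using Cons.prems(1)[of j] by auto
  have Z': "curve (ds i) (Z i) \<and> ibelow (Suc N') (Z i)" if "i \<in> set (j # js)" for i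
    using Cons.prems(1)[OF that] N'(2) ibelow_mono[of "Suc N" "Z i" "Suc N'"] by auto
  have le: "(a + k j) * N' \<le> N" "(a + ?s) * N' \<le> N"
    using Cons.prems(2) by (auto elim: order_trans[rotated] intro!: mult_le_mono1)
  have "(?l * ?x - ?x * ?l) * ?P \<in> rem_span N' ((a + k j) + ?s)"
    using Z' by (intro rem_span_mult_right rem_span_commute[OF D Zj le(1) N'(1)] letters_word_span[of js ds]) auto
  moreover have "?x * (?l * ?P - ?P * ?l) \<in> rem_span N' (k j + (a + ?s))"
    using Z'[of j] Cons.prems(1) le(2) by (intro rem_span_mult_left[OF word_span_letter] Cons.IH) auto
  ultimately have "(?l * ?x - ?x * ?l) * ?P + ?x * (?l * ?P - ?P * ?l) \<in> rem_span N' (a + (k j + ?s))"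
    by (intro subgrp_add[OF subgrp_rem_span]) (simp_all add: ac_simps)
  then show ?case by (simp add: algebra_simps)
qed

definition std_monomial :: "(nat \<Rightarrow> (nat, 'g uea) series) \<Rightarrow> nat list \<Rightarrow> nat multiset \<Rightarrow> 'g uea" where
  "std_monomial Z js M = prod_list (map (\<lambda>j. coef (Z j) (count M j)) js)"

text \<open>Integer coefficients appear as complex numbers with integral values, since
  \<open>monoid_algebra_lift\<close> evaluates complex combinations. The congruence is modulo words
  of smaller order.\<close>

definition std_span :: "nat \<Rightarrow> (nat \<Rightarrow> (nat, 'g uea) series) \<Rightarrow> nat list \<Rightarrow> nat \<Rightarrow> 'g uea set" where
  "std_span N Z js m = {u. \<exists>p :: nat multiset \<Rightarrow>\<^sub>0 complex.
     (\<forall>M\<in>Poly_Mapping.keys p. size M = m \<and> set_mset M \<subseteq> set js) \<and>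
     (\<forall>M. \<exists>k :: int. Poly_Mapping.lookup p M = of_int k) \<and>
     u - monoid_algebra_lift (std_monomial Z js) p \<in> rem_span N m}"

lemma rem_span_std: "u \<in> rem_span N m \<Longrightarrow> u \<in> std_span N Z js m"
  unfolding std_span_def by (intro CollectI exI[of _ 0]) (auto intro: exI[of _ 0])

lemma subgrp_std_span: "subgrp (std_span N Z js m)"
  unfolding subgrp_def
proof (intro conjI ballI)
  show "0 \<in> std_span N Z js m" using subgrp_rem_span by (intro rem_span_std) (simp add: subgrp_def)
  fix u v assume "u \<in> std_span N Z js m" "v \<in> std_span N Z js m"
  then obtain p q :: "nat multiset \<Rightarrow>\<^sub>0 complex" where
    p: "\<forall>M\<in>Poly_Mapping.keys p. size M = m \<and> set_mset M \<subseteq> set js"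
      "\<forall>M. \<exists>k :: int. Poly_Mapping.lookup p M = of_int k"
      "u - monoid_algebra_lift (std_monomial Z js) p \<in> rem_span N m"
    and q: "\<forall>M\<in>Poly_Mapping.keys q. size M = m \<and> set_mset M \<subseteq> set js"
      "\<forall>M. \<exists>k :: int. Poly_Mapping.lookup q M = of_int k"
      "v - monoid_algebra_lift (std_monomial Z js) q \<in> rem_span N m"
    unfolding std_span_def by blast
  have "\<forall>M\<in>Poly_Mapping.keys (p - q). size M = m \<and> set_mset M \<subseteq> set js"
    using p(1) q(1) keys_diff[of p q] by blast
  moreover have "\<exists>k :: int. Poly_Mapping.lookup (p - q) M = of_int k" for M
    using p(2) q(2) by (metis lookup_minus of_int_diff)
  moreover have "(u - monoid_algebra_lift (std_monomial Z js) p) - (v - monoid_algebra_lift (std_monomial Z js) q)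
      \<in> rem_span N m" by (rule subgrp_diff[OF subgrp_rem_span p(3) q(3)])
  then have "(u - v) - monoid_algebra_lift (std_monomial Z js) (p - q) \<in> rem_span N m"
    by (simp add: monoid_algebra_lift_diff algebra_simps)
  ultimately show "u - v \<in> std_span N Z js m" unfolding std_span_def by blast
qed

lemma std_monomial_std: "set_mset M \<subseteq> set js \<Longrightarrow> std_monomial Z js M \<in> std_span N Z js (size M)"
  unfolding std_span_def
  using subgrp_rem_span
  by (intro CollectI exI[of _ "Poly_Mapping.single M 1"])
    (auto simp: lookup_single when_def scaleC_one subgrp_def intro: exI[of _ 0] exI[of _ 1])

text \<open>The letter is moved to the place of Z_j and merged with the letter found there. The
  commutators and the merging error have smaller order, and merging degrees a and k gives the factor
  a + k choose a: symbols multiply as in a divided power algebra.\<close>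

lemma letter_std_monomial:
  assumes js: "distinct js" "set_mset M \<subseteq> set js" "j \<in> set js"
    and Z: "\<And>j. j \<in> set js \<Longrightarrow> curve (ds j) (Z j) \<and> ibelow (Suc N) (Z j)"
    and N': "0 < N'" "N' \<le> N" and N: "(a + size M) * N' \<le> N"
  shows "coef (Z j) a * std_monomial Z js M \<in> std_span N' Z js (a + size M)"
proof -
  obtain pre post where split: "js = pre @ j # post" using js(3) by (meson split_list)
  have nj: "j \<notin> set pre" "j \<notin> set post" using js(1) by (auto simp: split)
  let ?L = "\<lambda>M js. prod_list (map (\<lambda>j. coef (Z j) (count M j)) js)"
  let ?s = "\<lambda>js. sum_list (map (count M) js)"
  define k where "k = count M j"
  have size: "size M = ?s pre + (k + ?s post)"
    using size_eq_sum_list[OF js(1,2)] by (simp add: split k_def)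
  have Zj: "curve (ds j) (Z j)" "ibelow (Suc N) (Z j)" using Z[OF js(3)] by auto
  have Z': "curve (ds i) (Z i) \<and> ibelow (Suc N') (Z i)" if "i \<in> set js" for i
    using Z[OF that] N'(2) ibelow_mono[of "Suc N" "Z i" "Suc N'"] by auto
  have le: "(a + ?s pre) * N' \<le> N" "(a + k) * N' \<le> N"
    using N by (auto simp: size elim: order_trans[rotated] intro!: mult_le_mono1)
  have wpost: "word_span N' (?s post) (?L M post)" and wpre: "word_span N' (?s pre) (?L M pre)"
    using Z' by (auto intro!: letters_word_span[of _ ds] simp: split)
  have wk: "word_span N' k (coef (Z j) k)" using Z'[OF js(3)] by (auto intro: word_span_letter)
  have 1: "(coef (Z j) a * ?L M pre - ?L M pre * coef (Z j) a) * (coef (Z j) k * ?L M post)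
      \<in> rem_span N' ((a + ?s pre) + (k + ?s post))"
    using Z by (intro rem_span_mult_right rem_span_commute_list[OF Zj _ N' le(1)] word_span_mult wk wpost) (auto simp: split)
  have 2: "?L M pre * ((coef (Z j) a * coef (Z j) k - of_nat (a + k choose a) *\<^sub>C coef (Z j) (a + k)) * ?L M post)
      \<in> rem_span N' (?s pre + ((a + k) + ?s post))"
    by (intro rem_span_mult_left[OF wpre] rem_span_mult_right[OF _ wpost] rem_span_merge[OF Zj le(2) N'(1)])
  let ?M = "M + replicate_mset a j"
  have same: "?L ?M js' = ?L M js'" if "j \<notin> set js'" for js'
    using that by (intro arg_cong[of _ _ prod_list] map_cong) auto
  have new: "std_monomial Z js ?M = ?L M pre * (coef (Z j) (a + k) * ?L M post)"
    using same[OF nj(1)] same[OF nj(2)]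
    by (simp add: std_monomial_def split k_def add.commute)
  have old: "std_monomial Z js M = ?L M pre * (coef (Z j) k * ?L M post)"
    by (simp add: std_monomial_def split k_def)
  have "coef (Z j) a * std_monomial Z js M - of_nat (a + k choose a) *\<^sub>C std_monomial Z js ?M
      = (coef (Z j) a * ?L M pre - ?L M pre * coef (Z j) a) * (coef (Z j) k * ?L M post)
        + ?L M pre * ((coef (Z j) a * coef (Z j) k - of_nat (a + k choose a) *\<^sub>C coef (Z j) (a + k)) * ?L M post)"
    unfolding old new
    by (simp add: left_diff_distrib right_diff_distrib mult.assoc mult_scaleC_left mult_scaleC_right)
  moreover have "\<dots> \<in> rem_span N' (a + size M)"
    using 1 2 by (intro subgrp_add[OF subgrp_rem_span]) (simp_all add: size ac_simps)
  ultimately have "coef (Z j) a * std_monomial Z js M - of_nat (a + k choose a) *\<^sub>C std_monomial Z js ?M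
      \<in> std_span N' Z js (a + size M)" by (simp add: rem_span_std)
  moreover have "of_nat (a + k choose a) *\<^sub>C std_monomial Z js ?M \<in> std_span N' Z js (a + size M)"
  proof -
    have "size ?M = a + size M" by simp
    moreover have "set_mset ?M \<subseteq> set js" using js(2,3) by (auto split: if_splits)
    ultimately show ?thesis by (metis subgrp_of_nat subgrp_std_span std_monomial_std)
  qed
  ultimately have "(coef (Z j) a * std_monomial Z js M - of_nat (a + k choose a) *\<^sub>C std_monomial Z js ?M)
      + of_nat (a + k choose a) *\<^sub>C std_monomial Z js ?M \<in> std_span N' Z js (a + size M)"
    by (rule subgrp_add[OF subgrp_std_span])
  then show ?thesis by simp
qed

context
  fixes js :: "nat list" and ds :: "nat \<Rightarrow> nat \<Rightarrow> 'q" and Z N N'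
  assumes js: "distinct js"
    and Z: "\<And>j. j \<in> set js \<Longrightarrow> curve (ds j) (Z j) \<and> ibelow (Suc N) (Z j)"
    and N': "0 < N'" "N' \<le> N"
begin

lemma letter_std_span:
  assumes j: "j \<in> set js" and u: "u \<in> std_span N' Z js m" and N: "(a + m) * N' \<le> N"
  shows "coef (Z j) a * u \<in> std_span N' Z js (a + m)"
proof -
  obtain p :: "nat multiset \<Rightarrow>\<^sub>0 complex" where
    p: "\<forall>M\<in>Poly_Mapping.keys p. size M = m \<and> set_mset M \<subseteq> set js"
      "\<forall>M. \<exists>k :: int. Poly_Mapping.lookup p M = of_int k"
    and r: "u - monoid_algebra_lift (std_monomial Z js) p \<in> rem_span N' m"
    using u unfolding std_span_def by blast
  have "word_span N' a (coef (Z j) a)"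
    using Z[OF j] N' ibelow_mono[of "Suc N" "Z j" "Suc N'"] by (auto intro: word_span_letter)
  then have "coef (Z j) a * (u - monoid_algebra_lift (std_monomial Z js) p) \<in> std_span N' Z js (a + m)"
    by (intro rem_span_std rem_span_mult_left r)
  moreover have "(\<Sum>M\<in>Poly_Mapping.keys p. Poly_Mapping.lookup p M *\<^sub>C (coef (Z j) a * std_monomial Z js M)) \<in> std_span N' Z js (a + m)"
  proof (rule subgrp_sum[OF subgrp_std_span])
    fix M assume M: "M \<in> Poly_Mapping.keys p"
    obtain k :: int where k: "Poly_Mapping.lookup p M = of_int k" using p(2) by blast
    have "coef (Z j) a * std_monomial Z js M \<in> std_span N' Z js (a + size M)"
      using p(1) M N by (intro letter_std_monomial[OF js _ j Z N']) auto
    then show "Poly_Mapping.lookup p M *\<^sub>C (coef (Z j) a * std_monomial Z js M) \<in> std_span N' Z js (a + m)"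
      unfolding k using p(1) M by (intro subgrp_of_int[OF subgrp_std_span]) auto
  qed
  then have "coef (Z j) a * monoid_algebra_lift (std_monomial Z js) p \<in> std_span N' Z js (a + m)"
    by (simp add: monoid_algebra_lift_def sum_distrib_left mult_scaleC_right)
  ultimately have "coef (Z j) a * (u - monoid_algebra_lift (std_monomial Z js) p)
      + coef (Z j) a * monoid_algebra_lift (std_monomial Z js) p \<in> std_span N' Z js (a + m)"
    by (rule subgrp_add[OF subgrp_std_span])
  then show ?thesis by (simp flip: distrib_left)
qed

text \<open>The product of the series Z_j (b_j t) is the curve built from the family whose tangent
  vector is the combination of the z_j with coefficients b_j. Its coefficients expand into integer
  combinations of letters of the family.\<close>

lemma scaled_product_std_span:
  fixes b :: "nat \<Rightarrow> int"
  assumes "set is \<subseteq> set js" "u \<in> std_span N' Z js m" "(n + m) * N' \<le> N"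
  shows "coef (prod_list (map (\<lambda>j. scal (of_int (b j)) (Z j)) is)) n * u \<in> std_span N' Z js (n + m)"
  using assms(1,3)
proof (induction "is" arbitrary: n)
  case Nil
  then show ?case using assms(2) subgrp_std_span by (auto simp: coef_one subgrp_def)
next
  case (Cons i "is")
  let ?F = "prod_list (map (\<lambda>j. scal (of_int (b j)) (Z j)) is)"
  have "(\<Sum>k\<le>n. of_int (b i ^ k) *\<^sub>C (coef (Z i) k * (coef ?F (n - k) * u))) \<in> std_span N' Z js (n + m)"
  proof (intro subgrp_sum[OF subgrp_std_span] subgrp_of_int[OF subgrp_std_span])
    fix k assume k: "k \<in> {..n}"
    have "((n - k) + m) * N' \<le> (n + m) * N'" by (intro mult_le_mono1) simp
    then have "((n - k) + m) * N' \<le> N" using Cons.prems(2) by (rule order_trans)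
    then have "coef ?F (n - k) * u \<in> std_span N' Z js ((n - k) + m)"
      using Cons.prems(1) by (intro Cons.IH) auto
    then have "coef (Z i) k * (coef ?F (n - k) * u) \<in> std_span N' Z js (k + ((n - k) + m))"
      using Cons.prems k by (intro letter_std_span) auto
    moreover have "k + ((n - k) + m) = n + m" using k by simp
    ultimately show "coef (Z i) k * (coef ?F (n - k) * u) \<in> std_span N' Z js (n + m)" by (simp only:)
  qed
  then show ?case
    by (simp add: coef_mult sum_decomp_nat coef_scal sum_distrib_right mult_scaleC_left mult.assoc)
qed

text \<open>D is compared with the product F of the Z_j (b_j t), which has the same tangent vector.
  Their quotient starts in degree 2, so by \<open>word_span_leading\<close> the coefficients of D
  and F differ by words of smaller order.\<close>

lemma curve_std_span:
  fixes b :: "nat \<Rightarrow> int"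
  assumes D: "curve \<delta> D" "ibelow (Suc N) D"
    and b: "\<And>j. j \<in> set js \<Longrightarrow> b j \<noteq> 0 \<Longrightarrow> ds j = \<delta>" "coef D 1 = (\<Sum>j\<in>set js. of_int (b j) *\<^sub>C coef (Z j) 1)"
    and u: "u \<in> std_span N' Z js m" "word_span N' m u" and N: "(n + m) * N' \<le> N"
  shows "coef D n * u \<in> std_span N' Z js (n + m)"
proof -
  let ?F = "\<lambda>is. prod_list (map (\<lambda>j. scal (of_int (b j)) (Z j)) is)"
  have \<delta>: "monoid_hom \<delta>" using D by (simp add: curve_def)
  have sc: "curve \<delta> (scal (of_int (b j)) (Z j)) \<and> ibelow (Suc N) (scal (of_int (b j)) (Z j))" if j: "j \<in> set js" for j
  proof (cases "b j = 0")
    case True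
    \<comment> \<open>The tag of j may differ from \<delta> here, but the trivial series is a curve
      for every degree map.\<close>
    have "scal (of_int (b j)) (Z j) = 1"
    proof (rule series_eqI)
      fix w show "coef (scal (of_int (b j)) (Z j)) w = coef 1 w"
        using Z[OF j] True by (cases w) (auto simp: coef_scal coef_one curve_0 scaleC_one)
    qed
    then show ?thesis using curve_one[OF \<delta>] U_one U_zero by (auto simp: ibelow_def coef_one)
  next
    case False
    then have "curve \<delta> (Z j)" using Z[OF j] b(1)[OF j] by auto
    moreover have "ibelow (Suc N) (scal (of_int (b j)) (Z j))"
      using Z[OF j] U_of_int[of _ "b j ^ _"] by (auto simp: ibelow_def coef_scal)
    ultimately show ?thesis by (auto intro: curve_scal)
  qed
  have F: "curve \<delta> (?F is) \<and> ibelow (Suc N) (?F is) \<and> coef (?F is) 1 = sum_list (map (\<lambda>j. of_int (b j) *\<^sub>C coef (Z j) 1) is)"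
    if "set is \<subseteq> set js" for "is"
    using that
  proof (induction "is")
    case Nil
    show ?case using curve_one[OF \<delta>] U_one U_zero by (auto simp: ibelow_def coef_one)
  next
    case (Cons i "is")
    have IH: "curve \<delta> (?F is)" "ibelow (Suc N) (?F is)"
      "coef (?F is) 1 = sum_list (map (\<lambda>j. of_int (b j) *\<^sub>C coef (Z j) 1) is)" using Cons by auto
    have i: "curve \<delta> (scal (of_int (b i)) (Z i))" "ibelow (Suc N) (scal (of_int (b i)) (Z i))"
      using sc Cons.prems by auto
    have "coef (?F (i # is)) 1 = coef (scal (of_int (b i)) (Z i)) 1 + coef (?F is) 1"
      using coef_mult_1[OF curve_0[OF i(1)] curve_0[OF IH(1)]] by simp
    then show ?case
      using curve_mult[OF i(1) IH(1)] ibelow_mult[OF i(2) IH(2)] IH(3) by (simp add: coef_scal)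
  qed
  have Fjs: "curve \<delta> (?F js)" "ibelow (Suc N) (?F js)" "coef (?F js) 1 = coef D 1"
    using F[of js] b(2) js by (simp_all add: sum_list_distinct_conv_sum_set)
  obtain X where X: "D = ?F js * X" "curve \<delta> X" using curve_div[OF D(1) Fjs(1)] .
  have iX: "ibelow (Suc N) X" using ibelow_quot[OF curve_0[OF Fjs(1)] Fjs(2)] D(2) X(1) by simp
  have X1: "coef X 1 = 0"
    using coef_mult_1[OF curve_0[OF Fjs(1)] curve_0[OF X(2)]] Fjs(3) X(1) by simp
  have nN: "n * N' \<le> N" using N by (metis le_add1 le_trans mult_le_mono1)
  have "coef D n - coef (?F js) n = (\<Sum>i<n. coef (?F js) i * coef X (n - i))"
    unfolding X(1) coef_mult sum_decomp_nat using curve_0[OF X(2)] by (simp flip: lessThan_Suc_atMost add: X(1)[symmetric])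
  also have "\<dots> \<in> rem_span N' n"
  proof (rule subgrp_sum[OF subgrp_rem_span])
    fix i assume i: "i \<in> {..<n}"
    have "word_span N' ((n - i) div 2) (coef X (n - i))"
      by (rule word_span_leading[OF nN N'(1) _ X(2) iX]) (use X1 in \<open>auto simp: less_2_cases_iff\<close>)
    then have "word_span N' (i + (n - i) div 2) (coef (?F js) i * coef X (n - i))"
      using Fjs N' by (intro word_span.step[OF Fjs(1) ibelow_mono[OF Fjs(2)]]) auto
    moreover have "i + (n - i) div 2 < n" using i by auto
    ultimately show "coef (?F js) i * coef X (n - i) \<in> rem_span N' n" by (rule rem_span_word)
  qed
  finally have "(coef D n - coef (?F js) n) * u \<in> std_span N' Z js (n + m)"
    by (intro rem_span_std rem_span_mult_right u)
  then have "(coef D n - coef (?F js) n) * u + coef (?F js) n * u \<in> std_span N' Z js (n + m)"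
    by (rule subgrp_add[OF subgrp_std_span _ scaled_product_std_span[OF order_refl u(1) N]])
  then show ?thesis by (simp flip: distrib_right)
qed

end

text \<open>The finite set Y of tagged tangent vectors of the letters is fixed before the family,
  since a family can be chosen only when all letters to be covered are known. For any family
  covering Y, the word is then absorbed letter by letter from the right.\<close>

lemma straighten:
  assumes "word_span N m u" "m * N' \<le> N" "0 < N'"
  shows "\<exists>Y. finite Y \<and> (\<forall>(\<delta>, y)\<in>Y. y \<in> tangents N \<delta>) \<and>
    (\<forall>js ds Z. distinct js \<longrightarrow> (\<forall>j\<in>set js. curve (ds j) (Z j) \<and> ibelow (Suc N) (Z j)) \<longrightarrow>
       tagged_cover (set js) ds (\<lambda>j. coef (Z j) 1) Y \<longrightarrow> u \<in> std_span N' Z js m)"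
  using assms
proof (induction rule: word_span.induct)
  case (one m)
  have "1 \<in> std_span N' Z js m" if "\<forall>j\<in>set js. curve (ds j) (Z j) \<and> ibelow (Suc N) (Z j)"
    for js and ds :: "nat \<Rightarrow> nat \<Rightarrow> 'q" and Z
  proof (cases "m = 0")
    case True
    have "std_monomial Z js {#} = 1"
      unfolding std_monomial_def using that by (induction js) (auto simp: curve_0)
    then show ?thesis using std_monomial_std[of "{#}" js Z N'] True by simp
  next
    case False
    then show ?thesis by (intro rem_span_std rem_span_word[OF word_span.one[of N' 0]]) simp
  qed
  then show ?case by (intro exI[of _ "{}"]) auto
next
  case (diff m u v)
  then obtain Y1 Y2 where
    Y1: "finite Y1" "\<forall>(\<delta>, y)\<in>Y1. y \<in> tangents N \<delta>"
      "\<And>js ds Z. distinct js \<Longrightarrow> (\<forall>j\<in>set js. curve (ds j) (Z j) \<and> ibelow (Suc N) (Z j)) \<Longrightarrow>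
       tagged_cover (set js) ds (\<lambda>j. coef (Z j) 1) Y1 \<Longrightarrow> u \<in> std_span N' Z js m"
    and Y2: "finite Y2" "\<forall>(\<delta>, y)\<in>Y2. y \<in> tangents N \<delta>"
      "\<And>js ds Z. distinct js \<Longrightarrow> (\<forall>j\<in>set js. curve (ds j) (Z j) \<and> ibelow (Suc N) (Z j)) \<Longrightarrow>
       tagged_cover (set js) ds (\<lambda>j. coef (Z j) 1) Y2 \<Longrightarrow> v \<in> std_span N' Z js m"
    by blast
  show ?case
  proof (intro exI[of _ "Y1 \<union> Y2"] conjI allI impI)
    fix js and ds :: "nat \<Rightarrow> nat \<Rightarrow> 'q" and Z
    assume *: "distinct js" "\<forall>j\<in>set js. curve (ds j) (Z j) \<and> ibelow (Suc N) (Z j)"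
      "tagged_cover (set js) ds (\<lambda>j. coef (Z j) 1) (Y1 \<union> Y2)"
    then have "tagged_cover (set js) ds (\<lambda>j. coef (Z j) 1) Y1" "tagged_cover (set js) ds (\<lambda>j. coef (Z j) 1) Y2"
      by (auto simp: tagged_cover_def)
    with * show "u - v \<in> std_span N' Z js m" by (intro subgrp_diff[OF subgrp_std_span] Y1(3) Y2(3))
  qed (use Y1 Y2 in auto)
next
  case (mono m u m')
  have "m * N' \<le> N" using mono.hyps(2) mono.prems(1) by (meson le_trans mult_le_mono1)
  show ?case
  proof (cases "m = m'")
    case True
    then show ?thesis using mono by blast
  next
    case False
    then have "0 < m'" using mono.hyps(2) by simp
    then have "N' \<le> m' * N'" by simp
    then have "N' \<le> N" using mono.prems(1) by linarith
    \<comment> \<open>A word that is shorter than its bound already belongs to the remainder, and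
      there is nothing to straighten.\<close>
    then have "u \<in> rem_span N' m'"
      using False mono.hyps by (intro rem_span_word[OF word_span_antimono]) auto
    then show ?thesis by (intro exI[of _ "{}"]) (auto intro: rem_span_std)
  qed
next
  case (step \<delta> D m u n)
  have mN: "m * N' \<le> N" using step.prems(1) by (metis le_add2 le_trans mult_le_mono1)
  obtain Y where Y: "finite Y" "\<forall>(\<delta>, y)\<in>Y. y \<in> tangents N \<delta>"
      "\<And>js ds Z. distinct js \<Longrightarrow> (\<forall>j\<in>set js. curve (ds j) (Z j) \<and> ibelow (Suc N) (Z j)) \<Longrightarrow>
       tagged_cover (set js) ds (\<lambda>j. coef (Z j) 1) Y \<Longrightarrow> u \<in> std_span N' Z js m"
    using step.IH[OF mN step.prems(2)] by blast
  show ?case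
  proof (intro exI[of _ "insert (\<delta>, coef D 1) Y"] conjI allI impI)
    show "\<forall>(\<delta>, y)\<in>insert (\<delta>, coef D 1) Y. y \<in> tangents N \<delta>"
      using Y(2) step.hyps(1,2) by (auto simp: tangents_def)
    fix js and ds :: "nat \<Rightarrow> nat \<Rightarrow> 'q" and Z
    assume *: "distinct js" "\<forall>j\<in>set js. curve (ds j) (Z j) \<and> ibelow (Suc N) (Z j)"
      "tagged_cover (set js) ds (\<lambda>j. coef (Z j) 1) (insert (\<delta>, coef D 1) Y)"
    then have u: "u \<in> std_span N' Z js m" by (intro Y(3)) (auto simp: tagged_cover_def)
    obtain b :: "nat \<Rightarrow> int" where b: "\<forall>j\<in>set js. b j \<noteq> 0 \<longrightarrow> ds j = \<delta>"
      "coef D 1 = (\<Sum>j\<in>set js. of_int (b j) *\<^sub>C coef (Z j) 1)"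
      using *(3) by (auto simp: tagged_cover_def)
    show "coef D n * u \<in> std_span N' Z js (n + m)"
    proof (cases "n + m = 0")
      case True
      then show ?thesis using u curve_0[OF step.hyps(1)] by simp
    next
      case False
      then have "1 \<le> n + m" by linarith
      then have "1 * N' \<le> (n + m) * N'" by (rule mult_le_mono1)
      then have N'N: "N' \<le> N" using step.prems(1) by linarith
      have "word_span N' m u" by (rule word_span_antimono[OF step.hyps(3) N'N])
      then show ?thesis
        using * b by (intro curve_std_span[where ds = ds and b = b, OF _ _ step.prems(2) N'N step.hyps(1,2) _ _ u _ step.prems(1)]) auto
    qed
  qed (use Y in auto)
qed

text \<open>In degree k a curve has the symbol z^k / k!, so c is a product of inverse factorials;
  what matters is that it is nonzero.\<close>

lemma std_monomial_symbol:
  assumes Z: "\<And>j. j \<in> set js \<Longrightarrow> grouplike (Z j)"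
  shows "\<exists>c. c \<noteq> 0 \<and> prod_list (map (\<lambda>j. coef (Z j) (k j)) js)
     - c *\<^sub>C prod_list (map (\<lambda>j. coef (Z j) 1 ^ k j) js) \<in> lower (sum_list (map k js))"
  using assms
proof (induction js)
  case Nil
  show ?case by (intro exI[of _ 1]) (simp add: scaleC_one)
next
  case (Cons j js)
  let ?P = "prod_list (map (\<lambda>j. coef (Z j) (k j)) js)" and ?Q = "prod_list (map (\<lambda>j. coef (Z j) 1 ^ k j) js)"
  let ?s = "sum_list (map k js)"
  obtain c where c: "c \<noteq> 0" "?P - c *\<^sub>C ?Q \<in> lower ?s" using Cons by auto
  have g: "grouplike (Z j)" using Cons.prems by simp
  have P: "?P \<in> lower (Suc ?s)"
  proof -
    have "prod_list (map (\<lambda>j. coef (Z j) (k j)) js') \<in> lower (Suc (sum_list (map k js')))" if "set js' \<subseteq> set js" for js'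
      using that
    proof (induction js')
      case Nil
      show ?case by (simp add: lower_one)
    next
      case (Cons i js')
      then have "grouplike (Z i)" using \<open>\<And>i. i \<in> set (j # js) \<Longrightarrow> grouplike (Z i)\<close> by simp
      from lower_mult_right[OF grouplike_lower[OF this] Cons.IH, of "k i"] Cons.prems show ?case by simp
    qed
    then show ?thesis by blast
  qed
  let ?z = "(1 / fact (k j)) *\<^sub>C coef (Z j) 1 ^ k j"
  have "(coef (Z j) (k j) - ?z) * ?P \<in> lower (k j + ?s)"
    by (rule lower_mult_left[OF grouplike_symbol[OF g] P])
  moreover have "?z * (?P - c *\<^sub>C ?Q) \<in> lower (k j + ?s)"
    using coef_exp_series_lower[of "coef (Z j) 1" "k j"] grouplike_leading[OF g, of 1] c(2)
    by (intro lower_mult_right) (auto simp: coef_exp_series)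
  ultimately have "(coef (Z j) (k j) - ?z) * ?P + ?z * (?P - c *\<^sub>C ?Q) \<in> lower (k j + ?s)" by (rule lower_add)
  then have "coef (Z j) (k j) * ?P - (c / fact (k j)) *\<^sub>C (coef (Z j) 1 ^ k j * ?Q) \<in> lower (k j + ?s)"
    by (simp add: algebra_simps mult_scaleC_left mult_scaleC_right scaleC_scaleC)
  then show ?case using c(1) by (intro exI[of _ "c / fact (k j)"]) simp
qed

end

text \<open>Three properties of the integral form beyond those of a graded ring. Independence over
  the integers of homogeneous integral primitive elements is witnessed by complex linear
  functionals; an integral element of one degree equals the part of that degree in any decomposition
  into homogeneous integral elements; and the order m of an element as a word does not depend on the
  precision, so that N can be chosen after m.\<close>

locale separated_graded_form = graded_form Ag U
  for Ag :: "'q::comm_monoid_add \<Rightarrow> 'g::complex_lie_algebra uea set" and U :: "'g uea set" +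
  assumes dual_functional:
    "finite J \<Longrightarrow> (\<And>j. j \<in> J \<Longrightarrow> zs j \<in> U \<and> zs j \<in> Ag (\<beta> j) \<and> primitive (zs j)) \<Longrightarrow>
     tagged_independent J \<beta> zs \<Longrightarrow> j0 \<in> J \<Longrightarrow>
     \<exists>f :: 'g uea \<Rightarrow> complex. clinear f \<and> f 1 = 0 \<and> f (zs j0) = 1 \<and> (\<forall>i\<in>J. i \<noteq> j0 \<longrightarrow> f (zs i) = 0)"
    and degree_separation:
    "finite I \<Longrightarrow> x \<in> U \<Longrightarrow> x \<in> Ag \<alpha> \<Longrightarrow> (\<And>i. i \<in> I \<Longrightarrow> y i \<in> U \<and> y i \<in> Ag (\<beta> i)) \<Longrightarrow>
     x = (\<Sum>i\<in>I. y i) \<Longrightarrow> x = (\<Sum>i | i \<in> I \<and> \<beta> i = \<alpha>. y i)"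
    and U_words: "u \<in> U \<Longrightarrow> \<exists>m. \<forall>N. word_span N m u"
begin

lemma subgrp_tangents:
  assumes "monoid_hom \<delta>"
  shows "subgrp (tangents N \<delta>)"
  unfolding subgrp_def
proof (intro conjI ballI)
  show "0 \<in> tangents N \<delta>"
    using curve_one[OF assms] U_one U_zero
    by (auto simp: tangents_def ibelow_def coef_one intro!: exI[of _ 1])
  fix x y assume "x \<in> tangents N \<delta>" "y \<in> tangents N \<delta>"
  then obtain D D' where D: "curve \<delta> D" "ibelow (Suc N) D" "x = coef D 1"
    and D': "curve \<delta> D'" "ibelow (Suc N) D'" "y = coef D' 1"
    by (auto simp: tangents_def)
  obtain X where X: "D = D' * X" "curve \<delta> X" using curve_div[OF D(1) D'(1)] .
  have "ibelow (Suc N) X" using ibelow_quot[OF curve_0[OF D'(1)] D'(2)] D(2) X(1) by simp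
  moreover have "x - y = coef X 1"
    using coef_mult_1[OF curve_0[OF D'(1)] curve_0[OF X(2)]] D(3) D'(3) X(1) by simp
  ultimately show "x - y \<in> tangents N \<delta>" using X(2) by (auto simp: tangents_def)
qed

lemma tangents_hom: "x \<in> tangents N \<delta> \<Longrightarrow> monoid_hom \<delta>"
  by (auto simp: tangents_def curve_def)

lemma tangents_props: "0 < N \<Longrightarrow> x \<in> tangents N \<delta> \<Longrightarrow> x \<in> U \<and> x \<in> Ag (\<delta> 1) \<and> primitive x"
  by (auto simp: tangents_def ibelow_def curve_Ag intro!: curve_leading)

text \<open>The symbols of the words of order \<open>m\<close> form a divided power algebra over an independent family of
  tangent vectors; so a combination of such words whose symbol vanishes reduces to shorter words.\<close>

lemma word_span_descent:
  assumes u: "word_span N m u" "u \<in> lower m" and m: "0 < m" and N: "m * N' \<le> N" "0 < N'"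
  shows "word_span N' (m - 1) u"
proof -
  have "1 * N' \<le> m * N'" using m by (intro mult_le_mono1) linarith
  then have N0: "0 < N" using N by linarith
  obtain Y where Y: "finite Y" "\<forall>(\<delta>, y)\<in>Y. y \<in> tangents N \<delta>"
    and Yu: "\<And>js ds Z. distinct js \<Longrightarrow> (\<forall>j\<in>set js. curve (ds j) (Z j) \<and> ibelow (Suc N) (Z j)) \<Longrightarrow>
       tagged_cover (set js) ds (\<lambda>j. coef (Z j) 1) Y \<Longrightarrow> u \<in> std_span N' Z js m"
    using straighten[OF u(1) N] by blast
  have YT: "y \<in> tangents N \<delta>" if "(\<delta>, y) \<in> Y" for \<delta> y using Y(2) that by blast
  have YA: "x + y \<in> tangents N \<delta>" "x - y \<in> tangents N \<delta>"
    if "x \<in> tangents N \<delta>" "y \<in> tangents N \<delta>" for \<delta> x y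
    using subgrp_add[OF subgrp_tangents[OF tangents_hom[OF that(1)]] that]
      subgrp_diff[OF subgrp_tangents[OF tangents_hom[OF that(1)]] that] .
  obtain J ds zs where J: "finite J" "\<And>j. j \<in> J \<Longrightarrow> zs j \<in> tangents N (ds j)" "tagged_cover J ds zs Y"
    "tagged_independent J ds zs"
    by (rule tagged_family_exists[OF Y(1) YT YA]) blast+
  have "\<forall>j\<in>J. \<exists>D. curve (ds j) D \<and> ibelow (Suc N) D \<and> coef D 1 = zs j"
    using J(2) by (fastforce simp: tangents_def)
  then obtain Z where Z: "\<And>j. j \<in> J \<Longrightarrow> curve (ds j) (Z j) \<and> ibelow (Suc N) (Z j) \<and> coef (Z j) 1 = zs j"
    by metis
  define js where "js = sorted_list_of_set J"
  have js: "distinct js" "set js = J" using J(1) by (simp_all add: js_def)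
  have "tagged_cover (set js) ds (\<lambda>j. coef (Z j) 1) Y"
    using J(3) Z unfolding tagged_cover_def js(2) by (simp cong: sum.cong)
  then have "u \<in> std_span N' Z js m" using js Z by (intro Yu) auto
  then obtain p :: "nat multiset \<Rightarrow>\<^sub>0 complex" where
    p: "\<And>M. M \<in> Poly_Mapping.keys p \<Longrightarrow> size M = m \<and> set_mset M \<subseteq> set js"
    and r: "u - monoid_algebra_lift (std_monomial Z js) p \<in> rem_span N' m"
    unfolding std_span_def by blast
  have w: "word_span N' (m - 1) (u - monoid_algebra_lift (std_monomial Z js) p)"
    using r m by (simp add: rem_span_def)
  have "u - monoid_algebra_lift (std_monomial Z js) p \<in> lower m"
    using word_span_lower[OF w] m by simp
  then have "u - (u - monoid_algebra_lift (std_monomial Z js) p) \<in> lower m"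
    by (rule lower_diff[OF u(2)])
  then have low: "(\<Sum>M\<in>Poly_Mapping.keys p. Poly_Mapping.lookup p M *\<^sub>C std_monomial Z js M) \<in> lower m"
    by (simp add: monoid_algebra_lift_def)
  have "\<forall>M\<in>Poly_Mapping.keys p. \<exists>c. c \<noteq> 0 \<and> std_monomial Z js M - c *\<^sub>C pbw_monomial zs js M \<in> lower m"
  proof
    fix M assume M: "M \<in> Poly_Mapping.keys p"
    have "grouplike (Z j)" if "j \<in> set js" for j using Z that js by (simp add: curve_def)
    from std_monomial_symbol[of js Z "count M", OF this]
    obtain c where c: "c \<noteq> 0" "std_monomial Z js M - c *\<^sub>C prod_list (map (\<lambda>j. coef (Z j) 1 ^ count M j) js)
        \<in> lower (sum_list (map (count M) js))"
      unfolding std_monomial_def by blast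
    have eq: "prod_list (map (\<lambda>j. coef (Z j) 1 ^ count M j) js) = pbw_monomial zs js M"
      unfolding pbw_monomial_def using Z js by (intro arg_cong[of _ _ prod_list] map_cong) auto
    have "sum_list (map (count M) js) = m"
      using size_eq_sum_list[OF js(1), of M] p[OF M] by simp
    with c show "\<exists>c. c \<noteq> 0 \<and> std_monomial Z js M - c *\<^sub>C pbw_monomial zs js M \<in> lower m"
      unfolding eq by metis
  qed
  then obtain c where c: "\<And>M. M \<in> Poly_Mapping.keys p \<Longrightarrow> c M \<noteq> 0"
    "\<And>M. M \<in> Poly_Mapping.keys p \<Longrightarrow> std_monomial Z js M - c M *\<^sub>C pbw_monomial zs js M \<in> lower m"
    by metis
  have "(\<Sum>M\<in>Poly_Mapping.keys p. Poly_Mapping.lookup p M *\<^sub>C std_monomial Z js M)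
      - (\<Sum>M\<in>Poly_Mapping.keys p. Poly_Mapping.lookup p M *\<^sub>C (std_monomial Z js M - c M *\<^sub>C pbw_monomial zs js M)) \<in> lower m"
    by (intro lower_diff low lower_sum lower_scale c(2))
  then have pl: "(\<Sum>M\<in>Poly_Mapping.keys p. (Poly_Mapping.lookup p M * c M) *\<^sub>C pbw_monomial zs js M) \<in> lower m"
    by (simp add: complex_vector.scale_right_diff_distrib sum_subtractf scaleC_scaleC)
  have props: "zs j \<in> U \<and> zs j \<in> Ag (ds j 1) \<and> primitive (zs j)" if "j \<in> J" for j
    using tangents_props[OF N0 J(2)[OF that]] .
  \<comment> \<open>Degree maps are homomorphisms on the natural numbers and are determined by their
    value at 1, so independence by tags is independence by degrees.\<close>
  have "ds i = ds j" if "i \<in> J" "j \<in> J" "ds i 1 = ds j 1" for i j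
    using that J(2) tangents_hom by (intro monoid_hom_nat_eqI) auto
  then have "tagged_independent J (\<lambda>j. ds j 1) zs"
    using J(4) unfolding tagged_independent_def by metis
  from dual_functional[OF J(1) props this]
  have dual: "\<exists>f :: 'g uea \<Rightarrow> complex. clinear f \<and> f 1 = 0 \<and> f (zs j) = 1 \<and> (\<forall>i\<in>set js. i \<noteq> j \<longrightarrow> f (zs i) = 0)"
    if "j \<in> set js" for j using that js by simp
  have "Poly_Mapping.lookup p M * c M = 0" if "M \<in> Poly_Mapping.keys p" for M
    by (rule pbw_independent[OF js(1) _ dual _ p pl that]) (use props js in auto)
  then have "M \<notin> Poly_Mapping.keys p" for M
    using c(1)[of M] by (cases "M \<in> Poly_Mapping.keys p") (auto simp: in_keys_iff)
  then have "Poly_Mapping.keys p = {}" by blast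
  then show ?thesis using w by (simp add: monoid_algebra_lift_def)
qed

text \<open>Tangent vectors of different degrees cannot be combined into one, hence the list of
  tagged vectors. It is empty for m = 0, so that multiplication by a letter of degree 1 keeps the
  form.\<close>

lemma word_span_1_tangents:
  assumes "word_span N m u" "m \<le> 1"
  shows "\<exists>(c :: int) ps. (m = 0 \<longrightarrow> ps = []) \<and> (\<forall>(\<delta>, y)\<in>set ps. y \<in> tangents N \<delta>) \<and>
     u = of_int c *\<^sub>C 1 + sum_list (map snd ps)"
  using assms
proof (induction rule: word_span.induct)
  case (one m)
  show ?case by (intro exI[of _ 1] exI[of _ "[]"]) (simp add: scaleC_one)
next
  case (diff m u v)
  then obtain c ps d qs where
    1: "m = 0 \<longrightarrow> ps = []" "\<forall>(\<delta>, y)\<in>set ps. y \<in> tangents N \<delta>" "u = of_int c *\<^sub>C 1 + sum_list (map snd ps)"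
    and 2: "m = 0 \<longrightarrow> qs = []" "\<forall>(\<delta>, y)\<in>set qs. y \<in> tangents N \<delta>" "v = of_int d *\<^sub>C 1 + sum_list (map snd qs)"
    by blast
  have neg: "- y \<in> tangents N \<delta>" if "y \<in> tangents N \<delta>" for \<delta> y
    using subgrp_neg[OF subgrp_tangents[OF tangents_hom[OF that]] that] .
  let ?qs = "map (\<lambda>(\<delta>, y). (\<delta>, - y)) qs"
  have "sum_list (map snd ?qs) = - sum_list (map snd qs)" by (induction qs) auto
  then have "u - v = of_int (c - d) *\<^sub>C 1 + sum_list (map snd (ps @ ?qs))"
    by (simp add: 1(3) 2(3) complex_vector.scale_left_diff_distrib)
  moreover have "\<forall>(\<delta>, y)\<in>set (ps @ ?qs). y \<in> tangents N \<delta>"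
  proof (intro ballI, clarify)
    fix \<delta> y assume "(\<delta>, y) \<in> set (ps @ ?qs)"
    then consider "(\<delta>, y) \<in> set ps" | z where "(\<delta>, z) \<in> set qs" "y = - z" by auto
    then show "y \<in> tangents N \<delta>"
    proof cases
      case 1
      with \<open>\<forall>(\<delta>, y)\<in>set ps. y \<in> tangents N \<delta>\<close> show ?thesis by blast
    next
      case 2
      with \<open>\<forall>(\<delta>, y)\<in>set qs. y \<in> tangents N \<delta>\<close> have "z \<in> tangents N \<delta>" by blast
      then show ?thesis unfolding \<open>y = - z\<close> by (rule neg)
    qed
  qed
  moreover have "m = 0 \<longrightarrow> ps @ ?qs = []" using 1(1) 2(1) by simp
  ultimately show ?case by (intro exI[of _ "c - d"] exI[of _ "ps @ ?qs"] conjI)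
next
  case (mono m u m')
  then obtain c ps where "m = 0 \<longrightarrow> ps = []" "\<forall>(\<delta>, y)\<in>set ps. y \<in> tangents N \<delta>"
    "u = of_int c *\<^sub>C 1 + sum_list (map snd ps)" by (meson order_trans)
  then show ?case using mono.hyps(2) by (intro exI[of _ c] exI[of _ ps] conjI) auto
next
  case (step \<delta> D m u n)
  show ?case
  proof (cases "n = 0")
    case True
    then show ?thesis using step curve_0[OF step.hyps(1)] by simp
  next
    case False
    then have nm: "n = 1" "m = 0" using step.prems by auto
    then obtain c where c: "u = of_int c *\<^sub>C 1" using step by auto
    have T: "coef D 1 \<in> tangents N \<delta>" using step.hyps by (auto simp: tangents_def)
    have "of_int c *\<^sub>C coef D 1 \<in> tangents N \<delta>"
      by (rule subgrp_of_int[OF subgrp_tangents[OF tangents_hom[OF T]] T])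
    then show ?thesis
      using nm by (intro exI[of _ 0] exI[of _ "[(\<delta>, of_int c *\<^sub>C coef D 1)]"]) (simp add: c mult_scaleC_right)
  qed
qed

text \<open>As x has order 1, its symbol in every order m > 1 vanishes, and
  \<open>word_span_descent\<close> lowers m to 1, dividing the precision by m each time; hence the
  factorial. A word of order 1 is an integer plus tangent vectors of various degrees: the counit
  removes the integer, and degree separation discards the other degrees.\<close>

lemma integral_primitive_tangent:
  assumes \<delta>: "monoid_hom \<delta>" and x: "x \<in> U" "x \<in> Ag (\<delta> 1)" "primitive x" and N: "0 < N"
  shows "x \<in> tangents N \<delta>"
proof -
  obtain m where "\<And>N. word_span N m x" using U_words[OF x(1)] by blast
  then have m: "word_span N (Suc m) x" for N using word_span.mono[of N m x "Suc m"] by simp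
  have "word_span N 1 x" if "word_span (fact (Suc m) * N) (Suc m) x" for m
    using that
  proof (induction m)
    case 0
    then show ?case by simp
  next
    case (Suc m)
    have "word_span (fact (Suc m) * N) (Suc (Suc m) - 1) x"
    proof (rule word_span_descent[OF Suc.prems])
      show "x \<in> lower (Suc (Suc m))" using primitive_lower[OF x(3)] lower_mono[of "Suc 1" "Suc (Suc m)"] by auto
      show "Suc (Suc m) * (fact (Suc m) * N) \<le> fact (Suc (Suc m)) * N" by (simp only: fact_Suc[of "Suc m"] mult.assoc of_nat_id order_refl)
      show "0 < fact (Suc m) * N" using N by simp
    qed simp
    then show ?case using Suc.IH by simp
  qed
  then have "word_span N 1 x" using m by blast
  from word_span_1_tangents[OF this order_refl]
  obtain c :: int and ps where ps: "\<forall>(\<delta>, y)\<in>set ps. y \<in> tangents N \<delta>" "x = of_int c *\<^sub>C 1 + sum_list (map snd ps)"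
    by blast
  have P: "snd p \<in> tangents N (fst p)" if "p \<in> set ps" for p using ps(1) that by (cases p) auto
  have "counit (sum_list (map snd ps)) = 0"
    using P
  proof (induction ps)
    case Nil
    show ?case by (simp add: clinear_0[OF clinear_counit])
  next
    case (Cons p ps)
    then show ?case using tangents_props[OF N, of "snd p" "fst p"] by (simp add: counit_hom primitive_counit)
  qed
  then have "of_int c = (0 :: complex)"
    using primitive_counit[OF x(3)] by (simp add: ps(2) counit_hom)
  then have "x = sum_list (map snd ps)" by (simp add: ps(2))
  also have "\<dots> = (\<Sum>i<length ps. snd (ps ! i))"
    by (simp add: sum_list_sum_nth atLeast0LessThan)
  finally have "x = (\<Sum>i | i \<in> {..<length ps} \<and> fst (ps ! i) 1 = \<delta> 1. snd (ps ! i))"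
  proof (rule degree_separation[rotated 4])
    fix i assume "i \<in> {..<length ps}"
    then show "snd (ps ! i) \<in> U \<and> snd (ps ! i) \<in> Ag (fst (ps ! i) 1)"
      using tangents_props[OF N P[of "ps ! i"]] by simp
  qed (use x in simp_all)
  also have "\<dots> \<in> tangents N \<delta>"
  proof (rule subgrp_sum[OF subgrp_tangents[OF \<delta>]])
    fix i assume i: "i \<in> {i. i \<in> {..<length ps} \<and> fst (ps ! i) 1 = \<delta> 1}"
    then have T: "snd (ps ! i) \<in> tangents N (fst (ps ! i))" by (intro P) simp
    have "fst (ps ! i) = \<delta>"
      using i \<delta> tangents_hom[OF T] by (intro monoid_hom_nat_eqI) auto
    with T show "snd (ps ! i) \<in> tangents N \<delta>" by simp
  qed
  finally show ?thesis .
qed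

subsection \<open>Integral curves through integral primitive elements\<close>

text \<open>D is compared with a curve integral up to n through the same tangent vector. The
  quotient starts in degree 2, so its class in degree n comes from obstructions in degrees c = n / l
  with l \<ge> 2, which vanish by induction. In degree 1 the coefficient is itself
  primitive.\<close>

lemma obstruction_vanishes:
  "0 < n \<Longrightarrow> curve \<delta> D \<Longrightarrow> ibelow n D \<Longrightarrow> coef D n \<in> Bs (\<delta> n)" for \<delta> :: "nat \<Rightarrow> 'q"
proof (induction n arbitrary: \<delta> D rule: less_induct)
  case (less n)
  note D = \<open>curve \<delta> D\<close> \<open>ibelow n D\<close>
  have \<delta>: "monoid_hom \<delta>" using D by (simp add: curve_def)
  have prim: "primitive (coef D 1)" using D by (auto intro!: curve_leading)
  show ?case
  proof (cases "n = 1")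
    case True
    then show ?thesis
      using prim curve_Ag[OF D(1), of 1] U_zero by (force simp: Bs_def)
  next
    case False
    then have n: "2 \<le> n" using less.prems by simp
    have "coef D 1 \<in> U" using D(2) n by (simp add: ibelow_def)
    then have "coef D 1 \<in> tangents n \<delta>"
      using n curve_Ag[OF D(1), of 1] prim by (intro integral_primitive_tangent[OF \<delta>]) auto
    then obtain D0 where D0: "curve \<delta> D0" "ibelow (Suc n) D0" "coef D0 1 = coef D 1"
      by (auto simp: tangents_def)
    obtain X where X: "D = D0 * X" "curve \<delta> X" using curve_div[OF D(1) D0(1)] .
    have iD0: "ibelow n D0" by (rule ibelow_mono[OF D0(2)]) simp
    have iX: "ibelow n X" using ibelow_quot[OF curve_0[OF D0(1)] iD0] D(2) X(1) by simp
    have X1: "coef X 1 = 0"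
      using coef_mult_1[OF curve_0[OF D0(1)] curve_0[OF X(2)]] D0(3) X(1) by simp
    have "coef X n \<in> Bs (\<delta> n)"
    proof (rule leading_obstruction[where R = n and k = 2, OF lead_lifts less.prems(1) subgrp_Bs _ _ _ X(2) iX])
      show "U \<subseteq> Bs (\<delta> n)" using Bs_U by blast
      show "(n - 1) div 2 < n" using n by linarith
      show "coef X i = 0" if "0 < i" "i < 2" for i using that X1 by (auto simp: less_2_cases_iff)
      fix c l assume cl: "c * l = n" "2 \<le> l"
      have c0: "0 < c" using cl n by (cases c) auto
      then have "c * 1 < c * l" using cl(2) by (intro mult_strict_left_mono) auto
      then have cn: "c < n" using cl(1) by simp
      show "Ob c (\<lambda>j. \<delta> (j * l)) \<subseteq> Bs (\<delta> n)"
      proof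
        fix a assume "a \<in> Ob c (\<lambda>j. \<delta> (j * l))"
        then obtain D' where D': "curve (\<lambda>j. \<delta> (j * l)) D'" "ibelow c D'" "a - coef D' c \<in> Bs (\<delta> (c * l))"
          by (auto simp: Ob_def)
        have "coef D' c \<in> Bs (\<delta> (c * l))" by (rule less.IH[OF cn c0 D'(1,2)])
        from subgrp_add[OF subgrp_Bs D'(3) this] show "a \<in> Bs (\<delta> n)" by (simp add: cl(1))
      qed
    qed simp
    moreover have "coef D0 n \<in> Bs (\<delta> n)" using D0(2) by (intro Bs_U) (simp add: ibelow_def)
    moreover have "coef D n - (coef D0 n + coef X n) \<in> Bs (\<delta> n)"
      unfolding X(1) using less.prems(1)
      by (intro Bs_U coef_mult_top[OF curve_0[OF D0(1)] curve_0[OF X(2)] iD0 iX]) auto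
    ultimately have "(coef D n - (coef D0 n + coef X n)) + (coef D0 n + coef X n) \<in> Bs (\<delta> n)"
      using subgrp_add[OF subgrp_Bs] by blast
    then show ?thesis by simp
  qed
qed

text \<open>Each correction leaves the lower coefficients alone, so the successive curves converge
  coefficientwise to a diagonal series.\<close>

theorem integral_curve_exists:
  fixes \<delta> :: "nat \<Rightarrow> 'q"
  assumes \<delta>: "monoid_hom \<delta>" and x: "x \<in> U" "x \<in> Ag (\<delta> 1)" "primitive x"
  obtains D where "curve \<delta> D" "coef D 1 = x" "\<And>n. coef D n \<in> U"
proof -
  \<comment> \<open>The offset 2 puts degree 1 among the settled degrees from the start, which fixes
    the tangent vector.\<close>
  have "\<exists>F. \<forall>n. (curve \<delta> (F n) \<and> ibelow (n + 2) (F n) \<and> coef (F n) 1 = x) \<and>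
      (\<forall>k < n + 2. coef (F (Suc n)) k = coef (F n) k)"
  proof (rule dependent_nat_choice)
    have "curve \<delta> (exp_series x)" by (rule curve_exp_series[OF \<delta> x(3,2)])
    moreover have "ibelow (0 + 2) (exp_series x)"
      using x(1) U_one by (auto simp: ibelow_def less_Suc_eq)
    ultimately show "\<exists>F. curve \<delta> F \<and> ibelow (0 + 2) F \<and> coef F 1 = x"
      by (intro exI[of _ "exp_series x"]) simp
    fix F n assume F: "curve \<delta> F \<and> ibelow (n + 2) F \<and> coef F 1 = x"
    obtain X where "curve \<delta> X" "ibelow (Suc (n + 2)) X" "\<And>k. k < n + 2 \<Longrightarrow> coef X k = coef F k"
      using remove_obstruction[of \<delta> F "n + 2"] obstruction_vanishes[of "n + 2" \<delta> F] F by auto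
    then show "\<exists>X. (curve \<delta> X \<and> ibelow (Suc n + 2) X \<and> coef X 1 = x) \<and> (\<forall>k<n + 2. coef X k = coef F k)"
      using F by (intro exI[of _ X]) auto
  qed
  then obtain F where F: "\<And>n. curve \<delta> (F n)" "\<And>n. ibelow (n + 2) (F n)" "\<And>n. coef (F n) 1 = x"
    and step: "\<And>n k. k < n + 2 \<Longrightarrow> coef (F (Suc n)) k = coef (F n) k" by blast
  have agree: "coef (F m) k = coef (F k) k" if "k \<le> m" for m k
    using that
  proof (induction m)
    case (Suc m)
    then show ?case using step[of k m] by (cases "k = Suc m") auto
  qed simp
  define D where "D = Series (\<lambda>n. coef (F n) n)"
  have DF: "coef D k = coef (F m) k" if "k \<le> m" for k m using agree[OF that] by (simp add: D_def)
  have "grouplike D"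
    unfolding grouplike_def
  proof (intro conjI allI)
    show "coef D 0 = 1" using curve_0[OF F(1)] by (simp add: D_def)
    fix n
    have "comult (coef (F n) n) = (\<Sum>i\<le>n. coef (F n) i \<otimes> coef (F n) (n - i))"
      using curve_grouplike[OF F(1)[of n]] unfolding grouplike_def sum_decomp_nat by blast
    then show "comult (coef D n) = (\<Sum>(u, v)\<in>decomp n. coef D u \<otimes> coef D v)"
      unfolding sum_decomp_nat using DF[of _ n] by simp
  qed
  moreover have "coef D n \<in> Ag (\<delta> n)" for n using curve_Ag[OF F(1)] by (simp add: D_def)
  ultimately have "curve \<delta> D" using \<delta> by (simp add: curve_def)
  moreover have "coef D 1 = x" using F(3) by (simp add: D_def)
  moreover have "coef D n \<in> U" for n using F(2)[of n] by (simp add: D_def ibelow_def)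
  ultimately show ?thesis using that by blast
qed

end

subsection \<open>Graded extension of scalars\<close>

text \<open>For a ring \<open>'a\<close>, the type \<open>('q, 'a) scalar_ext\<close> is \<open>\<complex>['q] \<otimes>\<^sub>\<int> 'a\<close>; a complex structure on \<open>'a\<close> is
  disregarded. The \<open>\<complex>\<close>-linear map from the enveloping algebra that sends a generator \<open>x\<close> of degree \<open>q\<close> to
  \<open>q \<otimes> x\<close> separates the degrees, and it turns independence over \<open>\<int>\<close> of elements of the integral form into
  independence over \<open>\<complex>\<close>.\<close>

datatype ('q, 'a) gword = GWord 'q 'a

instantiation gword :: (monoid_add, monoid_mult) monoid_add
begin
definition zero_gword :: "('a, 'b) gword" where "zero_gword = GWord 0 1"
fun plus_gword :: "('a, 'b) gword \<Rightarrow> ('a, 'b) gword \<Rightarrow> ('a, 'b) gword" where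
  "plus_gword (GWord p a) (GWord q b) = GWord (p + q) (a * b)"
instance
proof
  fix x y z :: "('a, 'b) gword"
  show "x + y + z = x + (y + z)" "0 + x = x" "x + 0 = x"
    by (cases x; cases y; cases z; simp add: zero_gword_def mult.assoc add.assoc)+
qed
end

definition gsingle :: "'q \<Rightarrow> 'a \<Rightarrow> ('q, 'a) gword \<Rightarrow>\<^sub>0 complex" where
  "gsingle q a = Poly_Mapping.single (GWord q a) 1"

lemma gsingle_mult: "gsingle p a * gsingle q b = gsingle (p + q) (a * b)"
  by (simp add: gsingle_def mult_single)

text \<open>Additivity in the second argument is imposed, and the complex scalars are those of the
  monoid algebra. So rational numbers pass between the two factors, and other complex numbers do
  not.\<close>

inductive_set gword_relations :: "(('q::monoid_add, 'a::ring_1) gword \<Rightarrow>\<^sub>0 complex) set" where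
  "gsingle q (a + b) - (gsingle q a + gsingle q b) \<in> gword_relations"

lemma span_gword_relations_mult:
  fixes p :: "('q::monoid_add, 'a::ring_1) gword \<Rightarrow>\<^sub>0 complex"
  assumes p: "p \<in> complex_vector.span gword_relations"
  shows "r * p \<in> complex_vector.span gword_relations" "p * r \<in> complex_vector.span gword_relations"
proof -
  have single: "Poly_Mapping.single k c = c *\<^sub>C (case k of GWord q a \<Rightarrow> gsingle q a)"
    for k :: "('q, 'a) gword" and c
    by (rule poly_mapping_eqI, cases k) (simp add: gsingle_def lookup_single scaleC_complex_def when_def)
  have gen: "gsingle q a * s \<in> gword_relations" "s * gsingle q a \<in> gword_relations"
    if "s \<in> gword_relations" for q a and s :: "('q, 'a) gword \<Rightarrow>\<^sub>0 complex"
    using that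
    by (cases; simp add: gsingle_mult right_diff_distrib left_diff_distrib distrib_left distrib_right
        gword_relations.intros)+
  have span: "gsingle q a * s \<in> complex_vector.span gword_relations
      \<and> s * gsingle q a \<in> complex_vector.span gword_relations"
    if "s \<in> complex_vector.span gword_relations" for q a and s :: "('q, 'a) gword \<Rightarrow>\<^sub>0 complex"
    using that
    by (induction s rule: complex_vector.span_induct_alt)
      (simp_all add: complex_vector.span_zero distrib_left distrib_right scaleC_mult_monoid_algebra
        complex_vector.span_add complex_vector.span_scale complex_vector.span_base gen)
  show "r * p \<in> complex_vector.span gword_relations" "p * r \<in> complex_vector.span gword_relations"
    by (induction r rule: poly_mapping_add_induct)
      (auto simp: complex_vector.span_zero distrib_left distrib_right single
        scaleC_mult_monoid_algebra span[OF p] split: gword.splits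
        intro!: complex_vector.span_add complex_vector.span_scale)
qed

quotient_type (overloaded) ('q, 'a) scalar_ext = "('q::monoid_add, 'a::ring_1) gword \<Rightarrow>\<^sub>0 complex"
  / "\<lambda>p q. p - q \<in> complex_vector.span gword_relations"
  by (rule equivp_span)

definition ev_lift :: "'q \<Rightarrow> ('a \<Rightarrow> complex) \<Rightarrow> (('q, 'a) gword \<Rightarrow>\<^sub>0 complex) \<Rightarrow> complex" where
  "ev_lift q f = monoid_algebra_lift (\<lambda>w. case w of GWord q' a \<Rightarrow> if q' = q then f a else 0)"

lemma ev_lift_span:
  assumes f: "\<And>x y. f (x + y) = f x + f y" and r: "r \<in> complex_vector.span gword_relations"
  shows "ev_lift q f r = 0"
proof -
  have rel: "ev_lift q f r = 0" if "r \<in> gword_relations" for r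
    using that by cases
      (simp add: ev_lift_def gsingle_def monoid_algebra_lift_diff monoid_algebra_lift_add f scaleC_one)
  show ?thesis using r
    by (induction r rule: complex_vector.span_induct_alt)
      (simp_all add: rel[unfolded ev_lift_def] ev_lift_def monoid_algebra_lift_add
        monoid_algebra_lift_scaleC scaleC_complex_def)
qed

instantiation scalar_ext :: (monoid_add, complex_algebra_1) complex_algebra_1
begin
lift_definition zero_scalar_ext :: "('a, 'b) scalar_ext" is 0 .
lift_definition one_scalar_ext :: "('a, 'b) scalar_ext" is 1 .
lift_definition plus_scalar_ext :: "('a, 'b) scalar_ext \<Rightarrow> ('a, 'b) scalar_ext \<Rightarrow> ('a, 'b) scalar_ext" is "(+)"
  using complex_vector.span_add by (metis add_diff_add)
lift_definition minus_scalar_ext :: "('a, 'b) scalar_ext \<Rightarrow> ('a, 'b) scalar_ext \<Rightarrow> ('a, 'b) scalar_ext" is "(-)"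
proof -
  fix p p' q q' :: "('a, 'b) gword \<Rightarrow>\<^sub>0 complex"
  assume "p - p' \<in> complex_vector.span gword_relations" "q - q' \<in> complex_vector.span gword_relations"
  from complex_vector.span_diff[OF this]
  show "p - q - (p' - q') \<in> complex_vector.span gword_relations" by (simp add: algebra_simps)
qed
lift_definition uminus_scalar_ext :: "('a, 'b) scalar_ext \<Rightarrow> ('a, 'b) scalar_ext" is uminus
  by (metis complex_vector.span_neg minus_diff_eq minus_diff_minus)
lift_definition scaleC_scalar_ext :: "complex \<Rightarrow> ('a, 'b) scalar_ext \<Rightarrow> ('a, 'b) scalar_ext" is scaleC
  by (metis complex_vector.scale_right_diff_distrib complex_vector.span_scale)
lift_definition times_scalar_ext :: "('a, 'b) scalar_ext \<Rightarrow> ('a, 'b) scalar_ext \<Rightarrow> ('a, 'b) scalar_ext" is "(*)"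
proof -
  fix p p' q q' :: "('a, 'b) gword \<Rightarrow>\<^sub>0 complex"
  assume *: "p - p' \<in> complex_vector.span gword_relations" "q - q' \<in> complex_vector.span gword_relations"
  have "p * q - p' * q' = p * (q - q') + (p - p') * q'" by (simp add: algebra_simps)
  with * show "p * q - p' * q' \<in> complex_vector.span gword_relations"
    by (simp add: complex_vector.span_add span_gword_relations_mult)
qed
instance
proof
  show "(0::('a, 'b) scalar_ext) \<noteq> 1"
  proof transfer
    obtain f :: "'b \<Rightarrow> complex" where f: "\<And>x y. f (x + y) = f x + f y" "f 1 = 1"
      by (rule exists_linear_functional[of 1]) auto
    have ne: "ev_lift (0 :: 'a) f (0 - 1) = - 1"
      unfolding ev_lift_def
      by (simp only: monoid_algebra_lift_diff monoid_algebra_lift_one) (simp add: zero_gword_def f)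
    show "0 - 1 \<notin> complex_vector.span (gword_relations :: (('a, 'b) gword \<Rightarrow>\<^sub>0 complex) set)"
    proof
      assume "0 - 1 \<in> complex_vector.span (gword_relations :: (('a, 'b) gword \<Rightarrow>\<^sub>0 complex) set)"
      from ev_lift_span[OF f(1) this, of 0] ne show False by simp
    qed
  qed
qed (transfer; simp add: algebra_simps scaleC_add_right scaleC_add_left scaleC_scaleC scaleC_one
    scaleC_mult_monoid_algebra complex_vector.span_zero)+
end

instantiation scalar_ext :: (monoid_add, complex_algebra_1) complex_lie_algebra
begin
definition lie_bracket_scalar_ext :: "('a, 'b) scalar_ext \<Rightarrow> ('a, 'b) scalar_ext \<Rightarrow> ('a, 'b) scalar_ext" where
  "lie_bracket_scalar_ext x y = x * y - y * x"
instance
  by standard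
    (simp_all add: lie_bracket_scalar_ext_def algebra_simps mult_scaleC_left mult_scaleC_right
      complex_vector.scale_right_diff_distrib)
end

lift_definition gtensor :: "'q::monoid_add \<Rightarrow> 'a::complex_algebra_1 \<Rightarrow> ('q, 'a) scalar_ext" is gsingle .

lemma gtensor_add: "gtensor q (a + b) = gtensor q a + gtensor q b"
  by transfer (intro complex_vector.span_base gword_relations.intros)
lemma gtensor_mult: "gtensor p a * gtensor q b = gtensor (p + q) (a * b)"
  by transfer (simp add: gsingle_mult complex_vector.span_zero)
lemma gtensor_one: "gtensor 0 1 = 1"
  by transfer (simp add: gsingle_def complex_vector.span_zero flip: zero_gword_def)
lemma gtensor_zero [simp]: "gtensor q 0 = 0"
  by (metis add_cancel_right_right gtensor_add)
lemma gtensor_diff: "gtensor q (a - b) = gtensor q a - gtensor q b"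
  by (metis add_diff_cancel_right' diff_add_cancel gtensor_add)
lemma gtensor_of_nat: "gtensor q (of_nat n *\<^sub>C a) = of_nat n *\<^sub>C gtensor q a"
  by (induction n) (simp_all add: gtensor_add scaleC_add_left scaleC_one)
lemma gtensor_of_int: "gtensor q (of_int n *\<^sub>C a) = of_int n *\<^sub>C gtensor q a"
proof (cases n rule: int_cases2)
  case (nonneg k)
  then show ?thesis by (simp add: gtensor_of_nat)
next
  case (nonpos k)
  then show ?thesis
    using gtensor_diff[of q 0 "of_nat k *\<^sub>C a"] by (simp add: gtensor_of_nat complex_vector.scale_minus_left)
qed
text \<open>In a complex vector space n can be cancelled. The denominators of divided powers and
  binomials therefore pass through \<open>gtensor\<close>.\<close>

lemma gtensor_inverse_nat:
  assumes "0 < n"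
  shows "gtensor q ((1 / of_nat n) *\<^sub>C a) = (1 / of_nat n) *\<^sub>C gtensor q a"
proof -
  have "of_nat n *\<^sub>C gtensor q ((1 / of_nat n) *\<^sub>C a) = gtensor q a"
    using assms by (simp add: scaleC_scaleC scaleC_one flip: gtensor_of_nat)
  then have "(1 / of_nat n) *\<^sub>C of_nat n *\<^sub>C gtensor q ((1 / of_nat n) *\<^sub>C a) = (1 / of_nat n) *\<^sub>C gtensor q a" by simp
  then show ?thesis using assms by (simp only: scaleC_scaleC) (simp add: scaleC_one)
qed

text \<open>Even a merely additive f induces a complex linear functional here, read off in degree
  q.\<close>

definition ev :: "'q::monoid_add \<Rightarrow> ('a::complex_algebra_1 \<Rightarrow> complex) \<Rightarrow> ('q, 'a) scalar_ext \<Rightarrow> complex" where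
  "ev q f u = ev_lift q f (rep_scalar_ext u)"

context
  fixes f :: "'a::complex_algebra_1 \<Rightarrow> complex"
  assumes f: "\<And>x y. f (x + y) = f x + f y"
begin

lemma ev_abs: "ev q f (abs_scalar_ext p) = ev_lift q f p"
proof -
  have "rep_scalar_ext (abs_scalar_ext p) - p \<in> complex_vector.span gword_relations"
    using Quotient3_rep_abs[OF Quotient3_scalar_ext, of p] complex_vector.span_zero by fastforce
  from ev_lift_span[OF f this, of q] show ?thesis
    by (simp add: ev_def ev_lift_def monoid_algebra_lift_diff)
qed

lemma clinear_ev: "clinear (ev q f)"
proof (rule clinearI)
  fix s t :: "('b, 'a) scalar_ext" and c
  obtain p r where pr: "s = abs_scalar_ext p" "t = abs_scalar_ext r"
    using Quotient3_abs_rep[OF Quotient3_scalar_ext] by metis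
  show "ev q f (s + t) = ev q f s + ev q f t"
    by (simp add: pr plus_scalar_ext.abs_eq ev_abs) (simp add: ev_lift_def monoid_algebra_lift_add)
  show "ev q f (c *\<^sub>C s) = c *\<^sub>C ev q f s"
    by (simp add: pr scaleC_scalar_ext.abs_eq ev_abs) (simp add: ev_lift_def monoid_algebra_lift_scaleC)
qed

lemma ev_gtensor: "ev q f (gtensor q' a) = (if q' = q then f a else 0)"
  by (simp add: gtensor.abs_eq ev_abs) (simp add: ev_lift_def gsingle_def scaleC_one)

end

definition gpart :: "'q::monoid_add \<Rightarrow> ('q, 'a::complex_algebra_1) scalar_ext set" where
  "gpart q = complex_vector.span (range (gtensor q))"

lemma gtensor_gpart: "gtensor q a \<in> gpart q"
  by (simp add: gpart_def complex_vector.span_base)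

lemma gpart_mult:
  assumes "x \<in> gpart p" "y \<in> gpart q"
  shows "x * y \<in> gpart (p + q)"
proof -
  have 1: "gtensor p a * y \<in> gpart (p + q)" for a
    by (rule clinear_span_mem[OF clinear_mult_left[OF clinear_id] assms(2)[unfolded gpart_def]])
      (auto simp: gtensor_mult gtensor_gpart, simp add: gpart_def)
  have "clinear (\<lambda>x. x * y)" by (simp add: clinear_def distrib_right mult_scaleC_left)
  then show ?thesis
    by (rule clinear_span_mem[OF _ assms(1)[unfolded gpart_def]]) (auto simp: 1, simp add: gpart_def)
qed

lemma ev_gpart:
  assumes "\<And>x y. f (x + y) = f x + f y" "x \<in> gpart q'" "q' \<noteq> q"
  shows "ev q f x = 0"
proof -
  have "ev q f x \<in> {0}"
    by (rule clinear_span_mem[OF clinear_ev assms(2)[unfolded gpart_def]])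
      (use assms in \<open>auto simp: ev_gtensor\<close>)
  then show ?thesis by simp
qed

subsection \<open>Additive functionals\<close>

lemma vector_space_rat: "vector_space (\<lambda>(r::rat) (x::'a::complex_vector). of_rat r *\<^sub>C x)"
  by unfold_locales (simp_all add: scaleC_add_right scaleC_add_left scaleC_scaleC scaleC_one of_rat_add of_rat_mult)

lemma common_denominator:
  fixes r :: "'b \<Rightarrow> rat"
  assumes "finite A"
  obtains d :: int where "d \<noteq> 0" "\<And>x. x \<in> A \<Longrightarrow> \<exists>k :: int. of_int d * r x = of_int k"
proof -
  have "\<exists>d :: int. d \<noteq> 0 \<and> (\<forall>x\<in>A. \<exists>k :: int. of_int d * r x = of_int k)"
    using assms
  proof (induction A rule: finite_induct)
    case empty
    show ?case by (intro exI[of _ 1]) simp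
  next
    case (insert x A)
    then obtain d :: int where d: "d \<noteq> 0" "\<forall>x\<in>A. \<exists>k :: int. of_int d * r x = of_int k" by blast
    obtain a b where ab: "r x = of_int a / of_int b" "b > 0"
      using quotient_of_div[of "r x"] quotient_of_denom_pos[of "r x"] by (metis prod.collapse)
    have "\<exists>k :: int. of_int (d * b) * r y = of_int k" if y: "y \<in> insert x A" for y
    proof (cases "y = x")
      case True
      then show ?thesis using ab by (intro exI[of _ "d * a"]) simp
    next
      case False
      then obtain k :: int where "of_int d * r y = of_int k" using d(2) y by auto
      then have "of_int (d * b) * r y = of_int (b * k)" by (metis mult.assoc mult.commute of_int_mult)
      then show ?thesis by blast
    qed
    then show ?case using d(1) ab(2) by (intro exI[of _ "d * b"]) auto
  qed
  with that show ?thesis by blast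
qed

text \<open>Clearing denominators turns independence over the integers into independence over the
  rationals. After extension to a rational basis of the whole space, a coordinate function is
  additive, but in general not complex linear.\<close>

lemma additive_dual_functional:
  fixes zs :: "nat \<Rightarrow> 'a::complex_vector"
  assumes J: "finite J" "j0 \<in> J"
    and ind: "\<And>b :: nat \<Rightarrow> int. (\<Sum>j\<in>J. of_int (b j) *\<^sub>C zs j) = 0 \<Longrightarrow> \<forall>j\<in>J. b j = 0"
  obtains f :: "'a \<Rightarrow> complex" where "\<And>x y. f (x + y) = f x + f y" "f (zs j0) = 1"
    "\<And>i. i \<in> J \<Longrightarrow> i \<noteq> j0 \<Longrightarrow> f (zs i) = 0"
proof -
  interpret Q: vector_space "\<lambda>(r::rat) (x::'a). of_rat r *\<^sub>C x" by (rule vector_space_rat)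
  have rat_ind: "r j = 0" if r: "(\<Sum>j\<in>J. of_rat (r j) *\<^sub>C zs j) = 0" and j: "j \<in> J" for r j
  proof -
    obtain d :: int where d: "d \<noteq> 0" "\<And>j. j \<in> J \<Longrightarrow> \<exists>k :: int. of_int d * r j = of_int k"
      using common_denominator[OF J(1)] by blast
    then obtain k :: "nat \<Rightarrow> int" where k: "\<And>j. j \<in> J \<Longrightarrow> of_int d * r j = of_int (k j)" by metis
    have "(\<Sum>j\<in>J. of_int (k j) *\<^sub>C zs j) = (\<Sum>j\<in>J. of_int d *\<^sub>C of_rat (r j) *\<^sub>C zs j)"
    proof (rule sum.cong[OF HOL.refl])
      fix j assume "j \<in> J"
      then have "(of_rat (of_int d * r j) :: complex) = of_rat (of_int (k j))" by (simp add: k)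
      then have "(of_int d * of_rat (r j) :: complex) = of_int (k j)" by (simp add: of_rat_mult)
      then show "of_int (k j) *\<^sub>C zs j = of_int d *\<^sub>C of_rat (r j) *\<^sub>C zs j" by (simp add: scaleC_scaleC)
    qed
    also have "\<dots> = of_int d *\<^sub>C (\<Sum>j\<in>J. of_rat (r j) *\<^sub>C zs j)" by (simp add: complex_vector.scale_sum_right)
    finally have "\<forall>j\<in>J. k j = 0" using r by (intro ind) simp
    then show ?thesis using k[OF j] d(1) j by simp
  qed
  have inj: "inj_on zs J"
  proof (rule inj_onI, rule ccontr)
    fix i j assume ij: "i \<in> J" "j \<in> J" "zs i = zs j" "i \<noteq> j"
    let ?b = "\<lambda>l. if l = i then 1 else if l = j then - 1 else 0 :: int"
    have "(\<Sum>l\<in>J. of_int (?b l) *\<^sub>C zs l) = (\<Sum>l\<in>J. (if l = i then zs i else 0) - (if l = j then zs j else 0))"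
      using ij(4) by (intro sum.cong) (auto simp: scaleC_one complex_vector.scale_minus_left)
    also have "\<dots> = 0" using ij J(1) by (simp add: sum_subtractf)
    finally have "?b i = 0" using ind[of ?b] ij(1) by blast
    then show False by simp
  qed
  have indep: "Q.independent (zs ` J)"
  proof (rule Q.independent_if_scalars_zero)
    show "finite (zs ` J)" using J by simp
    fix g x assume g: "(\<Sum>x\<in>zs ` J. of_rat (g x) *\<^sub>C x) = 0" and x: "x \<in> zs ` J"
    from x obtain j where j: "j \<in> J" "x = zs j" by blast
    have "(\<Sum>j\<in>J. of_rat (g (zs j)) *\<^sub>C zs j) = 0" using g by (simp add: sum.reindex[OF inj])
    from rat_ind[of "\<lambda>j. g (zs j)", OF this j(1)] show "g x = 0" by (simp add: j(2))
  qed
  define B where "B = Q.extend_basis (zs ` J)"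
  have B: "Q.independent B" "Q.span B = UNIV" "zs ` J \<subseteq> B"
    using Q.independent_extend_basis[OF indep] Q.span_extend_basis[OF indep] Q.extend_basis_superset[OF indep]
    by (auto simp: B_def)
  have in_B: "zs i \<in> B" if "i \<in> J" for i using B(3) that by blast
  show ?thesis
  proof (rule that[of "\<lambda>x. of_rat (Q.representation B x (zs j0))"])
    show "of_rat (Q.representation B (x + y) (zs j0))
        = (of_rat (Q.representation B x (zs j0)) + of_rat (Q.representation B y (zs j0)) :: complex)" for x y
      by (simp add: Q.representation_add B of_rat_add)
    show "of_rat (Q.representation B (zs j0) (zs j0)) = (1 :: complex)"
      using in_B[OF J(2)] by (simp add: Q.representation_basis B)
    fix i assume i: "i \<in> J" "i \<noteq> j0"
    then have "zs i \<noteq> zs j0" using inj J(2) by (auto dest: inj_onD)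
    then show "of_rat (Q.representation B (zs i) (zs j0)) = (0 :: complex)"
      using in_B[OF i(1)] by (simp add: Q.representation_basis B)
  qed
qed

lemma functionals_separate:
  fixes x y :: "'a::complex_vector"
  assumes "\<And>f :: 'a \<Rightarrow> complex. clinear f \<Longrightarrow> f x = f y"
  shows "x = y"
proof (rule ccontr)
  assume "x \<noteq> y"
  then have "x - y \<noteq> 0" by simp
  then obtain f :: "'a \<Rightarrow> complex" where f: "\<And>x y. f (x + y) = f x + f y" "\<And>c x. f (c *\<^sub>C x) = c * f x" "f (x - y) = 1"
    by (rule exists_linear_functional) blast
  then have lin: "clinear f" by (simp add: clinear_def scaleC_complex_def)
  then show False using assms[OF lin] f(3) by (simp add: clinear_minus)
qed

lemma clinear_additive: "clinear f \<Longrightarrow> f (x + y) = f x + f y"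
  by (simp add: clinear_def)

subsection \<open>Kac--Moody algebras\<close>

lemma uea_of_zero [simp]: "uea_of 0 = 0"
  using uea_of_add[of 0 0] by simp

lemma monoid_hom_frag_cmul: "monoid_hom (\<lambda>n. frag_cmul (int n) \<beta>)"
  by (simp add: monoid_hom_def frag_cmul_distrib)

lemma lie_bracket_gtensor:
  fixes p q :: "'q::comm_monoid_add"
  shows "lie_bracket (gtensor p (uea_of x)) (gtensor q (uea_of y)) = gtensor (p + q) (uea_of (lie_bracket x y))"
  by (simp add: lie_bracket_scalar_ext_def gtensor_mult uea_of_lie_bracket gtensor_diff add.commute)

primrec km_degree :: "('i, 'y) km_generator \<Rightarrow> ('i \<Rightarrow>\<^sub>0 int)" where
  "km_degree (H y) = 0"
| "km_degree (E i) = frag_of i"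
| "km_degree (F i) = - frag_of i"

lemma uea_of_minus: "uea_of (- x) = - uea_of x"
  using uea_of_scaleC[of "- 1" x] by (simp add: complex_vector.scale_minus_left scaleC_one)

lemma gtensor_minus: "gtensor q (- a) = - gtensor q a"
  using gtensor_diff[of q 0 a] by simp

lemma gtensor_inverse_fact: "gtensor q ((1 / fact n) *\<^sub>C a) = (1 / fact n) *\<^sub>C gtensor q a"
  using gtensor_inverse_nat[of "fact n" q a] by simp

lemma subspace_gpart: "complex_vector.subspace (gpart q)"
  by (simp add: gpart_def)

locale kac_moody =
  fixes S :: "('i, 'y::ab_group_add) root_system_data"
    and \<gamma> :: "('i, 'y) km_generator \<Rightarrow> 'g::complex_lie_algebra"
  assumes presented: "kac_moody_algebra S \<gamma>"
begin

abbreviation U :: "'g uea set" where "U \<equiv> integral_form S \<gamma>"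
abbreviation Ag :: "('i \<Rightarrow>\<^sub>0 int) \<Rightarrow> 'g uea set" where "Ag \<equiv> uea_root_space S \<gamma>"

definition graded_generator :: "('i, 'y) km_generator \<Rightarrow> ('i \<Rightarrow>\<^sub>0 int, 'g uea) scalar_ext" where
  "graded_generator z = gtensor (km_degree z) (uea_of (\<gamma> z))"

lemma set_lie_term_serre: "set_lie_term ((LBracket (LGen x) ^^ n) (LGen y)) \<subseteq> {x, y}"
  by (induction n) auto

text \<open>Brackets of elements of the form q \<otimes> x are again of this form, so a Serre
  element of the graded generators vanishes with the original one.\<close>

lemma lie_eval_graded_serre:
  "\<exists>q. lie_eval graded_generator ((LBracket (LGen x) ^^ n) (LGen y))
    = gtensor q (uea_of (lie_eval \<gamma> ((LBracket (LGen x) ^^ n) (LGen y))))"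
proof (induction n)
  case 0
  show ?case by (auto simp: graded_generator_def)
next
  case (Suc n)
  then show ?case by (auto simp: graded_generator_def lie_bracket_gtensor)
qed

lemma km_relation_terms:
  "km_relation S s t \<Longrightarrow> set_lie_term s \<subseteq> km_generators S \<and> set_lie_term t \<subseteq> km_generators S"
proof (induction rule: km_relation.induct)
  case (serre_E i j)
  then show ?case
    using set_lie_term_serre[where x = "E i" and y = "E j" and n = "nat (1 - km_matrix S i j)"]
    by (fastforce simp: km_generators_def)
next
  case (serre_F i j)
  then show ?case
    using set_lie_term_serre[where x = "F i" and y = "F j" and n = "nat (1 - km_matrix S i j)"]
    by (fastforce simp: km_generators_def)
qed (auto simp: km_generators_def)

lemma km_relation_eval:
  assumes "km_relation S s t"
  shows "lie_eval \<gamma> s = lie_eval \<gamma> t"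
  using presented km_relation_terms[OF assms] lie_derivable.rel[of "km_relation S", OF assms]
  unfolding kac_moody_algebra_def lie_presented_def by blast

text \<open>Every relation is homogeneous and has integer scalars, which pass through
  \<open>gtensor\<close>; so it holds for the graded generators because it holds in the Lie
  algebra.\<close>

lemma km_relation_graded:
  assumes "km_relation S s t"
  shows "lie_eval graded_generator s = lie_eval graded_generator t"
  using assms km_relation_eval[OF assms]
proof cases
  case (H_F i y)
  \<comment> \<open>The scalar is rewritten as the image of an integer, to which
    \<open>gtensor_of_int\<close> applies.\<close>
  have "- of_int (simple_root S i y) = (of_int (- simple_root S i y) :: complex)" by simp
  with H_F km_relation_eval[OF assms] show ?thesis
    by (simp add: graded_generator_def lie_bracket_gtensor uea_of_scaleC gtensor_of_int del: of_int_minus)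
next
  case (serre_E i j)
  with km_relation_eval[OF assms] show ?thesis
    using lie_eval_graded_serre[where x = "E i" and y = "E j" and n = "nat (1 - km_matrix S i j)"] by auto
next
  case (serre_F i j)
  with km_relation_eval[OF assms] show ?thesis
    using lie_eval_graded_serre[where x = "F i" and y = "F j" and n = "nat (1 - km_matrix S i j)"] by auto
qed (simp_all add: graded_generator_def lie_bracket_gtensor uea_of_scaleC gtensor_of_int uea_of_add gtensor_add
    uea_of_minus gtensor_minus)

lemma graded_hom_exists:
  "\<exists>\<Phi> :: 'g uea \<Rightarrow> ('i \<Rightarrow>\<^sub>0 int, 'g uea) scalar_ext. clinear \<Phi> \<and> \<Phi> 1 = 1 \<and> (\<forall>u v. \<Phi> (u * v) = \<Phi> u * \<Phi> v) \<and>
    (\<forall>z\<in>km_generators S. \<Phi> (uea_of (\<gamma> z)) = gtensor (km_degree z) (uea_of (\<gamma> z)))"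
proof -
  obtain \<phi> where \<phi>: "\<And>x y. \<phi> (x + y) = \<phi> x + \<phi> y" "\<And>c x. \<phi> (c *\<^sub>C x) = c *\<^sub>C \<phi> x"
    "\<And>x y. \<phi> (lie_bracket x y) = lie_bracket (\<phi> x) (\<phi> y)" "\<And>z. z \<in> km_generators S \<Longrightarrow> \<phi> (\<gamma> z) = graded_generator z"
    using lie_presented_universal[OF presented[unfolded kac_moody_algebra_def] km_relation_graded] by blast
  have "lie_representation \<phi>"
    by (simp add: lie_representation_def \<phi> lie_bracket_scalar_ext_def)
  from uea_lift_hom[OF this] \<phi>(4) show ?thesis
    by (intro exI[of _ "uea_lift \<phi>"]) (simp add: clinear_def graded_generator_def)
qed

definition graded_hom :: "'g uea \<Rightarrow> ('i \<Rightarrow>\<^sub>0 int, 'g uea) scalar_ext" where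
  "graded_hom = (SOME \<Phi>. clinear \<Phi> \<and> \<Phi> 1 = 1 \<and> (\<forall>u v. \<Phi> (u * v) = \<Phi> u * \<Phi> v) \<and>
    (\<forall>z\<in>km_generators S. \<Phi> (uea_of (\<gamma> z)) = gtensor (km_degree z) (uea_of (\<gamma> z))))"

lemma clinear_graded_hom: "clinear graded_hom"
  and graded_hom_one: "graded_hom 1 = 1"
  and graded_hom_mult: "graded_hom (u * v) = graded_hom u * graded_hom v"
  and graded_hom_generator:
    "z \<in> km_generators S \<Longrightarrow> graded_hom (uea_of (\<gamma> z)) = gtensor (km_degree z) (uea_of (\<gamma> z))"
  using someI_ex[OF graded_hom_exists] unfolding graded_hom_def by blast+

lemma graded_hom_add: "graded_hom (u + v) = graded_hom u + graded_hom v"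
  and graded_hom_scale: "graded_hom (c *\<^sub>C u) = c *\<^sub>C graded_hom u"
  using clinear_graded_hom by (simp_all add: clinear_def)

lemmas graded_hom_0 = clinear_0[OF clinear_graded_hom]
lemmas graded_hom_diff = clinear_minus[OF clinear_graded_hom]

text \<open>In general the image of x is a complex combination of tensors of degree \<beta> and not
  \<beta> \<otimes> x, since complex scalars do not pass through \<open>gtensor\<close>. Integral
  elements behave better, see \<open>graded_hom_integral\<close>.\<close>

lemma graded_hom_homogeneous: "km_homogeneous S \<gamma> \<beta> x \<Longrightarrow> graded_hom (uea_of x) \<in> gpart \<beta>"
proof (induction rule: km_homogeneous.induct)
  case (7 \<alpha> x \<beta> y)
  then show ?case
    using gpart_mult[OF 7(3,4)] gpart_mult[OF 7(4,3)]
    by (simp add: uea_of_lie_bracket graded_hom_diff graded_hom_mult add.commute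
        complex_vector.subspace_diff[OF subspace_gpart])
qed (simp_all add: graded_hom_0 uea_of_add graded_hom_add uea_of_scaleC graded_hom_scale graded_hom_generator
    km_generators_def gtensor_gpart complex_vector.subspace_0[OF subspace_gpart]
    complex_vector.subspace_add[OF subspace_gpart] complex_vector.subspace_scale[OF subspace_gpart])

lemma graded_hom_Ag:
  assumes "u \<in> Ag \<beta>"
  shows "graded_hom u \<in> gpart \<beta>"
proof (rule clinear_span_mem[OF clinear_graded_hom assms[unfolded uea_root_space_def] subspace_gpart])
  fix w assume "w \<in> {prod_list (map uea_of xs) | xs \<beta>s.
    list_all2 (\<lambda>x \<beta>. x \<in> root_space S \<gamma> \<beta>) xs \<beta>s \<and> sum_list \<beta>s = \<beta>}"
  then obtain xs \<beta>s where w: "w = prod_list (map uea_of xs)" "\<beta> = sum_list \<beta>s"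
    and "list_all2 (\<lambda>x \<beta>. x \<in> root_space S \<gamma> \<beta>) xs \<beta>s" by blast
  from this(3) have "graded_hom (prod_list (map uea_of xs)) \<in> gpart (sum_list \<beta>s)"
  proof induction
    case Nil
    show ?case using gtensor_gpart[of 0 1] by (simp add: graded_hom_one gtensor_one)
  next
    case (Cons x xs \<beta> \<beta>s)
    then show ?case by (simp add: graded_hom_mult gpart_mult graded_hom_homogeneous root_space_def)
  qed
  then show "graded_hom w \<in> gpart \<beta>" by (simp add: w)
qed

text \<open>Generated by the elements a that are sent to q \<otimes> a for a single q. The
  generators of the integral form are of this kind, as they involve rational scalars only.\<close>

inductive integral_sum :: "'g uea \<Rightarrow> bool" where
  homogeneous: "graded_hom a = gtensor q a \<Longrightarrow> integral_sum a"
| diff: "integral_sum a \<Longrightarrow> integral_sum b \<Longrightarrow> integral_sum (a - b)"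

lemma integral_sum_mult:
  assumes "integral_sum a" "integral_sum b"
  shows "integral_sum (a * b)"
  using assms(1)
proof induction
  case (homogeneous a p)
  show ?case using assms(2)
  proof induction
    case (homogeneous b q)
    with \<open>graded_hom a = gtensor p a\<close> have "graded_hom (a * b) = gtensor (p + q) (a * b)"
      by (simp add: graded_hom_mult gtensor_mult)
    then show ?case by (rule integral_sum.homogeneous)
  qed (simp add: right_diff_distrib integral_sum.diff)
qed (simp add: left_diff_distrib integral_sum.diff)

lemma graded_hom_divided_power:
  assumes "graded_hom a = gtensor q a"
  shows "\<exists>q'. graded_hom (divided_power a n) = gtensor q' (divided_power a n)"
proof -
  have "\<exists>q'. graded_hom (a ^ n) = gtensor q' (a ^ n)"
  proof (induction n)
    case 0
    show ?case using gtensor_one by (auto simp: graded_hom_one intro!: exI[of _ 0])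
  next
    case (Suc n)
    then show ?case by (auto simp: graded_hom_mult assms gtensor_mult)
  qed
  then show ?thesis by (auto simp: divided_power_def graded_hom_scale gtensor_inverse_fact)
qed

lemma graded_hom_binomial_element:
  assumes "graded_hom a = gtensor 0 a"
  shows "graded_hom (binomial_element a n) = gtensor 0 (binomial_element a n)"
proof -
  have nat: "graded_hom (of_nat k) = gtensor 0 (of_nat k)" for k
    by (induction k) (simp_all add: graded_hom_0 graded_hom_add graded_hom_one gtensor_add gtensor_one)
  have "graded_hom (prod_list (map (\<lambda>k. a - of_nat k) ks)) = gtensor 0 (prod_list (map (\<lambda>k. a - of_nat k) ks))" for ks
    by (induction ks) (simp_all add: graded_hom_one gtensor_one graded_hom_mult graded_hom_diff assms nat
        gtensor_mult flip: gtensor_diff)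
  then show ?thesis by (simp add: binomial_element_def graded_hom_scale gtensor_inverse_fact)
qed

lemma integral_sum_U: "u \<in> U \<Longrightarrow> integral_sum u"
proof (induction rule: integral_form.induct)
  case 1
  show ?case by (rule integral_sum.homogeneous[of _ 0]) (simp add: graded_hom_one gtensor_one)
next
  case (4 i n)
  then have "graded_hom (uea_of (\<gamma> (E i))) = gtensor (frag_of i) (uea_of (\<gamma> (E i)))"
    using graded_hom_generator[of "E i"] by (simp add: km_generators_def)
  from graded_hom_divided_power[OF this] show ?case using integral_sum.homogeneous by blast
next
  case (5 i n)
  then have "graded_hom (uea_of (\<gamma> (F i))) = gtensor (- frag_of i) (uea_of (\<gamma> (F i)))"
    using graded_hom_generator[of "F i"] by (simp add: km_generators_def)
  from graded_hom_divided_power[OF this] show ?case using integral_sum.homogeneous by blast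
next
  case (6 y n)
  have "graded_hom (uea_of (\<gamma> (H y))) = gtensor 0 (uea_of (\<gamma> (H y)))"
    using graded_hom_generator[of "H y"] by (simp add: km_generators_def)
  from graded_hom_binomial_element[OF this] show ?case by (rule integral_sum.homogeneous)
qed (simp_all add: integral_sum.diff integral_sum_mult)

lemma integral_sum_components:
  "integral_sum u \<Longrightarrow> \<exists>K a. finite K \<and> u = (\<Sum>q\<in>K. a q) \<and> (\<forall>q. graded_hom (a q) = gtensor q (a q))"
proof (induction rule: integral_sum.induct)
  case (homogeneous a q)
  then show ?case
    by (intro exI[of _ "{q}"] exI[of _ "\<lambda>q'. if q' = q then a else 0"]) (simp add: graded_hom_0)
next
  case (diff u v)
  then obtain K a L b where K: "finite K" "u = (\<Sum>q\<in>K. a q)" "\<And>q. graded_hom (a q) = gtensor q (a q)"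
    and L: "finite L" "v = (\<Sum>q\<in>L. b q)" "\<And>q. graded_hom (b q) = gtensor q (b q)" by blast
  let ?c = "\<lambda>q. (if q \<in> K then a q else 0) - (if q \<in> L then b q else 0)"
  have "u - v = (\<Sum>q\<in>K \<union> L. ?c q)"
    using K(1) L(1) by (simp add: sum_subtractf K(2) L(2) Int_Un_distrib2 flip: sum.inter_restrict)
  moreover have "graded_hom (?c q) = gtensor q (?c q)" for q
    by (simp add: graded_hom_diff gtensor_diff K L graded_hom_0)
  ultimately show ?case using K(1) L(1) by (intro exI[of _ "K \<union> L"] exI[of _ ?c]) blast
qed

text \<open>Write u as a sum of parts a_q with images q \<otimes> a_q. As the image of u lies in
  degree \<beta>, functionals in the other degrees show that a_q = 0 for q \<noteq> \<beta>.
  Additive functionals on homogeneous integral elements thereby become restrictions of complex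
  linear ones.\<close>

lemma graded_hom_integral:
  assumes "u \<in> U" "u \<in> Ag \<beta>"
  shows "graded_hom u = gtensor \<beta> u"
proof -
  obtain K a where K: "finite K" "u = (\<Sum>q\<in>K. a q)" "\<And>q. graded_hom (a q) = gtensor q (a q)"
    using integral_sum_components[OF integral_sum_U[OF assms(1)]] by blast
  have \<Phi>u: "graded_hom u = (\<Sum>q\<in>K. gtensor q (a q))"
    by (simp add: K(2,3) clinear_sum[OF clinear_graded_hom])
  have zero: "a q = 0" if q: "q \<in> K" "q \<noteq> \<beta>" for q
  proof (rule functionals_separate)
    fix f :: "'g uea \<Rightarrow> complex" assume f: "clinear f"
    have "0 = ev q f (graded_hom u)"
      using ev_gpart[OF clinear_additive[OF f] graded_hom_Ag[OF assms(2)]] q(2) by metis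
    also have "\<dots> = (\<Sum>q'\<in>K. if q' = q then f (a q') else 0)"
      by (simp add: \<Phi>u clinear_sum[OF clinear_ev[OF clinear_additive[OF f]]] ev_gtensor[OF clinear_additive[OF f]])
    also have "\<dots> = f (a q)" using q(1) K(1) by simp
    finally show "f (a q) = f 0" by (simp add: clinear_0[OF f])
  qed
  have "(\<Sum>q\<in>K. gtensor q (a q)) = (\<Sum>q\<in>K. gtensor \<beta> (a q))"
    by (rule sum.cong) (use zero in fastforce)+
  also have "\<dots> = gtensor \<beta> u"
    unfolding K(2) by (induction K rule: infinite_finite_induct) (simp_all add: gtensor_add)
  finally show ?thesis by (simp add: \<Phi>u)
qed

text \<open>Evaluation in the degree of z_(j0) kills the elements of other degrees. Within that
  degree there is an additive dual functional, and \<open>ev\<close> makes it complex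
  linear.\<close>

lemma Ag_dual_functional:
  assumes J: "finite J" "j0 \<in> J" and zs: "\<And>j. j \<in> J \<Longrightarrow> zs j \<in> U \<and> zs j \<in> Ag (\<beta> j) \<and> primitive (zs j)"
    and ind: "tagged_independent J \<beta> zs"
  shows "\<exists>f :: 'g uea \<Rightarrow> complex. clinear f \<and> f 1 = 0 \<and> f (zs j0) = 1 \<and> (\<forall>i\<in>J. i \<noteq> j0 \<longrightarrow> f (zs i) = 0)"
proof -
  define J' where "J' = {j \<in> J. \<beta> j = \<beta> j0}"
  have J': "finite J'" "j0 \<in> J'" using J by (auto simp: J'_def)
  have ind': "\<forall>j\<in>J'. b j = 0" if b: "(\<Sum>j\<in>J'. of_int (b j) *\<^sub>C zs j) = 0" for b :: "nat \<Rightarrow> int"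
  proof -
    define c where "c j = (if \<beta> j = \<beta> j0 then b j else 0)" for j
    have "(\<Sum>j\<in>J. of_int (c j) *\<^sub>C zs j) = (\<Sum>j\<in>J. if \<beta> j = \<beta> j0 then of_int (b j) *\<^sub>C zs j else 0)"
      by (rule sum.cong) (simp_all add: c_def)
    also have "\<dots> = 0" using b J(1) by (simp add: J'_def sum.inter_filter)
    finally have c: "(\<Sum>j\<in>J. of_int (c j) *\<^sub>C zs j) = 0" .
    have "\<forall>i\<in>J. \<forall>j\<in>J. c i \<noteq> 0 \<longrightarrow> c j \<noteq> 0 \<longrightarrow> \<beta> i = \<beta> j" by (simp add: c_def)
    then have c0: "\<forall>j\<in>J. c j = 0"
      by (rule mp[OF mp[OF spec[OF ind[unfolded tagged_independent_def]]] c])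
    show ?thesis
    proof
      fix j assume "j \<in> J'"
      then show "b j = 0" using c0[rule_format, of j] by (simp add: J'_def c_def)
    qed
  qed
  obtain f0 :: "'g uea \<Rightarrow> complex" where add: "\<And>x y. f0 (x + y) = f0 x + f0 y" and f0: "f0 (zs j0) = 1"
    "\<And>i. i \<in> J' \<Longrightarrow> i \<noteq> j0 \<Longrightarrow> f0 (zs i) = 0"
    using additive_dual_functional[of J' j0 zs, OF J' ind'] by blast
  define g where "g u = ev (\<beta> j0) f0 (graded_hom u)" for u
  have g: "clinear g" unfolding g_def by (rule clinear_compose[OF clinear_ev[OF add] clinear_graded_hom])
  \<comment> \<open>The multiple of the counit makes the functional vanish at 1 and is invisible on
    primitive elements.\<close>
  define f where "f u = g u - g 1 * counit u" for u
  have "clinear f"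
    using g by (simp add: clinear_def f_def counit_hom scaleC_complex_def algebra_simps)
  moreover have "f 1 = 0" by (simp add: f_def counit_hom)
  moreover have fz: "f (zs j) = (if \<beta> j = \<beta> j0 then f0 (zs j) else 0)" if "j \<in> J" for j
    using zs[OF that] graded_hom_integral[of "zs j" "\<beta> j"]
    by (simp add: f_def primitive_counit g_def ev_gtensor[OF add])
  moreover have "f (zs i) = 0" if "i \<in> J" "i \<noteq> j0" for i
    using fz[OF that(1)] f0(2)[of i] that by (simp add: J'_def)
  ultimately show ?thesis using J(2) f0(1) by (intro exI[of _ f]) simp
qed

lemma Ag_degree_separation:
  assumes "x \<in> U" "x \<in> Ag \<alpha>" "\<And>i. i \<in> I \<Longrightarrow> y i \<in> U \<and> y i \<in> Ag (\<beta> i)"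
    and "finite I" "x = (\<Sum>i\<in>I. y i)"
  shows "x = (\<Sum>i | i \<in> I \<and> \<beta> i = \<alpha>. y i)"
proof (rule functionals_separate)
  fix f :: "'g uea \<Rightarrow> complex" assume f: "clinear f"
  note add = clinear_additive[OF f]
  have "f x = ev \<alpha> f (graded_hom x)" by (simp add: graded_hom_integral[OF assms(1,2)] ev_gtensor[OF add])
  also have "graded_hom x = (\<Sum>i\<in>I. gtensor (\<beta> i) (y i))"
    unfolding assms(5) clinear_sum[OF clinear_graded_hom]
    by (rule sum.cong) (use assms(3) graded_hom_integral in blast)+
  also have "ev \<alpha> f \<dots> = (\<Sum>i\<in>I. if \<beta> i = \<alpha> then f (y i) else 0)"
    by (simp add: clinear_sum[OF clinear_ev[OF add]] ev_gtensor[OF add])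
  also have "\<dots> = f (\<Sum>i | i \<in> I \<and> \<beta> i = \<alpha>. y i)"
    by (simp add: clinear_sum[OF f] sum.inter_filter assms(4) if_distrib[of f] clinear_0[OF f] cong: if_cong)
  finally show "f x = f (\<Sum>i | i \<in> I \<and> \<beta> i = \<alpha>. y i)" .
qed

lemma uea_of_Ag: "x \<in> root_space S \<gamma> \<beta> \<Longrightarrow> uea_of x \<in> Ag \<beta>"
  unfolding uea_root_space_def
  by (rule complex_vector.span_base) (auto intro!: exI[of _ "[x]"] exI[of _ "[\<beta>]"])

sublocale graded_form Ag U
proof
  let ?W = "\<lambda>\<beta>. {prod_list (map uea_of xs) | xs \<beta>s.
    list_all2 (\<lambda>x \<beta>. x \<in> root_space S \<gamma> \<beta>) xs \<beta>s \<and> sum_list \<beta>s = \<beta>}"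
  show sub: "complex_vector.subspace (Ag q)" for q
    by (simp add: uea_root_space_def)
  show "1 \<in> Ag 0"
    unfolding uea_root_space_def by (rule complex_vector.span_base) (auto intro!: exI[of _ "[]"])
  fix u v p q assume uv: "u \<in> Ag p" "v \<in> Ag q"
  have word: "w * w' \<in> Ag (p + q)" if ww: "w \<in> ?W p" "w' \<in> ?W q" for w w'
  proof -
    obtain xs \<beta>s ys \<delta>s where "w = prod_list (map uea_of xs)" "w' = prod_list (map uea_of ys)"
      "list_all2 (\<lambda>x \<beta>. x \<in> root_space S \<gamma> \<beta>) xs \<beta>s" "sum_list \<beta>s = p"
      "list_all2 (\<lambda>x \<beta>. x \<in> root_space S \<gamma> \<beta>) ys \<delta>s" "sum_list \<delta>s = q"
      using ww by (elim CollectE exE conjE) (rule that)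
    then show ?thesis
      unfolding uea_root_space_def
      by (intro complex_vector.span_base CollectI exI[of _ "xs @ ys"] exI[of _ "\<beta>s @ \<delta>s"])
        (simp add: list_all2_appendI)
  qed
  have left: "w * v \<in> Ag (p + q)" if "w \<in> ?W p" for w
    by (rule clinear_span_mem[OF clinear_mult_left[OF clinear_id] uv(2)[unfolded uea_root_space_def] sub])
      (rule word[OF that])
  have "clinear (\<lambda>x. x * v)" by (simp add: clinear_def distrib_right mult_scaleC_left)
  then show "u * v \<in> Ag (p + q)"
    by (rule clinear_span_mem[OF _ uv(1)[unfolded uea_root_space_def] sub]) (rule left)
qed (rule integral_form.intros; assumption)+

lemma word_span_curve:
  fixes \<delta> :: "nat \<Rightarrow> ('i \<Rightarrow>\<^sub>0 int)"
  shows "curve \<delta> D \<Longrightarrow> (\<And>n. coef D n \<in> U) \<Longrightarrow> \<exists>m. \<forall>N. word_span N m (coef D n)"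
  using word_span_letter[of \<delta> D _ n] unfolding ibelow_def by blast

text \<open>The generators are coefficients of curves integral in all degrees: exponentials with
  degrees the multiples of a simple root or its negative, and (1 + t)^h with constant degree 0.
  Their order is the index of the coefficient, at every precision.\<close>

lemma word_span_U: "u \<in> U \<Longrightarrow> \<exists>m. \<forall>N. word_span N m u"
proof (induction rule: integral_form.induct)
  case 1
  show ?case using word_span.one by blast
next
  case (2 u v)
  then obtain m m' where "\<forall>N. word_span N m u" "\<forall>N. word_span N m' v" by blast
  then have "\<forall>N. word_span N (max m m') (u - v)" by (intro allI word_span.diff; metis word_span.mono max.cobounded1 max.cobounded2)
  then show ?case by blast
next
  case (3 u v)
  then show ?case using word_span_mult by blast
next
  case (4 i n)
  have "curve (\<lambda>k. frag_cmul (int k) (frag_of i)) (exp_series (uea_of (\<gamma> (E i))))"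
    using 4 by (intro curve_exp_series monoid_hom_frag_cmul primitive_uea_of)
      (simp add: uea_of_Ag root_space_def km_homogeneous.intros)
  from word_span_curve[OF this, of n] show ?case
    using 4 by (simp add: exp_series_def integral_form.intros)
next
  case (5 i n)
  have "curve (\<lambda>k. frag_cmul (int k) (- frag_of i)) (exp_series (uea_of (\<gamma> (F i))))"
    using 5 by (intro curve_exp_series monoid_hom_frag_cmul primitive_uea_of)
      (simp add: uea_of_Ag root_space_def km_homogeneous.intros)
  from word_span_curve[OF this, of n] show ?case
    using 5 by (simp add: exp_series_def integral_form.intros)
next
  case (6 y n)
  let ?h = "uea_of (\<gamma> (H y))"
  have h: "?h - of_nat k \<in> Ag 0" for k
    using Ag_scale[OF Ag_one, of "of_nat k"]
    by (intro Ag_diff uea_of_Ag) (simp_all add: scaleC_of_nat root_space_def km_homogeneous.intros)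
  have "prod_list (map (\<lambda>k. ?h - of_nat k) ks) \<in> Ag 0" for ks
    using Ag_mult[of _ 0 _ 0] by (induction ks) (simp_all add: Ag_one h)
  then have "curve (\<lambda>_. 0) (binomial_series ?h)"
    by (simp add: curve_def monoid_hom_def grouplike_binomial_series primitive_uea_of)
      (simp add: binomial_series_def binomial_element_def Ag_scale)
  from word_span_curve[OF this, of n] show ?case
    by (simp add: binomial_series_def integral_form.intros)
qed

sublocale separated_graded_form Ag U
  by unfold_locales (rule Ag_dual_functional Ag_degree_separation word_span_U; blast)+

end

text \<open>Applying the counit to both legs in degree n gives c = 2 c, the mixed terms being zero
  by induction.\<close>

lemma counit_grouplike:
  fixes f :: "(nat, 'g::complex_lie_algebra uea) series"
  assumes f: "grouplike f"
  shows "0 < n \<Longrightarrow> counit (coef f n) = 0"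
proof (induction n rule: less_induct)
  case (less n)
  note lin = clinear_tensor_lift[OF bilin_contract[OF clinear_counit]]
  have "coef f n = contract counit (coef f n)" by (simp add: contract_counit)
  also have "\<dots> = (\<Sum>i\<le>n. counit (coef f i) *\<^sub>C coef f (n - i))"
    using f by (simp add: contract_def grouplike_def sum_decomp_nat clinear_sum[OF lin]
        tensor_lift_tensor_of[OF bilin_contract[OF clinear_counit]])
  finally have "counit (coef f n) = (\<Sum>i\<le>n. counit (coef f i) * counit (coef f (n - i)))"
    by (metis (no_types, lifting) clinear_sum[OF clinear_counit] counit_hom(4) sum.cong)
  also have "\<dots> = (\<Sum>i\<in>{0, n}. counit (coef f i) * counit (coef f (n - i)))"
    by (rule sum.mono_neutral_right) (auto simp: less.IH)
  also have "\<dots> = 2 * counit (coef f n)"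
    using f less.prems by (simp add: grouplike_def counit_hom)
  finally show ?case by simp
qed

theorem proposition2p7:
  fixes S :: "('i, 'y::ab_group_add) root_system_data"
    and \<gamma> :: "('i, 'y) km_generator \<Rightarrow> 'g::complex_lie_algebra"
    and \<alpha> :: "'i \<Rightarrow>\<^sub>0 int"
    and x :: 'g
  assumes "root_generating_system S"
    and "kac_moody_algebra S \<gamma>"
    and "\<alpha> \<in> roots S \<gamma> \<union> {0}"
    and "x \<in> integral_root_space S \<gamma> \<alpha>"
  shows "\<exists>d :: nat \<Rightarrow> 'g uea.
    (\<forall>n. d n \<in> integral_uea_root_space S \<gamma> (frag_cmul (int n) \<alpha>)) \<and>
    d 0 = 1 \<and> d 1 = uea_of x \<and>
    (\<forall>n. filtration_less (d n - (1 / fact n) *\<^sub>C uea_of x ^ n) n) \<and>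
    (\<forall>n. comult (d n) = (\<Sum>(p, q)\<in>{(p, q). p + q = n}. d p \<otimes> d q)) \<and>
    (\<forall>n>0. counit (d n) = 0)"
proof -
  interpret kac_moody S \<gamma> by standard (fact assms(2))
  obtain D where D: "curve (\<lambda>n. frag_cmul (int n) \<alpha>) D" "coef D 1 = uea_of x"
    "\<And>n. coef D n \<in> integral_form S \<gamma>"
    using integral_curve_exists[OF monoid_hom_frag_cmul[of \<alpha>], of "uea_of x"] assms(4)
    by (auto simp: integral_root_space_def uea_of_Ag primitive_uea_of)
  note gl = curve_grouplike[OF D(1)]
  show ?thesis
    using D curve_Ag[OF D(1)] gl counit_grouplike[OF gl] grouplike_symbol[OF gl]
    by (intro exI[of _ "coef D"])
      (simp add: integral_uea_root_space_def grouplike_def decomp_def filtration_less_iff_lower)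
qed

end
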